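(* Let $R$ be a commutative noetherian ring, $\mathfrak{a}$ an ideal of $R$, and $K$ the Koszul $N$-complex on a sequence of $n$ generators for $\mathfrak{a}$. For any $X\in\mathbf{D}_N(R)$ and any fixed $t\in\{1,\dots,N-1\}$, one has $$\inf\{\ell\in\mathbb{Z}\mid\mathrm{H}^\ell_t(\mathrm{RHom}_R(R/\mathfrak{a},X))\neq0\}=\inf\{\ell\in\mathbb{Z}\mid\mathrm{H}^\ell_{t,\mathfrak{a}}(X)\neq0\}=\inf\{\ell\in\mathbb{Z}\mid\mathrm{H}^\ell_t(\mathrm{Hom}_R(K,X))\neq0\}.$$
   Context: All rings are commutative; $N\ge 2$ is a fixed integer. Infima are taken in $\mathbb{Z}\cup\{\pm\infty\}$, with $\inf\emptyset=+\infty$. $N$-complexes. An $N$-complex $X$ of $R$-modules is a sequence of $R$-modules $X^n$ ($n\in\mathbb{Z}$) and maps $d^n:X^n\to X^{n+1}$ such that any $N$ consecutive maps compose to $0$; morphisms are families of maps commuting with $d$. For $1\le t\le N-1$, $\mathrm{H}^n_t(X)=\mathrm{Ker}(d^{n+t-1}\cdots d^n)/\mathrm{Im}(d^{n-1}\cdots d^{n-(N-t)})$. $X$ is $N$-acyclic if all $\mathrm{H}^n_t(X)=0$. Morphisms $f,g:X\to Y$ are homotopic if there are $s^n:X^n\to Y^{n-N+1}$ with $g^n-f^n=\sum_{i=0}^{N-1}d^{N-1-i}s^{n+i}d^i$; $\mathbf{K}_N(R)$ is the (triangulated) homotopy category, and $\mathbf{D}_N(R)$ is its Verdier quotient by the $N$-acyclic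 $N$-complexes. A module is regarded as an $N$-complex concentrated in degree $0$. Suspension and cone. $(\Sigma X)^n=X^{n+1}\oplus\cdots\oplus X^{n+N-1}$ with $d(a_1,\dots,a_{N-1})=(a_2,\dots,a_{N-1},-d^{N-1}a_1-d^{N-2}a_2-\cdots-d\,a_{N-1})$. For $f:X\to Y$ the mapping cone is $C(f)^n=Y^n\oplus(\Sigma X)^n$ with $d(y,a_1,\dots,a_{N-1})=(dy+f(a_1),\,d_{\Sigma X}(a_1,\dots,a_{N-1}))$. $q$-Hom. Fix a primitive $N$-th root of unity $q\in R$ (in a sense ensuring $d^N=0$ below). $\mathrm{Hom}_R(X,Y)^n=\prod_i\mathrm{Hom}_R(X^i,Y^{i+n})$ with $d(f)^i=d_Yf^i-q^nf^{i+1}d_X$ for $f$ of degree $n$. Koszul $N$-complex. For $x\in R$, $K^\bullet(x;R)$ is the mapping cone of $x:R\to R$, i.e. $0\to R\xrightarrow{1}R\xrightarrow{1}\cdots\xrightarrow{1}R\xrightarrow{x}R\to0$ in degrees $-N+1,\dots,0$. For $\mathbf{x}=x_1,\dots,x_n$, $K^\bullet(\mathbf{x};R)$ is inductively the mapping cone of multiplication by $x_n$ on $K^\bullet(x_1,\dots,x_{n-1};R)$. Derived functors. An $N$-complex $I$ is semi-injective if every $I^n$ is injective and every morphism from an $N$-acyclic $N$-complex to $I$ is null-homotopic. $\mathrm{RHom}_R(R/\mathfrak{a},X)=\mathrm{Hom}_R(R/\mathfrak{a},I)$ for a semi-injective resolution $X\to I$ (a quasi-isomorphism, i.e. a morphism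 inducing isomorphisms on all $\mathrm{H}^n_t$, with $I$ semi-injective). $\Gamma_{\mathfrak{a}}(M)=\{m\in M:\mathfrak{a}^nm=0\text{ for some }n\}$, extended degreewise to $N$-complexes, and $\mathrm{R}\Gamma_{\mathfrak{a}}(X)=\Gamma_{\mathfrak a}(I)$. Local cohomology is $\mathrm{H}^\ell_{t,\mathfrak{a}}(X)=\mathrm{H}^\ell_t(\mathrm{R}\Gamma_{\mathfrak{a}}(X))$. *)

theory Defs
  imports "HOL-Algebra.Module" "HOL-Algebra.Ideal_Product" "HOL-Algebra.Ring_Divisibility"
    "HOL-Library.Extended"
begin

section \<open>Modules\<close>

text \<open>The record type of modules extends that of rings; the multiplicative fields are irrelevant
  for modules and are filled with a dummy value here.\<close>

definition mk_module ::
  "'m set \<Rightarrow> 'm \<Rightarrow> ('m \<Rightarrow> 'm \<Rightarrow> 'm) \<Rightarrow> ('r \<Rightarrow> 'm \<Rightarrow> 'm) \<Rightarrow> ('r, 'm) module" where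
  "mk_module C z a s =
     \<lparr>carrier = C, monoid.mult = (\<lambda>_ _. z), one = z, ring.zero = z, ring.add = a, module.smult = s\<rparr>"

definition regular_module :: "('r, 's) ring_scheme \<Rightarrow> ('r, 'r) module" where
  "regular_module R = mk_module (carrier R) \<zero>\<^bsub>R\<^esub> (ring.add R) (monoid.mult R)"

definition trivial_module :: "('r, 'm) module \<Rightarrow> bool" where
  "trivial_module M \<longleftrightarrow> carrier M = {\<zero>\<^bsub>M\<^esub>}"

definition mhom ::
  "('r, 's) ring_scheme \<Rightarrow> ('r, 'm) module \<Rightarrow> ('r, 'k) module \<Rightarrow> ('m \<Rightarrow> 'k) set" where
  "mhom R M L = {f \<in> hom (add_monoid M) (add_monoid L).
     \<forall>r\<in>carrier R. \<forall>x\<in>carrier M. f (r \<odot>\<^bsub>M\<^esub> x) = r \<odot>\<^bsub>L\<^esub> f x}"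

definition quotient_module :: "('r, 'm) module \<Rightarrow> 'm set \<Rightarrow> ('r, 'm set) module" where
  "quotient_module M H = mk_module (a_rcosets\<^bsub>M\<^esub> H) H (set_add M)
     (\<lambda>r A. \<Union>x\<in>A. H +>\<^bsub>M\<^esub> (r \<odot>\<^bsub>M\<^esub> x))"

text \<open>HOL cannot quantify over types inside a formula, so injectivity (and semi-injectivity below)
  is relative to the modules whose carriers live in a type \<open>'u\<close>.\<close>

definition injective_module ::
  "'u itself \<Rightarrow> ('r, 's) ring_scheme \<Rightarrow> ('r, 'i) module \<Rightarrow> bool" where
  "injective_module _ R E \<longleftrightarrow> module R E \<and>
     (\<forall>(A :: ('r, 'u) module) (B :: ('r, 'u) module). \<forall>i f.
        module R A \<and> module R B \<and> i \<in> mhom R A B \<and> inj_on i (carrier A) \<and> f \<in> mhom R A E \<longrightarrow>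
        (\<exists>g \<in> mhom R B E. \<forall>x\<in>carrier A. g (i x) = f x))"


section \<open>N-complexes\<close>

record ('r, 'm) ncomplex =
  obj :: "int \<Rightarrow> ('r, 'm) module"
  dif :: "int \<Rightarrow> 'm \<Rightarrow> 'm"

text \<open>\<open>dpow X n k\<close> is the composite of the \<open>k\<close> consecutive differentials starting in degree \<open>n\<close>.\<close>

primrec dpow :: "('r, 'm) ncomplex \<Rightarrow> int \<Rightarrow> nat \<Rightarrow> 'm \<Rightarrow> 'm" where
  "dpow X n 0 = (\<lambda>x. x)"
| "dpow X n (Suc k) = (\<lambda>x. dif X (n + int k) (dpow X n k x))"

definition n_complex :: "('r, 's) ring_scheme \<Rightarrow> nat \<Rightarrow> ('r, 'm) ncomplex \<Rightarrow> bool" where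
  "n_complex R N X \<longleftrightarrow>
     (\<forall>n. module R (obj X n) \<and> dif X n \<in> mhom R (obj X n) (obj X (n + 1)) \<and>
          (\<forall>x\<in>carrier (obj X n). dpow X n N x = \<zero>\<^bsub>obj X (n + int N)\<^esub>))"

definition chain_map ::
  "('r, 's) ring_scheme \<Rightarrow> ('r, 'x) ncomplex \<Rightarrow> ('r, 'y) ncomplex \<Rightarrow> (int \<Rightarrow> 'x \<Rightarrow> 'y) \<Rightarrow> bool" where
  "chain_map R X Y f \<longleftrightarrow>
     (\<forall>n. f n \<in> mhom R (obj X n) (obj Y n) \<and>
          (\<forall>x\<in>carrier (obj X n). f (n + 1) (dif X n x) = dif Y n (f n x)))"

definition cycles :: "('r, 'm) ncomplex \<Rightarrow> nat \<Rightarrow> int \<Rightarrow> 'm set" where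
  "cycles X t n = {x \<in> carrier (obj X n). dpow X n t x = \<zero>\<^bsub>obj X (n + int t)\<^esub>}"

definition boundaries :: "nat \<Rightarrow> ('r, 'm) ncomplex \<Rightarrow> nat \<Rightarrow> int \<Rightarrow> 'm set" where
  "boundaries N X t n =
     dpow X (n - int (N - t)) (N - t) ` carrier (obj X (n - int (N - t)))"

definition homology :: "nat \<Rightarrow> ('r, 'm) ncomplex \<Rightarrow> nat \<Rightarrow> int \<Rightarrow> ('r, 'm set) module" where
  "homology N X t n = quotient_module (obj X n\<lparr>carrier := cycles X t n\<rparr>) (boundaries N X t n)"

definition homology_map ::
  "nat \<Rightarrow> ('r, 'y) ncomplex \<Rightarrow> (int \<Rightarrow> 'x \<Rightarrow> 'y) \<Rightarrow> nat \<Rightarrow> int \<Rightarrow> 'x set \<Rightarrow> 'y set" where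
  "homology_map N Y f t n A = (\<Union>x\<in>A. boundaries N Y t n +>\<^bsub>obj Y n\<^esub> f n x)"

definition quasi_iso ::
  "('r, 's) ring_scheme \<Rightarrow> nat \<Rightarrow> ('r, 'x) ncomplex \<Rightarrow> ('r, 'y) ncomplex \<Rightarrow>
   (int \<Rightarrow> 'x \<Rightarrow> 'y) \<Rightarrow> bool" where
  "quasi_iso R N X Y f \<longleftrightarrow> chain_map R X Y f \<and>
     (\<forall>t\<in>{1..N - 1}. \<forall>n. bij_betw (homology_map N Y f t n)
        (carrier (homology N X t n)) (carrier (homology N Y t n)))"

definition n_acyclic :: "nat \<Rightarrow> ('r, 'm) ncomplex \<Rightarrow> bool" where
  "n_acyclic N X \<longleftrightarrow> (\<forall>t\<in>{1..N - 1}. \<forall>n. trivial_module (homology N X t n))"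

definition homotopic ::
  "('r, 's) ring_scheme \<Rightarrow> nat \<Rightarrow> ('r, 'x) ncomplex \<Rightarrow> ('r, 'y) ncomplex \<Rightarrow>
   (int \<Rightarrow> 'x \<Rightarrow> 'y) \<Rightarrow> (int \<Rightarrow> 'x \<Rightarrow> 'y) \<Rightarrow> bool" where
  "homotopic R N X Y f g \<longleftrightarrow>
     (\<exists>s. (\<forall>n. s n \<in> mhom R (obj X n) (obj Y (n - int N + 1))) \<and>
          (\<forall>n. \<forall>x\<in>carrier (obj X n). g n x \<ominus>\<^bsub>obj Y n\<^esub> f n x =
             (\<Oplus>\<^bsub>obj Y n\<^esub> i\<in>{0..N - 1}.
                dpow Y (n + int i - int N + 1) (N - 1 - i) (s (n + int i) (dpow X n i x)))))"

definition null_homotopic ::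
  "('r, 's) ring_scheme \<Rightarrow> nat \<Rightarrow> ('r, 'x) ncomplex \<Rightarrow> ('r, 'y) ncomplex \<Rightarrow>
   (int \<Rightarrow> 'x \<Rightarrow> 'y) \<Rightarrow> bool" where
  "null_homotopic R N X Y f \<longleftrightarrow> homotopic R N X Y (\<lambda>n x. \<zero>\<^bsub>obj Y n\<^esub>) f"

definition concentrated_in_0 :: "('r, 'm) module \<Rightarrow> ('r, 'm) ncomplex" where
  "concentrated_in_0 M =
     \<lparr>obj = (\<lambda>n. if n = 0 then M else M\<lparr>carrier := {\<zero>\<^bsub>M\<^esub>}\<rparr>), dif = (\<lambda>_ _. \<zero>\<^bsub>M\<^esub>)\<rparr>"


section \<open>Suspension and cone\<close>

text \<open>An element \<open>(a\<^sub>1, \<dots>, a\<^bsub>N-1\<^esub>)\<close> of \<open>(\<Sigma>X)\<^sup>n\<close> is the list of its components, so that the list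
  entry with index \<open>j\<close> is \<open>a\<^bsub>j+1\<^esub>\<close> and lies in \<open>X\<^bsup>n+1+j\<^esup>\<close>.\<close>

definition suspension :: "nat \<Rightarrow> ('r, 'x) ncomplex \<Rightarrow> ('r, 'x list) ncomplex" where
  "suspension N X =
     \<lparr>obj = (\<lambda>n. mk_module
        {as. length as = N - 1 \<and> (\<forall>j<N - 1. as ! j \<in> carrier (obj X (n + 1 + int j)))}
        (map (\<lambda>j. \<zero>\<^bsub>obj X (n + 1 + int j)\<^esub>) [0..<N - 1])
        (\<lambda>as bs. map (\<lambda>j. as ! j \<oplus>\<^bsub>obj X (n + 1 + int j)\<^esub> bs ! j) [0..<N - 1])
        (\<lambda>r as. map (\<lambda>j. r \<odot>\<^bsub>obj X (n + 1 + int j)\<^esub> as ! j) [0..<N - 1])),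
      dif = (\<lambda>n as. tl as @
        [\<ominus>\<^bsub>obj X (n + int N)\<^esub> (\<Oplus>\<^bsub>obj X (n + int N)\<^esub> j\<in>{..<N - 1}.
            dpow X (n + 1 + int j) (N - 1 - j) (as ! j))])\<rparr>"

definition cone ::
  "nat \<Rightarrow> ('r, 'x) ncomplex \<Rightarrow> ('r, 'y) ncomplex \<Rightarrow> (int \<Rightarrow> 'x \<Rightarrow> 'y) \<Rightarrow>
   ('r, 'y \<times> 'x list) ncomplex" where
  "cone N X Y f =
     \<lparr>obj = (\<lambda>n. mk_module
        (carrier (obj Y n) \<times> carrier (obj (suspension N X) n))
        (\<zero>\<^bsub>obj Y n\<^esub>, \<zero>\<^bsub>obj (suspension N X) n\<^esub>)
        (\<lambda>(y, as) (z, bs). (y \<oplus>\<^bsub>obj Y n\<^esub> z, as \<oplus>\<^bsub>obj (suspension N X) n\<^esub> bs))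
        (\<lambda>r (y, as). (r \<odot>\<^bsub>obj Y n\<^esub> y, r \<odot>\<^bsub>obj (suspension N X) n\<^esub> as))),
      dif = (\<lambda>n (y, as).
        (dif Y n y \<oplus>\<^bsub>obj Y (n + 1)\<^esub> f (n + 1) (as ! 0), dif (suspension N X) n as))\<rparr>"


section \<open>The Koszul N-complex\<close>

text \<open>Every cone changes the carrier type. To iterate the construction, the elements of all the
  iterated cones are encoded in the single datatype \<open>'r koszul_elem\<close>, by transport of structure
  along the injective constructors \<open>Base\<close> and \<open>Node\<close>.\<close>

datatype 'r koszul_elem =
    Base (the_base: 'r)
  | Node (the_node: "'r koszul_elem \<times> 'r koszul_elem list")

text \<open>\<open>transport e u X\<close> is the image of \<open>X\<close> under an injection \<open>e\<close> with left inverse \<open>u\<close>.\<close>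

definition transport ::
  "('m \<Rightarrow> 'k) \<Rightarrow> ('k \<Rightarrow> 'm) \<Rightarrow> ('r, 'm) ncomplex \<Rightarrow> ('r, 'k) ncomplex" where
  "transport e u X =
     \<lparr>obj = (\<lambda>n. mk_module (e ` carrier (obj X n)) (e \<zero>\<^bsub>obj X n\<^esub>)
        (\<lambda>a b. e (u a \<oplus>\<^bsub>obj X n\<^esub> u b)) (\<lambda>r a. e (r \<odot>\<^bsub>obj X n\<^esub> u a))),
      dif = (\<lambda>n x. e (dif X n (u x)))\<rparr>"

definition koszul ::
  "('r, 's) ring_scheme \<Rightarrow> nat \<Rightarrow> 'r list \<Rightarrow> ('r, 'r koszul_elem) ncomplex" where
  "koszul R N xs =
     foldl (\<lambda>K x. transport Node the_node (cone N K K (\<lambda>n k. x \<odot>\<^bsub>obj K n\<^esub> k)))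
       (transport Base the_base (concentrated_in_0 (regular_module R))) xs"


section \<open>The q-Hom complex\<close>

primrec q_binomial :: "('r, 's) ring_scheme \<Rightarrow> 'r \<Rightarrow> nat \<Rightarrow> nat \<Rightarrow> 'r" where
  "q_binomial R q 0 k = (if k = 0 then \<one>\<^bsub>R\<^esub> else \<zero>\<^bsub>R\<^esub>)"
| "q_binomial R q (Suc n) k =
     (case k of 0 \<Rightarrow> \<one>\<^bsub>R\<^esub>
      | Suc j \<Rightarrow> q_binomial R q n j \<oplus>\<^bsub>R\<^esub> (q [^]\<^bsub>R\<^esub> Suc j \<otimes>\<^bsub>R\<^esub> q_binomial R q n (Suc j)))"

text \<open>In a ring with zero divisors or of positive characteristic, having exact order \<open>N\<close> does not
  make the \<open>N\<close>-th power of the differential of the q-Hom complex vanish: what makes it vanish is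
  that the Gaussian binomial coefficients \<open>[N choose k]\<^sub>q\<close> are zero for \<open>0 < k < N\<close>. In a domain in
  which \<open>N\<close> is nonzero, the condition below holds iff \<open>q\<close> has exact order \<open>N\<close>. In general
  it is implied both by the vanishing at \<open>q\<close> of the \<open>N\<close>-th cyclotomic polynomial and by the
  condition that \<open>[N]\<^sub>q = 0\<close> with \<open>[k]\<^sub>q\<close> invertible for \<open>0 < k < N\<close>. For \<open>N = 2\<close> it says
  \<open>q = -1\<close>, also in characteristic 2.\<close>

definition primitive_root_of_unity :: "('r, 's) ring_scheme \<Rightarrow> nat \<Rightarrow> 'r \<Rightarrow> bool" where
  "primitive_root_of_unity R N q \<longleftrightarrow>
     q \<in> carrier R \<and> q [^]\<^bsub>R\<^esub> N = \<one>\<^bsub>R\<^esub> \<and> (\<forall>k. 0 < k \<and> k < N \<longrightarrow> q_binomial R q N k = \<zero>\<^bsub>R\<^esub>)"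

text \<open>Homomorphisms are represented by functions that are extensional on their domain, so that
  equal homomorphisms are equal elements.\<close>

definition q_Hom ::
  "('r, 's) ring_scheme \<Rightarrow> 'r \<Rightarrow> ('r, 'x) ncomplex \<Rightarrow> ('r, 'y) ncomplex \<Rightarrow>
   ('r, int \<Rightarrow> 'x \<Rightarrow> 'y) ncomplex" where
  "q_Hom R q X Y =
     \<lparr>obj = (\<lambda>n. mk_module
        {f. \<forall>i. f i \<in> mhom R (obj X i) (obj Y (i + n)) \<inter> extensional (carrier (obj X i))}
        (\<lambda>i. \<lambda>x\<in>carrier (obj X i). \<zero>\<^bsub>obj Y (i + n)\<^esub>)
        (\<lambda>f g i. \<lambda>x\<in>carrier (obj X i). f i x \<oplus>\<^bsub>obj Y (i + n)\<^esub> g i x)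
        (\<lambda>r f i. \<lambda>x\<in>carrier (obj X i). r \<odot>\<^bsub>obj Y (i + n)\<^esub> f i x)),
      dif = (\<lambda>n f i. \<lambda>x\<in>carrier (obj X i).
        dif Y (i + n) (f i x) \<ominus>\<^bsub>obj Y (i + n + 1)\<^esub>
          (q [^]\<^bsub>R\<^esub> n \<odot>\<^bsub>obj Y (i + n + 1)\<^esub> f (i + 1) (dif X i x)))\<rparr>"


section \<open>Semi-injective resolutions and torsion\<close>

definition semi_injective ::
  "'u itself \<Rightarrow> ('r, 's) ring_scheme \<Rightarrow> nat \<Rightarrow> ('r, 'i) ncomplex \<Rightarrow> bool" where
  "semi_injective U R N E \<longleftrightarrow> n_complex R N E \<and> (\<forall>n. injective_module U R (obj E n)) \<and>
     (\<forall>(A :: ('r, 'u) ncomplex) f.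
        n_complex R N A \<and> n_acyclic N A \<and> chain_map R A E f \<longrightarrow> null_homotopic R N A E f)"

text \<open>The test type \<open>nat \<Rightarrow> 'r\<close> loses nothing: every module over \<open>R\<close> of cardinality at most
  \<open>max |R| \<aleph>\<^sub>0\<close> has an isomorphic copy in it. By Baer's criterion these modules detect
  injectivity. They also detect semi-injectivity: every \<open>N\<close>-acyclic \<open>N\<close>-complex is the union of a
  continuous chain of \<open>N\<close>-acyclic subcomplexes whose successive quotients have at most that
  cardinality, so that null-homotopy against all of it follows by Eklof's lemma. In any case a
  smaller test type only weakens the hypothesis on \<open>E\<close>. The carrier type of \<open>E\<close> is arbitrary.\<close>

definition semi_injective_resolution ::
  "('r, 's) ring_scheme \<Rightarrow> nat \<Rightarrow> ('r, 'x) ncomplex \<Rightarrow> ('r, 'i) ncomplex \<Rightarrow>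
   (int \<Rightarrow> 'x \<Rightarrow> 'i) \<Rightarrow> bool" where
  "semi_injective_resolution R N X E f \<longleftrightarrow>
     semi_injective TYPE(nat \<Rightarrow> 'r) R N E \<and> quasi_iso R N X E f"

definition torsion_submodule ::
  "('r, 's) ring_scheme \<Rightarrow> 'r set \<Rightarrow> ('r, 'm) module \<Rightarrow> 'm set" where
  "torsion_submodule R \<aa> M =
     {m \<in> carrier M. \<exists>n::nat. \<forall>r \<in> \<aa> [^]\<^bsub>ideals_set R\<^esub> n. r \<odot>\<^bsub>M\<^esub> m = \<zero>\<^bsub>M\<^esub>}"

definition torsion_complex ::
  "('r, 's) ring_scheme \<Rightarrow> 'r set \<Rightarrow> ('r, 'm) ncomplex \<Rightarrow> ('r, 'm) ncomplex" where
  "torsion_complex R \<aa> X =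
     X\<lparr>obj := (\<lambda>n. obj X n\<lparr>carrier := torsion_submodule R \<aa> (obj X n)\<rparr>)\<rparr>"

definition inf_ext :: "int set \<Rightarrow> int extended" where
  "inf_ext S = (if S = {} then Pinf else if bdd_below S then Fin (Inf S) else Minf)"

end

theory Submission
  imports Defs
begin

text \<open>Say that a complex is exact below \<open>s\<close> if its homology of the fixed amplitude \<open>t\<close> vanishes in all degrees
\<open>l < s\<close>. The infimum of the degrees with nonzero homology is determined by the set of all such \<open>s\<close>
(\<open>inf_ext_cong\<close>), so it suffices that the complexes \<open>Hom(R/\<aa>, E)\<close>, \<open>\<Gamma>\<^sub>\<aa> E\<close> and \<open>Hom(K, C)\<close> are exact
below the same \<open>s\<close>. Exactness below \<open>s\<close> for one amplitude controls the other amplitudes as well, with a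
shift of degrees (\<open>exact_below_change\<close>). This makes it possible to argue with the two amplitudes \<open>t\<close> and
\<open>N - t\<close> at once, although the statement mentions only one.

The first two complexes are subcomplexes of \<open>E\<close>: the elements killed by \<open>\<aa>\<close> (\<open>qHom_cyclic\<close>) and the
elements killed by a power of each generator (\<open>torsion_submodule_generators\<close>). They are compared through
a lifting property of the semi-injective \<open>E\<close> (\<open>exact_below_lift\<close>): if a subcomplex \<open>W\<close> of \<open>E\<close> is exact
below \<open>s\<close>, then a cycle \<open>z\<close> of \<open>W\<close> in a degree below \<open>s\<close> is the boundary of some \<open>y\<close> in \<open>E\<close> which is
killed by every scalar that kills \<open>z\<close>. Indeed \<open>z\<close> lies in a small acyclic subcomplex of \<open>E\<close>, the
inclusion of which is null-homotopic, and the homotopy formula writes \<open>z\<close> as the boundary of a linear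
expression in \<open>z\<close>. For \<open>W\<close> the torsion part this gives primitives killed by \<open>\<aa>\<close>. Conversely, let \<open>W\<close> be
the part killed by \<open>\<aa>\<close> and \<open>z\<close> a torsion cycle. Some multiple \<open>r z \<noteq> 0\<close> is killed by \<open>\<aa>\<close> and can be
lifted, Baer's criterion divides the lift by \<open>r\<close>, and subtracting the boundary so obtained enlarges the
annihilator of \<open>z\<close>. As \<open>R\<close> is noetherian, this stops (\<open>exact_below_annihilated_iff_torsion\<close>).

For the Koszul complex the argument is an induction on the sequence. If \<open>P\<close> is the cone of \<open>x\<close> on \<open>K\<close>,
then \<open>Hom(P, Y)\<close> is an extension of \<open>H = Hom(K, Y)\<close> by \<open>A = Hom(\<Sigma>K, Y)\<close> whose twist is \<open>x\<close> times a map
\<open>\<theta>\<close> that does not depend on \<open>x\<close> (\<open>cone_split_iso\<close>), and for \<open>x = 1\<close> the extension is acyclic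
(\<open>cone_ext_acyclic\<close>). This acyclicity is the precise form in which \<open>\<theta>\<close> identifies the homology of \<open>H\<close>
with that of \<open>A\<close>, and it replaces the long exact sequence of the cone. It has three consequences:
maps that are isomorphisms on homology stay so when a cone is attached (\<open>ext_cpx_hiso\<close>); if \<open>H\<close>
is \<open>x\<close>-power torsion, the extension and \<open>H\<close> are exact below the same \<open>s\<close> (\<open>exact_below_of_ext_cpx\<close>,
\<open>ext_cpx_exact_below\<close>); and if \<open>x\<close> acts bijectively on the quotient of \<open>H\<close> by a subcomplex, then
passing to the subcomplex does not change the homology of the extension (\<open>ext_cpx_sub_hiso\<close>). They yield

\<^item> \<open>Hom(K, C)\<close> and \<open>Hom(K, E)\<close> have the same homology (\<open>koszul_hiso\<close>),
\<^item> \<open>Hom(K, \<Gamma>\<^sub>\<aa> E)\<close> and \<open>Hom(K, E)\<close> have the same homology (\<open>koszul_tors_hiso\<close>), because an injective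
  module over a noetherian ring is divisible modulo torsion (\<open>injective_divisible\<close>),
\<^item> \<open>Hom(K, \<Gamma>\<^sub>\<aa> E)\<close> and \<open>\<Gamma>\<^sub>\<aa> E\<close> are exact below the same \<open>s\<close> (\<open>koszul_exact_torsion\<close>).\<close>

section \<open>Modules and homomorphisms\<close>

abbreviation elts :: "('r, 'm) ncomplex \<Rightarrow> int \<Rightarrow> 'm set" where
  "elts X n \<equiv> carrier (obj X n)"

context cring
begin

text \<open>The module laws, with the module as an explicit argument: as simplification rules they then serve in
  arguments that involve many modules at once.\<close>

lemma mod_abelian: "module R M \<Longrightarrow> abelian_group M"
  by (simp add: module_def)

lemma mod_zero [simp]: "module R M \<Longrightarrow> \<zero>\<^bsub>M\<^esub> \<in> carrier M"
  by (drule mod_abelian) (simp add: abelian_group.axioms abelian_monoid.zero_closed)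

lemma mod_add [simp]:
  "module R M \<Longrightarrow> x \<in> carrier M \<Longrightarrow> y \<in> carrier M \<Longrightarrow> x \<oplus>\<^bsub>M\<^esub> y \<in> carrier M"
  by (drule mod_abelian) (simp add: abelian_group.axioms abelian_monoid.a_closed)

lemma mod_neg [simp]: "module R M \<Longrightarrow> x \<in> carrier M \<Longrightarrow> \<ominus>\<^bsub>M\<^esub> x \<in> carrier M"
  by (drule mod_abelian) (simp add: abelian_group.a_inv_closed)

lemma mod_diff [simp]:
  "module R M \<Longrightarrow> x \<in> carrier M \<Longrightarrow> y \<in> carrier M \<Longrightarrow> x \<ominus>\<^bsub>M\<^esub> y \<in> carrier M"
  by (drule mod_abelian) (simp add: abelian_group.minus_closed)

lemma mod_smult [simp]:
  "module R M \<Longrightarrow> r \<in> carrier R \<Longrightarrow> x \<in> carrier M \<Longrightarrow> r \<odot>\<^bsub>M\<^esub> x \<in> carrier M"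
  by (simp add: module.smult_closed)

lemma mod_l_zero [simp]: "module R M \<Longrightarrow> x \<in> carrier M \<Longrightarrow> \<zero>\<^bsub>M\<^esub> \<oplus>\<^bsub>M\<^esub> x = x"
  by (drule mod_abelian) (simp add: abelian_group.axioms abelian_monoid.l_zero)

lemma mod_r_zero [simp]: "module R M \<Longrightarrow> x \<in> carrier M \<Longrightarrow> x \<oplus>\<^bsub>M\<^esub> \<zero>\<^bsub>M\<^esub> = x"
  by (drule mod_abelian) (simp add: abelian_group.axioms abelian_monoid.r_zero)

lemma mod_assoc:
  "module R M \<Longrightarrow> x \<in> carrier M \<Longrightarrow> y \<in> carrier M \<Longrightarrow> z \<in> carrier M \<Longrightarrow>
   (x \<oplus>\<^bsub>M\<^esub> y) \<oplus>\<^bsub>M\<^esub> z = x \<oplus>\<^bsub>M\<^esub> (y \<oplus>\<^bsub>M\<^esub> z)"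
  by (drule mod_abelian) (simp add: abelian_group.axioms abelian_monoid.a_assoc)

lemma mod_comm:
  "module R M \<Longrightarrow> x \<in> carrier M \<Longrightarrow> y \<in> carrier M \<Longrightarrow> x \<oplus>\<^bsub>M\<^esub> y = y \<oplus>\<^bsub>M\<^esub> x"
  by (drule mod_abelian) (simp add: abelian_group.axioms abelian_monoid.a_comm)

lemma mod_lcomm:
  "module R M \<Longrightarrow> x \<in> carrier M \<Longrightarrow> y \<in> carrier M \<Longrightarrow> z \<in> carrier M \<Longrightarrow>
   x \<oplus>\<^bsub>M\<^esub> (y \<oplus>\<^bsub>M\<^esub> z) = y \<oplus>\<^bsub>M\<^esub> (x \<oplus>\<^bsub>M\<^esub> z)"
  by (drule mod_abelian) (simp add: abelian_group.axioms abelian_monoid.a_lcomm)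

lemmas mod_ac = mod_assoc mod_comm mod_lcomm

lemma mod_r_neg [simp]: "module R M \<Longrightarrow> x \<in> carrier M \<Longrightarrow> x \<oplus>\<^bsub>M\<^esub> (\<ominus>\<^bsub>M\<^esub> x) = \<zero>\<^bsub>M\<^esub>"
  by (drule mod_abelian) (simp add: abelian_group.r_neg)

lemma mod_l_neg [simp]: "module R M \<Longrightarrow> x \<in> carrier M \<Longrightarrow> (\<ominus>\<^bsub>M\<^esub> x) \<oplus>\<^bsub>M\<^esub> x = \<zero>\<^bsub>M\<^esub>"
  by (drule mod_abelian) (simp add: abelian_group.l_neg)

lemma mod_neg_neg [simp]: "module R M \<Longrightarrow> x \<in> carrier M \<Longrightarrow> \<ominus>\<^bsub>M\<^esub> (\<ominus>\<^bsub>M\<^esub> x) = x"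
  by (drule mod_abelian) (simp add: abelian_group.minus_minus)

lemma mod_neg_add:
  "module R M \<Longrightarrow> x \<in> carrier M \<Longrightarrow> y \<in> carrier M \<Longrightarrow>
   \<ominus>\<^bsub>M\<^esub> (x \<oplus>\<^bsub>M\<^esub> y) = \<ominus>\<^bsub>M\<^esub> x \<oplus>\<^bsub>M\<^esub> \<ominus>\<^bsub>M\<^esub> y"
  by (drule mod_abelian) (simp add: abelian_group.minus_add)

lemma mod_neg_zero [simp]: "module R M \<Longrightarrow> \<ominus>\<^bsub>M\<^esub> \<zero>\<^bsub>M\<^esub> = \<zero>\<^bsub>M\<^esub>"
  by (metis mod_l_zero mod_neg mod_r_neg mod_zero)

lemma mod_diff_eq: "x \<ominus>\<^bsub>M\<^esub> y = x \<oplus>\<^bsub>M\<^esub> \<ominus>\<^bsub>M\<^esub> y"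
  by (simp add: a_minus_def)

lemma mod_add_neg_cancel [simp]:
  "module R M \<Longrightarrow> x \<in> carrier M \<Longrightarrow> y \<in> carrier M \<Longrightarrow> x \<oplus>\<^bsub>M\<^esub> (\<ominus>\<^bsub>M\<^esub> x \<oplus>\<^bsub>M\<^esub> y) = y"
  by (metis mod_assoc mod_l_zero mod_neg mod_r_neg)

lemma mod_neg_add_cancel [simp]:
  "module R M \<Longrightarrow> x \<in> carrier M \<Longrightarrow> y \<in> carrier M \<Longrightarrow> \<ominus>\<^bsub>M\<^esub> x \<oplus>\<^bsub>M\<^esub> (x \<oplus>\<^bsub>M\<^esub> y) = y"
  by (metis mod_assoc mod_l_zero mod_neg mod_l_neg)

lemma mod_diff_self [simp]: "module R M \<Longrightarrow> x \<in> carrier M \<Longrightarrow> x \<ominus>\<^bsub>M\<^esub> x = \<zero>\<^bsub>M\<^esub>"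
  by (simp add: mod_diff_eq)

lemma mod_diff_zero [simp]: "module R M \<Longrightarrow> x \<in> carrier M \<Longrightarrow> x \<ominus>\<^bsub>M\<^esub> \<zero>\<^bsub>M\<^esub> = x"
  by (simp add: mod_diff_eq)

lemma mod_diff_add [simp]:
  "module R M \<Longrightarrow> x \<in> carrier M \<Longrightarrow> y \<in> carrier M \<Longrightarrow> (x \<ominus>\<^bsub>M\<^esub> y) \<oplus>\<^bsub>M\<^esub> y = x"
  by (simp add: mod_diff_eq mod_ac)

lemma mod_add_diff [simp]:
  "module R M \<Longrightarrow> x \<in> carrier M \<Longrightarrow> y \<in> carrier M \<Longrightarrow> (x \<oplus>\<^bsub>M\<^esub> y) \<ominus>\<^bsub>M\<^esub> y = x"
  by (simp add: mod_diff_eq mod_ac)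

lemma mod_diff_eq_zero:
  "module R M \<Longrightarrow> x \<in> carrier M \<Longrightarrow> y \<in> carrier M \<Longrightarrow> x \<ominus>\<^bsub>M\<^esub> y = \<zero>\<^bsub>M\<^esub> \<longleftrightarrow> x = y"
  by (metis mod_diff_add mod_diff_self mod_l_zero)

lemma mod_eq_diff:
  "module R M \<Longrightarrow> x \<in> carrier M \<Longrightarrow> y \<in> carrier M \<Longrightarrow> z \<in> carrier M \<Longrightarrow>
    x = z \<ominus>\<^bsub>M\<^esub> y \<longleftrightarrow> x \<oplus>\<^bsub>M\<^esub> y = z"
  by (metis mod_add_diff mod_diff_add)

lemma mod_add_eq_zero:
  "module R M \<Longrightarrow> x \<in> carrier M \<Longrightarrow> y \<in> carrier M \<Longrightarrow> x \<oplus>\<^bsub>M\<^esub> y = \<zero>\<^bsub>M\<^esub> \<longleftrightarrow> x = \<ominus>\<^bsub>M\<^esub> y"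
  by (metis mod_add_diff mod_diff_eq mod_l_zero mod_neg mod_l_neg mod_zero)

lemma mod_smult_add:
  "module R M \<Longrightarrow> r \<in> carrier R \<Longrightarrow> x \<in> carrier M \<Longrightarrow> y \<in> carrier M \<Longrightarrow>
   r \<odot>\<^bsub>M\<^esub> (x \<oplus>\<^bsub>M\<^esub> y) = r \<odot>\<^bsub>M\<^esub> x \<oplus>\<^bsub>M\<^esub> r \<odot>\<^bsub>M\<^esub> y"
  by (simp add: module.smult_r_distr)

lemma mod_add_smult:
  "module R M \<Longrightarrow> r \<in> carrier R \<Longrightarrow> r' \<in> carrier R \<Longrightarrow> x \<in> carrier M \<Longrightarrow>
   (r \<oplus> r') \<odot>\<^bsub>M\<^esub> x = r \<odot>\<^bsub>M\<^esub> x \<oplus>\<^bsub>M\<^esub> r' \<odot>\<^bsub>M\<^esub> x"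
  by (simp add: module.smult_l_distr)

lemma mod_mult_smult:
  "module R M \<Longrightarrow> r \<in> carrier R \<Longrightarrow> r' \<in> carrier R \<Longrightarrow> x \<in> carrier M \<Longrightarrow>
   (r \<otimes> r') \<odot>\<^bsub>M\<^esub> x = r \<odot>\<^bsub>M\<^esub> (r' \<odot>\<^bsub>M\<^esub> x)"
  by (simp add: module.smult_assoc1)

lemma mod_smult_comm:
  "module R M \<Longrightarrow> r \<in> carrier R \<Longrightarrow> r' \<in> carrier R \<Longrightarrow> x \<in> carrier M \<Longrightarrow>
   r \<odot>\<^bsub>M\<^esub> (r' \<odot>\<^bsub>M\<^esub> x) = r' \<odot>\<^bsub>M\<^esub> (r \<odot>\<^bsub>M\<^esub> x)"
  by (metis mod_mult_smult m_comm)

lemma mod_one_smult [simp]: "module R M \<Longrightarrow> x \<in> carrier M \<Longrightarrow> \<one> \<odot>\<^bsub>M\<^esub> x = x"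
  by (simp add: module.smult_one)

lemma mod_zero_smult [simp]: "module R M \<Longrightarrow> x \<in> carrier M \<Longrightarrow> \<zero> \<odot>\<^bsub>M\<^esub> x = \<zero>\<^bsub>M\<^esub>"
  by (simp add: module.smult_l_null)

lemma mod_smult_zero [simp]: "module R M \<Longrightarrow> r \<in> carrier R \<Longrightarrow> r \<odot>\<^bsub>M\<^esub> \<zero>\<^bsub>M\<^esub> = \<zero>\<^bsub>M\<^esub>"
  by (simp add: module.smult_r_null)

lemma mod_smult_neg:
  "module R M \<Longrightarrow> r \<in> carrier R \<Longrightarrow> x \<in> carrier M \<Longrightarrow> r \<odot>\<^bsub>M\<^esub> (\<ominus>\<^bsub>M\<^esub> x) = \<ominus>\<^bsub>M\<^esub> (r \<odot>\<^bsub>M\<^esub> x)"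
  by (simp add: module.smult_r_minus)

lemma mod_neg_smult:
  "module R M \<Longrightarrow> r \<in> carrier R \<Longrightarrow> x \<in> carrier M \<Longrightarrow> (\<ominus> r) \<odot>\<^bsub>M\<^esub> x = \<ominus>\<^bsub>M\<^esub> (r \<odot>\<^bsub>M\<^esub> x)"
  by (simp add: module.smult_l_minus)

lemma mod_smult_diff:
  "module R M \<Longrightarrow> r \<in> carrier R \<Longrightarrow> x \<in> carrier M \<Longrightarrow> y \<in> carrier M \<Longrightarrow>
   r \<odot>\<^bsub>M\<^esub> (x \<ominus>\<^bsub>M\<^esub> y) = r \<odot>\<^bsub>M\<^esub> x \<ominus>\<^bsub>M\<^esub> r \<odot>\<^bsub>M\<^esub> y"
  by (simp add: mod_diff_eq mod_smult_add mod_smult_neg)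

lemma mhomI:
  assumes "\<And>x. x \<in> carrier M \<Longrightarrow> f x \<in> carrier L"
    and "\<And>x y. x \<in> carrier M \<Longrightarrow> y \<in> carrier M \<Longrightarrow> f (x \<oplus>\<^bsub>M\<^esub> y) = f x \<oplus>\<^bsub>L\<^esub> f y"
    and "\<And>r x. r \<in> carrier R \<Longrightarrow> x \<in> carrier M \<Longrightarrow> f (r \<odot>\<^bsub>M\<^esub> x) = r \<odot>\<^bsub>L\<^esub> f x"
  shows "f \<in> mhom R M L"
  using assms by (auto simp: mhom_def hom_def)

lemma mhom_closed: "f \<in> mhom R M L \<Longrightarrow> x \<in> carrier M \<Longrightarrow> f x \<in> carrier L"
  by (auto simp: mhom_def hom_def)

lemma mhom_add:
  "f \<in> mhom R M L \<Longrightarrow> x \<in> carrier M \<Longrightarrow> y \<in> carrier M \<Longrightarrow> f (x \<oplus>\<^bsub>M\<^esub> y) = f x \<oplus>\<^bsub>L\<^esub> f y"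
  by (auto simp: mhom_def hom_def)

lemma mhom_smult:
  "f \<in> mhom R M L \<Longrightarrow> r \<in> carrier R \<Longrightarrow> x \<in> carrier M \<Longrightarrow> f (r \<odot>\<^bsub>M\<^esub> x) = r \<odot>\<^bsub>L\<^esub> f x"
  by (auto simp: mhom_def)

lemma mhom_zero:
  "f \<in> mhom R M L \<Longrightarrow> module R M \<Longrightarrow> module R L \<Longrightarrow> f \<zero>\<^bsub>M\<^esub> = \<zero>\<^bsub>L\<^esub>"
  by (metis mhom_closed mhom_smult mod_smult_zero mod_zero mod_zero_smult zero_closed)

lemma mhom_neg:
  "f \<in> mhom R M L \<Longrightarrow> module R M \<Longrightarrow> module R L \<Longrightarrow> x \<in> carrier M \<Longrightarrow>
   f (\<ominus>\<^bsub>M\<^esub> x) = \<ominus>\<^bsub>L\<^esub> f x"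
  using mhom_add[of f M L "\<ominus>\<^bsub>M\<^esub> x" x] mod_add_eq_zero[of L "f (\<ominus>\<^bsub>M\<^esub> x)" "f x"]
  by (simp add: mhom_zero mhom_closed)

lemma mhom_diff:
  "f \<in> mhom R M L \<Longrightarrow> module R M \<Longrightarrow> module R L \<Longrightarrow> x \<in> carrier M \<Longrightarrow> y \<in> carrier M \<Longrightarrow>
   f (x \<ominus>\<^bsub>M\<^esub> y) = f x \<ominus>\<^bsub>L\<^esub> f y"
  by (simp add: mod_diff_eq mhom_add mhom_neg)

lemma mhom_cong:
  "f \<in> mhom R M L \<Longrightarrow> module R M \<Longrightarrow> (\<And>x. x \<in> carrier M \<Longrightarrow> g x = f x) \<Longrightarrow> g \<in> mhom R M L"
  by (rule mhomI) (auto simp: mhom_add mhom_smult mhom_closed)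

lemma mhom_comp:
  "f \<in> mhom R M L \<Longrightarrow> g \<in> mhom R L L' \<Longrightarrow> (\<lambda>x. g (f x)) \<in> mhom R M L'"
  by (rule mhomI) (auto simp: mhom_add mhom_smult mhom_closed)

lemma mhom_plus:
  "f \<in> mhom R M L \<Longrightarrow> g \<in> mhom R M L \<Longrightarrow> module R L \<Longrightarrow> (\<lambda>x. f x \<oplus>\<^bsub>L\<^esub> g x) \<in> mhom R M L"
  by (rule mhomI) (auto simp: mhom_add mhom_smult mhom_closed mod_smult_add mod_ac)

lemma mhom_scale:
  "f \<in> mhom R M L \<Longrightarrow> r \<in> carrier R \<Longrightarrow> module R L \<Longrightarrow> (\<lambda>x. r \<odot>\<^bsub>L\<^esub> f x) \<in> mhom R M L"
  by (rule mhomI) (auto simp: mhom_add mhom_smult mhom_closed mod_smult_add intro: mod_smult_comm)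

lemma mhom_uminus:
  "f \<in> mhom R M L \<Longrightarrow> module R L \<Longrightarrow> (\<lambda>x. \<ominus>\<^bsub>L\<^esub> f x) \<in> mhom R M L"
  by (rule mhomI) (auto simp: mhom_add mhom_smult mhom_closed mod_neg_add mod_smult_neg)

lemma mhom_minus:
  "f \<in> mhom R M L \<Longrightarrow> g \<in> mhom R M L \<Longrightarrow> module R L \<Longrightarrow> (\<lambda>x. f x \<ominus>\<^bsub>L\<^esub> g x) \<in> mhom R M L"
  unfolding mod_diff_eq by (intro mhom_plus mhom_uminus)

lemma mhom_const_zero: "module R L \<Longrightarrow> (\<lambda>x. \<zero>\<^bsub>L\<^esub>) \<in> mhom R M L"
  by (rule mhomI) auto

lemma mhom_id: "(\<lambda>x. x) \<in> mhom R M M"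
  by (rule mhomI) auto

text \<open>Negation is scalar multiplication by \<open>-1\<close>, so additive inverses need no separate check once \<open>0 x = 0\<close>.\<close>

lemma module_by_zero_neg:
  assumes "\<And>x y. x \<in> carrier M \<Longrightarrow> y \<in> carrier M \<Longrightarrow> x \<oplus>\<^bsub>M\<^esub> y \<in> carrier M"
    and "\<zero>\<^bsub>M\<^esub> \<in> carrier M"
    and "\<And>x y z. x \<in> carrier M \<Longrightarrow> y \<in> carrier M \<Longrightarrow> z \<in> carrier M \<Longrightarrow>
       (x \<oplus>\<^bsub>M\<^esub> y) \<oplus>\<^bsub>M\<^esub> z = x \<oplus>\<^bsub>M\<^esub> (y \<oplus>\<^bsub>M\<^esub> z)"
    and "\<And>x y. x \<in> carrier M \<Longrightarrow> y \<in> carrier M \<Longrightarrow> x \<oplus>\<^bsub>M\<^esub> y = y \<oplus>\<^bsub>M\<^esub> x"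
    and "\<And>x. x \<in> carrier M \<Longrightarrow> \<zero>\<^bsub>M\<^esub> \<oplus>\<^bsub>M\<^esub> x = x"
    and "\<And>r x. r \<in> carrier R \<Longrightarrow> x \<in> carrier M \<Longrightarrow> r \<odot>\<^bsub>M\<^esub> x \<in> carrier M"
    and add: "\<And>r s x. r \<in> carrier R \<Longrightarrow> s \<in> carrier R \<Longrightarrow> x \<in> carrier M \<Longrightarrow>
       (r \<oplus> s) \<odot>\<^bsub>M\<^esub> x = r \<odot>\<^bsub>M\<^esub> x \<oplus>\<^bsub>M\<^esub> s \<odot>\<^bsub>M\<^esub> x"
    and "\<And>r x y. r \<in> carrier R \<Longrightarrow> x \<in> carrier M \<Longrightarrow> y \<in> carrier M \<Longrightarrow>
       r \<odot>\<^bsub>M\<^esub> (x \<oplus>\<^bsub>M\<^esub> y) = r \<odot>\<^bsub>M\<^esub> x \<oplus>\<^bsub>M\<^esub> r \<odot>\<^bsub>M\<^esub> y"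
    and "\<And>r s x. r \<in> carrier R \<Longrightarrow> s \<in> carrier R \<Longrightarrow> x \<in> carrier M \<Longrightarrow>
       (r \<otimes> s) \<odot>\<^bsub>M\<^esub> x = r \<odot>\<^bsub>M\<^esub> (s \<odot>\<^bsub>M\<^esub> x)"
    and one: "\<And>x. x \<in> carrier M \<Longrightarrow> \<one> \<odot>\<^bsub>M\<^esub> x = x"
    and null: "\<And>x. x \<in> carrier M \<Longrightarrow> \<zero> \<odot>\<^bsub>M\<^esub> x = \<zero>\<^bsub>M\<^esub>"
  shows "module R M"
proof (rule moduleI)
  show "abelian_group M"
  proof (rule abelian_groupI)
    fix x assume x: "x \<in> carrier M"
    have "(\<ominus> \<one>) \<odot>\<^bsub>M\<^esub> x \<oplus>\<^bsub>M\<^esub> x = (\<ominus> \<one> \<oplus> \<one>) \<odot>\<^bsub>M\<^esub> x"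
      using x by (simp add: add one)
    then show "\<exists>y\<in>carrier M. y \<oplus>\<^bsub>M\<^esub> x = \<zero>\<^bsub>M\<^esub>"
      using x assms(6)[of "\<ominus> \<one>" x] by (auto simp: l_neg null)
  qed (use assms in auto)
qed (use assms is_cring in auto)

lemma mk_module_simps [simp]:
  "carrier (mk_module C z a s) = C" "\<zero>\<^bsub>mk_module C z a s\<^esub> = z"
  "x \<oplus>\<^bsub>mk_module C z a s\<^esub> y = a x y" "r \<odot>\<^bsub>mk_module C z a s\<^esub> x = s r x"
  by (simp_all add: mk_module_def)

lemma module_restrict:
  assumes M: "module R M" and S: "S \<subseteq> carrier M" "\<zero>\<^bsub>M\<^esub> \<in> S"
    and "\<And>x y. x \<in> S \<Longrightarrow> y \<in> S \<Longrightarrow> x \<oplus>\<^bsub>M\<^esub> y \<in> S"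
    and "\<And>r x. r \<in> carrier R \<Longrightarrow> x \<in> S \<Longrightarrow> r \<odot>\<^bsub>M\<^esub> x \<in> S"
  shows "module R (M\<lparr>carrier := S\<rparr>)"
proof (rule module_by_zero_neg)
qed (use assms in \<open>auto simp: subset_iff mod_ac mod_smult_add mod_add_smult mod_mult_smult\<close>)

lemma mhom_finsum:
  assumes f: "f \<in> mhom R M L" and M: "module R M" and L: "module R L"
  shows "finite I \<Longrightarrow> g \<in> I \<rightarrow> carrier M \<Longrightarrow> f (\<Oplus>\<^bsub>M\<^esub>i\<in>I. g i) = (\<Oplus>\<^bsub>L\<^esub>i\<in>I. f (g i))"
proof (induction rule: finite_induct)
  case empty
  interpret M: abelian_group M using M by (rule mod_abelian)
  interpret L: abelian_group L using L by (rule mod_abelian)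
  show ?case by (simp add: mhom_zero[OF f M L])
next
  case (insert i I)
  interpret M: abelian_group M using M by (rule mod_abelian)
  interpret L: abelian_group L using L by (rule mod_abelian)
  have fg: "(\<lambda>i. f (g i)) \<in> I \<rightarrow> carrier L" "f (g i) \<in> carrier L"
    using insert.prems mhom_closed[OF f] by auto
  have "f (\<Oplus>\<^bsub>M\<^esub>i\<in>insert i I. g i) = f (g i \<oplus>\<^bsub>M\<^esub> (\<Oplus>\<^bsub>M\<^esub>i\<in>I. g i))"
    using insert by (subst M.finsum_insert) auto
  also have "\<dots> = f (g i) \<oplus>\<^bsub>L\<^esub> (\<Oplus>\<^bsub>L\<^esub>i\<in>I. f (g i))"
    using insert by (subst mhom_add[OF f]) (auto intro: M.finsum_closed)
  also have "\<dots> = (\<Oplus>\<^bsub>L\<^esub>i\<in>insert i I. f (g i))"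
    using insert fg by (subst L.finsum_insert) auto
  finally show ?case .
qed

end

section \<open>Exactness in one amplitude\<close>

locale n_complexes = cring R for R :: "('r, 's) ring_scheme" (structure) +
  fixes N :: nat
  assumes N_ge_2: "2 \<le> N"
begin

lemma cpx_module [simp]: "n_complex R N X \<Longrightarrow> module R (obj X n)"
  by (simp add: n_complex_def)

text \<open>Target degrees are variables constrained by an equation, because the same degree arises in several
  shapes such as \<open>n + (k + 1)\<close> and \<open>(n + 1) + k\<close>.\<close>

lemma cpx_dif: "n_complex R N X \<Longrightarrow> m = n + 1 \<Longrightarrow> dif X n \<in> mhom R (obj X n) (obj X m)"
  by (simp add: n_complex_def)

lemma dif_closed:
  "n_complex R N X \<Longrightarrow> x \<in> elts X n \<Longrightarrow> m = n + 1 \<Longrightarrow> dif X n x \<in> elts X m"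
  by (rule mhom_closed[OF cpx_dif])

lemma dpow_mhom:
  assumes "n_complex R N X"
  shows "m = n + int k \<Longrightarrow> dpow X n k \<in> mhom R (obj X n) (obj X m)"
proof (induction k arbitrary: m)
  case 0
  then show ?case by (simp add: mhom_id)
next
  case (Suc k)
  have "dif X (n + int k) \<in> mhom R (obj X (n + int k)) (obj X m)"
    by (rule cpx_dif[OF assms]) (simp add: Suc)
  then show ?case using mhom_comp[OF Suc.IH[OF refl]] by simp
qed

lemma dpow_closed:
  "n_complex R N X \<Longrightarrow> x \<in> elts X n \<Longrightarrow> m = n + int k \<Longrightarrow>
   dpow X n k x \<in> elts X m"
  by (rule mhom_closed[OF dpow_mhom])

lemma dpow_zero:
  "n_complex R N X \<Longrightarrow> m = n + int k \<Longrightarrow> dpow X n k \<zero>\<^bsub>obj X n\<^esub> = \<zero>\<^bsub>obj X m\<^esub>"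
  by (simp add: mhom_zero[OF dpow_mhom])

lemma dpow_add:
  "n_complex R N X \<Longrightarrow> m = n + int k \<Longrightarrow> x \<in> elts X n \<Longrightarrow> y \<in> elts X n \<Longrightarrow>
   dpow X n k (x \<oplus>\<^bsub>obj X n\<^esub> y) = dpow X n k x \<oplus>\<^bsub>obj X m\<^esub> dpow X n k y"
  by (simp add: mhom_add[OF dpow_mhom])

lemma dpow_neg:
  "n_complex R N X \<Longrightarrow> m = n + int k \<Longrightarrow> x \<in> elts X n \<Longrightarrow>
   dpow X n k (\<ominus>\<^bsub>obj X n\<^esub> x) = \<ominus>\<^bsub>obj X m\<^esub> dpow X n k x"
  by (simp add: mhom_neg[OF dpow_mhom])

lemma dpow_diff:
  "n_complex R N X \<Longrightarrow> m = n + int k \<Longrightarrow> x \<in> elts X n \<Longrightarrow> y \<in> elts X n \<Longrightarrow>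
   dpow X n k (x \<ominus>\<^bsub>obj X n\<^esub> y) = dpow X n k x \<ominus>\<^bsub>obj X m\<^esub> dpow X n k y"
  by (simp add: mhom_diff[OF dpow_mhom])

lemma dpow_smult:
  "n_complex R N X \<Longrightarrow> m = n + int k \<Longrightarrow> r \<in> carrier R \<Longrightarrow> x \<in> elts X n \<Longrightarrow>
   dpow X n k (r \<odot>\<^bsub>obj X n\<^esub> x) = r \<odot>\<^bsub>obj X m\<^esub> dpow X n k x"
  by (simp add: mhom_smult[OF dpow_mhom])

lemma dpow_dpow: "m = n + int j \<Longrightarrow> dpow X m k (dpow X n j x) = dpow X n (j + k) x"
  by (induction k) (auto simp: algebra_simps)

lemma dpow_comp: "m = n + int j \<Longrightarrow> i = j + k \<Longrightarrow> dpow X m k (dpow X n j x) = dpow X n i x"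
  by (simp add: dpow_dpow)

lemma dpow_Suc_shift: "dpow X n (Suc k) x = dpow X (n + 1) k (dif X n x)"
  using dpow_dpow[of "n + 1" n 1 X k x] by simp

lemma dpow_ge_N:
  assumes X: "n_complex R N X" and k: "N \<le> k" and x: "x \<in> elts X n" and m: "m = n + int k"
  shows "dpow X n k x = \<zero>\<^bsub>obj X m\<^esub>"
proof -
  have "dpow X n k x = dpow X (n + int N) (k - N) (dpow X n N x)"
    using k by (simp add: dpow_dpow)
  also have "dpow X n N x = \<zero>\<^bsub>obj X (n + int N)\<^esub>" using X x by (simp add: n_complex_def)
  also have "dpow X (n + int N) (k - N) \<dots> = \<zero>\<^bsub>obj X m\<^esub>" using k m X by (intro dpow_zero) auto
  finally show ?thesis .
qed

definition exact_at :: "('r, 'm) ncomplex \<Rightarrow> nat \<Rightarrow> int \<Rightarrow> bool" where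
  "exact_at X t l \<longleftrightarrow> (\<forall>z\<in>elts X l. dpow X l t z = \<zero>\<^bsub>obj X (l + int t)\<^esub> \<longrightarrow>
     (\<exists>y\<in>elts X (l - int (N - t)). dpow X (l - int (N - t)) (N - t) y = z))"

lemma exact_atE:
  assumes "exact_at X t l" "z \<in> elts X l" "dpow X l t z = \<zero>\<^bsub>obj X m\<^esub>"
    "m = l + int t" "k = N - t" "j = l - int k"
  obtains y where "y \<in> elts X j" "dpow X j k y = z"
  using assms unfolding exact_at_def by blast

definition exact_below :: "('r, 'm) ncomplex \<Rightarrow> nat \<Rightarrow> int \<Rightarrow> bool" where
  "exact_below X t s \<longleftrightarrow> (\<forall>l<s. exact_at X t l)"

text \<open>An element killed by one differential is divisible by \<open>d\<^sup>k\<close> for all \<open>k \<le> N - 1\<close>, and the exponent is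
  raised one at a time. Let \<open>x = d\<^sup>k y\<close>. If \<open>k < t\<close>, then \<open>y\<close> itself is killed by \<open>d\<^sup>t\<close> and exactness
  applies to it. Otherwise exactness applies to \<open>d\<^bsup>k+1-t\<^esup> y\<close>, which leads to an element \<open>w\<close> with
  \<open>x = d\<^bsup>N-1\<^esup> w\<close>.\<close>

lemma exact_below_cycle:
  assumes X: "n_complex R N X" and t: "1 \<le> t" "t < N" and ex: "exact_below X t s"
    and j: "j < s" and x: "x \<in> elts X j" and dx: "dif X j x = \<zero>\<^bsub>obj X (j + 1)\<^esub>"
    and k: "k \<le> N - 1"
  shows "\<exists>y\<in>elts X (j - int k). dpow X (j - int k) k y = x"
  using k
proof (induction k rule: less_induct)
  case (less k)
  show ?case
  proof (cases k)
    case 0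
    then show ?thesis using x by auto
  next
    case (Suc k')
    obtain y where y: "y \<in> elts X (j - int k')" "dpow X (j - int k') k' y = x"
      using less Suc by auto
    have dy: "dpow X (j - int k') (k' + 1) y = \<zero>\<^bsub>obj X (j + 1)\<^esub>"
      using y dx by simp
    show ?thesis
    proof (cases "k' + 1 \<le> t")
      case True
      have "dpow X (j - int k') t y = dpow X (j + 1) (t - (k' + 1)) (dpow X (j - int k') (k' + 1) y)"
        using True by (subst dpow_dpow) auto
      also have "\<dots> = \<zero>\<^bsub>obj X (j - int k' + int t)\<^esub>"
        unfolding dy using True X by (intro dpow_zero) auto
      finally obtain w where w: "w \<in> elts X (j - int k' - int (N - t))"
         "dpow X (j - int k' - int (N - t)) (N - t) w = y"
        using ex j y(1) exact_atE[of X t "j - int k'" y] unfolding exact_below_def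
        by (metis diff_le_eq add_increasing2 le_less_trans of_nat_0_le_iff order_refl)
      have wx: "dpow X (j - int k' - int (N - t)) (N - t + k') w = x"
        using w y by (metis add.commute diff_add_cancel dpow_dpow)
      show ?thesis
      proof (rule bexI)
        show "dpow X (j - int k) k (dpow X (j - int k' - int (N - t)) (N - t - 1) w) = x"
          unfolding wx[symmetric] using t Suc by (intro dpow_comp) (auto simp: algebra_simps of_nat_diff)
        show "dpow X (j - int k' - int (N - t)) (N - t - 1) w \<in> elts X (j - int k)"
          using X w t Suc by (intro dpow_closed) (auto simp: of_nat_diff)
      qed
    next
      case False
      \<comment> \<open>\<open>d\<^sup>i y\<close> is killed by \<open>d\<^sup>t\<close> and lies in degree \<open>j + 1 - t < s\<close>, where exactness applies.\<close>
      define i where "i = k' + 1 - t"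
      have i: "k' + 1 = i + t" "i < N - t" "i \<le> k'" using False t less.prems Suc by (auto simp: i_def)
      let ?u = "dpow X (j - int k') i y"
      have u: "?u \<in> elts X (j + 1 - int t)"
        using X y i by (intro dpow_closed) auto
      have "dpow X (j + 1 - int t) t ?u = \<zero>\<^bsub>obj X (j + 1)\<^esub>"
        using dy[unfolded i(1)] dpow_comp[of "j + 1 - int t" "j - int k'" i "i + t" t X y] i(1) by simp
      then obtain w where w: "w \<in> elts X (j + 1 - int t - int (N - t))"
         "dpow X (j + 1 - int t - int (N - t)) (N - t) w = ?u"
        using ex j u t exact_atE[of X t "j + 1 - int t" ?u] unfolding exact_below_def by force
      define w' where "w' = dpow X (j + 1 - int t - int (N - t)) (N - t - i) w"
      have w': "w' \<in> elts X (j - int k')"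
        unfolding w'_def using X w i t by (intro dpow_closed) (auto simp: of_nat_diff)
      have iw': "dpow X (j - int k') i w' = ?u"
        unfolding w'_def w(2)[symmetric] using i t by (subst dpow_dpow) (auto simp: of_nat_diff)
      have "dpow X (j - int k') k' w' = dpow X (j - int k' + int i) (k' - i) (dpow X (j - int k') i w')"
        using i by (subst dpow_dpow) auto
      also have "\<dots> = x" unfolding iw' using i y by (subst dpow_dpow) auto
      finally have "dpow X (j + 1 - int t - int (N - t)) (N - t - i + k') w = x"
        unfolding w'_def using i t by (subst (asm) dpow_dpow) (auto simp: of_nat_diff)
      moreover have e: "j + 1 - int t - int (N - t) = j + 1 - int N" "N - t - i + k' = N - 1"
        using t i less.prems Suc by auto
      ultimately have wx: "dpow X (j + 1 - int N) (N - 1) w = x" "w \<in> elts X (j + 1 - int N)"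
        using w(1)[unfolded e(1)] by (simp_all only: e)
      show ?thesis
      proof (rule bexI)
        show "dpow X (j - int k) k (dpow X (j + 1 - int N) (N - 1 - k) w) = x"
          using wx less.prems N_ge_2 by (subst dpow_dpow) (auto simp: of_nat_diff)
        show "dpow X (j + 1 - int N) (N - 1 - k) w \<in> elts X (j - int k)"
          using X wx less.prems N_ge_2 by (intro dpow_closed) (auto simp: of_nat_diff)
      qed
    qed
  qed
qed

text \<open>Homology of amplitude \<open>t\<close> below \<open>s\<close> controls homology of every amplitude \<open>r\<close> in the degrees
  \<open>j < s\<close> with \<open>j + r \<le> s\<close>.
  If \<open>d\<^bsup>r+1\<^esup> x = 0\<close>, then \<open>d\<^sup>r x\<close> is killed by \<open>d\<close> and hence equal to some \<open>d\<^bsup>N-1\<^esup> w\<close>. Subtracting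
  \<open>d\<^bsup>N-1-r\<^esup> w\<close> from \<open>x\<close> leaves an element killed by \<open>d\<^sup>r\<close>, and \<open>r\<close> decreases.\<close>

theorem exact_below_change:
  assumes X: "n_complex R N X" and t: "1 \<le> t" "t < N" and ex: "exact_below X t s"
  shows "r < N \<Longrightarrow> j + int r \<le> s \<Longrightarrow> j < s \<Longrightarrow> exact_at X r j"
proof (induction r)
  case 0
  have "\<exists>y\<in>elts X (j - int N). dpow X (j - int N) N y = \<zero>\<^bsub>obj X j\<^esub>"
    using X by (intro bexI[of _ "\<zero>\<^bsub>obj X (j - int N)\<^esub>"]) (auto intro: dpow_zero)
  then show ?case by (simp add: exact_at_def)
next
  case (Suc r)
  show ?case
    unfolding exact_at_def
  proof (intro ballI impI)
    fix x assume x: "x \<in> elts X j"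
      and dx: "dpow X j (Suc r) x = \<zero>\<^bsub>obj X (j + int (Suc r))\<^esub>"
    let ?u = "dpow X j r x"
    have u: "?u \<in> elts X (j + int r)" using X x by (intro dpow_closed) auto
    have "dif X (j + int r) ?u = \<zero>\<^bsub>obj X (j + int r + 1)\<^esub>" using dx by (simp add: algebra_simps)
    then obtain w where w: "w \<in> elts X (j + int r - int (N - 1))"
      "dpow X (j + int r - int (N - 1)) (N - 1) w = ?u"
      using exact_below_cycle[OF X t ex _ u] Suc.prems by force
    have e: "j + int r - int (N - 1) = j - int (N - Suc r)" "N - Suc r + r = N - 1"
      using Suc.prems by (auto simp: of_nat_diff)
    note w = w[unfolded e(1)]
    define v where "v = dpow X (j - int (N - Suc r)) (N - Suc r) w"
    have v: "v \<in> elts X j" unfolding v_def using X w by (intro dpow_closed) auto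
    have "dpow X j r v = ?u" unfolding v_def w(2)[symmetric] using e by (intro dpow_comp) auto
    then have "dpow X j r (x \<ominus>\<^bsub>obj X j\<^esub> v) = \<zero>\<^bsub>obj X (j + int r)\<^esub>"
      using X x v u by (simp add: dpow_diff)
    moreover have "exact_at X r j" using Suc by simp
    ultimately obtain y where y: "y \<in> elts X (j - int (N - r))"
      "dpow X (j - int (N - r)) (N - r) y = x \<ominus>\<^bsub>obj X j\<^esub> v"
      using exact_atE[of X r j "x \<ominus>\<^bsub>obj X j\<^esub> v"] X x v by (metis mod_diff cpx_module)
    let ?y = "dif X (j - int (N - r)) y"
    have y': "?y \<in> elts X (j - int (N - Suc r))"
      using X y Suc.prems by (intro dif_closed) (auto simp: of_nat_diff)
    have e': "Suc (N - Suc r) = N - r" "j - int (N - r) + 1 = j - int (N - Suc r)"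
      using Suc.prems by (auto simp: of_nat_diff)
    have dy: "dpow X (j - int (N - Suc r)) (N - Suc r) ?y = x \<ominus>\<^bsub>obj X j\<^esub> v"
      using dpow_Suc_shift[of X "j - int (N - r)" "N - Suc r" y] y(2) unfolding e' by simp
    have dw: "dpow X (j - int (N - Suc r)) (N - Suc r) w = v" by (simp add: v_def)
    have "dpow X (j - int (N - Suc r)) (N - Suc r) (?y \<oplus>\<^bsub>obj X (j - int (N - Suc r))\<^esub> w) = x"
      using X y' w(1) v x by (simp add: dpow_add[of X j] dy dw)
    then show "\<exists>y\<in>elts X (j - int (N - Suc r)).
              dpow X (j - int (N - Suc r)) (N - Suc r) y = x"
      using X y' w(1) by (intro bexI[of _ "?y \<oplus>\<^bsub>obj X (j - int (N - Suc r))\<^esub> w"]) auto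
  qed
qed

lemma exact_change:
  assumes "n_complex R N X" "1 \<le> t" "t < N" "\<And>l. exact_at X t l" "r < N"
  shows "exact_at X r j"
  using exact_below_change[of X t "j + int r + 1" r j] assms by (simp add: exact_below_def)

lemma trivial_quotient_module:
  assumes M: "module R M" and H: "\<zero>\<^bsub>M\<^esub> \<in> H" "H \<subseteq> carrier M"
    and add: "\<And>x y. x \<in> H \<Longrightarrow> y \<in> H \<Longrightarrow> x \<oplus>\<^bsub>M\<^esub> y \<in> H"
    and neg: "\<And>x. x \<in> H \<Longrightarrow> \<ominus>\<^bsub>M\<^esub> x \<in> H"
  shows "trivial_module (quotient_module M H) \<longleftrightarrow> carrier M \<subseteq> H"
proof -
  have in_coset: "a \<in> H +>\<^bsub>M\<^esub> a" if "a \<in> carrier M" for a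
  proof -
    have "\<zero>\<^bsub>M\<^esub> \<oplus>\<^bsub>M\<^esub> a = a" using M that by simp
    then show ?thesis unfolding a_r_coset_def' using H(1) by blast
  qed
  have coset: "H +>\<^bsub>M\<^esub> a = H" if a: "a \<in> H" for a
  proof
    show "H +>\<^bsub>M\<^esub> a \<subseteq> H" using a add by (auto simp: a_r_coset_def')
    show "H \<subseteq> H +>\<^bsub>M\<^esub> a"
    proof
      fix h assume h: "h \<in> H"
      then have "h \<oplus>\<^bsub>M\<^esub> \<ominus>\<^bsub>M\<^esub> a \<in> H" using a add neg by auto
      moreover have "(h \<oplus>\<^bsub>M\<^esub> \<ominus>\<^bsub>M\<^esub> a) \<oplus>\<^bsub>M\<^esub> a = h" using h a H M by (auto simp: mod_assoc subset_iff)
      ultimately show "h \<in> H +>\<^bsub>M\<^esub> a" unfolding a_r_coset_def' by force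
    qed
  qed
  have car: "carrier (quotient_module M H) = (\<lambda>a. H +>\<^bsub>M\<^esub> a) ` carrier M"
    by (auto simp: quotient_module_def A_RCOSETS_def')
  have zero: "\<zero>\<^bsub>quotient_module M H\<^esub> = H" by (simp add: quotient_module_def)
  show ?thesis
  proof
    assume "trivial_module (quotient_module M H)"
    then have "H +>\<^bsub>M\<^esub> a = H" if "a \<in> carrier M" for a
      using that unfolding trivial_module_def car zero by blast
    then show "carrier M \<subseteq> H" using in_coset by blast
  next
    assume "carrier M \<subseteq> H"
    then have "H = carrier M" using H by auto
    then show "trivial_module (quotient_module M H)"
      unfolding trivial_module_def car zero using coset M by (metis image_cong image_constant mod_zero)
  qed
qed

lemma a_inv_restrict:
  assumes M: "module R M" and S: "module R (M\<lparr>carrier := S\<rparr>)" "S \<subseteq> carrier M" and x: "x \<in> S"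
  shows "\<ominus>\<^bsub>M\<lparr>carrier := S\<rparr>\<^esub> x = \<ominus>\<^bsub>M\<^esub> x"
proof -
  let ?S = "M\<lparr>carrier := S\<rparr>"
  have y: "\<ominus>\<^bsub>?S\<^esub> x \<in> S" using mod_neg[OF S(1), of x] x by simp
  have "\<ominus>\<^bsub>?S\<^esub> x \<oplus>\<^bsub>M\<^esub> x = \<zero>\<^bsub>M\<^esub>" using mod_l_neg[OF S(1), of x] x by simp
  then show ?thesis using mod_add_eq_zero[OF M, of "\<ominus>\<^bsub>?S\<^esub> x" x] y x S by auto
qed

lemma cycles_module:
  assumes X: "n_complex R N X"
  shows "module R (obj X n\<lparr>carrier := cycles X t n\<rparr>)"
proof (rule module_restrict)
qed (use X in \<open>auto simp: cycles_def dpow_zero dpow_add dpow_smult\<close>)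

lemma mem_boundaries:
  "k = N - t \<Longrightarrow> m = n - int k \<Longrightarrow>
   z \<in> boundaries N X t n \<longleftrightarrow> (\<exists>y\<in>elts X m. dpow X m k y = z)"
  by (auto simp: boundaries_def image_iff)

lemma boundaries_le_cycles:
  assumes "n_complex R N X" "t \<le> N" shows "boundaries N X t n \<subseteq> cycles X t n"
proof
  fix z assume "z \<in> boundaries N X t n"
  then obtain y where y: "y \<in> elts X (n - int (N - t))" "z = dpow X (n - int (N - t)) (N - t) y"
    by (auto simp: boundaries_def)
  have "dpow X n t z = \<zero>\<^bsub>obj X (n + int t)\<^esub>"
    unfolding y(2) using assms y by (subst dpow_dpow) (auto intro: dpow_ge_N simp: of_nat_diff)
  then show "z \<in> cycles X t n"
    using y assms by (auto simp: cycles_def intro: dpow_closed)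
qed

lemma boundaries_zero: "n_complex R N X \<Longrightarrow> \<zero>\<^bsub>obj X n\<^esub> \<in> boundaries N X t n"
  by (subst mem_boundaries[OF refl refl]) (auto intro!: bexI[of _ "\<zero>\<^bsub>obj X (n - int (N - t))\<^esub>"] dpow_zero)

lemma boundaries_add:
  assumes X: "n_complex R N X" and "x \<in> boundaries N X t n" "y \<in> boundaries N X t n"
  shows "x \<oplus>\<^bsub>obj X n\<^esub> y \<in> boundaries N X t n"
proof -
  let ?m = "n - int (N - t)"
  obtain x' y' where "x' \<in> elts X ?m" "x = dpow X ?m (N - t) x'"
     "y' \<in> elts X ?m" "y = dpow X ?m (N - t) y'"
    using assms by (auto simp: boundaries_def)
  then have "x \<oplus>\<^bsub>obj X n\<^esub> y = dpow X ?m (N - t) (x' \<oplus>\<^bsub>obj X ?m\<^esub> y')" "x' \<oplus>\<^bsub>obj X ?m\<^esub> y' \<in> elts X ?m"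
    using X by (auto simp: dpow_add[of X n])
  then show ?thesis unfolding boundaries_def by blast
qed

lemma boundaries_neg:
  assumes X: "n_complex R N X" and "x \<in> boundaries N X t n"
  shows "\<ominus>\<^bsub>obj X n\<^esub> x \<in> boundaries N X t n"
proof -
  let ?m = "n - int (N - t)"
  obtain x' where "x' \<in> elts X ?m" "x = dpow X ?m (N - t) x'"
    using assms by (auto simp: boundaries_def)
  then have "\<ominus>\<^bsub>obj X n\<^esub> x = dpow X ?m (N - t) (\<ominus>\<^bsub>obj X ?m\<^esub> x')" "\<ominus>\<^bsub>obj X ?m\<^esub> x' \<in> elts X ?m"
    using X by (auto simp: dpow_neg[of X n])
  then show ?thesis unfolding boundaries_def by blast
qed

lemma trivial_homology_iff:
  assumes X: "n_complex R N X" and t: "t \<le> N"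
  shows "trivial_module (homology N X t n) \<longleftrightarrow> exact_at X t n"
proof -
  let ?Z = "obj X n\<lparr>carrier := cycles X t n\<rparr>"
  have "trivial_module (homology N X t n) \<longleftrightarrow> carrier ?Z \<subseteq> boundaries N X t n"
    unfolding homology_def
  proof (rule trivial_quotient_module)
    show Z: "module R ?Z" using X by (rule cycles_module)
    fix x assume x: "x \<in> boundaries N X t n"
    have "\<ominus>\<^bsub>?Z\<^esub> x = \<ominus>\<^bsub>obj X n\<^esub> x"
      using X Z x boundaries_le_cycles[OF X t] by (intro a_inv_restrict) (auto simp: cycles_def)
    then show "\<ominus>\<^bsub>?Z\<^esub> x \<in> boundaries N X t n" using boundaries_neg[OF X x] by simp
  qed (use X t boundaries_le_cycles in \<open>auto simp: boundaries_zero boundaries_add\<close>)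
  also have "\<dots> \<longleftrightarrow> exact_at X t n"
    by (auto simp: exact_at_def cycles_def mem_boundaries[OF refl refl] subset_iff)
  finally show ?thesis .
qed

lemma n_acyclicI:
  assumes "n_complex R N X" "1 \<le> t" "t < N" "\<And>l. exact_at X t l"
  shows "n_acyclic N X"
  unfolding n_acyclic_def
proof (intro ballI allI)
  fix r n assume "r \<in> {1..N - 1}"
  then have "r < N" using N_ge_2 by auto
  then show "trivial_module (homology N X r n)"
    using assms exact_change[OF assms] by (simp add: trivial_homology_iff)
qed

end

text \<open>A set of integers has the same infimum as another one as soon as both have the same lower bounds.
  This covers the empty set and sets that are unbounded below.\<close>

lemma inf_ext_cong:
  assumes "\<And>s. (\<forall>l<s. l \<notin> S) \<longleftrightarrow> (\<forall>l<s. l \<notin> T)"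
  shows "inf_ext S = inf_ext T"
proof -
  have empty: "S = {} \<longleftrightarrow> (\<forall>s. \<forall>l<s. l \<notin> S)" for S :: "int set"
    by (metis all_not_in_conv less_add_one)
  have lower: "(\<forall>x\<in>S. s \<le> x) \<longleftrightarrow> (\<forall>l<s. l \<notin> S)" for S and s :: int
    by (auto simp: not_less[symmetric])
  have same: "(\<forall>x\<in>S. s \<le> x) \<longleftrightarrow> (\<forall>x\<in>T. s \<le> x)" for s
    unfolding lower by (rule assms)
  have "Inf S = Inf T" if "S \<noteq> {}" "T \<noteq> {}" "bdd_below S" "bdd_below T"
  proof (rule antisym)
    show "Inf S \<le> Inf T" using that same by (intro cInf_greatest) (auto intro: cInf_lower)
    show "Inf T \<le> Inf S" using that same by (intro cInf_greatest) (auto intro: cInf_lower)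
  qed
  moreover have "S = {} \<longleftrightarrow> T = {}" unfolding empty[of S] empty[of T] using assms by simp
  moreover have "bdd_below S \<longleftrightarrow> bdd_below T" unfolding bdd_below_def using same by simp
  ultimately show ?thesis unfolding inf_ext_def by simp
qed

section \<open>Isomorphisms on homology\<close>

context n_complexes
begin

lemma chain_map_mhom: "chain_map R X Y f \<Longrightarrow> f n \<in> mhom R (obj X n) (obj Y n)"
  by (simp add: chain_map_def)

lemma chain_map_closed: "chain_map R X Y f \<Longrightarrow> x \<in> elts X n \<Longrightarrow> f n x \<in> elts Y n"
  by (rule mhom_closed[OF chain_map_mhom])

lemma chain_map_dif:
  "chain_map R X Y f \<Longrightarrow> x \<in> elts X n \<Longrightarrow> m = n + 1 \<Longrightarrow> f m (dif X n x) = dif Y n (f n x)"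
  by (simp add: chain_map_def)

lemma chain_map_dpow:
  assumes "chain_map R X Y f" "n_complex R N X" "x \<in> elts X n"
  shows "m = n + int k \<Longrightarrow> f m (dpow X n k x) = dpow Y n k (f n x)"
proof (induction k arbitrary: m)
  case (Suc k)
  then show ?case
    using chain_map_dif[OF assms(1), of "dpow X n k x" "n + int k" m] dpow_closed[OF assms(2,3) refl]
    by simp
qed simp

lemma boundariesI:
  "y \<in> elts X m \<Longrightarrow> k = N - t \<Longrightarrow> m = n - int k \<Longrightarrow> z = dpow X m k y \<Longrightarrow> z \<in> boundaries N X t n"
  by (auto simp: boundaries_def)

lemma boundariesE:
  assumes "z \<in> boundaries N X t n" "k = N - t" "m = n - int k"
  obtains y where "y \<in> elts X m" "z = dpow X m k y"
  using assms by (auto simp: boundaries_def)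

lemma cyclesI: "z \<in> elts X n \<Longrightarrow> m = n + int t \<Longrightarrow> dpow X n t z = \<zero>\<^bsub>obj X m\<^esub> \<Longrightarrow> z \<in> cycles X t n"
  by (simp add: cycles_def)

lemma cyclesD:
  assumes "z \<in> cycles X t n"
  shows "z \<in> elts X n" "m = n + int t \<Longrightarrow> dpow X n t z = \<zero>\<^bsub>obj X m\<^esub>"
  using assms by (simp_all add: cycles_def)

lemma exact_at_iff: "exact_at X t n \<longleftrightarrow> cycles X t n \<subseteq> boundaries N X t n"
  by (auto simp: exact_at_def cycles_def mem_boundaries[OF refl refl] subset_iff)

lemma boundaries_carrier: "n_complex R N X \<Longrightarrow> z \<in> boundaries N X t n \<Longrightarrow> t \<le> N \<Longrightarrow> z \<in> elts X n"
  by (auto simp: boundaries_def intro: dpow_closed)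

lemma boundaries_diff:
  "n_complex R N X \<Longrightarrow> x \<in> boundaries N X t n \<Longrightarrow> y \<in> boundaries N X t n \<Longrightarrow>
   x \<ominus>\<^bsub>obj X n\<^esub> y \<in> boundaries N X t n"
  by (simp add: mod_diff_eq boundaries_add boundaries_neg)

lemma chain_map_cycles:
  "chain_map R X Y f \<Longrightarrow> n_complex R N X \<Longrightarrow> n_complex R N Y \<Longrightarrow> z \<in> cycles X t n \<Longrightarrow> f n z \<in> cycles Y t n"
  by (auto simp: cycles_def chain_map_closed chain_map_dpow[symmetric] mhom_zero[OF chain_map_mhom])

lemma chain_map_boundaries:
  assumes f: "chain_map R X Y f" and X: "n_complex R N X" and t: "t \<le> N" and z: "z \<in> boundaries N X t n"
  shows "f n z \<in> boundaries N Y t n"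
proof -
  obtain y where y: "y \<in> elts X (n - int (N - t))" "z = dpow X (n - int (N - t)) (N - t) y"
    using boundariesE[OF z refl refl] .
  show ?thesis
    by (rule boundariesI[of "f (n - int (N - t)) y", OF _ refl refl])
      (use y f X in \<open>auto simp: chain_map_closed intro: chain_map_dpow\<close>)
qed

text \<open>A chain map that is an isomorphism on homology of all amplitudes, phrased with cycles and boundaries
  instead of cosets: the first clause is injectivity, the second one surjectivity.\<close>

definition hiso :: "('r, 'x) ncomplex \<Rightarrow> ('r, 'y) ncomplex \<Rightarrow> (int \<Rightarrow> 'x \<Rightarrow> 'y) \<Rightarrow> bool" where
  "hiso X Y f \<longleftrightarrow> chain_map R X Y f \<and> (\<forall>t\<in>{1..N - 1}. \<forall>n.
     (\<forall>z\<in>cycles X t n. f n z \<in> boundaries N Y t n \<longrightarrow> z \<in> boundaries N X t n) \<and>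
     (\<forall>z'\<in>cycles Y t n. \<exists>z\<in>cycles X t n. z' \<ominus>\<^bsub>obj Y n\<^esub> f n z \<in> boundaries N Y t n))"

lemma hiso_inj:
  "hiso X Y f \<Longrightarrow> 1 \<le> t \<Longrightarrow> t < N \<Longrightarrow> z \<in> cycles X t n \<Longrightarrow> f n z \<in> boundaries N Y t n \<Longrightarrow>
   z \<in> boundaries N X t n"
  unfolding hiso_def by (auto dest!: bspec[where x = t])

lemma hiso_surj:
  assumes "hiso X Y f" "1 \<le> t" "t < N" "z' \<in> cycles Y t n"
  obtains z where "z \<in> cycles X t n" "z' \<ominus>\<^bsub>obj Y n\<^esub> f n z \<in> boundaries N Y t n"
proof -
  have "t \<in> {1..N - 1}" using assms by auto
  then show ?thesis using assms that unfolding hiso_def by blast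
qed

lemma hiso_exact_at:
  assumes f: "hiso X Y f" and X: "n_complex R N X" and Y: "n_complex R N Y" and t: "1 \<le> t" "t < N"
  shows "exact_at X t n \<longleftrightarrow> exact_at Y t n"
proof
  have cm: "chain_map R X Y f" using f by (simp add: hiso_def)
  show "exact_at Y t n" if ex: "exact_at X t n"
    unfolding exact_at_iff
  proof
    fix z' assume z': "z' \<in> cycles Y t n"
    obtain z where z: "z \<in> cycles X t n" "z' \<ominus>\<^bsub>obj Y n\<^esub> f n z \<in> boundaries N Y t n"
      by (rule hiso_surj[OF f t z'])
    have "f n z \<in> boundaries N Y t n"
      using ex z t by (intro chain_map_boundaries[OF cm X]) (auto simp: exact_at_iff)
    from boundaries_add[OF Y z(2) this] show "z' \<in> boundaries N Y t n"
      using z' z(1) Y cm by (simp add: cyclesD chain_map_closed)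
  qed
  show "exact_at X t n" if ex: "exact_at Y t n"
    unfolding exact_at_iff
  proof
    fix z assume z: "z \<in> cycles X t n"
    have "f n z \<in> boundaries N Y t n"
      using ex z chain_map_cycles[OF cm X Y] by (auto simp: exact_at_iff)
    then show "z \<in> boundaries N X t n" by (rule hiso_inj[OF f t z])
  qed
qed

lemma coset_mem:
  "module R M \<Longrightarrow> a \<in> H +>\<^bsub>M\<^esub> b \<Longrightarrow> H \<subseteq> carrier M \<Longrightarrow> b \<in> carrier M \<Longrightarrow> a \<ominus>\<^bsub>M\<^esub> b \<in> H"
  by (auto simp: a_r_coset_def' subset_iff)

lemma coset_boundaries:
  assumes X: "n_complex R N X" and t: "t \<le> N" and b: "b \<in> boundaries N X t n" and z: "z \<in> elts X n"
  shows "boundaries N X t n +>\<^bsub>obj X n\<^esub> (b \<oplus>\<^bsub>obj X n\<^esub> z) = boundaries N X t n +>\<^bsub>obj X n\<^esub> z"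
    (is "?L = ?R")
proof
  have c: "x \<in> elts X n" if "x \<in> boundaries N X t n" for x
    using X that t by (rule boundaries_carrier)
  show "?L \<subseteq> ?R"
  proof
    fix a assume "a \<in> ?L"
    then obtain h where h: "h \<in> boundaries N X t n" "a = h \<oplus>\<^bsub>obj X n\<^esub> (b \<oplus>\<^bsub>obj X n\<^esub> z)"
      by (auto simp: a_r_coset_def')
    have "a = (h \<oplus>\<^bsub>obj X n\<^esub> b) \<oplus>\<^bsub>obj X n\<^esub> z" using h b z c X by (simp add: mod_assoc)
    moreover have "h \<oplus>\<^bsub>obj X n\<^esub> b \<in> boundaries N X t n" using X h b by (simp add: boundaries_add)
    ultimately show "a \<in> ?R" unfolding a_r_coset_def' by blast
  qed
  show "?R \<subseteq> ?L"
  proof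
    fix a assume "a \<in> ?R"
    then obtain h where h: "h \<in> boundaries N X t n" "a = h \<oplus>\<^bsub>obj X n\<^esub> z"
      by (auto simp: a_r_coset_def')
    have "a = (h \<ominus>\<^bsub>obj X n\<^esub> b) \<oplus>\<^bsub>obj X n\<^esub> (b \<oplus>\<^bsub>obj X n\<^esub> z)"
      using h b z c X by (simp add: mod_diff_eq mod_assoc)
    moreover have "h \<ominus>\<^bsub>obj X n\<^esub> b \<in> boundaries N X t n" using X h b by (simp add: boundaries_diff)
    ultimately show "a \<in> ?L" unfolding a_r_coset_def' by blast
  qed
qed

lemma homology_map_coset:
  assumes f: "chain_map R X Y f" and X: "n_complex R N X" and Y: "n_complex R N Y" and t: "t \<le> N"
    and z: "z \<in> elts X n"
  shows "homology_map N Y f t n (boundaries N X t n +>\<^bsub>obj X n\<^esub> z) = boundaries N Y t n +>\<^bsub>obj Y n\<^esub> f n z"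
proof -
  have "boundaries N Y t n +>\<^bsub>obj Y n\<^esub> f n (b \<oplus>\<^bsub>obj X n\<^esub> z) = boundaries N Y t n +>\<^bsub>obj Y n\<^esub> f n z"
    if b: "b \<in> boundaries N X t n" for b
  proof -
    have "f n (b \<oplus>\<^bsub>obj X n\<^esub> z) = f n b \<oplus>\<^bsub>obj Y n\<^esub> f n z"
      using f X b z t by (intro mhom_add[OF chain_map_mhom]) (auto intro: boundaries_carrier)
    then show ?thesis
      using coset_boundaries[OF Y t chain_map_boundaries[OF f X t b], of "f n z"] f z
      by (simp add: chain_map_closed)
  qed
  then show ?thesis
    using boundaries_zero[OF X, of n t] unfolding homology_map_def a_r_coset_def'[where G = "obj X n"]
    by auto
qed

lemma quasi_iso_hiso:
  assumes q: "quasi_iso R N X Y f" and X: "n_complex R N X" and Y: "n_complex R N Y"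
  shows "hiso X Y f"
  unfolding hiso_def
proof (intro conjI ballI allI impI)
  show f: "chain_map R X Y f" using q by (simp add: quasi_iso_def)
  fix t n assume tt: "t \<in> {1..N - 1}"
  then have t: "t \<le> N" by auto
  have bij: "bij_betw (homology_map N Y f t n) (carrier (homology N X t n)) (carrier (homology N Y t n))"
    using q tt by (simp add: quasi_iso_def)
  have car: "carrier (homology N Z t n) = (\<lambda>z. boundaries N Z t n +>\<^bsub>obj Z n\<^esub> z) ` cycles Z t n"
    for Z :: "('r, 'z) ncomplex"
    by (auto simp: homology_def quotient_module_def A_RCOSETS_def' a_r_coset_def')
  have zero: "boundaries N Z t n +>\<^bsub>obj Z n\<^esub> z = boundaries N Z t n"
    if Z: "n_complex R N Z" and z: "z \<in> boundaries N Z t n" for Z :: "('r, 'z) ncomplex" and z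
    using coset_boundaries[OF Z t z, of "\<zero>\<^bsub>obj Z n\<^esub>"] boundaries_carrier[OF Z _ t] Z z
    by (auto simp: a_r_coset_def')
  have mem: "z \<in> boundaries N Z t n +>\<^bsub>obj Z n\<^esub> z"
    if Z: "n_complex R N Z" and z: "z \<in> elts Z n" for Z :: "('r, 'z) ncomplex" and z
    using boundaries_zero[OF Z, of n t] mod_l_zero[of "obj Z n" z] Z z
    unfolding a_r_coset_def' by (metis UN_I cpx_module singletonI)
  {
    fix z assume z: "z \<in> cycles X t n" and fz: "f n z \<in> boundaries N Y t n"
    let ?B = "boundaries N X t n"
    have z0: "\<zero>\<^bsub>obj X n\<^esub> \<in> cycles X t n" using boundaries_zero[OF X] boundaries_le_cycles[OF X t] by blast
    have "f n \<zero>\<^bsub>obj X n\<^esub> \<in> boundaries N Y t n"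
      using chain_map_boundaries[OF f X t boundaries_zero[OF X]] .
    then have "homology_map N Y f t n (?B +>\<^bsub>obj X n\<^esub> z) = homology_map N Y f t n (?B +>\<^bsub>obj X n\<^esub> \<zero>\<^bsub>obj X n\<^esub>)"
      using fz z X by (simp add: homology_map_coset[OF f X Y t] cyclesD zero[OF Y])
    then have "?B +>\<^bsub>obj X n\<^esub> z = ?B +>\<^bsub>obj X n\<^esub> \<zero>\<^bsub>obj X n\<^esub>"
      using bij z z0 unfolding bij_betw_def inj_on_def car by blast
    then have "?B +>\<^bsub>obj X n\<^esub> z = ?B" using zero[OF X boundaries_zero[OF X]] by simp
    then show "z \<in> boundaries N X t n" using mem[OF X, of z] z by (simp add: cyclesD)
  }
  {
    fix z' assume z': "z' \<in> cycles Y t n"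
    then have "boundaries N Y t n +>\<^bsub>obj Y n\<^esub> z' \<in> carrier (homology N Y t n)" unfolding car by blast
    then have "boundaries N Y t n +>\<^bsub>obj Y n\<^esub> z' \<in> homology_map N Y f t n ` carrier (homology N X t n)"
      using bij by (simp add: bij_betw_def)
    then obtain z where z: "z \<in> cycles X t n"
      "boundaries N Y t n +>\<^bsub>obj Y n\<^esub> z' = homology_map N Y f t n (boundaries N X t n +>\<^bsub>obj X n\<^esub> z)"
      unfolding car by blast
    then have "boundaries N Y t n +>\<^bsub>obj Y n\<^esub> z' = boundaries N Y t n +>\<^bsub>obj Y n\<^esub> f n z"
      using X by (simp add: homology_map_coset[OF f X Y t] cyclesD)
    then have "z' \<in> boundaries N Y t n +>\<^bsub>obj Y n\<^esub> f n z" using mem[OF Y, of z'] z' by (auto simp: cyclesD)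
    then have "z' \<ominus>\<^bsub>obj Y n\<^esub> f n z \<in> boundaries N Y t n"
      using Y f z boundaries_carrier[OF Y _ t] by (intro coset_mem) (auto simp: cyclesD chain_map_closed)
    then show "\<exists>z\<in>cycles X t n. z' \<ominus>\<^bsub>obj Y n\<^esub> f n z \<in> boundaries N Y t n" using z by blast
  }
qed

definition chain_iso :: "('r, 'x) ncomplex \<Rightarrow> ('r, 'y) ncomplex \<Rightarrow> (int \<Rightarrow> 'x \<Rightarrow> 'y) \<Rightarrow> bool" where
  "chain_iso X Y f \<longleftrightarrow> chain_map R X Y f \<and> (\<forall>n. bij_betw (f n) (elts X n) (elts Y n))"

lemma chain_iso_cycles:
  assumes f: "chain_iso X Y f" and X: "n_complex R N X" and Y: "n_complex R N Y" and z: "z \<in> elts X n"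
  shows "f n z \<in> cycles Y t n \<longleftrightarrow> z \<in> cycles X t n"
proof -
  have cm: "chain_map R X Y f" and inj: "inj_on (f m) (elts X m)" for m
    using f by (auto simp: chain_iso_def bij_betw_def)
  show ?thesis
  proof
    assume "f n z \<in> cycles Y t n"
    then have "f (n + int t) (dpow X n t z) = f (n + int t) \<zero>\<^bsub>obj X (n + int t)\<^esub>"
      using X Y z cm by (simp add: cycles_def chain_map_dpow[of X Y f] mhom_zero[OF chain_map_mhom])
    then have "dpow X n t z = \<zero>\<^bsub>obj X (n + int t)\<^esub>"
      using inj_onD[OF inj] X z dpow_closed[OF X z refl] by (metis mod_zero cpx_module)
    then show "z \<in> cycles X t n" using z by (simp add: cycles_def)
  qed (rule chain_map_cycles[OF cm X Y])
qed

lemma chain_iso_boundaries: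
  assumes f: "chain_iso X Y f" and X: "n_complex R N X" and z: "z \<in> elts X n" and t: "t \<le> N"
  shows "f n z \<in> boundaries N Y t n \<longleftrightarrow> z \<in> boundaries N X t n"
proof -
  have cm: "chain_map R X Y f" and inj: "inj_on (f m) (elts X m)"
    and surj: "f m ` elts X m = elts Y m" for m
    using f by (auto simp: chain_iso_def bij_betw_def)
  show ?thesis
  proof
    let ?m = "n - int (N - t)"
    assume "f n z \<in> boundaries N Y t n"
    then obtain y' where "y' \<in> elts Y ?m" and fz: "f n z = dpow Y ?m (N - t) y'"
      by (rule boundariesE[OF _ refl refl])
    then obtain y where y: "y \<in> elts X ?m" "y' = f ?m y" using surj[of ?m] by blast
    then have "f n z = f n (dpow X ?m (N - t) y)"
      using fz by (simp add: chain_map_dpow[OF cm X])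
    then have "z = dpow X ?m (N - t) y"
      using inj_onD[OF inj, of n z] z dpow_closed[OF X y(1), of n "N - t"] by simp
    then show "z \<in> boundaries N X t n" using y by (intro boundariesI) auto
  qed (rule chain_map_boundaries[OF cm X t])
qed

lemma chain_iso_hiso:
  assumes f: "chain_iso X Y f" and X: "n_complex R N X" and Y: "n_complex R N Y"
  shows "hiso X Y f"
  unfolding hiso_def
proof (intro conjI ballI allI impI)
  show cm: "chain_map R X Y f" using f by (simp add: chain_iso_def)
  fix t n assume "t \<in> {1..N - 1}" then have t: "t \<le> N" by auto
  show "z \<in> boundaries N X t n" if "z \<in> cycles X t n" "f n z \<in> boundaries N Y t n" for z
    using that chain_iso_boundaries[OF f X _ t] by (auto simp: cyclesD)
  fix z' assume z': "z' \<in> cycles Y t n"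
  then have "z' \<in> f n ` elts X n" using f by (simp add: chain_iso_def bij_betw_def cyclesD)
  then obtain z where z: "z \<in> elts X n" "z' = f n z" by blast
  then show "\<exists>z\<in>cycles X t n. z' \<ominus>\<^bsub>obj Y n\<^esub> f n z \<in> boundaries N Y t n"
    using chain_iso_cycles[OF f X Y z(1)] z' Y boundaries_zero[OF Y]
    by (intro bexI[of _ z]) (auto simp: cyclesD)
qed

text \<open>This allows passing from \<open>Hom(P, Y)\<close>, for \<open>P\<close> a cone, to its description as a twisted extension.\<close>

lemma hiso_conjugate:
  assumes e: "chain_iso X X' e" and e': "chain_iso Y Y' e'"
    and X: "n_complex R N X" and Y: "n_complex R N Y" and X': "n_complex R N X'" and Y': "n_complex R N Y'"
    and comm: "\<And>n x. x \<in> elts X n \<Longrightarrow> f' n (e n x) = e' n (f n x)"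
    and f': "hiso X' Y' f'" and f: "chain_map R X Y f"
  shows "hiso X Y f"
  unfolding hiso_def
proof (intro conjI ballI allI impI)
  show "chain_map R X Y f" by (rule f)
  have cm: "chain_map R Y Y' e'" using e' by (simp add: chain_iso_def)
  fix t n assume tt: "t \<in> {1..N - 1}"
  then have t: "t \<le> N" "1 \<le> t" "t < N" using N_ge_2 by auto
  show "z \<in> boundaries N X t n" if z: "z \<in> cycles X t n" and fz: "f n z \<in> boundaries N Y t n" for z
  proof -
    have "f' n (e n z) \<in> boundaries N Y' t n"
      using fz z chain_map_boundaries[OF cm Y t(1)] by (simp add: comm cyclesD)
    then have "e n z \<in> boundaries N X' t n"
      using z chain_iso_cycles[OF e X X'] by (intro hiso_inj[OF f' t(2,3)]) (auto simp: cyclesD)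
    then show ?thesis using chain_iso_boundaries[OF e X _ t(1)] z by (auto simp: cyclesD)
  qed
  fix z' assume z': "z' \<in> cycles Y t n"
  then have "e' n z' \<in> cycles Y' t n" using chain_map_cycles[OF cm Y Y'] by simp
  then obtain w where w: "w \<in> cycles X' t n" "e' n z' \<ominus>\<^bsub>obj Y' n\<^esub> f' n w \<in> boundaries N Y' t n"
    by (rule hiso_surj[OF f' t(2,3)])
  have "w \<in> e n ` elts X n" using e w by (simp add: chain_iso_def bij_betw_def cyclesD)
  then obtain z where z: "z \<in> elts X n" "w = e n z" by blast
  have zc: "z \<in> cycles X t n" using w z chain_iso_cycles[OF e X X'] by simp
  have "e' n (z' \<ominus>\<^bsub>obj Y n\<^esub> f n z) = e' n z' \<ominus>\<^bsub>obj Y' n\<^esub> f' n w"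
    using z z' Y Y' f cm by (simp add: comm mhom_diff[OF chain_map_mhom] cyclesD chain_map_closed)
  then have "z' \<ominus>\<^bsub>obj Y n\<^esub> f n z \<in> boundaries N Y t n"
    using w(2) chain_iso_boundaries[OF e' Y _ t(1), of "z' \<ominus>\<^bsub>obj Y n\<^esub> f n z" n]
      cyclesD(1)[OF z'] chain_map_closed[OF f z(1)] Y by simp
  then show "\<exists>z\<in>cycles X t n. z' \<ominus>\<^bsub>obj Y n\<^esub> f n z \<in> boundaries N Y t n" using zc by blast
qed

lemma hiso_comp:
  assumes f: "hiso X Y f" and g: "hiso Y Z g" and X: "n_complex R N X" and Y: "n_complex R N Y" and Z: "n_complex R N Z"
  shows "hiso X Z (\<lambda>n x. g n (f n x))"
  unfolding hiso_def
proof (intro conjI ballI allI impI)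
  have fc: "chain_map R X Y f" and gc: "chain_map R Y Z g" using f g by (simp_all add: hiso_def)
  show "chain_map R X Z (\<lambda>n x. g n (f n x))"
    unfolding chain_map_def
  proof (intro allI conjI ballI)
    fix n
    show "(\<lambda>x. g n (f n x)) \<in> mhom R (obj X n) (obj Z n)"
      by (rule mhom_comp[OF chain_map_mhom[OF fc] chain_map_mhom[OF gc]])
    fix x assume x: "x \<in> elts X n"
    show "g (n + 1) (f (n + 1) (dif X n x)) = dif Z n (g n (f n x))"
      unfolding chain_map_dif[OF fc x refl] by (rule chain_map_dif[OF gc chain_map_closed[OF fc x] refl])
  qed
  fix t l assume "t \<in> {1..N - 1}"
  then have t: "1 \<le> t" "t < N" "t \<le> N" using N_ge_2 by auto
  show "z \<in> boundaries N X t l" if "z \<in> cycles X t l" "g l (f l z) \<in> boundaries N Z t l" for z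
    using that hiso_inj[OF f t(1,2)] hiso_inj[OF g t(1,2)] chain_map_cycles[OF fc X Y] by blast
  fix z assume z: "z \<in> cycles Z t l"
  obtain y where y: "y \<in> cycles Y t l" "z \<ominus>\<^bsub>obj Z l\<^esub> g l y \<in> boundaries N Z t l"
    by (rule hiso_surj[OF g t(1,2) z])
  obtain x where x: "x \<in> cycles X t l" "y \<ominus>\<^bsub>obj Y l\<^esub> f l x \<in> boundaries N Y t l"
    by (rule hiso_surj[OF f t(1,2) y(1)])
  have c: "y \<in> elts Y l" "f l x \<in> elts Y l"
    using y x fc by (auto simp: cyclesD chain_map_closed)
  have "g l (y \<ominus>\<^bsub>obj Y l\<^esub> f l x) = g l y \<ominus>\<^bsub>obj Z l\<^esub> g l (f l x)"
    using Y Z by (intro mhom_diff[OF chain_map_mhom[OF gc] _ _ c]) auto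
  then have "(z \<ominus>\<^bsub>obj Z l\<^esub> g l y) \<oplus>\<^bsub>obj Z l\<^esub> (g l y \<ominus>\<^bsub>obj Z l\<^esub> g l (f l x)) \<in> boundaries N Z t l"
    using boundaries_add[OF Z y(2) chain_map_boundaries[OF gc Y t(3) x(2)]] by simp
  moreover have "(z \<ominus>\<^bsub>obj Z l\<^esub> g l y) \<oplus>\<^bsub>obj Z l\<^esub> (g l y \<ominus>\<^bsub>obj Z l\<^esub> g l (f l x)) = z \<ominus>\<^bsub>obj Z l\<^esub> g l (f l x)"
    using Z cyclesD(1)[OF z] chain_map_closed[OF gc c(1)] chain_map_closed[OF gc c(2)]
    by (simp add: mod_diff_eq mod_assoc)
  ultimately show "\<exists>x\<in>cycles X t l. z \<ominus>\<^bsub>obj Z l\<^esub> g l (f l x) \<in> boundaries N Z t l" using x(1) by auto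
qed

lemma chain_map_cong:
  assumes f: "chain_map R X Y f" and X: "n_complex R N X"
    and eq: "\<And>n x. x \<in> elts X n \<Longrightarrow> g n x = f n x"
  shows "chain_map R X Y g"
  unfolding chain_map_def
proof (intro allI conjI ballI)
  fix n
  show "g n \<in> mhom R (obj X n) (obj Y n)" using mhom_cong[OF chain_map_mhom[OF f] cpx_module[OF X] eq] .
  fix x assume x: "x \<in> elts X n"
  show "g (n + 1) (dif X n x) = dif Y n (g n x)"
    using eq[OF dif_closed[OF X x refl]] eq[OF x] chain_map_dif[OF f x refl] by simp
qed

lemma hiso_cong:
  assumes f: "hiso X Y f" and X: "n_complex R N X"
    and eq: "\<And>n x. x \<in> elts X n \<Longrightarrow> g n x = f n x"
  shows "hiso X Y g"
proof -
  have fc: "chain_map R X Y f" using f by (simp add: hiso_def)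
  show ?thesis
    using f chain_map_cong[OF fc X eq] by (simp add: hiso_def cyclesD eq)
qed

end

section \<open>Twisted extensions\<close>

context n_complexes
begin

text \<open>The extension of \<open>H\<close> by \<open>A\<close> in which the differential picks up \<open>x \<theta>\<close> as a component from \<open>H\<close> to \<open>A\<close>. The
  scalar is kept apart from \<open>\<theta>\<close> because the arguments compare the extension for a given \<open>x\<close> with the
  one for \<open>x = 1\<close>.\<close>

definition ext_cpx ::
  "('r, 'h) ncomplex \<Rightarrow> ('r, 'a) ncomplex \<Rightarrow> (int \<Rightarrow> 'h \<Rightarrow> 'a) \<Rightarrow> 'r \<Rightarrow> ('r, 'h \<times> 'a) ncomplex" where
  "ext_cpx H A \<theta> x =
     \<lparr>obj = (\<lambda>n. mk_module (elts H n \<times> elts A n) (\<zero>\<^bsub>obj H n\<^esub>, \<zero>\<^bsub>obj A n\<^esub>)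
        (\<lambda>p p'. (fst p \<oplus>\<^bsub>obj H n\<^esub> fst p', snd p \<oplus>\<^bsub>obj A n\<^esub> snd p'))
        (\<lambda>r p. (r \<odot>\<^bsub>obj H n\<^esub> fst p, r \<odot>\<^bsub>obj A n\<^esub> snd p))),
      dif = (\<lambda>n p. (dif H n (fst p),
        x \<odot>\<^bsub>obj A (n + 1)\<^esub> \<theta> n (fst p) \<oplus>\<^bsub>obj A (n + 1)\<^esub> dif A n (snd p)))\<rparr>"

text \<open>The component from \<open>H\<close> to \<open>A\<close> of the \<open>k\<close>-th power of the differential for \<open>x = 1\<close>; for a general \<open>x\<close>
  this component is \<open>x\<close> times as large, since \<open>\<theta>\<close> is applied only once along any path from \<open>H\<close> to \<open>A\<close>.
  On homology it is the connecting homomorphism.\<close>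

primrec conn :: "('r, 'h) ncomplex \<Rightarrow> ('r, 'a) ncomplex \<Rightarrow> (int \<Rightarrow> 'h \<Rightarrow> 'a) \<Rightarrow> nat \<Rightarrow> int \<Rightarrow> 'h \<Rightarrow> 'a" where
  "conn H A \<theta> 0 n = (\<lambda>g. \<zero>\<^bsub>obj A n\<^esub>)"
| "conn H A \<theta> (Suc k) n = (\<lambda>g. \<theta> (n + int k) (dpow H n k g) \<oplus>\<^bsub>obj A (n + int k + 1)\<^esub>
     dif A (n + int k) (conn H A \<theta> k n g))"

text \<open>The last condition says that the \<open>N\<close>-th power of the differential vanishes.\<close>

definition ext_data :: "('r, 'h) ncomplex \<Rightarrow> ('r, 'a) ncomplex \<Rightarrow> (int \<Rightarrow> 'h \<Rightarrow> 'a) \<Rightarrow> bool" where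
  "ext_data H A \<theta> \<longleftrightarrow> n_complex R N H \<and> n_complex R N A \<and>
     (\<forall>n. \<theta> n \<in> mhom R (obj H n) (obj A (n + 1))) \<and>
     (\<forall>n. \<forall>g\<in>elts H n. conn H A \<theta> N n g = \<zero>\<^bsub>obj A (n + int N)\<^esub>)"

lemma ext_cpx_simps [simp]:
  "elts (ext_cpx H A \<theta> x) n = elts H n \<times> elts A n"
  "\<zero>\<^bsub>obj (ext_cpx H A \<theta> x) n\<^esub> = (\<zero>\<^bsub>obj H n\<^esub>, \<zero>\<^bsub>obj A n\<^esub>)"
  "(g, h) \<oplus>\<^bsub>obj (ext_cpx H A \<theta> x) n\<^esub> (g', h') = (g \<oplus>\<^bsub>obj H n\<^esub> g', h \<oplus>\<^bsub>obj A n\<^esub> h')"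
  "r \<odot>\<^bsub>obj (ext_cpx H A \<theta> x) n\<^esub> (g, h) = (r \<odot>\<^bsub>obj H n\<^esub> g, r \<odot>\<^bsub>obj A n\<^esub> h)"
  "dif (ext_cpx H A \<theta> x) n (g, h) =
     (dif H n g, x \<odot>\<^bsub>obj A (n + 1)\<^esub> \<theta> n g \<oplus>\<^bsub>obj A (n + 1)\<^esub> dif A n h)"
  by (simp_all add: ext_cpx_def)

lemma ext_cpx_obj_module:
  assumes "module R (obj H n)" "module R (obj A n)"
  shows "module R (obj (ext_cpx H A \<theta> x) n)"
  by (rule module_by_zero_neg)
    (use assms in \<open>auto simp: mod_ac mod_smult_add mod_add_smult mod_mult_smult\<close>)

context
  fixes H :: "('r, 'h) ncomplex" and A :: "('r, 'a) ncomplex" and \<theta>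
  assumes H: "n_complex R N H" and A: "n_complex R N A"
    and th: "\<And>n m. m = n + 1 \<Longrightarrow> \<theta> n \<in> mhom R (obj H n) (obj A m)"
begin

lemma conn_mhom: "m = n + int k \<Longrightarrow> conn H A \<theta> k n \<in> mhom R (obj H n) (obj A m)"
proof (induction k arbitrary: m)
  case 0
  then show ?case using A by (simp add: mhom_const_zero)
next
  case (Suc k)
  have e: "n + int k + 1 = m" using Suc by simp
  have "(\<lambda>g. \<theta> (n + int k) (dpow H n k g) \<oplus>\<^bsub>obj A m\<^esub> dif A (n + int k) (conn H A \<theta> k n g))
    \<in> mhom R (obj H n) (obj A m)"
    using A e by (intro mhom_plus mhom_comp[OF dpow_mhom[OF H refl] th] mhom_comp[OF Suc.IH[OF refl] cpx_dif]) auto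
  then show ?case by (simp add: e)
qed

lemma conn_closed: "g \<in> elts H n \<Longrightarrow> m = n + int k \<Longrightarrow> conn H A \<theta> k n g \<in> elts A m"
  by (rule mhom_closed[OF conn_mhom])

lemma conn_add:
  assumes g: "g \<in> elts H n"
  shows "m = n + int (j + k) \<Longrightarrow> n' = n + int j \<Longrightarrow> conn H A \<theta> (j + k) n g =
     conn H A \<theta> k n' (dpow H n j g) \<oplus>\<^bsub>obj A m\<^esub> dpow A n' k (conn H A \<theta> j n g)"
proof (induction k arbitrary: m)
  case 0
  then show ?case using A conn_closed[OF g, of m j] by simp
next
  case (Suc k)
  let ?u = "conn H A \<theta> k n' (dpow H n j g)" and ?v = "dpow A n' k (conn H A \<theta> j n g)"
  have u: "?u \<in> elts A (n' + int k)"
    by (rule conn_closed[OF dpow_closed[OF H g] refl]) (rule Suc)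
  have v: "?v \<in> elts A (n' + int k)"
    by (rule dpow_closed[OF A conn_closed[OF g] refl]) (rule Suc)
  have w: "\<theta> (n' + int k) (dpow H n' k (dpow H n j g)) \<in> elts A m"
    using Suc.prems by (intro mhom_closed[OF th] dpow_closed[OF H] dpow_closed[OF H g]) auto
  have d: "dif A (n' + int k) (?u \<oplus>\<^bsub>obj A (n' + int k)\<^esub> ?v) =
      dif A (n' + int k) ?u \<oplus>\<^bsub>obj A m\<^esub> dif A (n' + int k) ?v"
    using Suc.prems u v by (intro mhom_add[OF cpx_dif[OF A]]) auto
  have dd: "dpow H n (j + k) g = dpow H n' k (dpow H n j g)"
    using Suc.prems by (simp add: dpow_dpow)
  have e: "n + int (j + k) = n' + int k" "n' + int k + 1 = m" using Suc.prems by auto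
  have "conn H A \<theta> (j + Suc k) n g = \<theta> (n' + int k) (dpow H n' k (dpow H n j g)) \<oplus>\<^bsub>obj A m\<^esub>
      dif A (n' + int k) (?u \<oplus>\<^bsub>obj A (n' + int k)\<^esub> ?v)"
    using Suc.IH[OF e(1)[symmetric] Suc.prems(2)] e by (simp add: dd del: of_nat_add)
  also have "\<dots> = (\<theta> (n' + int k) (dpow H n' k (dpow H n j g)) \<oplus>\<^bsub>obj A m\<^esub> dif A (n' + int k) ?u) \<oplus>\<^bsub>obj A m\<^esub>
      dif A (n' + int k) ?v"
    unfolding d using A w u v e dif_closed[OF A u] dif_closed[OF A v] by (simp add: mod_assoc)
  finally show ?case using e by simp
qed

lemma ext_cpx_dpow:
  assumes g: "g \<in> elts H n" and h: "h \<in> elts A n" and x: "x \<in> carrier R"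
  shows "m = n + int k \<Longrightarrow> dpow (ext_cpx H A \<theta> x) n k (g, h) =
     (dpow H n k g, x \<odot>\<^bsub>obj A m\<^esub> conn H A \<theta> k n g \<oplus>\<^bsub>obj A m\<^esub> dpow A n k h)"
proof (induction k arbitrary: m)
  case 0
  then show ?case using A h x by simp
next
  case (Suc k)
  let ?c = "conn H A \<theta> k n g" and ?d = "dpow A n k h" and ?M = "obj A (n + int k)"
  have m: "n + int k + 1 = m" using Suc by simp
  have c: "?c \<in> carrier ?M" "?d \<in> carrier ?M" using conn_closed[OF g] dpow_closed[OF A h] by auto
  have w: "\<theta> (n + int k) (dpow H n k g) \<in> elts A m"
    using m by (intro mhom_closed[OF th] dpow_closed[OF H g]) auto
  have "dif A (n + int k) (x \<odot>\<^bsub>?M\<^esub> ?c \<oplus>\<^bsub>?M\<^esub> ?d) = x \<odot>\<^bsub>obj A m\<^esub> dif A (n + int k) ?c \<oplus>\<^bsub>obj A m\<^esub> dif A (n + int k) ?d"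
    using A c x m by (simp add: mhom_add[OF cpx_dif[OF A]] mhom_smult[OF cpx_dif[OF A]])
  then have "x \<odot>\<^bsub>obj A m\<^esub> \<theta> (n + int k) (dpow H n k g) \<oplus>\<^bsub>obj A m\<^esub> dif A (n + int k) (x \<odot>\<^bsub>?M\<^esub> ?c \<oplus>\<^bsub>?M\<^esub> ?d)
     = x \<odot>\<^bsub>obj A m\<^esub> (\<theta> (n + int k) (dpow H n k g) \<oplus>\<^bsub>obj A m\<^esub> dif A (n + int k) ?c) \<oplus>\<^bsub>obj A m\<^esub> dif A (n + int k) ?d"
    using A c w x m dif_closed[OF A c(1)] dif_closed[OF A c(2)] by (simp add: mod_smult_add mod_assoc)
  then show ?case using Suc.IH[OF refl] m by simp
qed

end

lemma ext_dataD:
  assumes "ext_data H A \<theta>"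
  shows "n_complex R N H" "n_complex R N A" "m = n + 1 \<Longrightarrow> \<theta> n \<in> mhom R (obj H n) (obj A m)"
  using assms by (simp_all add: ext_data_def)

lemma ext_conn_mhom:
  assumes e: "ext_data H A \<theta>"
  shows "m = n + int k \<Longrightarrow> conn H A \<theta> k n \<in> mhom R (obj H n) (obj A m)"
  by (rule conn_mhom[OF ext_dataD[OF e]])

lemma ext_conn_closed:
  assumes e: "ext_data H A \<theta>"
  shows "g \<in> elts H n \<Longrightarrow> m = n + int k \<Longrightarrow> conn H A \<theta> k n g \<in> elts A m"
  by (rule conn_closed[OF ext_dataD[OF e]])

lemma ext_dpow:
  assumes e: "ext_data H A \<theta>"
    and "g \<in> elts H n" "h \<in> elts A n" "x \<in> carrier R" "m = n + int k"
  shows "dpow (ext_cpx H A \<theta> x) n k (g, h) =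
     (dpow H n k g, x \<odot>\<^bsub>obj A m\<^esub> conn H A \<theta> k n g \<oplus>\<^bsub>obj A m\<^esub> dpow A n k h)"
  by (rule ext_cpx_dpow[OF ext_dataD[OF e] assms(2-)])

text \<open>The vanishing of the \<open>N\<close>-th power of the differential, split after \<open>j\<close> steps. It says that the
  connecting maps are compatible with cycles and boundaries.\<close>

lemma ext_cocycle:
  assumes e: "ext_data H A \<theta>" and g: "g \<in> elts H n" and jk: "j + k = N" "n' = n + int j" "m = n + int N"
  shows "conn H A \<theta> k n' (dpow H n j g) \<oplus>\<^bsub>obj A m\<^esub> dpow A n' k (conn H A \<theta> j n g) = \<zero>\<^bsub>obj A m\<^esub>"
  using conn_add[OF ext_dataD[OF e] g, where j = j and k = k and m = m and n' = n'] e g jk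
  by (simp add: ext_data_def)

lemma ext_cpx_n_complex:
  assumes e: "ext_data H A \<theta>" and x: "x \<in> carrier R"
  shows "n_complex R N (ext_cpx H A \<theta> x)"
  unfolding n_complex_def
proof (intro allI conjI ballI)
  note H = ext_dataD(1)[OF e] and A = ext_dataD(2)[OF e] and th = ext_dataD(3)[OF e]
  fix n
  show "module R (obj (ext_cpx H A \<theta> x) n)" using H A by (intro ext_cpx_obj_module) auto
  show "dif (ext_cpx H A \<theta> x) n \<in> mhom R (obj (ext_cpx H A \<theta> x) n) (obj (ext_cpx H A \<theta> x) (n + 1))"
  proof (rule mhomI)
    fix p assume "p \<in> elts (ext_cpx H A \<theta> x) n"
    then obtain g h where p: "p = (g, h)" "g \<in> elts H n" "h \<in> elts A n" by auto
    note c = mhom_closed[OF th[OF refl] p(2)] dif_closed[OF A p(3) refl] dif_closed[OF H p(2) refl]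
    show "dif (ext_cpx H A \<theta> x) n p \<in> elts (ext_cpx H A \<theta> x) (n + 1)"
      using p x A c by simp
    show "dif (ext_cpx H A \<theta> x) n (r \<odot>\<^bsub>obj (ext_cpx H A \<theta> x) n\<^esub> p) =
         r \<odot>\<^bsub>obj (ext_cpx H A \<theta> x) (n + 1)\<^esub> dif (ext_cpx H A \<theta> x) n p" if r: "r \<in> carrier R" for r
      using p x A H c r mod_smult_comm[of "obj A (n + 1)" r x]
      by (simp add: mhom_smult[OF cpx_dif[OF H]] mhom_smult[OF cpx_dif[OF A]] mhom_smult[OF th] mod_smult_add)
    fix p' assume "p' \<in> elts (ext_cpx H A \<theta> x) n"
    then obtain g' h' where p': "p' = (g', h')" "g' \<in> elts H n" "h' \<in> elts A n" by auto
    note c' = mhom_closed[OF th[OF refl] p'(2)] dif_closed[OF A p'(3) refl] dif_closed[OF H p'(2) refl]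
    show "dif (ext_cpx H A \<theta> x) n (p \<oplus>\<^bsub>obj (ext_cpx H A \<theta> x) n\<^esub> p') =
         dif (ext_cpx H A \<theta> x) n p \<oplus>\<^bsub>obj (ext_cpx H A \<theta> x) (n + 1)\<^esub> dif (ext_cpx H A \<theta> x) n p'"
      using p p' x A H c c'
      by (simp add: mhom_add[OF cpx_dif[OF H]] mhom_add[OF cpx_dif[OF A]] mhom_add[OF th] mod_smult_add mod_ac)
  qed
  fix p assume "p \<in> elts (ext_cpx H A \<theta> x) n"
  then obtain g h where p: "p = (g, h)" "g \<in> elts H n" "h \<in> elts A n" by auto
  show "dpow (ext_cpx H A \<theta> x) n N p = \<zero>\<^bsub>obj (ext_cpx H A \<theta> x) (n + int N)\<^esub>"
    using p e x H A by (simp add: ext_dpow[OF e _ _ _ refl] dpow_ge_N ext_data_def)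
qed

text \<open>Acyclicity for \<open>x = 1\<close> expresses that \<open>conn\<close> induces isomorphisms between the homology of \<open>H\<close> and that
  of \<open>A\<close> with complementary amplitudes.\<close>

definition ext_acyclic :: "('r, 'h) ncomplex \<Rightarrow> ('r, 'a) ncomplex \<Rightarrow> (int \<Rightarrow> 'h \<Rightarrow> 'a) \<Rightarrow> bool" where
  "ext_acyclic H A \<theta> \<longleftrightarrow> ext_data H A \<theta> \<and> (\<forall>t\<in>{1..N - 1}. \<forall>n. exact_at (ext_cpx H A \<theta> \<one>) t n)"

lemma ext_acyclicE:
  assumes ac: "ext_acyclic H A \<theta>" and t: "1 \<le> t" "t < N"
    and g: "g \<in> elts H l" and h: "h \<in> elts A l"
    and dg: "dpow H l t g = \<zero>\<^bsub>obj H (l + int t)\<^esub>"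
    and dh: "conn H A \<theta> t l g \<oplus>\<^bsub>obj A (l + int t)\<^esub> dpow A l t h = \<zero>\<^bsub>obj A (l + int t)\<^esub>"
    and m: "m = l - int (N - t)"
  obtains w v where "w \<in> elts H m" "v \<in> elts A m" "dpow H m (N - t) w = g"
    "conn H A \<theta> (N - t) m w \<oplus>\<^bsub>obj A l\<^esub> dpow A m (N - t) v = h"
proof -
  have e: "ext_data H A \<theta>" using ac by (simp add: ext_acyclic_def)
  note A = ext_dataD(2)[OF e]
  have "exact_at (ext_cpx H A \<theta> \<one>) t l" using ac t by (simp add: ext_acyclic_def)
  moreover have "dpow (ext_cpx H A \<theta> \<one>) l t (g, h) = \<zero>\<^bsub>obj (ext_cpx H A \<theta> \<one>) (l + int t)\<^esub>"
    using g h dg dh A ext_conn_closed[OF e g refl] by (simp add: ext_dpow[OF e g h _ refl])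
  ultimately obtain p where p: "p \<in> elts (ext_cpx H A \<theta> \<one>) m"
    "dpow (ext_cpx H A \<theta> \<one>) m (N - t) p = (g, h)"
    using g h m exact_atE[of "ext_cpx H A \<theta> \<one>" t l "(g, h)"] by (metis SigmaI ext_cpx_simps(1))
  obtain w v where wv: "p = (w, v)" by (cases p)
  have w: "w \<in> elts H m" "v \<in> elts A m" using p wv by auto
  have "dpow H m (N - t) w = g \<and> conn H A \<theta> (N - t) m w \<oplus>\<^bsub>obj A l\<^esub> dpow A m (N - t) v = h"
    using p(2) wv ext_dpow[OF e w one_closed, of l "N - t"] m A ext_conn_closed[OF e w(1), of l "N - t"] by auto
  then show ?thesis using that w by blast
qed

text \<open>Let \<open>g\<close> be a cycle of \<open>H\<close>. If \<open>x g\<close> is a boundary, say of \<open>w\<close>, then \<open>(g, conn w)\<close> is a cycle of the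
  extension, hence a boundary, and so \<open>g\<close> is a boundary. An induction on the power of \<open>x\<close> that kills \<open>g\<close>
  thus proves that all cycles are boundaries.\<close>

theorem exact_below_of_ext_cpx:
  assumes e: "ext_data H A \<theta>" and x: "x \<in> carrier R" and t: "1 \<le> t" "t < N"
    and ex: "exact_below (ext_cpx H A \<theta> x) t s"
    and tors: "\<And>n g. g \<in> elts H n \<Longrightarrow> \<exists>k::nat. (x [^] k) \<odot>\<^bsub>obj H n\<^esub> g = \<zero>\<^bsub>obj H n\<^esub>"
  shows "exact_below H t s"
  unfolding exact_below_def exact_at_iff
proof (intro allI impI subsetI)
  note H = ext_dataD(1)[OF e] and A = ext_dataD(2)[OF e]
  fix l g assume l: "l < s" and g: "g \<in> cycles H t l"
  let ?m = "l - int (N - t)"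
  have "g \<in> boundaries N H t l" if "g \<in> cycles H t l" "(x [^] k) \<odot>\<^bsub>obj H l\<^esub> g = \<zero>\<^bsub>obj H l\<^esub>" for g and k :: nat
    using that
  proof (induction k arbitrary: g)
    case 0
    then show ?case using H boundaries_zero[OF H] by (simp add: cyclesD)
  next
    case (Suc k)
    note g = cyclesD(1)[OF Suc.prems(1)]
    have xg: "x \<odot>\<^bsub>obj H l\<^esub> g \<in> cycles H t l"
      using Suc.prems g H x by (auto simp: cycles_def dpow_smult)
    have "(x [^] k) \<odot>\<^bsub>obj H l\<^esub> (x \<odot>\<^bsub>obj H l\<^esub> g) = \<zero>\<^bsub>obj H l\<^esub>"
      using Suc.prems g H x by (simp add: mod_mult_smult[symmetric])
    from Suc.IH[OF xg this] obtain w where w: "w \<in> elts H ?m" "x \<odot>\<^bsub>obj H l\<^esub> g = dpow H ?m (N - t) w"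
      by (rule boundariesE[OF _ refl refl])
    \<comment> \<open>By the cocycle identity for \<open>w\<close>, the second component \<open>conn w\<close> completes \<open>g\<close> to a cycle.\<close>
    let ?h = "conn H A \<theta> (N - t) ?m w" and ?M = "obj A (l + int t)"
    have h: "?h \<in> elts A l" by (rule ext_conn_closed[OF e w(1)]) simp
    have cg: "conn H A \<theta> t l g \<in> carrier ?M" by (rule ext_conn_closed[OF e g refl])
    have "x \<odot>\<^bsub>?M\<^esub> conn H A \<theta> t l g = conn H A \<theta> t l (x \<odot>\<^bsub>obj H l\<^esub> g)"
      using mhom_smult[OF ext_conn_mhom[OF e refl] x g] by simp
    also have "\<dots> \<oplus>\<^bsub>?M\<^esub> dpow A l t ?h = \<zero>\<^bsub>?M\<^esub>"
      unfolding w(2) using t by (intro ext_cocycle[OF e w(1)]) (auto simp: of_nat_diff)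
    finally have "x \<odot>\<^bsub>?M\<^esub> conn H A \<theta> t l g \<oplus>\<^bsub>?M\<^esub> dpow A l t ?h = \<zero>\<^bsub>?M\<^esub>" by simp
    then have "(g, ?h) \<in> cycles (ext_cpx H A \<theta> x) t l"
      using g h x Suc.prems by (auto simp: cycles_def ext_dpow[OF e g h x refl])
    then have "(g, ?h) \<in> boundaries N (ext_cpx H A \<theta> x) t l"
      using ex l by (auto simp: exact_below_def exact_at_iff)
    then obtain p where p: "p \<in> elts (ext_cpx H A \<theta> x) ?m"
      "(g, ?h) = dpow (ext_cpx H A \<theta> x) ?m (N - t) p"
      by (rule boundariesE[OF _ refl refl])
    obtain w' v' where "p = (w', v')" by (cases p)
    then have "w' \<in> elts H ?m" "g = dpow H ?m (N - t) w'"
      using p x by (auto simp: ext_dpow[OF e _ _ x, of _ ?m _ l])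
    then show ?case by (rule boundariesI[OF _ refl refl])
  qed
  then show "g \<in> boundaries N H t l" using tors[OF cyclesD(1)[OF g]] g by blast
qed

text \<open>A cycle of the extension can be modified by a boundary so that its component in \<open>H\<close> becomes zero. The
  remaining element \<open>(0, h)\<close> is also a cycle of the acyclic extension for \<open>x = 1\<close>, which writes \<open>h\<close> as
  \<open>conn w\<close> plus a boundary for some cycle \<open>w\<close> of amplitude \<open>N - t\<close> in a lower degree. There \<open>H\<close> is exact
  as well, so \<open>w\<close> is a boundary and then so is \<open>h\<close>.\<close>

theorem ext_cpx_exact_below:
  assumes ac: "ext_acyclic H A \<theta>" and x: "x \<in> carrier R" and t: "1 \<le> t" "t < N"
    and ex: "exact_below H t s"
  shows "exact_below (ext_cpx H A \<theta> x) t s"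
  unfolding exact_below_def exact_at_iff
proof (intro allI impI subsetI)
  have e: "ext_data H A \<theta>" using ac by (simp add: ext_acyclic_def)
  note H = ext_dataD(1)[OF e] and A = ext_dataD(2)[OF e]
  note E = ext_cpx_n_complex[OF e x]
  fix l p assume l: "l < s" and p: "p \<in> cycles (ext_cpx H A \<theta> x) t l"
  let ?m = "l - int (N - t)" and ?M = "obj A (l + int t)"
  have vert: "(\<zero>\<^bsub>obj H l\<^esub>, h) \<in> boundaries N (ext_cpx H A \<theta> x) t l"
    if h: "h \<in> elts A l" "dpow A l t h = \<zero>\<^bsub>?M\<^esub>" for h
  proof -
    obtain w v where w: "w \<in> elts H ?m" and v: "v \<in> elts A ?m"
      and dw: "dpow H ?m (N - t) w = \<zero>\<^bsub>obj H l\<^esub>"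
      and hwv: "conn H A \<theta> (N - t) ?m w \<oplus>\<^bsub>obj A l\<^esub> dpow A ?m (N - t) v = h"
    proof (rule ext_acyclicE[OF ac t _ h(1) _ _ refl])
      show "\<zero>\<^bsub>obj H l\<^esub> \<in> elts H l" using H by simp
      show "dpow H l t \<zero>\<^bsub>obj H l\<^esub> = \<zero>\<^bsub>obj H (l + int t)\<^esub>" using H by (intro dpow_zero) auto
      have "conn H A \<theta> t l \<zero>\<^bsub>obj H l\<^esub> = \<zero>\<^bsub>?M\<^esub>" using H A by (intro mhom_zero[OF ext_conn_mhom[OF e]]) auto
      then show "conn H A \<theta> t l \<zero>\<^bsub>obj H l\<^esub> \<oplus>\<^bsub>?M\<^esub> dpow A l t h = \<zero>\<^bsub>?M\<^esub>" using h A by simp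
    qed
    have "exact_at H (N - t) ?m"
      using t l by (intro exact_below_change[OF H t ex]) auto
    then obtain u where u: "u \<in> elts H (l - int N)" "dpow H (l - int N) t u = w"
      using w dw t exact_atE[of H "N - t" ?m w l t "l - int N"] by (auto simp: of_nat_diff)
    \<comment> \<open>By the cocycle identity for \<open>u\<close>, \<open>conn w\<close> is the boundary of \<open>- conn u\<close>.\<close>
    let ?u = "conn H A \<theta> t (l - int N) u"
    have u': "?u \<in> elts A ?m"
      using t by (intro ext_conn_closed[OF e u(1)]) (auto simp: of_nat_diff)
    have "conn H A \<theta> (N - t) ?m w \<oplus>\<^bsub>obj A l\<^esub> dpow A ?m (N - t) ?u = \<zero>\<^bsub>obj A l\<^esub>"
      unfolding u(2)[symmetric] using t by (intro ext_cocycle[OF e u(1)]) (auto simp: of_nat_diff)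
    then have cw: "conn H A \<theta> (N - t) ?m w = \<ominus>\<^bsub>obj A l\<^esub> dpow A ?m (N - t) ?u"
      using A dpow_closed[OF A u', of l "N - t"] ext_conn_closed[OF e w, of l "N - t"]
      by (simp add: mod_add_eq_zero)
    have "dpow A ?m (N - t) (v \<ominus>\<^bsub>obj A ?m\<^esub> ?u) = h"
      using A dpow_closed[OF A u', of l "N - t"] dpow_closed[OF A v, of l "N - t"] hwv
      unfolding cw by (subst dpow_diff[of A l, OF A _ v u']) (simp_all add: mod_diff_eq mod_comm)
    then have "dpow (ext_cpx H A \<theta> x) ?m (N - t) (\<zero>\<^bsub>obj H ?m\<^esub>, v \<ominus>\<^bsub>obj A ?m\<^esub> ?u) = (\<zero>\<^bsub>obj H l\<^esub>, h)"
      using H A u' v x h mhom_zero[OF ext_conn_mhom[OF e, of l ?m "N - t"]]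
      by (simp add: ext_dpow[OF e _ _ x, of _ ?m _ l] dpow_zero)
    then show ?thesis
      using H A u' v by (intro boundariesI[of "(\<zero>\<^bsub>obj H ?m\<^esub>, v \<ominus>\<^bsub>obj A ?m\<^esub> ?u)", OF _ refl refl]) auto
  qed
  obtain g h where gh: "p = (g, h)" by (cases p)
  have g: "g \<in> elts H l" "h \<in> elts A l" using p gh by (auto simp: cycles_def)
  have dg: "dpow H l t g = \<zero>\<^bsub>obj H (l + int t)\<^esub>"
    using p gh by (auto simp: cycles_def ext_dpow[OF e g x refl])
  then have "g \<in> boundaries N H t l" using ex l g by (auto simp: exact_below_def exact_at_iff cycles_def)
  then obtain w where w: "w \<in> elts H ?m" "g = dpow H ?m (N - t) w" by (rule boundariesE[OF _ refl refl])
  let ?b = "dpow (ext_cpx H A \<theta> x) ?m (N - t) (w, \<zero>\<^bsub>obj A ?m\<^esub>)"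
  define h' where "h' = x \<odot>\<^bsub>obj A l\<^esub> conn H A \<theta> (N - t) ?m w"
  have cw: "conn H A \<theta> (N - t) ?m w \<in> elts A l" by (rule ext_conn_closed[OF e w(1)]) simp
  have h': "h' \<in> elts A l" using A x cw by (simp add: h'_def)
  have b: "?b = (g, h')"
    using A w x cw by (simp add: ext_dpow[OF e _ _ x, of _ ?m _ l] dpow_zero[of A l] h'_def)
  have b_bd: "?b \<in> boundaries N (ext_cpx H A \<theta> x) t l"
    by (rule boundariesI[of "(w, \<zero>\<^bsub>obj A ?m\<^esub>)", OF _ refl refl refl]) (use w A in auto)
  have bc: "(g, h') \<in> cycles (ext_cpx H A \<theta> x) t l"
    using subsetD[OF boundaries_le_cycles[OF E less_imp_le[OF t(2)]] b_bd] unfolding b .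
  have "dpow A l t (h \<ominus>\<^bsub>obj A l\<^esub> h') = \<zero>\<^bsub>?M\<^esub>"
  proof -
    let ?c = "x \<odot>\<^bsub>?M\<^esub> conn H A \<theta> t l g"
    have c: "?c \<in> carrier ?M" using A x ext_conn_closed[OF e g(1) refl] by simp
    have 1: "?c \<oplus>\<^bsub>?M\<^esub> dpow A l t h = \<zero>\<^bsub>?M\<^esub>"
      using p gh by (auto simp: cycles_def ext_dpow[OF e g x refl])
    have 2: "?c \<oplus>\<^bsub>?M\<^esub> dpow A l t h' = \<zero>\<^bsub>?M\<^esub>"
      using bc by (auto simp: cycles_def ext_dpow[OF e g(1) h' x refl])
    have "dpow A l t h = dpow A l t h'"
      using 1 2 c A dpow_closed[OF A g(2) refl] dpow_closed[OF A h' refl]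
      by (metis mod_neg_add_cancel cpx_module)
    then show ?thesis using A g h' dpow_closed[OF A h' refl] by (simp add: dpow_diff)
  qed
  then have "(\<zero>\<^bsub>obj H l\<^esub>, h \<ominus>\<^bsub>obj A l\<^esub> h') \<in> boundaries N (ext_cpx H A \<theta> x) t l"
    using A g h' by (intro vert) auto
  from boundaries_add[OF E this b_bd] show "p \<in> boundaries N (ext_cpx H A \<theta> x) t l"
    using H A g h' gh b by simp
qed

end

section \<open>Homology isomorphisms of twisted extensions\<close>

context n_complexes
begin

lemma cycles_diff:
  assumes X: "n_complex R N X" and x: "x \<in> cycles X t n" and y: "y \<in> cycles X t n"
  shows "x \<ominus>\<^bsub>obj X n\<^esub> y \<in> cycles X t n"
  unfolding cycles_def mem_Collect_eq using X cyclesD[OF x] cyclesD[OF y]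
  by (simp add: dpow_diff[OF X refl] del: ext_cpx_simps)

lemma conn_natural:
  assumes e: "ext_data H A \<theta>" and f: "chain_map R H H' f" and k: "chain_map R A A' k"
    and comm: "\<And>n g. g \<in> elts H n \<Longrightarrow> k (n + 1) (\<theta> n g) = \<theta>' n (f n g)"
    and A': "n_complex R N A'" and g: "g \<in> elts H n"
  shows "m = n + int j \<Longrightarrow> k m (conn H A \<theta> j n g) = conn H' A' \<theta>' j n (f n g)"
proof (induction j arbitrary: m)
  case 0
  then show ?case using ext_dataD(2)[OF e] A' k by (simp add: mhom_zero[OF chain_map_mhom])
next
  case (Suc j)
  note H = ext_dataD(1)[OF e] and A = ext_dataD(2)[OF e]
  have m: "m = n + int j + 1" using Suc by simp
  let ?c = "conn H A \<theta> j n g" and ?d = "dpow H n j g"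
  have c: "?c \<in> elts A (n + int j)" by (rule ext_conn_closed[OF e g refl])
  have d: "?d \<in> elts H (n + int j)" by (rule dpow_closed[OF H g refl])
  have "k m (conn H A \<theta> (Suc j) n g) = k m (\<theta> (n + int j) ?d) \<oplus>\<^bsub>obj A' m\<^esub> k m (dif A (n + int j) ?c)"
    using m mhom_add[OF chain_map_mhom[OF k, of m]] mhom_closed[OF ext_dataD(3)[OF e refl] d] dif_closed[OF A c refl]
    by simp
  also have "\<dots> = \<theta>' (n + int j) (f (n + int j) ?d) \<oplus>\<^bsub>obj A' m\<^esub> dif A' (n + int j) (k (n + int j) ?c)"
    using m chain_map_dif[OF k c m] comm[OF d] by simp
  finally show ?case
    using m Suc.IH[OF refl] chain_map_dpow[OF f H g refl, of j] by simp
qed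

text \<open>Surjectivity of the connecting homomorphism, from acyclicity applied to \<open>(0, h)\<close>.\<close>

lemma ext_acyclic_vertical:
  assumes ac: "ext_acyclic H A \<theta>" and t: "1 \<le> t" "t < N" and h: "h \<in> cycles A t l"
    and m: "m = l - int (N - t)"
  obtains w v where "w \<in> cycles H (N - t) m" "v \<in> elts A m"
    "conn H A \<theta> (N - t) m w \<oplus>\<^bsub>obj A l\<^esub> dpow A m (N - t) v = h"
proof -
  have e: "ext_data H A \<theta>" using ac by (simp add: ext_acyclic_def)
  note H = ext_dataD(1)[OF e] and A = ext_dataD(2)[OF e]
  show ?thesis
  proof (rule ext_acyclicE[OF ac t _ cyclesD(1)[OF h] _ _ m])
    show "\<zero>\<^bsub>obj H l\<^esub> \<in> elts H l" using H by simp
    show "dpow H l t \<zero>\<^bsub>obj H l\<^esub> = \<zero>\<^bsub>obj H (l + int t)\<^esub>" using H by (intro dpow_zero) auto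
    have "conn H A \<theta> t l \<zero>\<^bsub>obj H l\<^esub> = \<zero>\<^bsub>obj A (l + int t)\<^esub>"
      using H A by (intro mhom_zero[OF ext_conn_mhom[OF e]]) auto
    then show "conn H A \<theta> t l \<zero>\<^bsub>obj H l\<^esub> \<oplus>\<^bsub>obj A (l + int t)\<^esub> dpow A l t h = \<zero>\<^bsub>obj A (l + int t)\<^esub>"
      using h A by (simp add: cyclesD)
  qed (use that m t in \<open>auto simp: cycles_def of_nat_diff\<close>)
qed

lemma conn_boundary:
  assumes e: "ext_data H A \<theta>" and t: "t \<le> N" and w: "w \<in> boundaries N H (N - t) m"
    and m: "m = l - int (N - t)"
  shows "conn H A \<theta> (N - t) m w \<in> boundaries N A t l"
proof -
  note A = ext_dataD(2)[OF e]
  obtain u where u: "u \<in> elts H (m - int t)" "w = dpow H (m - int t) t u"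
    by (rule boundariesE[OF w, of t "m - int t"]) (use t in auto)
  let ?u = "conn H A \<theta> t (m - int t) u"
  have u': "?u \<in> elts A m" by (rule ext_conn_closed[OF e u(1)]) simp
  have "conn H A \<theta> (N - t) m w \<oplus>\<^bsub>obj A l\<^esub> dpow A m (N - t) ?u = \<zero>\<^bsub>obj A l\<^esub>"
    unfolding u(2) using t m by (intro ext_cocycle[OF e u(1)]) (auto simp: of_nat_diff)
  moreover have "conn H A \<theta> (N - t) m w \<in> elts A l"
    using u t m ext_dataD(1)[OF e] by (intro ext_conn_closed[OF e]) (auto intro: dpow_closed)
  ultimately have cw: "conn H A \<theta> (N - t) m w = \<ominus>\<^bsub>obj A l\<^esub> dpow A m (N - t) ?u"
    using A m dpow_closed[OF A u', of l "N - t"] by (simp add: mod_add_eq_zero)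
  show ?thesis unfolding cw using A u' m by (intro boundaries_neg boundariesI[OF u' refl]) auto
qed

lemma conn_cycle:
  assumes e: "ext_data H A \<theta>" and t: "t \<le> N" and w: "w \<in> cycles H (N - t) m" and m: "m = l - int (N - t)"
  shows "conn H A \<theta> (N - t) m w \<in> cycles A t l"
proof -
  note H = ext_dataD(1)[OF e] and A = ext_dataD(2)[OF e]
  let ?c = "conn H A \<theta> (N - t) m w"
  have c: "?c \<in> elts A l" using m by (intro ext_conn_closed[OF e cyclesD(1)[OF w]]) auto
  have "conn H A \<theta> t l (dpow H m (N - t) w) \<oplus>\<^bsub>obj A (l + int t)\<^esub> dpow A l t ?c = \<zero>\<^bsub>obj A (l + int t)\<^esub>"
    using t m by (intro ext_cocycle[OF e cyclesD(1)[OF w]]) (auto simp: of_nat_diff)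
  moreover have "conn H A \<theta> t l (dpow H m (N - t) w) = \<zero>\<^bsub>obj A (l + int t)\<^esub>"
    using H A w m by (simp add: cyclesD[of w] mhom_zero[OF ext_conn_mhom[OF e]])
  ultimately show ?thesis using c A dpow_closed[OF A c refl] by (simp add: cycles_def)
qed

lemma ext_boundary_fst:
  assumes e: "ext_data H A \<theta>" and x: "x \<in> carrier R" and w: "w \<in> elts H m" and m: "m = l - int (N - t)"
  shows "(dpow H m (N - t) w, x \<odot>\<^bsub>obj A l\<^esub> conn H A \<theta> (N - t) m w) \<in> boundaries N (ext_cpx H A \<theta> x) t l"
proof -
  note A = ext_dataD(2)[OF e]
  have c: "conn H A \<theta> (N - t) m w \<in> elts A l" using m by (intro ext_conn_closed[OF e w]) auto
  have "dpow (ext_cpx H A \<theta> x) m (N - t) (w, \<zero>\<^bsub>obj A m\<^esub>) =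
      (dpow H m (N - t) w, x \<odot>\<^bsub>obj A l\<^esub> conn H A \<theta> (N - t) m w)"
  proof -
    have l: "l = m + int (N - t)" using m by simp
    have "x \<odot>\<^bsub>obj A l\<^esub> conn H A \<theta> (N - t) m w \<oplus>\<^bsub>obj A l\<^esub> \<zero>\<^bsub>obj A l\<^esub> = x \<odot>\<^bsub>obj A l\<^esub> conn H A \<theta> (N - t) m w"
      using A x c by simp
    then show ?thesis
      using ext_dpow[OF e w mod_zero[OF cpx_module[OF A]] x l] dpow_zero[OF A l] by simp
  qed
  then show ?thesis
    using A w by (intro boundariesI[of "(w, \<zero>\<^bsub>obj A m\<^esub>)", OF _ refl m]) auto
qed

lemma ext_boundary_snd:
  assumes e: "ext_data H A \<theta>" and x: "x \<in> carrier R" and h: "h \<in> boundaries N A t l" and t: "t \<le> N"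
  shows "(\<zero>\<^bsub>obj H l\<^esub>, h) \<in> boundaries N (ext_cpx H A \<theta> x) t l"
proof -
  note H = ext_dataD(1)[OF e] and A = ext_dataD(2)[OF e]
  let ?m = "l - int (N - t)"
  obtain v where v: "v \<in> elts A ?m" "h = dpow A ?m (N - t) v" by (rule boundariesE[OF h refl refl])
  have "conn H A \<theta> (N - t) ?m \<zero>\<^bsub>obj H ?m\<^esub> = \<zero>\<^bsub>obj A l\<^esub>"
    using H A by (intro mhom_zero[OF ext_conn_mhom[OF e]]) auto
  then have "dpow (ext_cpx H A \<theta> x) ?m (N - t) (\<zero>\<^bsub>obj H ?m\<^esub>, v) = (\<zero>\<^bsub>obj H l\<^esub>, h)"
    using ext_dpow[OF e _ v(1) x, of "\<zero>\<^bsub>obj H ?m\<^esub>" l "N - t"] H A x v(2)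
      dpow_closed[OF A v(1), of l "N - t"] dpow_zero[OF H, of l ?m "N - t"] by simp
  then show ?thesis
    using H v by (intro boundariesI[of "(\<zero>\<^bsub>obj H ?m\<^esub>, v)", OF _ refl refl]) auto
qed

lemma ext_cycle_iff:
  assumes e: "ext_data H A \<theta>" and x: "x \<in> carrier R" and g: "g \<in> elts H l" "h \<in> elts A l"
  shows "(g, h) \<in> cycles (ext_cpx H A \<theta> x) t l \<longleftrightarrow> g \<in> cycles H t l \<and>
    x \<odot>\<^bsub>obj A (l + int t)\<^esub> conn H A \<theta> t l g \<oplus>\<^bsub>obj A (l + int t)\<^esub> dpow A l t h = \<zero>\<^bsub>obj A (l + int t)\<^esub>"
  using g by (auto simp: cycles_def ext_dpow[OF e g x refl])

lemma ext_chain_map: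
  assumes e: "ext_data H A \<theta>" and e': "ext_data H' A' \<theta>'" and f: "chain_map R H H' f" and k: "chain_map R A A' k"
    and comm: "\<And>n g. g \<in> elts H n \<Longrightarrow> k (n + 1) (\<theta> n g) = \<theta>' n (f n g)"
    and x: "x \<in> carrier R"
  shows "chain_map R (ext_cpx H A \<theta> x) (ext_cpx H' A' \<theta>' x) (\<lambda>n p. (f n (fst p), k n (snd p)))"
  unfolding chain_map_def
proof (intro allI conjI ballI)
  fix n
  show "(\<lambda>p. (f n (fst p), k n (snd p))) \<in> mhom R (obj (ext_cpx H A \<theta> x) n) (obj (ext_cpx H' A' \<theta>' x) n)"
    by (rule mhomI) (use f k in \<open>auto simp: chain_map_closed mhom_add[OF chain_map_mhom] mhom_smult[OF chain_map_mhom]\<close>)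
  fix p assume "p \<in> elts (ext_cpx H A \<theta> x) n"
  then obtain g h where p: "p = (g, h)" "g \<in> elts H n" "h \<in> elts A n" by auto
  note A = ext_dataD(2)[OF e]
  show "(f (n + 1) (fst (dif (ext_cpx H A \<theta> x) n p)), k (n + 1) (snd (dif (ext_cpx H A \<theta> x) n p))) =
      dif (ext_cpx H' A' \<theta>' x) n (f n (fst p), k n (snd p))"
    using p x A comm[OF p(2)] dif_closed[OF A p(3) refl] mhom_closed[OF ext_dataD(3)[OF e refl] p(2)]
    by (simp add: chain_map_dif[OF f p(2) refl, symmetric] chain_map_dif[OF k p(3) refl, symmetric]
       mhom_add[OF chain_map_mhom[OF k]] mhom_smult[OF chain_map_mhom[OF k]])
qed

context
  fixes H :: "('r, 'h) ncomplex" and A :: "('r, 'a) ncomplex" and \<theta>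
    and H' :: "('r, 'h1) ncomplex" and A' :: "('r, 'a1) ncomplex" and \<theta>' f k
  assumes ac: "ext_acyclic H A \<theta>" and ac': "ext_acyclic H' A' \<theta>'"
    and f: "hiso H H' f" and k: "chain_map R A A' k"
    and comm: "\<And>n g. g \<in> elts H n \<Longrightarrow> k (n + 1) (\<theta> n g) = \<theta>' n (f n g)"
begin

lemma ext_e: "ext_data H A \<theta>" and ext_e': "ext_data H' A' \<theta>'"
  using ac ac' by (simp_all add: ext_acyclic_def)

lemmas ext_cpxs = ext_dataD(1)[OF ext_e] ext_dataD(2)[OF ext_e] ext_dataD(1)[OF ext_e'] ext_dataD(2)[OF ext_e']

lemma ext_fc: "chain_map R H H' f"
  using f by (simp add: hiso_def)

lemma ext_conn_nat: "g \<in> elts H n \<Longrightarrow> m = n + int j \<Longrightarrow> k m (conn H A \<theta> j n g) = conn H' A' \<theta>' j n (f n g)"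
  by (rule conn_natural[OF ext_e ext_fc k comm ext_cpxs(4)])

text \<open>The connecting homomorphisms identify the homology of \<open>A\<close> and \<open>A'\<close> with that of \<open>H\<close> and \<open>H'\<close> in a way
  compatible with the two maps. So \<open>k\<close> is an isomorphism on homology because \<open>f\<close> is.\<close>

lemma hiso_fibre: "hiso A A' k"
  unfolding hiso_def
proof (intro conjI ballI allI impI)
  show "chain_map R A A' k" by (rule k)
  fix t l assume "t \<in> {1..N - 1}"
  then have t: "1 \<le> t" "t < N" "t \<le> N" and t': "1 \<le> N - t" "N - t < N" using N_ge_2 by auto
  let ?m = "l - int (N - t)"
  note c = ext_cpxs
  {
    fix h assume h: "h \<in> cycles A t l" and kh: "k l h \<in> boundaries N A' t l"
    obtain k' where k': "k' \<in> elts A' ?m" "k l h = dpow A' ?m (N - t) k'"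
      by (rule boundariesE[OF kh refl refl])
    obtain w v where w: "w \<in> cycles H (N - t) ?m" and v: "v \<in> elts A ?m"
      and hwv: "conn H A \<theta> (N - t) ?m w \<oplus>\<^bsub>obj A l\<^esub> dpow A ?m (N - t) v = h"
      by (rule ext_acyclic_vertical[OF ac t(1,2) h refl])
    note w1 = cyclesD(1)[OF w]
    have cw: "conn H A \<theta> (N - t) ?m w \<in> elts A l" by (rule ext_conn_closed[OF ext_e w1]) simp
    have dv: "dpow A ?m (N - t) v \<in> elts A l" by (rule dpow_closed[OF c(2) v]) simp
    have kv: "k ?m v \<in> elts A' ?m" by (rule chain_map_closed[OF k v])
    have dkv: "dpow A' ?m (N - t) (k ?m v) \<in> elts A' l" "dpow A' ?m (N - t) k' \<in> elts A' l"
      using dpow_closed[OF c(4) kv, of l] dpow_closed[OF c(4) k'(1), of l] by auto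
    have fw: "f ?m w \<in> elts H' ?m" by (rule chain_map_closed[OF ext_fc w1])
    have cfw: "conn H' A' \<theta>' (N - t) ?m (f ?m w) \<in> elts A' l"
      by (rule ext_conn_closed[OF ext_e' fw]) simp
    have "conn H' A' \<theta>' (N - t) ?m (f ?m w) \<oplus>\<^bsub>obj A' l\<^esub> dpow A' ?m (N - t) (k ?m v) = k l h"
      unfolding hwv[symmetric] using ext_conn_nat[OF w1, of l "N - t"] chain_map_dpow[OF k c(2) v, of l]
      by (simp add: mhom_add[OF chain_map_mhom[OF k] cw dv])
    then have "conn H' A' \<theta>' (N - t) ?m (f ?m w) = dpow A' ?m (N - t) k' \<ominus>\<^bsub>obj A' l\<^esub> dpow A' ?m (N - t) (k ?m v)"
      using k'(2) cfw dkv c by (simp add: mod_eq_diff)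
    also have "\<dots> = dpow A' ?m (N - t) (k' \<ominus>\<^bsub>obj A' ?m\<^esub> k ?m v)"
      using c kv k' by (simp add: dpow_diff[of A' l])
    finally have e: "conn H' A' \<theta>' (N - t) ?m (f ?m w) \<oplus>\<^bsub>obj A' l\<^esub>
       dpow A' ?m (N - t) (\<ominus>\<^bsub>obj A' ?m\<^esub> (k' \<ominus>\<^bsub>obj A' ?m\<^esub> k ?m v)) = \<zero>\<^bsub>obj A' l\<^esub>"
      using c kv k' dpow_closed[OF c(4), of "k' \<ominus>\<^bsub>obj A' ?m\<^esub> k ?m v" ?m l] by (simp add: dpow_neg[of A' l])
    have "f ?m w \<in> boundaries N H' (N - t) ?m"
    proof (rule ext_acyclicE[OF ac' t' fw, of _ "?m - int t"])
      show "\<ominus>\<^bsub>obj A' ?m\<^esub> (k' \<ominus>\<^bsub>obj A' ?m\<^esub> k ?m v) \<in> elts A' ?m" using c k' kv by simp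
      show "dpow H' ?m (N - t) (f ?m w) = \<zero>\<^bsub>obj H' (?m + int (N - t))\<^esub>"
        using chain_map_cycles[OF ext_fc c(1,3) w] by (simp add: cyclesD)
    qed (use e t in \<open>auto intro: boundariesI[where m = "?m - int t"]\<close>)
    then have "w \<in> boundaries N H (N - t) ?m" by (rule hiso_inj[OF f t' w])
    then have "conn H A \<theta> (N - t) ?m w \<in> boundaries N A t l" by (rule conn_boundary[OF ext_e t(3) _ refl])
    moreover have "dpow A ?m (N - t) v \<in> boundaries N A t l" by (rule boundariesI[OF v refl refl refl])
    ultimately show "h \<in> boundaries N A t l" unfolding hwv[symmetric] by (rule boundaries_add[OF c(2)])
  }
  {
    fix h' assume h': "h' \<in> cycles A' t l"
    obtain w' v' where w': "w' \<in> cycles H' (N - t) ?m" and v': "v' \<in> elts A' ?m"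
      and hwv: "conn H' A' \<theta>' (N - t) ?m w' \<oplus>\<^bsub>obj A' l\<^esub> dpow A' ?m (N - t) v' = h'"
      by (rule ext_acyclic_vertical[OF ac' t(1,2) h' refl])
    obtain w where w: "w \<in> cycles H (N - t) ?m" "w' \<ominus>\<^bsub>obj H' ?m\<^esub> f ?m w \<in> boundaries N H' (N - t) ?m"
      by (rule hiso_surj[OF f t' w'])
    let ?z = "conn H A \<theta> (N - t) ?m w"
    have z: "?z \<in> cycles A t l" by (rule conn_cycle[OF ext_e t(3) w(1) refl])
    have fw: "f ?m w \<in> elts H' ?m" by (rule chain_map_closed[OF ext_fc cyclesD(1)[OF w(1)]])
    note w'1 = cyclesD(1)[OF w']
    have cl: "conn H' A' \<theta>' (N - t) ?m w' \<in> elts A' l" "conn H' A' \<theta>' (N - t) ?m (f ?m w) \<in> elts A' l"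
       "dpow A' ?m (N - t) v' \<in> elts A' l"
      using ext_conn_closed[OF ext_e' w'1, of l] ext_conn_closed[OF ext_e' fw, of l] dpow_closed[OF c(4) v', of l] by auto
    have "h' \<ominus>\<^bsub>obj A' l\<^esub> k l ?z = conn H' A' \<theta>' (N - t) ?m (w' \<ominus>\<^bsub>obj H' ?m\<^esub> f ?m w) \<oplus>\<^bsub>obj A' l\<^esub> dpow A' ?m (N - t) v'"
      unfolding hwv[symmetric]
      using ext_conn_nat[OF cyclesD(1)[OF w(1)], of l "N - t"] cl c
       mhom_diff[OF ext_conn_mhom[OF ext_e', of l ?m "N - t"] _ _ w'1 fw]
      by (simp add: mod_diff_eq mod_ac)
    moreover have "conn H' A' \<theta>' (N - t) ?m (w' \<ominus>\<^bsub>obj H' ?m\<^esub> f ?m w) \<in> boundaries N A' t l"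
      by (rule conn_boundary[OF ext_e' t(3) w(2) refl])
    moreover have "dpow A' ?m (N - t) v' \<in> boundaries N A' t l" by (rule boundariesI[OF v' refl refl refl])
    ultimately have "h' \<ominus>\<^bsub>obj A' l\<^esub> k l ?z \<in> boundaries N A' t l" using boundaries_add[OF c(4)] by simp
    then show "\<exists>z\<in>cycles A t l. h' \<ominus>\<^bsub>obj A' l\<^esub> k l z \<in> boundaries N A' t l" using z by blast
  }
qed

text \<open>This is the five lemma for the long exact sequences of the two extensions, carried out on elements.
  For injectivity, a cycle \<open>(g, h)\<close> is reduced to \<open>(0, h\<^sub>1)\<close> by injectivity on \<open>H\<close>; then \<open>h\<^sub>1\<close> agrees up to a
  boundary with \<open>x\<close> times the connecting image of a cycle of \<open>H\<close>. For surjectivity, the component in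
  \<open>H'\<close> is lifted first, the obstruction to completing the lift to a cycle vanishes by injectivity on \<open>A\<close>,
  and the remaining error in \<open>A'\<close> is removed by surjectivity on \<open>A\<close>.\<close>

theorem ext_cpx_hiso:
  assumes x: "x \<in> carrier R"
  shows "hiso (ext_cpx H A \<theta> x) (ext_cpx H' A' \<theta>' x) (\<lambda>n p. (f n (fst p), k n (snd p)))"
  unfolding hiso_def
proof (intro conjI ballI allI impI)
  note c = ext_cpxs
  note E = ext_cpx_n_complex[OF ext_e x] and E' = ext_cpx_n_complex[OF ext_e' x]
  show F: "chain_map R (ext_cpx H A \<theta> x) (ext_cpx H' A' \<theta>' x) (\<lambda>n p. (f n (fst p), k n (snd p)))"
    by (rule ext_chain_map[OF ext_e ext_e' ext_fc k comm x])
  fix t l assume "t \<in> {1..N - 1}"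
  then have t: "1 \<le> t" "t < N" "t \<le> N" and t': "1 \<le> N - t" "N - t < N" using N_ge_2 by auto
  let ?m = "l - int (N - t)" and ?n = "l + int t"
  let ?E = "ext_cpx H A \<theta> x" and ?E' = "ext_cpx H' A' \<theta>' x"
  {
    fix p assume p: "p \<in> cycles ?E t l" and Fp: "(f l (fst p), k l (snd p)) \<in> boundaries N ?E' t l"
    obtain g h where gh: "p = (g, h)" by (cases p)
    have g: "g \<in> elts H l" "h \<in> elts A l" using p gh by (auto simp: cycles_def)
    have gc: "g \<in> cycles H t l" using p gh ext_cycle_iff[OF ext_e x g] by simp
    obtain b where b: "b \<in> elts ?E' ?m" "(f l g, k l h) = dpow ?E' ?m (N - t) b"
      using boundariesE[OF Fp refl refl] gh by auto
    have "f l g \<in> boundaries N H' t l"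
      using b ext_dpow[OF ext_e' _ _ x, of _ ?m _ l "N - t"] by (cases b) (auto intro: boundariesI)
    then have "g \<in> boundaries N H t l" by (rule hiso_inj[OF f t(1,2) gc])
    then obtain u where u: "u \<in> elts H ?m" "g = dpow H ?m (N - t) u" by (rule boundariesE[OF _ refl refl])
    have cu: "conn H A \<theta> (N - t) ?m u \<in> elts A l" by (rule ext_conn_closed[OF ext_e u(1)]) simp
    define h0 where "h0 = x \<odot>\<^bsub>obj A l\<^esub> conn H A \<theta> (N - t) ?m u"
    have h0: "h0 \<in> elts A l" using cu x c by (simp add: h0_def)
    have ub: "(g, h0) \<in> boundaries N ?E t l"
      unfolding u(2) h0_def by (rule ext_boundary_fst[OF ext_e x u(1) refl])
    define h1 where "h1 = h \<ominus>\<^bsub>obj A l\<^esub> h0"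
    have h1: "h1 \<in> elts A l" using g h0 c by (simp add: h1_def)
    have sub: "(\<zero>\<^bsub>obj H l\<^esub>, h1) \<oplus>\<^bsub>obj ?E l\<^esub> (g, h0) = (g, h)" using c g h0 by (simp add: h1_def)
    have z1: "(\<zero>\<^bsub>obj H l\<^esub>, h1) = (g, h) \<ominus>\<^bsub>obj ?E l\<^esub> (g, h0)"
      using E g h0 h1 c by (subst mod_eq_diff[of "obj ?E l"]) (use sub in auto)
    have "(\<zero>\<^bsub>obj H l\<^esub>, h1) \<in> cycles ?E t l"
    proof -
      have "(g, h) \<in> cycles ?E t l" "(g, h0) \<in> cycles ?E t l"
        using p gh ub boundaries_le_cycles[OF E t(3)] by auto
      then show ?thesis unfolding z1 by (rule cycles_diff[OF E])
    qed
    then have "dpow A l t h1 = \<zero>\<^bsub>obj A ?n\<^esub>"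
      using h1 c x mhom_zero[OF ext_conn_mhom[OF ext_e, of ?n l t]] dpow_closed[OF c(2) h1 refl, of t]
      by (simp add: ext_cycle_iff[OF ext_e x _ h1])
    then have h1c: "h1 \<in> cycles A t l" using h1 by (intro cyclesI) auto
    have "(\<zero>\<^bsub>obj H' l\<^esub>, k l h1) \<in> boundaries N ?E' t l"
    proof -
      let ?F = "\<lambda>n p. (f n (fst p), k n (snd p))"
      have "?F l (\<zero>\<^bsub>obj H l\<^esub>, h1) = ?F l (g, h) \<ominus>\<^bsub>obj ?E' l\<^esub> ?F l (g, h0)"
        unfolding z1 using g h0 E E' by (intro mhom_diff[OF chain_map_mhom[OF F]]) auto
      moreover have "?F l (g, h0) \<in> boundaries N ?E' t l" using chain_map_boundaries[OF F E t(3) ub] .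
      ultimately have "?F l (\<zero>\<^bsub>obj H l\<^esub>, h1) \<in> boundaries N ?E' t l"
        using Fp gh boundaries_diff[OF E'] by simp
      then show ?thesis using c by (simp add: mhom_zero[OF chain_map_mhom[OF ext_fc]])
    qed
    then obtain b' where b': "b' \<in> elts ?E' ?m" "(\<zero>\<^bsub>obj H' l\<^esub>, k l h1) = dpow ?E' ?m (N - t) b'"
      by (rule boundariesE[OF _ refl refl])
    obtain p' q' where pq: "b' = (p', q')" by (cases b')
    have p': "p' \<in> elts H' ?m" "q' \<in> elts A' ?m" using b' pq by auto
    have dp': "dpow H' ?m (N - t) p' = \<zero>\<^bsub>obj H' l\<^esub>"
      and kh1: "k l h1 = x \<odot>\<^bsub>obj A' l\<^esub> conn H' A' \<theta>' (N - t) ?m p' \<oplus>\<^bsub>obj A' l\<^esub> dpow A' ?m (N - t) q'"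
      using b'(2) pq ext_dpow[OF ext_e' p' x, of l "N - t"] by auto
    have p'c: "p' \<in> cycles H' (N - t) ?m" using p' dp' by (intro cyclesI) auto
    obtain y where y: "y \<in> cycles H (N - t) ?m" "p' \<ominus>\<^bsub>obj H' ?m\<^esub> f ?m y \<in> boundaries N H' (N - t) ?m"
      by (rule hiso_surj[OF f t' p'c])
    note y1 = cyclesD(1)[OF y(1)]
    have fy: "f ?m y \<in> elts H' ?m" by (rule chain_map_closed[OF ext_fc y1])
    define h2 where "h2 = x \<odot>\<^bsub>obj A l\<^esub> conn H A \<theta> (N - t) ?m y"
    have cy: "conn H A \<theta> (N - t) ?m y \<in> cycles A t l" by (rule conn_cycle[OF ext_e t(3) y(1) refl])
    then have h2c: "h2 \<in> cycles A t l" using c x by (auto simp: cycles_def h2_def dpow_smult)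
    have cl: "conn H' A' \<theta>' (N - t) ?m p' \<in> elts A' l" "conn H' A' \<theta>' (N - t) ?m (f ?m y) \<in> elts A' l"
       "dpow A' ?m (N - t) q' \<in> elts A' l"
      using ext_conn_closed[OF ext_e' p'(1), of l] ext_conn_closed[OF ext_e' fy, of l] dpow_closed[OF c(4) p'(2), of l] by auto
    have "k l h2 = x \<odot>\<^bsub>obj A' l\<^esub> conn H' A' \<theta>' (N - t) ?m (f ?m y)"
      using ext_conn_nat[OF y1, of l "N - t"] x cyclesD(1)[OF cy]
      by (simp add: h2_def mhom_smult[OF chain_map_mhom[OF k]])
    then have "k l (h1 \<ominus>\<^bsub>obj A l\<^esub> h2) = x \<odot>\<^bsub>obj A' l\<^esub> conn H' A' \<theta>' (N - t) ?m (p' \<ominus>\<^bsub>obj H' ?m\<^esub> f ?m y)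
       \<oplus>\<^bsub>obj A' l\<^esub> dpow A' ?m (N - t) q'"
    proof -
      have 1: "k l (h1 \<ominus>\<^bsub>obj A l\<^esub> h2) = k l h1 \<ominus>\<^bsub>obj A' l\<^esub> k l h2"
        using c by (intro mhom_diff[OF chain_map_mhom[OF k] _ _ h1 cyclesD(1)[OF h2c]]) auto
      have 2: "conn H' A' \<theta>' (N - t) ?m (p' \<ominus>\<^bsub>obj H' ?m\<^esub> f ?m y) =
          conn H' A' \<theta>' (N - t) ?m p' \<ominus>\<^bsub>obj A' l\<^esub> conn H' A' \<theta>' (N - t) ?m (f ?m y)"
        using c by (intro mhom_diff[OF ext_conn_mhom[OF ext_e'] _ _ p'(1) fy]) auto
      assume "k l h2 = x \<odot>\<^bsub>obj A' l\<^esub> conn H' A' \<theta>' (N - t) ?m (f ?m y)"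
      then show ?thesis
        unfolding 1 2 kh1 using c cl x by (simp add: mod_smult_add mod_smult_neg mod_diff_eq mod_ac)
    qed
    also have "\<dots> \<in> boundaries N A' t l"
    proof (rule boundaries_add[OF c(4)])
      have "conn H' A' \<theta>' (N - t) ?m (p' \<ominus>\<^bsub>obj H' ?m\<^esub> f ?m y) \<in> boundaries N A' t l"
        by (rule conn_boundary[OF ext_e' t(3) y(2) refl])
      then obtain a where a: "a \<in> elts A' ?m"
        "conn H' A' \<theta>' (N - t) ?m (p' \<ominus>\<^bsub>obj H' ?m\<^esub> f ?m y) = dpow A' ?m (N - t) a"
        by (rule boundariesE[OF _ refl refl])
      show "x \<odot>\<^bsub>obj A' l\<^esub> conn H' A' \<theta>' (N - t) ?m (p' \<ominus>\<^bsub>obj H' ?m\<^esub> f ?m y) \<in> boundaries N A' t l"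
        using a x c by (intro boundariesI[of "x \<odot>\<^bsub>obj A' ?m\<^esub> a", OF _ refl refl]) (auto simp: dpow_smult[of A' l])
    qed (rule boundariesI[OF p'(2) refl refl refl])
    finally have "h1 \<ominus>\<^bsub>obj A l\<^esub> h2 \<in> boundaries N A t l"
      using h1c h2c c by (intro hiso_inj[OF hiso_fibre t(1,2)]) (auto simp: cycles_def dpow_diff)
    from ext_boundary_snd[OF ext_e x this t(3)]
    have "(\<zero>\<^bsub>obj H l\<^esub>, h1 \<ominus>\<^bsub>obj A l\<^esub> h2) \<in> boundaries N ?E t l" .
    moreover have "(\<zero>\<^bsub>obj H l\<^esub>, h2) \<in> boundaries N ?E t l"
      using ext_boundary_fst[OF ext_e x y1 refl] cyclesD(2)[OF y(1), of l] by (simp add: h2_def)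
    ultimately have "(\<zero>\<^bsub>obj H l\<^esub>, h1) \<in> boundaries N ?E t l"
      using boundaries_add[OF E, of "(\<zero>\<^bsub>obj H l\<^esub>, h1 \<ominus>\<^bsub>obj A l\<^esub> h2)" t l "(\<zero>\<^bsub>obj H l\<^esub>, h2)"]
        h1 cyclesD(1)[OF h2c] c by simp
    from boundaries_add[OF E this ub] show "p \<in> boundaries N ?E t l" using sub gh by simp
  }
  {
    fix p assume p: "p \<in> cycles ?E' t l"
    obtain g' h' where gh: "p = (g', h')" by (cases p)
    have g': "g' \<in> elts H' l" "h' \<in> elts A' l" using p gh by (auto simp: cycles_def)
    have gc': "g' \<in> cycles H' t l" using p gh ext_cycle_iff[OF ext_e' x g'] by simp
    obtain g where g: "g \<in> cycles H t l" "g' \<ominus>\<^bsub>obj H' l\<^esub> f l g \<in> boundaries N H' t l"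
      by (rule hiso_surj[OF f t(1,2) gc'])
    note g1 = cyclesD(1)[OF g(1)]
    have fg: "f l g \<in> elts H' l" by (rule chain_map_closed[OF ext_fc g1])
    obtain w where w: "w \<in> elts H' ?m" "g' \<ominus>\<^bsub>obj H' l\<^esub> f l g = dpow H' ?m (N - t) w"
      by (rule boundariesE[OF g(2) refl refl])
    define h0 where "h0 = x \<odot>\<^bsub>obj A' l\<^esub> conn H' A' \<theta>' (N - t) ?m w"
    have h0: "h0 \<in> elts A' l" using ext_conn_closed[OF ext_e' w(1), of l "N - t"] x c by (simp add: h0_def)
    have wb: "(g' \<ominus>\<^bsub>obj H' l\<^esub> f l g, h0) \<in> boundaries N ?E' t l"
      unfolding w(2) h0_def by (rule ext_boundary_fst[OF ext_e' x w(1) refl])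
    define h1 where "h1 = h' \<ominus>\<^bsub>obj A' l\<^esub> h0"
    have h1: "h1 \<in> elts A' l" using g' h0 c by (simp add: h1_def)
    have z1: "(f l g, h1) = (g', h') \<ominus>\<^bsub>obj ?E' l\<^esub> (g' \<ominus>\<^bsub>obj H' l\<^esub> f l g, h0)"
      by (subst mod_eq_diff[of "obj ?E' l"])
        (use E' g' h0 h1 fg c in \<open>auto simp: h1_def mod_diff_eq mod_ac\<close>)
    have "(g', h') \<in> cycles ?E' t l" "(g' \<ominus>\<^bsub>obj H' l\<^esub> f l g, h0) \<in> cycles ?E' t l"
      using p gh wb boundaries_le_cycles[OF E' t(3)] by auto
    then have "(f l g, h1) \<in> cycles ?E' t l" unfolding z1 by (rule cycles_diff[OF E'])
    then have eq: "x \<odot>\<^bsub>obj A' ?n\<^esub> conn H' A' \<theta>' t l (f l g) \<oplus>\<^bsub>obj A' ?n\<^esub> dpow A' l t h1 = \<zero>\<^bsub>obj A' ?n\<^esub>"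
      by (simp add: ext_cycle_iff[OF ext_e' x fg h1])
    let ?c = "conn H A \<theta> t l g"
    have "conn H A \<theta> (N - (N - t)) l g \<in> cycles A (N - t) ?n"
      by (rule conn_cycle[OF ext_e]) (use g t in auto)
    then have cc: "?c \<in> cycles A (N - t) ?n" using t by simp
    note c1 = cyclesD(1)[OF cc]
    have xc: "x \<odot>\<^bsub>obj A ?n\<^esub> ?c \<in> cycles A (N - t) ?n" using cc c x by (auto simp: cycles_def dpow_smult)
    have "k ?n (x \<odot>\<^bsub>obj A ?n\<^esub> ?c) = x \<odot>\<^bsub>obj A' ?n\<^esub> conn H' A' \<theta>' t l (f l g)"
      using ext_conn_nat[OF g1, of ?n t] c1 x by (simp add: mhom_smult[OF chain_map_mhom[OF k]])
    also have "\<dots> = \<ominus>\<^bsub>obj A' ?n\<^esub> dpow A' l t h1"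
      using eq c x ext_conn_closed[OF ext_e' fg refl, of t] dpow_closed[OF c(4) h1 refl, of t] by (simp add: mod_add_eq_zero)
    also have "\<dots> \<in> boundaries N A' (N - t) ?n"
      using t h1 c by (intro boundaries_neg boundariesI[OF h1]) auto
    finally have "x \<odot>\<^bsub>obj A ?n\<^esub> ?c \<in> boundaries N A (N - t) ?n" by (rule hiso_inj[OF hiso_fibre t' xc])
    then obtain h2 where h2: "h2 \<in> elts A l" "x \<odot>\<^bsub>obj A ?n\<^esub> ?c = dpow A l t h2"
      by (rule boundariesE[of _ _ _ _ t l]) (use t in auto)
    let ?h2 = "\<ominus>\<^bsub>obj A l\<^esub> h2"
    have h2': "?h2 \<in> elts A l" using h2 c by simp
    have gh2: "(g, ?h2) \<in> cycles ?E t l"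
      using g h2 c dpow_closed[OF c(2) h2(1) refl, of t]
      by (simp add: ext_cycle_iff[OF ext_e x g1 h2'] dpow_neg)
    have kh2: "k l ?h2 \<in> elts A' l" by (rule chain_map_closed[OF k h2'])
    have Fgh2: "(f l g, k l ?h2) \<in> cycles ?E' t l"
      using chain_map_cycles[OF F E E' gh2] by simp
    then have eq2: "x \<odot>\<^bsub>obj A' ?n\<^esub> conn H' A' \<theta>' t l (f l g) \<oplus>\<^bsub>obj A' ?n\<^esub> dpow A' l t (k l ?h2) = \<zero>\<^bsub>obj A' ?n\<^esub>"
      by (simp add: ext_cycle_iff[OF ext_e' x fg kh2])
    have "dpow A' l t h1 = dpow A' l t (k l ?h2)"
      using eq eq2 c x ext_conn_closed[OF ext_e' fg refl, of t] dpow_closed[OF c(4) h1 refl, of t]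
        dpow_closed[OF c(4) kh2 refl, of t] by (metis mod_neg_add_cancel mod_smult cpx_module)
    then have "h1 \<ominus>\<^bsub>obj A' l\<^esub> k l ?h2 \<in> cycles A' t l"
      using h1 kh2 c dpow_closed[OF c(4) kh2 refl, of t] by (simp add: cycles_def dpow_diff)
    then obtain h3 where h3: "h3 \<in> cycles A t l" "(h1 \<ominus>\<^bsub>obj A' l\<^esub> k l ?h2) \<ominus>\<^bsub>obj A' l\<^esub> k l h3 \<in> boundaries N A' t l"
      by (rule hiso_surj[OF hiso_fibre t(1,2)])
    note h31 = cyclesD(1)[OF h3(1)]
    let ?q = "(g, ?h2 \<oplus>\<^bsub>obj A l\<^esub> h3)"
    have kh3: "k l h3 \<in> elts A' l" by (rule chain_map_closed[OF k h31])
    have q: "?q \<in> cycles ?E t l"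
    proof -
      have "dpow A l t (?h2 \<oplus>\<^bsub>obj A l\<^esub> h3) = dpow A l t ?h2"
        using h2' h31 c cyclesD(2)[OF h3(1) refl] dpow_closed[OF c(2) h2' refl, of t] by (simp add: dpow_add)
      then show ?thesis using gh2 h2' h31 c by (simp add: ext_cycle_iff[OF ext_e x g1])
    qed
    have "(\<zero>\<^bsub>obj H' l\<^esub>, (h1 \<ominus>\<^bsub>obj A' l\<^esub> k l ?h2) \<ominus>\<^bsub>obj A' l\<^esub> k l h3) \<in> boundaries N ?E' t l"
      by (rule ext_boundary_snd[OF ext_e' x h3(2) t(3)])
    from boundaries_add[OF E' wb this]
    have "(g' \<ominus>\<^bsub>obj H' l\<^esub> f l g, h0 \<oplus>\<^bsub>obj A' l\<^esub> ((h1 \<ominus>\<^bsub>obj A' l\<^esub> k l ?h2) \<ominus>\<^bsub>obj A' l\<^esub> k l h3)) \<in> boundaries N ?E' t l"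
      using c g' fg by simp
    moreover have "(g', h') \<ominus>\<^bsub>obj ?E' l\<^esub> (f l g, k l (?h2 \<oplus>\<^bsub>obj A l\<^esub> h3)) =
      (g' \<ominus>\<^bsub>obj H' l\<^esub> f l g, h0 \<oplus>\<^bsub>obj A' l\<^esub> ((h1 \<ominus>\<^bsub>obj A' l\<^esub> k l ?h2) \<ominus>\<^bsub>obj A' l\<^esub> k l h3))"
    proof -
      have "h0 \<oplus>\<^bsub>obj A' l\<^esub> ((h1 \<ominus>\<^bsub>obj A' l\<^esub> k l ?h2) \<ominus>\<^bsub>obj A' l\<^esub> k l h3) = (h0 \<oplus>\<^bsub>obj A' l\<^esub> h1) \<ominus>\<^bsub>obj A' l\<^esub> (k l ?h2 \<oplus>\<^bsub>obj A' l\<^esub> k l h3)"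
        using h0 h1 kh2 kh3 c by (simp add: mod_diff_eq mod_assoc mod_neg_add)
      also have "h0 \<oplus>\<^bsub>obj A' l\<^esub> h1 = h'" using h0 g' c by (simp add: h1_def mod_comm[of _ h0])
      also have "k l ?h2 \<oplus>\<^bsub>obj A' l\<^esub> k l h3 = k l (?h2 \<oplus>\<^bsub>obj A l\<^esub> h3)"
        using mhom_add[OF chain_map_mhom[OF k] h2' h31] by simp
      finally have e: "h0 \<oplus>\<^bsub>obj A' l\<^esub> ((h1 \<ominus>\<^bsub>obj A' l\<^esub> k l ?h2) \<ominus>\<^bsub>obj A' l\<^esub> k l h3) = h' \<ominus>\<^bsub>obj A' l\<^esub> k l (?h2 \<oplus>\<^bsub>obj A l\<^esub> h3)" .
      have kq: "k l (?h2 \<oplus>\<^bsub>obj A l\<^esub> h3) \<in> elts A' l" using h2' h31 c by (intro chain_map_closed[OF k]) simp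
      show ?thesis unfolding e
        by (rule sym, subst mod_eq_diff[of "obj ?E' l"]) (use E' g' fg kq c in auto)
    qed
    ultimately have "(g', h') \<ominus>\<^bsub>obj ?E' l\<^esub> (f l (fst ?q), k l (snd ?q)) \<in> boundaries N ?E' t l" by simp
    then show "\<exists>z\<in>cycles ?E t l. p \<ominus>\<^bsub>obj ?E' l\<^esub> (f l (fst z), k l (snd z)) \<in> boundaries N ?E' t l"
      unfolding gh using q by blast
  }
qed

end

end

section \<open>Twisted extensions and subcomplexes\<close>

context n_complexes
begin

text \<open>The hypothesis says that the quotient of \<open>X\<close> by \<open>G\<close> is acyclic, phrased without forming the quotient.\<close>

lemma hiso_inclusion:
  assumes G: "n_complex R N G" and X: "n_complex R N X" and i: "chain_map R G X (\<lambda>n x. x)"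
    and rel: "\<And>r n b. 1 \<le> r \<Longrightarrow> r < N \<Longrightarrow> b \<in> elts X n \<Longrightarrow>
      dpow X n r b \<in> elts G (n + int r) \<Longrightarrow>
      \<exists>c\<in>elts X (n - int (N - r)). b \<ominus>\<^bsub>obj X n\<^esub> dpow X (n - int (N - r)) (N - r) c \<in> elts G n"
  shows "hiso G X (\<lambda>n x. x)"
  unfolding hiso_def
proof (intro conjI ballI allI impI)
  show "chain_map R G X (\<lambda>n x. x)" by (rule i)
  have inc: "x \<in> elts X n" if "x \<in> elts G n" for x n using chain_map_closed[OF i that] .
  have dp: "dpow G n k x = dpow X n k x" if "x \<in> elts G n" for x n k
    using chain_map_dpow[OF i G that refl, of k] .
  have zr: "\<zero>\<^bsub>obj G n\<^esub> = \<zero>\<^bsub>obj X n\<^esub>" for n using mhom_zero[OF chain_map_mhom[OF i]] G X by simp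
  fix t l assume "t \<in> {1..N - 1}"
  then have t: "1 \<le> t" "t < N" "t \<le> N" and t': "1 \<le> N - t" "N - t < N" using N_ge_2 by auto
  let ?m = "l - int (N - t)"
  {
    fix z assume z: "z \<in> cycles G t l" "z \<in> boundaries N X t l"
    note z1 = cyclesD(1)[OF z(1)]
    obtain c where c: "c \<in> elts X ?m" "z = dpow X ?m (N - t) c" by (rule boundariesE[OF z(2) refl refl])
    have "dpow X ?m (N - t) c \<in> elts G (?m + int (N - t))" using z1 c by simp
    from rel[OF t' c(1) this] t obtain e where e: "e \<in> elts X (?m - int t)"
      "c \<ominus>\<^bsub>obj X ?m\<^esub> dpow X (?m - int t) t e \<in> elts G ?m" by auto
    let ?c = "c \<ominus>\<^bsub>obj X ?m\<^esub> dpow X (?m - int t) t e"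
    have de: "dpow X (?m - int t) t e \<in> elts X ?m" by (rule dpow_closed[OF X e(1)]) simp
    have "dpow X ?m (N - t) (dpow X (?m - int t) t e) = dpow X (?m - int t) N e"
      using t by (intro dpow_comp) auto
    also have "\<dots> = \<zero>\<^bsub>obj X l\<^esub>" using t by (intro dpow_ge_N[OF X _ e(1)]) (auto simp: of_nat_diff)
    finally have "dpow X ?m (N - t) ?c = z"
      using c de X cyclesD(1)[OF z(1)] inc[OF z1] by (simp add: dpow_diff[OF X, of l])
    then show "z \<in> boundaries N G t l"
      using dp[OF e(2)] by (intro boundariesI[OF e(2) refl refl]) simp
  }
  {
    fix z' assume z': "z' \<in> cycles X t l"
    note z1 = cyclesD(1)[OF z']
    have "dpow X l t z' \<in> elts G (l + int t)"
      using cyclesD(2)[OF z' refl] G by (simp add: zr[symmetric])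
    from rel[OF t(1,2) z1 this] obtain c where c: "c \<in> elts X ?m"
      "z' \<ominus>\<^bsub>obj X l\<^esub> dpow X ?m (N - t) c \<in> elts G l" by blast
    let ?b = "dpow X ?m (N - t) c"
    have b: "?b \<in> boundaries N X t l" by (rule boundariesI[OF c(1) refl refl refl])
    have b1: "?b \<in> elts X l" by (rule boundaries_carrier[OF X b t(3)])
    have "z' \<ominus>\<^bsub>obj X l\<^esub> ?b \<in> cycles X t l"
      using cycles_diff[OF X z'] boundaries_le_cycles[OF X t(3)] b by blast
    then have "z' \<ominus>\<^bsub>obj X l\<^esub> ?b \<in> cycles G t l"
      using dp[OF c(2), of t] c(2) by (auto simp: cycles_def zr)
    moreover have "z' \<ominus>\<^bsub>obj X l\<^esub> (z' \<ominus>\<^bsub>obj X l\<^esub> ?b) = ?b"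
      using z1 b1 X by (simp add: mod_diff_eq mod_neg_add)
    ultimately show "\<exists>z\<in>cycles G t l. z' \<ominus>\<^bsub>obj X l\<^esub> z \<in> boundaries N X t l" using b by metis
  }
qed

text \<open>If two of the three complexes \<open>G\<close>, \<open>X\<close> and the quotient of \<open>X\<close> by \<open>G\<close> are acyclic, so is the third.
  The amplitude \<open>N - r\<close> for \<open>G\<close> is the one shifted by the connecting homomorphism.\<close>

lemma relative_exact:
  assumes G: "n_complex R N G" and X: "n_complex R N X" and i: "chain_map R G X (\<lambda>n x. x)"
    and r: "1 \<le> r" "r < N" and exX: "\<And>n. exact_at X r n" and exG: "\<And>n. exact_at G (N - r) n"
    and b: "b \<in> elts X n" and db: "dpow X n r b \<in> elts G (n + int r)"
  shows "\<exists>c\<in>elts X (n - int (N - r)). b \<ominus>\<^bsub>obj X n\<^esub> dpow X (n - int (N - r)) (N - r) c \<in> elts G n"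
proof -
  have inc: "x \<in> elts X n" if "x \<in> elts G n" for x n using chain_map_closed[OF i that] .
  have dp: "dpow G n k x = dpow X n k x" if "x \<in> elts G n" for x n k
    using chain_map_dpow[OF i G that refl, of k] .
  have zr: "\<zero>\<^bsub>obj G n\<^esub> = \<zero>\<^bsub>obj X n\<^esub>" for n using mhom_zero[OF chain_map_mhom[OF i]] G X by simp
  let ?u = "dpow X n r b" and ?m = "n - int (N - r)"
  have "dpow G (n + int r) (N - r) ?u = dpow X n N b"
    unfolding dp[OF db] using r by (intro dpow_comp) auto
  also have "\<dots> = \<zero>\<^bsub>obj G (n + int r + int (N - r))\<^esub>"
    unfolding zr using r by (intro dpow_ge_N[OF X _ b]) (auto simp: of_nat_diff)
  finally obtain e where e: "e \<in> elts G n" "dpow G n r e = ?u"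
    using exact_atE[OF exG db _ refl, of r n] r by auto
  have e1: "e \<in> elts X n" by (rule inc[OF e(1)])
  have "dpow X n r (b \<ominus>\<^bsub>obj X n\<^esub> e) = \<zero>\<^bsub>obj X (n + int r)\<^esub>"
    using b e1 X e(2) dpow_closed[OF X b refl] unfolding dp[OF e(1)] by (simp add: dpow_diff)
  then obtain c where c: "c \<in> elts X ?m" "dpow X ?m (N - r) c = b \<ominus>\<^bsub>obj X n\<^esub> e"
    using exact_atE[OF exX, of "b \<ominus>\<^bsub>obj X n\<^esub> e" n] b e1 X by (metis mod_diff cpx_module)
  have "b \<ominus>\<^bsub>obj X n\<^esub> dpow X ?m (N - r) c = e"
    unfolding c(2) using b e1 X by (simp add: mod_diff_eq mod_neg_add)
  then show ?thesis using c e by metis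
qed

lemma ext_diff:
  assumes "module R (obj H n)" "module R (obj A n)"
    and "g \<in> elts H n" "h \<in> elts A n" "g' \<in> elts H n" "h' \<in> elts A n"
  shows "(g, h) \<ominus>\<^bsub>obj (ext_cpx H A \<theta> x) n\<^esub> (g', h') = (g \<ominus>\<^bsub>obj H n\<^esub> g', h \<ominus>\<^bsub>obj A n\<^esub> h')"
  by (rule sym, subst mod_eq_diff[OF ext_cpx_obj_module]) (use assms in auto)

text \<open>By \<open>cancel\<close> and \<open>divis\<close>, multiplication by \<open>x\<close> is bijective on the quotient of \<open>H\<close> by \<open>H0\<close>. Hence
  the quotient of the two extensions with parameter \<open>x\<close> is isomorphic to the one with parameter \<open>1\<close>,
  through \<open>(g, h) \<mapsto> (x g, h)\<close>, and the latter is acyclic because both extensions are.\<close>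

theorem ext_cpx_sub_hiso:
  assumes ac: "ext_acyclic H A \<theta>" and ac0: "ext_acyclic H0 A0 \<theta>0"
    and iH: "chain_map R H0 H (\<lambda>n x. x)" and iA: "chain_map R A0 A (\<lambda>n x. x)"
    and th: "\<And>n g. g \<in> elts H0 n \<Longrightarrow> \<theta>0 n g = \<theta> n g"
    and x: "x \<in> carrier R"
    and cancel: "\<And>n g. g \<in> elts H n \<Longrightarrow> x \<odot>\<^bsub>obj H n\<^esub> g \<in> elts H0 n \<Longrightarrow> g \<in> elts H0 n"
    and divis: "\<And>n g. g \<in> elts H n \<Longrightarrow>
      \<exists>g'\<in>elts H n. g \<ominus>\<^bsub>obj H n\<^esub> (x \<odot>\<^bsub>obj H n\<^esub> g') \<in> elts H0 n"
  shows "hiso (ext_cpx H0 A0 \<theta>0 x) (ext_cpx H A \<theta> x) (\<lambda>n p. p)"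
proof (rule hiso_inclusion)
  have e: "ext_data H A \<theta>" and e0: "ext_data H0 A0 \<theta>0" using ac ac0 by (simp_all add: ext_acyclic_def)
  note H = ext_dataD(1)[OF e] and A = ext_dataD(2)[OF e] and H0 = ext_dataD(1)[OF e0] and A0 = ext_dataD(2)[OF e0]
  show "n_complex R N (ext_cpx H0 A0 \<theta>0 x)" "n_complex R N (ext_cpx H A \<theta> x)"
    by (rule ext_cpx_n_complex[OF e0 x], rule ext_cpx_n_complex[OF e x])
  have inc: "chain_map R (ext_cpx H0 A0 \<theta>0 y) (ext_cpx H A \<theta> y) (\<lambda>n p. p)" if "y \<in> carrier R" for y
    using ext_chain_map[OF e0 e iH iA th that] by simp
  show "chain_map R (ext_cpx H0 A0 \<theta>0 x) (ext_cpx H A \<theta> x) (\<lambda>n p. p)" by (rule inc[OF x])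
  have iH': "g \<in> elts H n" if "g \<in> elts H0 n" for g n using chain_map_closed[OF iH that] .
  have iA': "g \<in> elts A n" if "g \<in> elts A0 n" for g n using chain_map_closed[OF iA that] .
  fix r n b assume r: "1 \<le> r" "r < N" and b: "b \<in> elts (ext_cpx H A \<theta> x) n"
    and db: "dpow (ext_cpx H A \<theta> x) n r b \<in> elts (ext_cpx H0 A0 \<theta>0 x) (n + int r)"
  let ?m = "n - int (N - r)" and ?n = "n + int r"
  obtain g h where gh: "b = (g, h)" "g \<in> elts H n" "h \<in> elts A n" using b by auto
  have dg: "dpow H n r g \<in> elts H0 ?n"
    and dh: "x \<odot>\<^bsub>obj A ?n\<^esub> conn H A \<theta> r n g \<oplus>\<^bsub>obj A ?n\<^esub> dpow A n r h \<in> elts A0 ?n"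
    using db unfolding gh(1) ext_dpow[OF e gh(2,3) x refl] by auto
  have xg: "x \<odot>\<^bsub>obj H n\<^esub> g \<in> elts H n" using gh x H by simp
  have "x \<odot>\<^bsub>obj H0 ?n\<^esub> dpow H n r g = x \<odot>\<^bsub>obj H ?n\<^esub> dpow H n r g"
    using mhom_smult[OF chain_map_mhom[OF iH] x dg] .
  then have "dpow H n r (x \<odot>\<^bsub>obj H n\<^esub> g) \<in> elts H0 ?n"
    using mod_smult[OF cpx_module[OF H0] x dg] gh x H by (simp add: dpow_smult)
  moreover have "\<one> \<odot>\<^bsub>obj A ?n\<^esub> conn H A \<theta> r n (x \<odot>\<^bsub>obj H n\<^esub> g) = x \<odot>\<^bsub>obj A ?n\<^esub> conn H A \<theta> r n g"
    using A x ext_conn_closed[OF e gh(2) refl] mhom_smult[OF ext_conn_mhom[OF e refl] x gh(2)] by simp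
  ultimately have "dpow (ext_cpx H A \<theta> \<one>) n r (x \<odot>\<^bsub>obj H n\<^esub> g, h) \<in> elts (ext_cpx H0 A0 \<theta>0 \<one>) ?n"
    using dh by (simp add: ext_dpow[OF e xg gh(3) one_closed refl])
  then have "\<exists>c\<in>elts (ext_cpx H A \<theta> \<one>) ?m. (x \<odot>\<^bsub>obj H n\<^esub> g, h) \<ominus>\<^bsub>obj (ext_cpx H A \<theta> \<one>) n\<^esub>
      dpow (ext_cpx H A \<theta> \<one>) ?m (N - r) c \<in> elts (ext_cpx H0 A0 \<theta>0 \<one>) n"
  proof (intro relative_exact[OF ext_cpx_n_complex[OF e0] ext_cpx_n_complex[OF e] inc r])
    have "r \<in> {1..N - 1}" "N - r \<in> {1..N - 1}" using r by auto
    then show "exact_at (ext_cpx H A \<theta> \<one>) r k" "exact_at (ext_cpx H0 A0 \<theta>0 \<one>) (N - r) k" for k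
      using ac ac0 unfolding ext_acyclic_def by blast+
  qed (use xg gh in auto)
  then obtain w v where w: "w \<in> elts H ?m" and v: "v \<in> elts A ?m"
    and wv: "(x \<odot>\<^bsub>obj H n\<^esub> g, h) \<ominus>\<^bsub>obj (ext_cpx H A \<theta> \<one>) n\<^esub> dpow (ext_cpx H A \<theta> \<one>) ?m (N - r) (w, v)
       \<in> elts (ext_cpx H0 A0 \<theta>0 \<one>) n" by auto
  have dw: "dpow H ?m (N - r) w \<in> elts H n" by (rule dpow_closed[OF H w]) simp
  have dv: "dpow A ?m (N - r) v \<in> elts A n" by (rule dpow_closed[OF A v]) simp
  have cw: "conn H A \<theta> (N - r) ?m w \<in> elts A n" by (rule ext_conn_closed[OF e w]) simp
  have n: "n = ?m + int (N - r)" by simp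
  have 1: "x \<odot>\<^bsub>obj H n\<^esub> g \<ominus>\<^bsub>obj H n\<^esub> dpow H ?m (N - r) w \<in> elts H0 n"
    and 2: "h \<ominus>\<^bsub>obj A n\<^esub> (conn H A \<theta> (N - r) ?m w \<oplus>\<^bsub>obj A n\<^esub> dpow A ?m (N - r) v) \<in> elts A0 n"
    using wv H A gh xg dw dv cw by (simp_all add: ext_dpow[OF e w v one_closed n] ext_diff)
  obtain w' where w': "w' \<in> elts H ?m" "w \<ominus>\<^bsub>obj H ?m\<^esub> (x \<odot>\<^bsub>obj H ?m\<^esub> w') \<in> elts H0 ?m"
    using divis[OF w] by blast
  let ?d = "w \<ominus>\<^bsub>obj H ?m\<^esub> (x \<odot>\<^bsub>obj H ?m\<^esub> w')"
  have xw': "x \<odot>\<^bsub>obj H ?m\<^esub> w' \<in> elts H ?m" using x w' H by simp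
  have dw': "dpow H ?m (N - r) w' \<in> elts H n" by (rule dpow_closed[OF H w'(1)]) simp
  have cw': "conn H A \<theta> (N - r) ?m w' \<in> elts A n" by (rule ext_conn_closed[OF e w'(1)]) simp
  have dd: "dpow H ?m (N - r) ?d \<in> elts H0 n"
    using dpow_closed[OF H0 w'(2) n] unfolding chain_map_dpow[OF iH H0 w'(2) n] .
  have cd: "conn H A \<theta> (N - r) ?m ?d \<in> elts A0 n"
  proof -
    have "conn H0 A0 \<theta>0 (N - r) ?m ?d = conn H A \<theta> (N - r) ?m ?d"
      by (rule conn_natural[where f = "\<lambda>n x. x" and k = "\<lambda>n x. x", OF e0 iH iA _ A w'(2) n]) (rule th)
    then show ?thesis using ext_conn_closed[OF e0 w'(2) n] by (simp only:)
  qed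
  have addH: "y \<oplus>\<^bsub>obj H n\<^esub> z \<in> elts H0 n" if "y \<in> elts H0 n" "z \<in> elts H0 n" for y z
    using mod_add[OF cpx_module[OF H0] that] unfolding mhom_add[OF chain_map_mhom[OF iH] that] .
  have addA: "y \<oplus>\<^bsub>obj A n\<^esub> z \<in> elts A0 n" if "y \<in> elts A0 n" "z \<in> elts A0 n" for y z
    using mod_add[OF cpx_module[OF A0] that] unfolding mhom_add[OF chain_map_mhom[OF iA] that] .
  have ddeq: "dpow H ?m (N - r) ?d = dpow H ?m (N - r) w \<ominus>\<^bsub>obj H n\<^esub> x \<odot>\<^bsub>obj H n\<^esub> dpow H ?m (N - r) w'"
    using w w'(1) xw' x H by (simp add: dpow_diff[OF H n] dpow_smult[OF H n])
  have "x \<odot>\<^bsub>obj H n\<^esub> (g \<ominus>\<^bsub>obj H n\<^esub> dpow H ?m (N - r) w') =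
     (x \<odot>\<^bsub>obj H n\<^esub> g \<ominus>\<^bsub>obj H n\<^esub> dpow H ?m (N - r) w) \<oplus>\<^bsub>obj H n\<^esub> dpow H ?m (N - r) ?d"
    unfolding ddeq using x H gh dw dw' xg by (simp add: mod_smult_add mod_smult_neg mod_diff_eq mod_assoc)
  then have "x \<odot>\<^bsub>obj H n\<^esub> (g \<ominus>\<^bsub>obj H n\<^esub> dpow H ?m (N - r) w') \<in> elts H0 n"
    using addH[OF 1 dd] by (simp only:)
  then have r1: "g \<ominus>\<^bsub>obj H n\<^esub> dpow H ?m (N - r) w' \<in> elts H0 n"
    using cancel[of "g \<ominus>\<^bsub>obj H n\<^esub> dpow H ?m (N - r) w'" n] gh dw' H by simp
  have cdeq: "conn H A \<theta> (N - r) ?m ?d = conn H A \<theta> (N - r) ?m w \<ominus>\<^bsub>obj A n\<^esub> x \<odot>\<^bsub>obj A n\<^esub> conn H A \<theta> (N - r) ?m w'"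
  proof -
    have "conn H A \<theta> (N - r) ?m ?d =
        conn H A \<theta> (N - r) ?m w \<ominus>\<^bsub>obj A n\<^esub> conn H A \<theta> (N - r) ?m (x \<odot>\<^bsub>obj H ?m\<^esub> w')"
      by (rule mhom_diff[OF ext_conn_mhom[OF e n] _ _ w xw']) (use H A in simp_all)
    then show ?thesis using mhom_smult[OF ext_conn_mhom[OF e n] x w'(1)] by (simp only:)
  qed
  have "h \<ominus>\<^bsub>obj A n\<^esub> (x \<odot>\<^bsub>obj A n\<^esub> conn H A \<theta> (N - r) ?m w' \<oplus>\<^bsub>obj A n\<^esub> dpow A ?m (N - r) v) =
     (h \<ominus>\<^bsub>obj A n\<^esub> (conn H A \<theta> (N - r) ?m w \<oplus>\<^bsub>obj A n\<^esub> dpow A ?m (N - r) v)) \<oplus>\<^bsub>obj A n\<^esub> conn H A \<theta> (N - r) ?m ?d"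
  proof -
    let ?a = "conn H A \<theta> (N - r) ?m w" and ?x = "x \<odot>\<^bsub>obj A n\<^esub> conn H A \<theta> (N - r) ?m w'" and ?v = "dpow A ?m (N - r) v"
    have m: "module R (obj A n)" "?x \<in> elts A n" using A x cw' by simp_all
    have "\<ominus>\<^bsub>obj A n\<^esub> ?v \<oplus>\<^bsub>obj A n\<^esub> (?a \<oplus>\<^bsub>obj A n\<^esub> \<ominus>\<^bsub>obj A n\<^esub> ?x) = ?a \<oplus>\<^bsub>obj A n\<^esub> (\<ominus>\<^bsub>obj A n\<^esub> ?x \<oplus>\<^bsub>obj A n\<^esub> \<ominus>\<^bsub>obj A n\<^esub> ?v)"
      using m cw dv by (simp add: mod_ac)
    then show ?thesis
      unfolding cdeq using m cw dv gh by (simp add: mod_diff_eq mod_neg_add mod_assoc)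
  qed
  then have r2: "h \<ominus>\<^bsub>obj A n\<^esub> (x \<odot>\<^bsub>obj A n\<^esub> conn H A \<theta> (N - r) ?m w' \<oplus>\<^bsub>obj A n\<^esub> dpow A ?m (N - r) v) \<in> elts A0 n"
    using addA[OF 2 cd] by (simp only:)
  show "\<exists>c\<in>elts (ext_cpx H A \<theta> x) ?m. b \<ominus>\<^bsub>obj (ext_cpx H A \<theta> x) n\<^esub>
      dpow (ext_cpx H A \<theta> x) ?m (N - r) c \<in> elts (ext_cpx H0 A0 \<theta>0 x) n"
    by (rule bexI[of _ "(w', v)"])
      (use r1 r2 w'(1) v gh H A x dw' dv cw' in \<open>simp_all add: ext_dpow[OF e w'(1) v x n] ext_diff\<close>)
qed

end

section \<open>The q-Hom complex\<close>

locale q_complexes = n_complexes R N for R :: "('r, 's) ring_scheme" (structure) and N +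
  fixes q :: 'r
  assumes prim: "primitive_root_of_unity R N q"
begin

lemma q_closed [simp]: "q \<in> carrier R"
  using prim by (simp add: primitive_root_of_unity_def)

lemma q_pow_N: "q [^] N = \<one>"
  using prim by (simp add: primitive_root_of_unity_def)

text \<open>As \<open>q\<^sup>N = 1\<close>, negative powers of \<open>q\<close> are nonnegative powers as well. This reduces integer exponents to
  natural ones.\<close>

lemma q_power_inverse: "q [^] (k::nat) \<otimes> q [^] (k * (N - 1)) = \<one>"
proof -
  have "k + k * (N - 1) = N * k" using N_ge_2 by (cases N) auto
  then have "q [^] k \<otimes> q [^] (k * (N - 1)) = (q [^] N) [^] k"
    by (simp only: nat_pow_mult[OF q_closed] nat_pow_pow[OF q_closed])
  then show ?thesis by (simp add: q_pow_N)
qed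

lemma q_int_neg: "n < 0 \<Longrightarrow> q [^] (n::int) = q [^] (nat (- n) * (N - 1))"
proof -
  assume "n < 0"
  then have "q [^] n = inv (q [^] nat (- n))" by (simp only: int_pow_def2 if_True)
  also have "\<dots> = q [^] (nat (- n) * (N - 1))"
    by (rule comm_inv_char) (simp_all only: q_power_inverse nat_pow_closed q_closed)
  finally show ?thesis .
qed

lemma q_int_nonneg: "0 \<le> n \<Longrightarrow> q [^] (n::int) = q [^] nat n"
  by (simp only: int_pow_def2 not_less[symmetric] if_False)

lemma q_int_closed [simp]: "q [^] (n::int) \<in> carrier R"
  by (cases "n < 0") (simp_all only: q_int_neg q_int_nonneg not_less nat_pow_closed[OF q_closed])

lemma q_int_Suc: "q [^] (n + 1 :: int) = q [^] n \<otimes> q"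
proof (cases "n < 0")
  case False
  then have "nat (n + 1) = Suc (nat n)" by simp
  then show ?thesis using False by (simp only: q_int_nonneg not_less nat_pow_Suc)
next
  case True
  define k where "k = nat (- n - 1)"
  have n: "nat (- n) = Suc k" using True by (simp add: k_def)
  have "q [^] (n + 1) = q [^] (k * (N - 1))"
  proof (cases "n = -1")
    case False
    then have "nat (- (n + 1)) = k" using True by (simp add: k_def)
    then show ?thesis using q_int_neg[of "n + 1"] True False by simp
  qed (simp add: k_def)
  moreover have "q [^] n = q [^] (k * (N - 1)) \<otimes> q [^] (N - 1)"
    using True n by (simp add: q_int_neg nat_pow_mult add.commute)
  moreover have "q [^] (N - 1) \<otimes> q = \<one>"
    using q_pow_N N_ge_2 nat_pow_mult[OF q_closed, of "N - 1" 1] by simp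
  ultimately show ?thesis by (simp add: m_assoc)
qed

lemma q_int_unit: "q [^] (- n) \<otimes> q [^] n = \<one>" for n :: int
proof -
  have *: "q [^] (- int k) \<otimes> q [^] int k = \<one>" for k
  proof (induction k)
    case (Suc k)
    have "q [^] (- int k) = q [^] (- int (Suc k)) \<otimes> q" using q_int_Suc[of "- int (Suc k)"] by simp
    moreover have "q [^] int (Suc k) = q [^] int k \<otimes> q" using q_int_Suc[of "int k"] by (simp add: algebra_simps)
    ultimately show ?case using Suc by (simp add: m_ac)
  qed simp
  show ?thesis
  proof (cases "n \<ge> 0")
    case True
    then show ?thesis using *[of "nat n"] by simp
  next
    case False
    then show ?thesis using *[of "nat (- n)"] m_comm by simp
  qed
qed

text \<open>The unit \<open>(-1)\<^sup>j q\<^bsup>n + (n+1) + \<dots> + (n+j-1)\<^esup>\<close> that accompanies the \<open>j\<close>-th term of the q-Leibniz formula in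
  \<open>qHom_dpow_expand\<close>.\<close>

primrec leibniz :: "nat \<Rightarrow> int \<Rightarrow> 'r" where
  "leibniz 0 n = \<one>"
| "leibniz (Suc j) n = (\<ominus> (q [^] n)) \<otimes> leibniz j (n + 1)"

lemma leibniz_closed [simp]: "leibniz j n \<in> carrier R"
  by (induction j arbitrary: n) auto

text \<open>Both sides are \<open>(-1)\<^sup>j\<close> times a power of \<open>q\<close>, and the exponents agree because each of the \<open>j\<close> factors
  contributes one more \<open>q\<close> on the right.\<close>

lemma leibniz_shift: "q [^] j \<otimes> leibniz j n = leibniz j (n + 1)"
proof (induction j arbitrary: n)
  case (Suc j)
  have "q [^] Suc j \<otimes> leibniz (Suc j) n = (\<ominus> (q [^] n \<otimes> q)) \<otimes> (q [^] j \<otimes> leibniz j (n + 1))"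
    by (simp add: m_ac l_minus r_minus)
  then show ?case using Suc q_int_Suc by simp
qed simp

lemma binom_closed [simp]: "q_binomial R q n k \<in> carrier R"
  by (induction n arbitrary: k) (auto split: nat.split)

lemma binom_0 [simp]: "q_binomial R q n 0 = \<one>"
  by (cases n) auto

lemma binom_gt: "n < k \<Longrightarrow> q_binomial R q n k = \<zero>"
  by (induction n arbitrary: k) (auto split: nat.split)

lemma binom_N: "0 < k \<Longrightarrow> k < N \<Longrightarrow> q_binomial R q N k = \<zero>"
  using prim by (simp add: primitive_root_of_unity_def)

abbreviation qHom :: "('r, 'x) ncomplex \<Rightarrow> ('r, 'y) ncomplex \<Rightarrow> ('r, int \<Rightarrow> 'x \<Rightarrow> 'y) ncomplex" where
  "qHom \<equiv> q_Hom R q"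

lemma qHom_carrier:
  "f \<in> elts (qHom X Y) n \<longleftrightarrow>
    (\<forall>i. f i \<in> mhom R (obj X i) (obj Y (i + n)) \<and> f i \<in> extensional (elts X i))"
  by (auto simp: q_Hom_def)

lemma qHom_mhom:
  "f \<in> elts (qHom X Y) n \<Longrightarrow> m = i + n \<Longrightarrow> f i \<in> mhom R (obj X i) (obj Y m)"
  by (simp add: qHom_carrier)

lemma qHom_closed:
  "f \<in> elts (qHom X Y) n \<Longrightarrow> x \<in> elts X i \<Longrightarrow> m = i + n \<Longrightarrow> f i x \<in> elts Y m"
  by (rule mhom_closed[OF qHom_mhom])

lemma qHom_apply:
  assumes "x \<in> elts X i" "m = i + n"
  shows "\<zero>\<^bsub>obj (qHom X Y) n\<^esub> i x = \<zero>\<^bsub>obj Y m\<^esub>"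
    "(f \<oplus>\<^bsub>obj (qHom X Y) n\<^esub> g) i x = f i x \<oplus>\<^bsub>obj Y m\<^esub> g i x"
    "(r \<odot>\<^bsub>obj (qHom X Y) n\<^esub> f) i x = r \<odot>\<^bsub>obj Y m\<^esub> f i x"
  using assms by (simp_all add: q_Hom_def)

lemma qHom_dif_apply:
  assumes "x \<in> elts X i" "m = i + n + 1"
  shows "dif (qHom X Y) n f i x =
     dif Y (i + n) (f i x) \<ominus>\<^bsub>obj Y m\<^esub> (q [^] n \<odot>\<^bsub>obj Y m\<^esub> f (i + 1) (dif X i x))"
  using assms by (simp add: q_Hom_def)

lemma qHom_eqI:
  assumes "f \<in> elts (qHom X Y) n" "g \<in> elts (qHom X Y) n"
    and "\<And>i x. x \<in> elts X i \<Longrightarrow> f i x = g i x"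
  shows "f = g"
proof
  fix i show "f i = g i"
    by (rule extensionalityI[of _ "elts X i"]) (use assms in \<open>auto simp: qHom_carrier\<close>)
qed

lemma qHom_restrict:
  assumes "\<And>i. module R (obj X i)" "\<And>i. F i \<in> mhom R (obj X i) (obj Y (i + n))"
  shows "(\<lambda>i. restrict (F i) (elts X i)) \<in> elts (qHom X Y) n"
  unfolding qHom_carrier using mhom_cong[OF assms(2,1)] by auto

lemma qHom_ops:
  "\<zero>\<^bsub>obj (qHom X Y) n\<^esub> = (\<lambda>i. restrict (\<lambda>x. \<zero>\<^bsub>obj Y (i + n)\<^esub>) (elts X i))"
  "f \<oplus>\<^bsub>obj (qHom X Y) n\<^esub> g = (\<lambda>i. restrict (\<lambda>x. f i x \<oplus>\<^bsub>obj Y (i + n)\<^esub> g i x) (elts X i))"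
  "r \<odot>\<^bsub>obj (qHom X Y) n\<^esub> f = (\<lambda>i. restrict (\<lambda>x. r \<odot>\<^bsub>obj Y (i + n)\<^esub> f i x) (elts X i))"
  "dif (qHom X Y) n f = (\<lambda>i. restrict (\<lambda>x. dif Y (i + n) (f i x) \<ominus>\<^bsub>obj Y (i + n + 1)\<^esub>
      (q [^] n \<odot>\<^bsub>obj Y (i + n + 1)\<^esub> f (i + 1) (dif X i x))) (elts X i))"
  by (simp_all add: q_Hom_def)

context
  fixes X :: "('r, 'x) ncomplex" and Y :: "('r, 'y) ncomplex"
  assumes X: "n_complex R N X" and Y: "n_complex R N Y"
begin

lemma qHom_closures:
  "\<zero>\<^bsub>obj (qHom X Y) n\<^esub> \<in> elts (qHom X Y) n"
  "f \<in> elts (qHom X Y) n \<Longrightarrow> g \<in> elts (qHom X Y) n \<Longrightarrow>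
     f \<oplus>\<^bsub>obj (qHom X Y) n\<^esub> g \<in> elts (qHom X Y) n"
  "r \<in> carrier R \<Longrightarrow> f \<in> elts (qHom X Y) n \<Longrightarrow>
     r \<odot>\<^bsub>obj (qHom X Y) n\<^esub> f \<in> elts (qHom X Y) n"
proof -
  show "\<zero>\<^bsub>obj (qHom X Y) n\<^esub> \<in> elts (qHom X Y) n"
    unfolding qHom_ops by (rule qHom_restrict) (use X Y in \<open>auto intro: mhom_const_zero\<close>)
  assume f: "f \<in> elts (qHom X Y) n"
  show "f \<oplus>\<^bsub>obj (qHom X Y) n\<^esub> g \<in> elts (qHom X Y) n" if g: "g \<in> elts (qHom X Y) n"
    unfolding qHom_ops
    by (rule qHom_restrict, use X in simp, rule mhom_plus[OF qHom_mhom[OF f refl] qHom_mhom[OF g refl]]) (use Y in simp)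
  show "r \<odot>\<^bsub>obj (qHom X Y) n\<^esub> f \<in> elts (qHom X Y) n" if r: "r \<in> carrier R"
    unfolding qHom_ops
    by (rule qHom_restrict, use X in simp, rule mhom_scale[OF qHom_mhom[OF f refl] r]) (use Y in simp)
qed

lemma qHom_dif_closed:
  assumes f: "f \<in> elts (qHom X Y) n"
  shows "dif (qHom X Y) n f \<in> elts (qHom X Y) (n + 1)"
  unfolding qHom_ops
proof (rule qHom_restrict)
  fix i
  have e: "i + n + 1 = i + (n + 1)" by simp
  show "(\<lambda>x. dif Y (i + n) (f i x) \<ominus>\<^bsub>obj Y (i + n + 1)\<^esub> q [^] n \<odot>\<^bsub>obj Y (i + n + 1)\<^esub> f (i + 1) (dif X i x))
    \<in> mhom R (obj X i) (obj Y (i + (n + 1)))"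
    unfolding e
    by (intro mhom_minus mhom_scale mhom_comp[OF qHom_mhom[OF f refl] cpx_dif[OF Y]] mhom_comp[OF cpx_dif[OF X] qHom_mhom[OF f]])
      (use Y in auto)
qed (use X in simp)

lemma qHom_module: "module R (obj (qHom X Y) n)"
proof (rule module_by_zero_neg)
  let ?Q = "obj (qHom X Y) n"
  note c = qHom_closures
  note a = qHom_apply[OF _ refl]
  fix f assume f: "f \<in> carrier ?Q"
  note fc = qHom_closed[OF f _ refl]
  show "\<zero>\<^bsub>?Q\<^esub> \<oplus>\<^bsub>?Q\<^esub> f = f" "\<one> \<odot>\<^bsub>?Q\<^esub> f = f" "\<zero> \<odot>\<^bsub>?Q\<^esub> f = \<zero>\<^bsub>?Q\<^esub>"
    using f Y by (auto intro!: qHom_eqI c simp: a fc)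
  fix r s assume r: "r \<in> carrier R" and s: "s \<in> carrier R"
  show "(r \<oplus> s) \<odot>\<^bsub>?Q\<^esub> f = r \<odot>\<^bsub>?Q\<^esub> f \<oplus>\<^bsub>?Q\<^esub> s \<odot>\<^bsub>?Q\<^esub> f"
    "(r \<otimes> s) \<odot>\<^bsub>?Q\<^esub> f = r \<odot>\<^bsub>?Q\<^esub> (s \<odot>\<^bsub>?Q\<^esub> f)"
    using f Y r s by (auto intro!: qHom_eqI c simp: a fc mod_add_smult mod_mult_smult)
next
  let ?Q = "obj (qHom X Y) n"
  note c = qHom_closures
  note a = qHom_apply[OF _ refl]
  fix f g assume f: "f \<in> carrier ?Q" and g: "g \<in> carrier ?Q"
  note fc = qHom_closed[OF f _ refl] qHom_closed[OF g _ refl]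
  show "f \<oplus>\<^bsub>?Q\<^esub> g = g \<oplus>\<^bsub>?Q\<^esub> f"
    using f g Y by (auto intro!: qHom_eqI c simp: a fc mod_comm)
  show "r \<odot>\<^bsub>?Q\<^esub> (f \<oplus>\<^bsub>?Q\<^esub> g) = r \<odot>\<^bsub>?Q\<^esub> f \<oplus>\<^bsub>?Q\<^esub> r \<odot>\<^bsub>?Q\<^esub> g" if r: "r \<in> carrier R" for r
    using f g Y r by (auto intro!: qHom_eqI c simp: a fc mod_smult_add)
  fix h assume h: "h \<in> carrier ?Q"
  show "f \<oplus>\<^bsub>?Q\<^esub> g \<oplus>\<^bsub>?Q\<^esub> h = f \<oplus>\<^bsub>?Q\<^esub> (g \<oplus>\<^bsub>?Q\<^esub> h)"
    using f g h Y by (auto intro!: qHom_eqI c simp: a fc qHom_closed[OF h _ refl] mod_assoc)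
qed (use qHom_closures in auto)

lemma qHom_dif_mhom: "dif (qHom X Y) n \<in> mhom R (obj (qHom X Y) n) (obj (qHom X Y) (n + 1))"
proof (rule mhomI)
  fix f assume f: "f \<in> elts (qHom X Y) n"
  show "dif (qHom X Y) n f \<in> elts (qHom X Y) (n + 1)" by (rule qHom_dif_closed[OF f])
  note a = qHom_apply[OF _ refl]
  {
    fix g assume g: "g \<in> elts (qHom X Y) n"
    show "dif (qHom X Y) n (f \<oplus>\<^bsub>obj (qHom X Y) n\<^esub> g) =
        dif (qHom X Y) n f \<oplus>\<^bsub>obj (qHom X Y) (n + 1)\<^esub> dif (qHom X Y) n g"
    proof (rule qHom_eqI)
      fix i x assume x: "x \<in> elts X i"
      have dx: "dif X i x \<in> elts X (i + 1)" by (rule dif_closed[OF X x refl])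
      let ?M = "obj Y (i + n + 1)"
      have c: "f i x \<in> elts Y (i + n)" "g i x \<in> elts Y (i + n)"
        "f (i + 1) (dif X i x) \<in> carrier ?M" "g (i + 1) (dif X i x) \<in> carrier ?M"
        using qHom_closed[OF f x] qHom_closed[OF g x] qHom_closed[OF f dx, of "i + n + 1"] qHom_closed[OF g dx, of "i + n + 1"] by auto
      have d: "dif Y (i + n) (f i x) \<in> carrier ?M" "dif Y (i + n) (g i x) \<in> carrier ?M"
        using dif_closed[OF Y c(1)] dif_closed[OF Y c(2)] by auto
      have sum: "(dif (qHom X Y) n f \<oplus>\<^bsub>obj (qHom X Y) (n + 1)\<^esub> dif (qHom X Y) n g) i x =
          dif (qHom X Y) n f i x \<oplus>\<^bsub>?M\<^esub> dif (qHom X Y) n g i x"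
        by (rule qHom_apply(2)[OF x]) simp
      show "dif (qHom X Y) n (f \<oplus>\<^bsub>obj (qHom X Y) n\<^esub> g) i x =
          (dif (qHom X Y) n f \<oplus>\<^bsub>obj (qHom X Y) (n + 1)\<^esub> dif (qHom X Y) n g) i x"
        unfolding sum using c d Y
        by (simp add: qHom_dif_apply[OF x refl] qHom_apply(2)[OF x refl]
            qHom_apply(2)[OF dx, of "i + n + 1" n]
            mhom_add[OF cpx_dif[OF Y refl]] mod_smult_add mod_diff_eq mod_neg_add mod_ac)
    qed (use f g in \<open>auto intro!: qHom_dif_closed qHom_closures\<close>)
  }
  fix r assume r: "r \<in> carrier R"
  show "dif (qHom X Y) n (r \<odot>\<^bsub>obj (qHom X Y) n\<^esub> f) = r \<odot>\<^bsub>obj (qHom X Y) (n + 1)\<^esub> dif (qHom X Y) n f"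
  proof (rule qHom_eqI)
    fix i x assume x: "x \<in> elts X i"
    have dx: "dif X i x \<in> elts X (i + 1)" by (rule dif_closed[OF X x refl])
    let ?M = "obj Y (i + n + 1)"
    have c: "f i x \<in> elts Y (i + n)" "f (i + 1) (dif X i x) \<in> carrier ?M"
      using qHom_closed[OF f x] qHom_closed[OF f dx, of "i + n + 1"] by auto
    have d: "dif Y (i + n) (f i x) \<in> carrier ?M" using dif_closed[OF Y c(1)] by auto
    have scale: "(r \<odot>\<^bsub>obj (qHom X Y) (n + 1)\<^esub> dif (qHom X Y) n f) i x = r \<odot>\<^bsub>?M\<^esub> dif (qHom X Y) n f i x"
      by (rule qHom_apply(3)[OF x]) simp
    show "dif (qHom X Y) n (r \<odot>\<^bsub>obj (qHom X Y) n\<^esub> f) i x =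
        (r \<odot>\<^bsub>obj (qHom X Y) (n + 1)\<^esub> dif (qHom X Y) n f) i x"
      unfolding scale using c d Y r
      by (simp add: qHom_dif_apply[OF x refl] qHom_apply(3)[OF x refl]
          qHom_apply(3)[OF dx, of "i + n + 1" n]
          mhom_smult[OF cpx_dif[OF Y refl]] mod_smult_diff mod_smult_comm[of ?M "q [^] n" r])
  qed (use f r in \<open>auto intro!: qHom_dif_closed qHom_closures\<close>)
qed

lemma qHom_dpow_closed:
  assumes f: "f \<in> elts (qHom X Y) n"
  shows "dpow (qHom X Y) n k f \<in> elts (qHom X Y) (n + int k)"
proof (induction k)
  case (Suc k)
  have e: "n + int (Suc k) = n + int k + 1" by simp
  show ?case unfolding e dpow.simps by (rule qHom_dif_closed[OF Suc.IH])
qed (use f in simp)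

text \<open>The index shift in the induction step of the q-Leibniz formula. When one more differential is applied to the
  \<open>j\<close>-th term, \<open>A j\<close> is the part in which it falls on the target and \<open>B j\<close> the part in which it falls on the
  source, and \<open>C\<close> sorts these parts by the number of differentials on the source.\<close>

lemma shifted_sum:
  fixes M (structure)
  assumes M: "module R M"
    and A: "\<And>j. A j \<in> carrier M" and B: "\<And>j. B j \<in> carrier M" and AS: "A (Suc k) = \<zero>\<^bsub>M\<^esub>"
    and C0: "C 0 = A 0" and CS: "\<And>j. C (Suc j) = B j \<oplus>\<^bsub>M\<^esub> A (Suc j)"
  shows "(\<Oplus>\<^bsub>M\<^esub>j\<in>{..Suc k}. C j) = (\<Oplus>\<^bsub>M\<^esub>j\<in>{..k}. A j \<oplus>\<^bsub>M\<^esub> B j)"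
proof -
  interpret M: abelian_group M using M by (rule mod_abelian)
  have C: "C j \<in> carrier M" for j using C0 CS A B by (cases j) auto
  have "(\<Oplus>\<^bsub>M\<^esub>j\<in>{..Suc k}. C j) = (\<Oplus>\<^bsub>M\<^esub>j\<in>{..k}. C (Suc j)) \<oplus>\<^bsub>M\<^esub> C 0"
    using C by (intro M.finsum_Suc2) auto
  also have "(\<Oplus>\<^bsub>M\<^esub>j\<in>{..k}. C (Suc j)) = (\<Oplus>\<^bsub>M\<^esub>j\<in>{..k}. B j) \<oplus>\<^bsub>M\<^esub> (\<Oplus>\<^bsub>M\<^esub>j\<in>{..k}. A (Suc j))"
    unfolding CS using A B by (intro M.finsum_addf) auto
  also have "\<dots> \<oplus>\<^bsub>M\<^esub> C 0 = (\<Oplus>\<^bsub>M\<^esub>j\<in>{..k}. B j) \<oplus>\<^bsub>M\<^esub> ((\<Oplus>\<^bsub>M\<^esub>j\<in>{..k}. A (Suc j)) \<oplus>\<^bsub>M\<^esub> A 0)"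
    unfolding C0 using A B by (intro M.a_assoc M.finsum_closed) auto
  also have "(\<Oplus>\<^bsub>M\<^esub>j\<in>{..k}. A (Suc j)) \<oplus>\<^bsub>M\<^esub> A 0 = (\<Oplus>\<^bsub>M\<^esub>j\<in>{..Suc k}. A j)"
    using A by (intro M.finsum_Suc2[symmetric]) auto
  also have "\<dots> = (\<Oplus>\<^bsub>M\<^esub>j\<in>{..k}. A j)"
    using A AS by (subst M.finsum_Suc) auto
  also have "(\<Oplus>\<^bsub>M\<^esub>j\<in>{..k}. B j) \<oplus>\<^bsub>M\<^esub> \<dots> = (\<Oplus>\<^bsub>M\<^esub>j\<in>{..k}. A j) \<oplus>\<^bsub>M\<^esub> (\<Oplus>\<^bsub>M\<^esub>j\<in>{..k}. B j)"
    using A B by (intro M.a_comm M.finsum_closed) auto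
  also have "\<dots> = (\<Oplus>\<^bsub>M\<^esub>j\<in>{..k}. A j \<oplus>\<^bsub>M\<^esub> B j)"
    using A B by (intro M.finsum_addf[symmetric]) auto
  finally show ?thesis .
qed

text \<open>The q-Leibniz formula for the powers of the differential of the q-Hom complex. The Gaussian binomial
  coefficients arise from Pascal's rule exactly as in the noncommutative binomial theorem, since the two
  parts of the differential commute up to the factor \<open>q\<close>.\<close>

lemma qHom_dpow_expand:
  assumes "f \<in> elts (qHom X Y) n" and x: "x \<in> elts X i" and m: "m = i + n + int k"
  shows "dpow (qHom X Y) n k f i x = (\<Oplus>\<^bsub>obj Y m\<^esub> j\<in>{..k}. (leibniz j n \<otimes> q_binomial R q k j) \<odot>\<^bsub>obj Y m\<^esub>
     dpow Y (i + int j + n) (k - j) (f (i + int j) (dpow X i j x)))"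
  using assms(1) m
proof (induction k arbitrary: f n)
  case 0
  interpret M: abelian_group "obj Y m" using Y by (intro mod_abelian) simp
  have "f i x \<in> elts Y m" by (rule qHom_closed[OF 0(1) x]) (use 0 in simp)
  then show ?case using 0 Y by (subst M.finsum_0) (auto simp: Pi_def)
next
  case (Suc k)
  let ?M = "obj Y m" and ?f = "dif (qHom X Y) n f"
  interpret M: abelian_group ?M using Y by (intro mod_abelian) simp
  have M: "module R ?M" using Y by simp
  have df: "?f \<in> elts (qHom X Y) (n + 1)" by (rule qHom_dif_closed[OF Suc.prems(1)])
  define T where "T j = (if j \<le> Suc k then dpow Y (i + int j + n) (Suc k - j) (f (i + int j) (dpow X i j x)) else \<zero>\<^bsub>?M\<^esub>)" for j
  have dX: "dpow X i j x \<in> elts X (i + int j)" for j by (rule dpow_closed[OF X x refl])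
  have fX: "f (i + int j) (dpow X i j x) \<in> elts Y (i + int j + n)" for j
    by (rule qHom_closed[OF Suc.prems(1) dX refl])
  have T: "T j \<in> carrier ?M" for j
  proof (cases "j \<le> Suc k")
    case True
    then have "m = i + int j + n + int (Suc k - j)" using Suc.prems(2) by (simp add: of_nat_diff)
    then show ?thesis unfolding T_def if_P[OF True] by (rule dpow_closed[OF Y fX])
  qed (use M in \<open>simp add: T_def\<close>)
  define A where "A j = (leibniz j (n + 1) \<otimes> q_binomial R q k j) \<odot>\<^bsub>?M\<^esub> T j" for j
  define B where "B j = (leibniz (Suc j) n \<otimes> q_binomial R q k j) \<odot>\<^bsub>?M\<^esub> T (Suc j)" for j
  have AB: "A j \<in> carrier ?M" "B j \<in> carrier ?M" for j unfolding A_def B_def using T M by simp_all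
  have summand: "(leibniz j (n + 1) \<otimes> q_binomial R q k j) \<odot>\<^bsub>?M\<^esub>
       dpow Y (i + int j + (n + 1)) (k - j) (?f (i + int j) (dpow X i j x)) = A j \<oplus>\<^bsub>?M\<^esub> B j" if j: "j \<le> k" for j
  proof -
    let ?y = "f (i + int j) (dpow X i j x)" and ?y' = "f (i + int j + 1) (dif X (i + int j) (dpow X i j x))"
    let ?L = "obj Y (i + int j + n + 1)"
    have y': "?y' \<in> carrier ?L" using fX[of "Suc j"] by (simp add: algebra_simps)
    have dy: "dif Y (i + int j + n) ?y \<in> carrier ?L" by (rule dif_closed[OF Y fX refl])
    have e: "i + int j + (n + 1) = i + int j + n + 1" by simp
    have mm: "m = i + int j + n + 1 + int (k - j)" using Suc.prems j by (simp add: of_nat_diff)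
    have "?f (i + int j) (dpow X i j x) = dif Y (i + int j + n) ?y \<ominus>\<^bsub>?L\<^esub> (q [^] n \<odot>\<^bsub>?L\<^esub> ?y')"
      by (rule qHom_dif_apply[OF dX refl])
    then have "dpow Y (i + int j + (n + 1)) (k - j) (?f (i + int j) (dpow X i j x)) =
        dpow Y (i + int j + n + 1) (k - j) (dif Y (i + int j + n) ?y) \<ominus>\<^bsub>?M\<^esub>
        (q [^] n \<odot>\<^bsub>?M\<^esub> dpow Y (i + int j + n + 1) (k - j) ?y')"
      unfolding e using Y y' dy by (simp add: dpow_diff[OF Y mm] dpow_smult[OF Y mm])
    also have "dpow Y (i + int j + n + 1) (k - j) (dif Y (i + int j + n) ?y) = T j"
      using j dpow_Suc_shift[of Y "i + int j + n" "k - j" ?y] by (simp add: T_def Suc_diff_le del: dpow.simps)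
    also have "dpow Y (i + int j + n + 1) (k - j) ?y' = T (Suc j)"
      using j by (simp add: T_def algebra_simps)
    finally show ?thesis
      using T[of j] T[of "Suc j"] M unfolding A_def B_def
      by (simp add: mod_diff_eq mod_smult_add mod_smult_neg mod_mult_smult[symmetric] mod_neg_smult[symmetric]
          l_minus r_minus m_ac)
  qed
  have "dpow (qHom X Y) n (Suc k) f i x = dpow (qHom X Y) (n + 1) k ?f i x"
    by (simp only: dpow_Suc_shift)
  also have "\<dots> = (\<Oplus>\<^bsub>?M\<^esub> j\<in>{..k}. (leibniz j (n + 1) \<otimes> q_binomial R q k j) \<odot>\<^bsub>?M\<^esub>
     dpow Y (i + int j + (n + 1)) (k - j) (?f (i + int j) (dpow X i j x)))"
    using Suc.prems by (intro Suc.IH[OF df]) simp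
  also have "\<dots> = (\<Oplus>\<^bsub>?M\<^esub> j\<in>{..k}. A j \<oplus>\<^bsub>?M\<^esub> B j)"
    using AB summand by (intro M.finsum_cong') auto
  also have "\<dots> = (\<Oplus>\<^bsub>?M\<^esub> j\<in>{..Suc k}. (leibniz j n \<otimes> q_binomial R q (Suc k) j) \<odot>\<^bsub>?M\<^esub> T j)"
  proof (rule shifted_sum[OF M AB, symmetric])
    show "A (Suc k) = \<zero>\<^bsub>?M\<^esub>" using T M by (simp add: A_def binom_gt)
    show "(leibniz 0 n \<otimes> q_binomial R q (Suc k) 0) \<odot>\<^bsub>?M\<^esub> T 0 = A 0" by (simp add: A_def)
    fix j
    have "leibniz (Suc j) n \<otimes> q_binomial R q (Suc k) (Suc j) =
      leibniz (Suc j) n \<otimes> q_binomial R q k j \<oplus> (q [^] Suc j \<otimes> leibniz (Suc j) n) \<otimes> q_binomial R q k (Suc j)"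
      by (simp add: r_distr m_ac del: leibniz.simps)
    also have "q [^] Suc j \<otimes> leibniz (Suc j) n = leibniz (Suc j) (n + 1)" by (rule leibniz_shift)
    finally show "(leibniz (Suc j) n \<otimes> q_binomial R q (Suc k) (Suc j)) \<odot>\<^bsub>?M\<^esub> T (Suc j) = B j \<oplus>\<^bsub>?M\<^esub> A (Suc j)"
      using T M by (simp add: A_def B_def mod_add_smult del: leibniz.simps)
  qed
  also have "\<dots> = (\<Oplus>\<^bsub>?M\<^esub> j\<in>{..Suc k}. (leibniz j n \<otimes> q_binomial R q (Suc k) j) \<odot>\<^bsub>?M\<^esub>
     dpow Y (i + int j + n) (Suc k - j) (f (i + int j) (dpow X i j x)))"
  proof (rule M.finsum_cong')
    show "(\<lambda>j. (leibniz j n \<otimes> q_binomial R q (Suc k) j) \<odot>\<^bsub>?M\<^esub>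
     dpow Y (i + int j + n) (Suc k - j) (f (i + int j) (dpow X i j x))) \<in> {..Suc k} \<rightarrow> carrier ?M"
    proof (rule Pi_I)
      fix j assume "j \<in> {..Suc k}"
      then have "dpow Y (i + int j + n) (Suc k - j) (f (i + int j) (dpow X i j x)) = T j"
        by (simp add: T_def)
      then show "(leibniz j n \<otimes> q_binomial R q (Suc k) j) \<odot>\<^bsub>?M\<^esub>
          dpow Y (i + int j + n) (Suc k - j) (f (i + int j) (dpow X i j x)) \<in> carrier ?M"
        using mod_smult[OF M m_closed[OF leibniz_closed binom_closed] T[of j]] by (simp only:)
    qed
  qed (auto simp: T_def)
  finally show ?case .
qed

text \<open>In the q-Leibniz formula for the \<open>N\<close>-th power, the two outer terms vanish because \<open>X\<close> and \<open>Y\<close> are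
  \<open>N\<close>-complexes, and the others because their Gaussian binomial coefficients vanish at \<open>q\<close>.\<close>

theorem qHom_n_complex: "n_complex R N (qHom X Y)"
  unfolding n_complex_def
proof (intro allI conjI ballI)
  fix n f
  show "module R (obj (qHom X Y) n)" by (rule qHom_module)
  show "dif (qHom X Y) n \<in> mhom R (obj (qHom X Y) n) (obj (qHom X Y) (n + 1))" by (rule qHom_dif_mhom)
  assume f: "f \<in> elts (qHom X Y) n"
  show "dpow (qHom X Y) n N f = \<zero>\<^bsub>obj (qHom X Y) (n + int N)\<^esub>"
  proof (rule qHom_eqI[OF qHom_dpow_closed[OF f] qHom_closures(1)])
    fix i x assume x: "x \<in> elts X i"
    let ?m = "i + n + int N"
    let ?M = "obj Y ?m"
    interpret M: abelian_group ?M using Y by (intro mod_abelian) simp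
    have M: "module R ?M" using Y by simp
    have dX: "dpow X i j x \<in> elts X (i + int j)" for j by (rule dpow_closed[OF X x refl])
    have fX: "f (i + int j) (dpow X i j x) \<in> elts Y (i + int j + n)" for j
      by (rule qHom_closed[OF f dX refl])
    have z: "(leibniz j n \<otimes> q_binomial R q N j) \<odot>\<^bsub>?M\<^esub> dpow Y (i + int j + n) (N - j) (f (i + int j) (dpow X i j x)) = \<zero>\<^bsub>?M\<^esub>"
      if j: "j \<le> N" for j
    proof -
      have c: "dpow Y (i + int j + n) (N - j) (f (i + int j) (dpow X i j x)) \<in> carrier ?M"
        using j by (intro dpow_closed[OF Y fX]) (simp add: of_nat_diff)
      consider "j = 0" | "0 < j" "j < N" | "j = N" using j by linarith
      then show ?thesis
      proof cases
        case 1
        then show ?thesis using Y M fX[of 0] dpow_ge_N[OF Y order_refl fX, of ?m 0] by simp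
      next
        case 2
        then show ?thesis using M c by (simp add: binom_N)
      next
        case 3
        have "dpow X i j x = \<zero>\<^bsub>obj X (i + int j)\<^esub>" using 3 X x by (intro dpow_ge_N) auto
        then have "f (i + int j) (dpow X i j x) = \<zero>\<^bsub>obj Y (i + int j + n)\<^esub>"
          using X Y mhom_zero[OF qHom_mhom[OF f refl]] by simp
        then show ?thesis using 3 M by (simp add: ac_simps)
      qed
    qed
    have "dpow (qHom X Y) n N f i x = (\<Oplus>\<^bsub>?M\<^esub> j\<in>{..N}. \<zero>\<^bsub>?M\<^esub>)"
      unfolding qHom_dpow_expand[OF f x refl] using z by (intro M.finsum_cong') auto
    also have "\<dots> = \<zero>\<^bsub>?M\<^esub>" by (rule M.finsum_zero)
    also have "\<dots> = \<zero>\<^bsub>obj (qHom X Y) (n + int N)\<^esub> i x"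
      by (subst qHom_apply(1)[OF x, of ?m]) simp_all
    finally show "dpow (qHom X Y) n N f i x = \<zero>\<^bsub>obj (qHom X Y) (n + int N)\<^esub> i x" .
  qed
qed

lemma qHom_diff_apply:
  assumes f: "f \<in> elts (qHom X Y) n" and g: "g \<in> elts (qHom X Y) n"
    and x: "x \<in> elts X i" and m: "m = i + n"
  shows "(f \<ominus>\<^bsub>obj (qHom X Y) n\<^esub> g) i x = f i x \<ominus>\<^bsub>obj Y m\<^esub> g i x"
proof -
  let ?Q = "obj (qHom X Y) n"
  have Q: "module R ?Q" by (rule qHom_module)
  have d: "f \<ominus>\<^bsub>?Q\<^esub> g \<in> carrier ?Q" using Q f g by simp
  have "((f \<ominus>\<^bsub>?Q\<^esub> g) \<oplus>\<^bsub>?Q\<^esub> g) i x = f i x" using Q f g by simp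
  then show ?thesis
    using Y qHom_closed[OF f x m] qHom_closed[OF g x m] qHom_closed[OF d x m]
    by (simp add: qHom_apply(2)[OF x m] mod_eq_diff)
qed

text \<open>Only the term in which all differentials fall on \<open>X\<close> survives when the earlier values of \<open>f\<close> along the
  orbit of \<open>x\<close> vanish.\<close>

lemma qHom_dpow_leading:
  assumes "f \<in> elts (qHom X Y) n" and x: "x \<in> elts X i"
    and "\<And>j. j < k \<Longrightarrow> f (i + int j) (dpow X i j x) = \<zero>\<^bsub>obj Y (i + int j + n)\<^esub>"
    and m: "m = i + n + int k"
  shows "dpow (qHom X Y) n k f i x = leibniz k n \<odot>\<^bsub>obj Y m\<^esub> f (i + int k) (dpow X i k x)"
  using assms(1,3,4)
proof (induction k arbitrary: f n)
  case 0
  have "f i x \<in> elts Y m" by (rule qHom_closed[OF 0(1) x]) (use 0 in simp)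
  then show ?case using Y by simp
next
  case (Suc k)
  let ?M = "obj Y m" and ?f = "dif (qHom X Y) n f"
  have df: "?f \<in> elts (qHom X Y) (n + 1)" by (rule qHom_dif_closed[OF Suc.prems(1)])
  have dX: "dpow X i j x \<in> elts X (i + int j)" for j by (rule dpow_closed[OF X x refl])
  have fX: "f (i + int j) (dpow X i j x) \<in> elts Y (i + int j + n)" for j
    by (rule qHom_closed[OF Suc.prems(1) dX refl])
  have dfj: "?f (i + int j) (dpow X i j x) = \<ominus>\<^bsub>obj Y l\<^esub> (q [^] n \<odot>\<^bsub>obj Y l\<^esub> f (i + int (Suc j)) (dpow X i (Suc j) x))"
    if j: "j < Suc k" and l: "l = i + int j + n + 1" for j l
  proof -
    have "dif Y (i + int j + n) (f (i + int j) (dpow X i j x)) = \<zero>\<^bsub>obj Y l\<^esub>"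
      unfolding Suc.prems(2)[OF j] using Y l by (intro mhom_zero[OF cpx_dif[OF Y]]) auto
    moreover have "f (i + int (Suc j)) (dpow X i (Suc j) x) \<in> elts Y l"
      using fX[of "Suc j"] l by (simp add: algebra_simps del: dpow.simps)
    ultimately show ?thesis
      using qHom_dif_apply[OF dX l, of Y f] Y by (simp add: mod_diff_eq algebra_simps)
  qed
  have "dpow (qHom X Y) n (Suc k) f i x = dpow (qHom X Y) (n + 1) k ?f i x"
    by (simp only: dpow_Suc_shift)
  also have "\<dots> = leibniz k (n + 1) \<odot>\<^bsub>?M\<^esub> ?f (i + int k) (dpow X i k x)"
  proof (rule Suc.IH[OF df])
    fix j assume j: "j < k"
    have "?f (i + int j) (dpow X i j x) = \<ominus>\<^bsub>obj Y (i + int j + (n + 1))\<^esub> (q [^] n \<odot>\<^bsub>obj Y (i + int j + (n + 1))\<^esub>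
       f (i + int (Suc j)) (dpow X i (Suc j) x))" using j by (intro dfj) auto
    also have "f (i + int (Suc j)) (dpow X i (Suc j) x) = \<zero>\<^bsub>obj Y (i + int j + (n + 1))\<^esub>"
      using Suc.prems(2)[of "Suc j"] j by (simp add: algebra_simps)
    finally show "?f (i + int j) (dpow X i j x) = \<zero>\<^bsub>obj Y (i + int j + (n + 1))\<^esub>" using Y by simp
  qed (use Suc.prems in simp)
  also have "?f (i + int k) (dpow X i k x) = \<ominus>\<^bsub>?M\<^esub> (q [^] n \<odot>\<^bsub>?M\<^esub> f (i + int (Suc k)) (dpow X i (Suc k) x))"
    using Suc.prems by (intro dfj) auto
  also have "leibniz k (n + 1) \<odot>\<^bsub>?M\<^esub> \<dots> = leibniz (Suc k) n \<odot>\<^bsub>?M\<^esub> f (i + int (Suc k)) (dpow X i (Suc k) x)"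
  proof -
    have c: "f (i + int (Suc k)) (dpow X i (Suc k) x) \<in> carrier ?M"
      using fX[of "Suc k"] Suc.prems by (simp add: algebra_simps del: dpow.simps)
    show ?thesis using c Y by (simp add: mod_neg_smult[symmetric] mod_mult_smult[symmetric] m_comm del: dpow.simps)
  qed
  finally show ?case .
qed

end

end

section \<open>The suspension\<close>

context n_complexes
begin

text \<open>The weighted sum whose negative is the last entry of the differential of \<open>as\<close> in the suspension.\<close>

definition wsum :: "('r, 'x) ncomplex \<Rightarrow> int \<Rightarrow> 'x list \<Rightarrow> 'x" where
  "wsum K n as = (\<Oplus>\<^bsub>obj K (n + int N)\<^esub> j\<in>{..<N - 1}. dpow K (n + 1 + int j) (N - 1 - j) (as ! j))"

abbreviation susp :: "('r, 'x) ncomplex \<Rightarrow> ('r, 'x list) ncomplex" where "susp \<equiv> suspension N"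

lemma susp_carrier:
  "as \<in> elts (susp K) n \<longleftrightarrow> length as = N - 1 \<and> (\<forall>j<N - 1. as ! j \<in> elts K (n + 1 + int j))"
  by (simp add: suspension_def)

lemma susp_ops:
  "\<zero>\<^bsub>obj (susp K) n\<^esub> = map (\<lambda>j. \<zero>\<^bsub>obj K (n + 1 + int j)\<^esub>) [0..<N - 1]"
  "as \<oplus>\<^bsub>obj (susp K) n\<^esub> bs = map (\<lambda>j. as ! j \<oplus>\<^bsub>obj K (n + 1 + int j)\<^esub> bs ! j) [0..<N - 1]"
  "r \<odot>\<^bsub>obj (susp K) n\<^esub> as = map (\<lambda>j. r \<odot>\<^bsub>obj K (n + 1 + int j)\<^esub> as ! j) [0..<N - 1]"
  by (simp_all add: suspension_def)

lemma susp_nth [simp]: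
  assumes "j < N - 1"
  shows "\<zero>\<^bsub>obj (susp K) n\<^esub> ! j = \<zero>\<^bsub>obj K (n + 1 + int j)\<^esub>"
    "(as \<oplus>\<^bsub>obj (susp K) n\<^esub> bs) ! j = as ! j \<oplus>\<^bsub>obj K (n + 1 + int j)\<^esub> bs ! j"
    "(r \<odot>\<^bsub>obj (susp K) n\<^esub> as) ! j = r \<odot>\<^bsub>obj K (n + 1 + int j)\<^esub> as ! j"
  using assms by (simp_all add: susp_ops)

lemma susp_length [simp]:
  "length \<zero>\<^bsub>obj (susp K) n\<^esub> = N - 1" "length (as \<oplus>\<^bsub>obj (susp K) n\<^esub> bs) = N - 1"
  "length (r \<odot>\<^bsub>obj (susp K) n\<^esub> as) = N - 1"
  by (simp_all add: susp_ops)

lemma susp_eqI: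
  "as \<in> elts (susp K) n \<Longrightarrow> bs \<in> elts (susp K) n \<Longrightarrow> (\<And>j. j < N - 1 \<Longrightarrow> as ! j = bs ! j) \<Longrightarrow> as = bs"
  by (rule nth_equalityI) (auto simp: susp_carrier)

lemma susp_dif: "dif (susp K) n as = tl as @ [\<ominus>\<^bsub>obj K (n + int N)\<^esub> wsum K n as]"
  by (simp add: suspension_def wsum_def)

lemma susp_dif_length: "length as = N - 1 \<Longrightarrow> length (dif (susp K) n as) = N - 1"
  using N_ge_2 by (simp add: susp_dif)

lemma susp_dif_nth:
  assumes "length as = N - 1" "j < N - 1"
  shows "dif (susp K) n as ! j = (if j < N - 2 then as ! (Suc j) else \<ominus>\<^bsub>obj K (n + int N)\<^esub> wsum K n as)"
  using assms N_ge_2 by (auto simp: susp_dif nth_append nth_tl)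

context
  fixes K :: "('r, 'x) ncomplex"
  assumes K: "n_complex R N K"
begin

lemma susp_module: "module R (obj (susp K) n)"
proof (rule module_by_zero_neg)
qed (use K in \<open>auto simp: susp_carrier mod_ac mod_smult_add mod_add_smult mod_mult_smult intro!: nth_equalityI\<close>)

lemma wsum_term:
  assumes "as \<in> elts (susp K) n" "j < N - 1"
  shows "dpow K (n + 1 + int j) (N - 1 - j) (as ! j) \<in> elts K (n + int N)"
  using assms by (intro dpow_closed[OF K]) (auto simp: susp_carrier of_nat_diff)

lemma wsum_mhom: "wsum K n \<in> mhom R (obj (susp K) n) (obj K (n + int N))"
proof -
  let ?M = "obj K (n + int N)"
  have M: "module R ?M" using K by simp
  interpret M: abelian_group ?M using M by (rule mod_abelian)
  show ?thesis
  proof (rule mhomI)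
    fix as assume as: "as \<in> elts (susp K) n"
    show "wsum K n as \<in> carrier ?M" unfolding wsum_def using wsum_term[OF as] by (intro M.finsum_closed) auto
    {
      fix bs assume bs: "bs \<in> elts (susp K) n"
      have "wsum K n (as \<oplus>\<^bsub>obj (susp K) n\<^esub> bs) = (\<Oplus>\<^bsub>?M\<^esub> j\<in>{..<N - 1}.
          dpow K (n + 1 + int j) (N - 1 - j) (as ! j) \<oplus>\<^bsub>?M\<^esub> dpow K (n + 1 + int j) (N - 1 - j) (bs ! j))"
        unfolding wsum_def
        by (rule M.finsum_cong')
          (use as bs wsum_term[OF as] wsum_term[OF bs] M in \<open>auto simp: susp_carrier of_nat_diff intro!: dpow_add[OF K]\<close>)
      also have "\<dots> = wsum K n as \<oplus>\<^bsub>?M\<^esub> wsum K n bs"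
        unfolding wsum_def using wsum_term[OF as] wsum_term[OF bs] by (intro M.finsum_addf) auto
      finally show "wsum K n (as \<oplus>\<^bsub>obj (susp K) n\<^esub> bs) = wsum K n as \<oplus>\<^bsub>?M\<^esub> wsum K n bs" .
    }
    fix r assume r: "r \<in> carrier R"
    have "wsum K n (r \<odot>\<^bsub>obj (susp K) n\<^esub> as) = (\<Oplus>\<^bsub>?M\<^esub> j\<in>{..<N - 1}. r \<odot>\<^bsub>?M\<^esub> dpow K (n + 1 + int j) (N - 1 - j) (as ! j))"
      unfolding wsum_def
      by (rule M.finsum_cong')
        (use as wsum_term[OF as] M r in \<open>auto simp: susp_carrier of_nat_diff intro!: dpow_smult[OF K]\<close>)
    also have "\<dots> = r \<odot>\<^bsub>?M\<^esub> wsum K n as"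
      unfolding wsum_def using wsum_term[OF as] r by (intro module.finsum_smult_ldistr[OF M, symmetric]) auto
    finally show "wsum K n (r \<odot>\<^bsub>obj (susp K) n\<^esub> as) = r \<odot>\<^bsub>?M\<^esub> wsum K n as" .
  qed
qed

lemma susp_dif_closed:
  assumes as: "as \<in> elts (susp K) n"
  shows "dif (susp K) n as \<in> elts (susp K) (n + 1)"
  unfolding susp_carrier
proof (intro conjI allI impI)
  have l: "length as = N - 1" using as by (simp add: susp_carrier)
  then show "length (dif (susp K) n as) = N - 1" by (rule susp_dif_length)
  fix j assume j: "j < N - 1"
  show "dif (susp K) n as ! j \<in> elts K (n + 1 + 1 + int j)"
  proof (cases "j < N - 2")
    case True
    then have "Suc j < N - 1" by simp
    then have "as ! Suc j \<in> elts K (n + 1 + int (Suc j))" using as unfolding susp_carrier by blast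
    moreover have "n + 1 + int (Suc j) = n + 1 + 1 + int j" by simp
    ultimately have "as ! Suc j \<in> elts K (n + 1 + 1 + int j)" by (simp only:)
    then show ?thesis using True by (simp only: susp_dif_nth[OF l j] if_True)
  next
    case False
    then have "n + 1 + 1 + int j = n + int N" using j by linarith
    then show ?thesis
      using mod_neg[OF cpx_module[OF K] mhom_closed[OF wsum_mhom as]]
      by (simp only: susp_dif_nth[OF l j] if_not_P[OF False])
  qed
qed

lemma susp_dif_mhom: "dif (susp K) n \<in> mhom R (obj (susp K) n) (obj (susp K) (n + 1))"
proof (rule mhomI)
  fix as assume as: "as \<in> elts (susp K) n"
  note S = susp_module
  show das: "dif (susp K) n as \<in> elts (susp K) (n + 1)" by (rule susp_dif_closed[OF as])
  have e: "n + 1 + 1 + int j = n + int N" if "j < N - 1" "\<not> j < N - 2" for j using that by linarith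
  have e': "n + 1 + int (Suc j) = n + 1 + 1 + int j" for j by simp
  note w = mhom_closed[OF wsum_mhom as]
  {
    fix bs assume bs: "bs \<in> elts (susp K) n"
    show "dif (susp K) n (as \<oplus>\<^bsub>obj (susp K) n\<^esub> bs) = dif (susp K) n as \<oplus>\<^bsub>obj (susp K) (n + 1)\<^esub> dif (susp K) n bs"
    proof (rule susp_eqI)
      show "dif (susp K) n (as \<oplus>\<^bsub>obj (susp K) n\<^esub> bs) \<in> elts (susp K) (n + 1)"
        using as bs S by (intro susp_dif_closed) simp
      show "dif (susp K) n as \<oplus>\<^bsub>obj (susp K) (n + 1)\<^esub> dif (susp K) n bs \<in> elts (susp K) (n + 1)"
        using das susp_dif_closed[OF bs] S by simp
      fix j assume j: "j < N - 1"
      have l: "length as = N - 1" "length bs = N - 1" using as bs by (auto simp: susp_carrier)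
      show "dif (susp K) n (as \<oplus>\<^bsub>obj (susp K) n\<^esub> bs) ! j =
         (dif (susp K) n as \<oplus>\<^bsub>obj (susp K) (n + 1)\<^esub> dif (susp K) n bs) ! j"
      proof (cases "j < N - 2")
        case True
        then have "Suc j < N - 1" by simp
        then show ?thesis using True j l by (simp add: susp_dif_nth e' del: of_nat_Suc)
      next
        case False
        have "(dif (susp K) n as \<oplus>\<^bsub>obj (susp K) (n + 1)\<^esub> dif (susp K) n bs) ! j =
            dif (susp K) n as ! j \<oplus>\<^bsub>obj K (n + int N)\<^esub> dif (susp K) n bs ! j"
          using susp_nth(2)[OF j, where n = "n + 1" and K = K] unfolding e[OF j False] .
        then show ?thesis
          using False j l w mhom_closed[OF wsum_mhom bs] K mhom_add[OF wsum_mhom as bs]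
          by (simp add: susp_dif_nth mod_neg_add)
      qed
    qed
  }
  fix r assume r: "r \<in> carrier R"
  show "dif (susp K) n (r \<odot>\<^bsub>obj (susp K) n\<^esub> as) = r \<odot>\<^bsub>obj (susp K) (n + 1)\<^esub> dif (susp K) n as"
  proof (rule susp_eqI)
    show "dif (susp K) n (r \<odot>\<^bsub>obj (susp K) n\<^esub> as) \<in> elts (susp K) (n + 1)"
      using as r S by (intro susp_dif_closed) simp
    show "r \<odot>\<^bsub>obj (susp K) (n + 1)\<^esub> dif (susp K) n as \<in> elts (susp K) (n + 1)"
      using das r S by simp
    fix j assume j: "j < N - 1"
    have l: "length as = N - 1" using as by (auto simp: susp_carrier)
    show "dif (susp K) n (r \<odot>\<^bsub>obj (susp K) n\<^esub> as) ! j = (r \<odot>\<^bsub>obj (susp K) (n + 1)\<^esub> dif (susp K) n as) ! j"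
    proof (cases "j < N - 2")
      case True
      then have "Suc j < N - 1" by simp
      then show ?thesis using True j l by (simp add: susp_dif_nth e' del: of_nat_Suc)
    next
      case False
      have "(r \<odot>\<^bsub>obj (susp K) (n + 1)\<^esub> dif (susp K) n as) ! j = r \<odot>\<^bsub>obj K (n + int N)\<^esub> dif (susp K) n as ! j"
        using susp_nth(3)[OF j, where n = "n + 1" and K = K] unfolding e[OF j False] .
      then show ?thesis
        using False j l w K mhom_smult[OF wsum_mhom r as] r
        by (simp add: susp_dif_nth mod_smult_neg)
    qed
  qed
qed

text \<open>The sum of \<open>d\<^bsup>i-j\<^esup> (a j)\<close> over \<open>j \<le> i\<close>, evaluated by Horner's scheme.\<close>

primrec horner :: "int \<Rightarrow> (nat \<Rightarrow> 'x) \<Rightarrow> nat \<Rightarrow> 'x" where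
  "horner n a 0 = a 0"
| "horner n a (Suc i) = dif K (n + int i) (horner n a i) \<oplus>\<^bsub>obj K (n + int i + 1)\<^esub> a (Suc i)"

lemma horner_closed:
  assumes "\<And>j. a j \<in> elts K (n + int j)"
  shows "m = n + int i \<Longrightarrow> horner n a i \<in> elts K m"
proof (induction i arbitrary: m)
  case 0
  then show ?case using assms[of 0] by simp
next
  case (Suc i)
  have m: "n + int i + 1 = m" using Suc by simp
  have "dif K (n + int i) (horner n a i) \<in> elts K m"
    by (rule dif_closed[OF K Suc.IH[OF refl]]) (simp add: m)
  moreover have "a (Suc i) \<in> elts K m" using assms[of "Suc i"] Suc by simp
  ultimately show ?case using K by (simp add: m)
qed

lemma horner_shift:
  assumes a: "\<And>j. a j \<in> elts K (n + int j)"
  shows "m = n + int (Suc i) \<Longrightarrow> horner n a (Suc i) = dpow K n (Suc i) (a 0) \<oplus>\<^bsub>obj K m\<^esub> horner (n + 1) (\<lambda>j. a (Suc j)) i"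
proof (induction i arbitrary: m)
  case 0
  then show ?case by simp
next
  case (Suc i)
  let ?b = "\<lambda>j. a (Suc j)"
  have b: "?b j \<in> elts K (n + 1 + int j)" for j using a[of "Suc j"] by (simp add: algebra_simps)
  let ?n = "n + int (Suc i)"
  have m: "m = ?n + 1" using Suc by simp
  have e: "n + 1 + int i = ?n" by simp
  have a0: "a 0 \<in> elts K n" using a[of 0] by simp
  have h: "horner (n + 1) ?b i \<in> elts K ?n" by (rule horner_closed[OF b]) simp
  have d: "dpow K n (Suc i) (a 0) \<in> elts K ?n" by (rule dpow_closed[OF K a0 refl])
  have A: "a (Suc (Suc i)) \<in> elts K m" using a[of "Suc (Suc i)"] m by (simp add: algebra_simps)
  have D: "dif K ?n (dpow K n (Suc i) (a 0)) \<in> elts K m" by (rule dif_closed[OF K d m])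
  have H: "dif K ?n (horner (n + 1) ?b i) \<in> elts K m" by (rule dif_closed[OF K h m])
  have "horner n a (Suc (Suc i)) = dif K ?n (horner n a (Suc i)) \<oplus>\<^bsub>obj K m\<^esub> a (Suc (Suc i))"
    using m by (simp del: of_nat_Suc horner.simps add: horner.simps(2)[of n a "Suc i"])
  also have "horner n a (Suc i) = dpow K n (Suc i) (a 0) \<oplus>\<^bsub>obj K ?n\<^esub> horner (n + 1) ?b i"
    by (rule Suc.IH[OF refl])
  also have "dif K ?n \<dots> = dif K ?n (dpow K n (Suc i) (a 0)) \<oplus>\<^bsub>obj K m\<^esub> dif K ?n (horner (n + 1) ?b i)"
    by (rule mhom_add[OF cpx_dif[OF K m] d h])
  also have "\<dots> \<oplus>\<^bsub>obj K m\<^esub> a (Suc (Suc i)) = dif K ?n (dpow K n (Suc i) (a 0)) \<oplus>\<^bsub>obj K m\<^esub>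
     (dif K ?n (horner (n + 1) ?b i) \<oplus>\<^bsub>obj K m\<^esub> a (Suc (Suc i)))"
    using K D H A by (simp add: mod_assoc)
  also have "dif K ?n (horner (n + 1) ?b i) \<oplus>\<^bsub>obj K m\<^esub> a (Suc (Suc i)) = horner (n + 1) ?b (Suc i)"
    using horner.simps(2)[of "n + 1" ?b i] unfolding e m[symmetric] by (rule sym)
  finally show ?case by (simp only: dpow.simps)
qed

lemma horner_sum:
  assumes a: "\<And>j. a j \<in> elts K (n + int j)"
  shows "m = n + int (Suc i) \<Longrightarrow>
    (\<Oplus>\<^bsub>obj K m\<^esub> j\<in>{..<Suc i}. dpow K (n + int j) (Suc i - j) (a j)) = dif K (n + int i) (horner n a i)"
proof (induction i arbitrary: m)
  case 0
  interpret M: abelian_group "obj K m" using K by (intro mod_abelian) simp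
  have "dif K n (a 0) \<in> elts K m" using 0 a[of 0] by (intro dif_closed[OF K]) auto
  then show ?case by (simp add: lessThan_Suc)
next
  case (Suc i)
  let ?M = "obj K m" and ?n = "n + int (Suc i)"
  let ?L = "obj K ?n"
  interpret M: abelian_group ?M using K by (intro mod_abelian) simp
  have m: "m = ?n + 1" using Suc by simp
  have c: "dpow K (n + int j) (Suc i - j) (a j) \<in> carrier ?L" if "j < Suc i" for j
    using that by (intro dpow_closed[OF K a]) auto
  have c': "dpow K (n + int j) (Suc (Suc i) - j) (a j) \<in> carrier ?M" if "j \<le> Suc i" for j
    using that m by (intro dpow_closed[OF K a]) (auto simp: of_nat_diff)
  have st: "dif K ?n (dpow K (n + int j) (Suc i - j) (a j)) = dpow K (n + int j) (Suc (Suc i) - j) (a j)" if "j < Suc i" for j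
  proof -
    have "Suc (Suc i) - j = Suc (Suc i - j)" "n + int j + int (Suc i - j) = ?n" using that by auto
    then show ?thesis by (simp del: of_nat_Suc)
  qed
  have hc: "horner n a i \<in> elts K (n + int i)" by (rule horner_closed[OF a refl])
  have dh: "dif K (n + int i) (horner n a i) \<in> carrier ?L" by (rule dif_closed[OF K hc]) simp
  have "dif K ?n (horner n a (Suc i)) = dif K ?n (dif K (n + int i) (horner n a i)) \<oplus>\<^bsub>?M\<^esub> dif K ?n (a (Suc i))"
    using mhom_add[OF cpx_dif[OF K m] dh a[of "Suc i"]] by (simp add: algebra_simps)
  also have "dif K (n + int i) (horner n a i) = (\<Oplus>\<^bsub>?L\<^esub> j\<in>{..<Suc i}. dpow K (n + int j) (Suc i - j) (a j))"
    by (rule Suc.IH[OF refl, symmetric])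
  also have "dif K ?n \<dots> = (\<Oplus>\<^bsub>?M\<^esub> j\<in>{..<Suc i}. dif K ?n (dpow K (n + int j) (Suc i - j) (a j)))"
    using K c by (intro mhom_finsum[OF cpx_dif[OF K m]]) auto
  also have "\<dots> = (\<Oplus>\<^bsub>?M\<^esub> j\<in>{..<Suc i}. dpow K (n + int j) (Suc (Suc i) - j) (a j))"
    using c' by (intro M.finsum_cong') (auto simp: st simp del: of_nat_Suc dpow.simps)
  also have "\<dots> \<oplus>\<^bsub>?M\<^esub> dif K ?n (a (Suc i)) = (\<Oplus>\<^bsub>?M\<^esub> j\<in>insert (Suc i) {..<Suc i}. dpow K (n + int j) (Suc (Suc i) - j) (a j))"
    using c' c'[of "Suc i"] K
    by (subst M.finsum_insert) (auto intro!: M.a_comm M.finsum_closed)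
  finally show ?case by (simp add: lessThan_Suc[of "Suc i"])
qed

context
  fixes n as
  assumes as: "as \<in> elts (susp K) n"
begin

lemma susp_dpow_closed: "m = n + int k \<Longrightarrow> dpow (susp K) n k as \<in> elts (susp K) m"
proof (induction k arbitrary: m)
  case (Suc k)
  have m: "m = n + int k + 1" using Suc by simp
  show ?case unfolding dpow.simps m by (rule susp_dif_closed[OF Suc.IH[OF refl]])
qed (use as in simp)

text \<open>The differential of the suspension shifts a list to the left, so all entries of the iterated
  differentials are values of the single sequence \<open>lead\<close> (\<open>lead_nth\<close>). The last entry supplied by the
  differential becomes a linear recursion of length \<open>N\<close> for it (\<open>lead_horner\<close>).\<close>

definition lead :: "nat \<Rightarrow> 'x" where "lead k = dpow (susp K) n k as ! 0"

lemma lead_nth: "j < N - 1 \<Longrightarrow> dpow (susp K) n k as ! j = lead (k + j)"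
proof (induction j arbitrary: k)
  case 0
  then show ?case by (simp add: lead_def)
next
  case (Suc j)
  have l: "length (dpow (susp K) n k as) = N - 1" using susp_dpow_closed[OF refl] by (simp add: susp_carrier)
  have "dpow (susp K) n k as ! Suc j = dpow (susp K) n (Suc k) as ! j"
  proof -
    have "j < N - 1" "j < N - 2" using Suc.prems by linarith+
    then show ?thesis by (simp add: susp_dif_nth[OF l])
  qed
  also have "\<dots> = lead (Suc k + j)" using Suc.prems by (intro Suc.IH) simp
  finally show ?case by simp
qed

lemma lead_closed: "lead k \<in> elts K (n + 1 + int k)"
  using susp_dpow_closed[of "n + int k" k] N_ge_2 unfolding susp_carrier lead_def
  by (auto simp: algebra_simps dest!: spec[of _ 0])

lemma lead_horner: "m = n + 1 + int k \<Longrightarrow> horner m (\<lambda>j. lead (k + j)) (N - 1) = \<zero>\<^bsub>obj K (m + int (N - 1))\<^esub>"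
proof -
  assume m: "m = n + 1 + int k"
  let ?s = "dpow (susp K) n k as" and ?b = "\<lambda>j. lead (k + j)"
  have b: "?b j \<in> elts K (m + int j)" for j using lead_closed[of "k + j"] m by (simp add: algebra_simps)
  define N' where "N' = N - 2"
  have N': "N - 1 = Suc N'" "N - 2 = N'" "N' < N - 1" "\<not> N' < N - 2" using N_ge_2 by (auto simp: N'_def)
  have e: "n + int k + int N = m + int (Suc N')" using m N'(1) N_ge_2 by linarith
  have l: "length ?s = N - 1" using susp_dpow_closed[OF refl] by (simp add: susp_carrier)
  let ?M = "obj K (m + int (Suc N'))"
  interpret M: abelian_group ?M using K by (intro mod_abelian) simp
  have c: "dpow K (m + int j) (Suc N' - j) (?b j) \<in> carrier ?M" if "j < Suc N'" for j
    using that by (intro dpow_closed[OF K b]) auto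
  have m': "n + int k + 1 = m" using m by simp
  have "wsum K (n + int k) ?s = (\<Oplus>\<^bsub>?M\<^esub> j\<in>{..<Suc N'}. dpow K (m + int j) (Suc N' - j) (?b j))"
    unfolding wsum_def e N'(1) m'
  proof (rule M.finsum_cong'[OF refl])
    fix j assume "j \<in> {..<Suc N'}"
    then show "dpow K (m + int j) (Suc N' - j) (?s ! j) = dpow K (m + int j) (Suc N' - j) (?b j)"
      using N'(1) by (simp only: lead_nth lessThan_iff)
  qed (use c in auto)
  also have "\<dots> = dif K (m + int N') (horner m ?b N')" by (rule horner_sum[OF b refl])
  finally have w: "wsum K (n + int k) ?s = dif K (m + int N') (horner m ?b N')" .
  have "lead (k + Suc N') = dpow (susp K) n (Suc k) as ! N'"
    using lead_nth[OF N'(3), of "Suc k"] by simp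
  also have "\<dots> = \<ominus>\<^bsub>?M\<^esub> dif K (m + int N') (horner m ?b N')"
    unfolding dpow.simps susp_dif_nth[OF l N'(3)] if_not_P[OF N'(4)] w e ..
  finally have "lead (k + Suc N') = \<ominus>\<^bsub>?M\<^esub> dif K (m + int N') (horner m ?b N')" .
  moreover have "dif K (m + int N') (horner m ?b N') \<in> carrier ?M"
    by (rule dif_closed[OF K horner_closed[OF b refl]]) simp
  moreover have "m + int N' + 1 = m + int (Suc N')" by simp
  ultimately show ?thesis using K by (simp only: N'(1) horner.simps mod_r_neg cpx_module)
qed

text \<open>Summing \<open>N + 1\<close> consecutive values of \<open>lead\<close> by Horner's scheme can be grouped in two ways. Splitting off
  the last value leaves the differential of an instance of the recursion, splitting off the first one leaves
  the \<open>N\<close>-th power of a differential and the next instance of the recursion. All of these vanish, and so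
  the last value does too.\<close>

lemma lead_zero: "lead (k + N) = \<zero>\<^bsub>obj K (n + 1 + int (k + N))\<^esub>"
proof -
  let ?m = "n + 1 + int k" and ?b = "\<lambda>j. lead (k + j)"
  have b: "?b j \<in> elts K (?m + int j)" for j using lead_closed[of "k + j"] by (simp add: algebra_simps)
  have sN: "Suc (N - 1) = N" using N_ge_2 by simp
  let ?M = "obj K (?m + int N)"
  have "horner ?m ?b N = dif K (?m + int (N - 1)) (horner ?m ?b (N - 1)) \<oplus>\<^bsub>obj K (?m + int (N - 1) + 1)\<^esub> ?b (Suc (N - 1))"
    using horner.simps(2)[of ?m ?b "N - 1"] unfolding sN .
  also have "?m + int (N - 1) + 1 = ?m + int N" using N_ge_2 by (simp add: of_nat_diff)
  also have "dif K (?m + int (N - 1)) (horner ?m ?b (N - 1)) = \<zero>\<^bsub>?M\<^esub>"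
    unfolding lead_horner[OF refl] using K N_ge_2 by (intro mhom_zero[OF cpx_dif[OF K]]) (auto simp: of_nat_diff)
  also have "\<zero>\<^bsub>?M\<^esub> \<oplus>\<^bsub>?M\<^esub> ?b (Suc (N - 1)) = ?b N" unfolding sN using K b[of N] by simp
  finally have 1: "horner ?m ?b N = ?b N" .
  have "horner ?m ?b N = dpow K ?m N (?b 0) \<oplus>\<^bsub>?M\<^esub> horner (?m + 1) (\<lambda>j. ?b (Suc j)) (N - 1)"
    using horner_shift[OF b, of "?m + int N" "N - 1"] unfolding sN by simp
  also have "dpow K ?m N (?b 0) = \<zero>\<^bsub>?M\<^esub>" using b[of 0] by (intro dpow_ge_N[OF K]) auto
  also have "horner (?m + 1) (\<lambda>j. ?b (Suc j)) (N - 1) = \<zero>\<^bsub>?M\<^esub>"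
  proof -
    have "horner (?m + 1) (\<lambda>j. lead (Suc k + j)) (N - 1) = \<zero>\<^bsub>obj K (?m + 1 + int (N - 1))\<^esub>"
      by (rule lead_horner) simp
    moreover have "?m + 1 + int (N - 1) = ?m + int N" using N_ge_2 by (simp add: of_nat_diff)
    ultimately show ?thesis by (simp only: add_Suc_right add_Suc)
  qed
  finally have "horner ?m ?b N = \<zero>\<^bsub>?M\<^esub>" using K by simp
  then show ?thesis using 1 by (simp add: algebra_simps)
qed

end

text \<open>The entries of the \<open>N\<close>-th power of the differential are values \<open>lead (N + j)\<close>, all of which are zero.\<close>

theorem susp_n_complex: "n_complex R N (susp K)"
  unfolding n_complex_def
proof (intro allI conjI ballI)
  fix n as
  show "module R (obj (susp K) n)" by (rule susp_module)
  show "dif (susp K) n \<in> mhom R (obj (susp K) n) (obj (susp K) (n + 1))" by (rule susp_dif_mhom)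
  assume as: "as \<in> elts (susp K) n"
  show "dpow (susp K) n N as = \<zero>\<^bsub>obj (susp K) (n + int N)\<^esub>"
  proof (rule susp_eqI[OF susp_dpow_closed[OF as refl]])
    show "\<zero>\<^bsub>obj (susp K) (n + int N)\<^esub> \<in> elts (susp K) (n + int N)" using susp_module by simp
    fix j assume j: "j < N - 1"
    have "dpow (susp K) n N as ! j = lead n as (j + N)" using lead_nth[OF as j, of N] by (simp add: add.commute)
    then show "dpow (susp K) n N as ! j = \<zero>\<^bsub>obj (susp K) (n + int N)\<^esub> ! j"
      using lead_zero[OF as, of j] j by (simp add: algebra_simps)
  qed
qed

end

end

section \<open>Homomorphisms from the cone of a multiplication\<close>

context n_complexes
begin

text \<open>The step \<open>K \<mapsto> cone of x on K\<close> in the construction of the Koszul complex.\<close>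

abbreviation kcone :: "'r \<Rightarrow> ('r, 'r koszul_elem) ncomplex \<Rightarrow> ('r, 'r koszul_elem) ncomplex" where
  "kcone x K \<equiv> transport Node the_node (cone N K K (\<lambda>n k. x \<odot>\<^bsub>obj K n\<^esub> k))"

lemma kcone_simps:
  "elts (kcone x K) n = Node ` (elts K n \<times> elts (susp K) n)"
  "\<zero>\<^bsub>obj (kcone x K) n\<^esub> = Node (\<zero>\<^bsub>obj K n\<^esub>, \<zero>\<^bsub>obj (susp K) n\<^esub>)"
  "Node (y, as) \<oplus>\<^bsub>obj (kcone x K) n\<^esub> Node (z, bs) = Node (y \<oplus>\<^bsub>obj K n\<^esub> z, as \<oplus>\<^bsub>obj (susp K) n\<^esub> bs)"
  "r \<odot>\<^bsub>obj (kcone x K) n\<^esub> Node (y, as) = Node (r \<odot>\<^bsub>obj K n\<^esub> y, r \<odot>\<^bsub>obj (susp K) n\<^esub> as)"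
  "dif (kcone x K) n (Node (y, as)) =
     Node (dif K n y \<oplus>\<^bsub>obj K (n + 1)\<^esub> (x \<odot>\<^bsub>obj K (n + 1)\<^esub> as ! 0), dif (susp K) n as)"
  by (simp_all add: transport_def cone_def)

lemma kcone_carrier [simp]:
  "Node (y, as) \<in> elts (kcone x K) n \<longleftrightarrow> y \<in> elts K n \<and> as \<in> elts (susp K) n"
  by (auto simp: kcone_simps)

lemma kcone_cases:
  assumes "p \<in> elts (kcone x K) n"
  obtains y as where "p = Node (y, as)" "y \<in> elts K n" "as \<in> elts (susp K) n"
  using assms by (auto simp: kcone_simps)

context
  fixes K :: "('r, 'r koszul_elem) ncomplex" and x :: 'r
  assumes K: "n_complex R N K" and x: "x \<in> carrier R"
begin

lemma susp_hd: "as \<in> elts (susp K) n \<Longrightarrow> m = n + 1 \<Longrightarrow> as ! 0 \<in> elts K m"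
  using N_ge_2 by (auto simp: susp_carrier dest!: spec[of _ 0])

lemma kcone_module: "module R (obj (kcone x K) n)"
proof (rule module_by_zero_neg)
qed (use K susp_module[OF K] in \<open>auto elim!: kcone_cases simp: kcone_simps(2-4) mod_ac mod_smult_add mod_add_smult mod_mult_smult\<close>)

lemma kcone_dif_mhom: "dif (kcone x K) n \<in> mhom R (obj (kcone x K) n) (obj (kcone x K) (n + 1))"
proof (rule mhomI)
  note S = susp_n_complex[OF K]
  note N1 = N_ge_2
  fix p assume "p \<in> elts (kcone x K) n"
  then obtain y as where p: "p = Node (y, as)" "y \<in> elts K n" "as \<in> elts (susp K) n"
    by (rule kcone_cases)
  note c = dif_closed[OF K p(2) refl] dif_closed[OF S p(3) refl] susp_hd[OF p(3) refl]
  have j0: "0 < N - 1" using N1 by simp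
  show "dif (kcone x K) n p \<in> elts (kcone x K) (n + 1)"
    using p c K x by (simp add: kcone_simps(5))
  {
    fix p' assume "p' \<in> elts (kcone x K) n"
    then obtain y' as' where p': "p' = Node (y', as')" "y' \<in> elts K n" "as' \<in> elts (susp K) n"
      by (rule kcone_cases)
    note c' = dif_closed[OF K p'(2) refl] dif_closed[OF S p'(3) refl] susp_hd[OF p'(3) refl]
    show "dif (kcone x K) n (p \<oplus>\<^bsub>obj (kcone x K) n\<^esub> p') = dif (kcone x K) n p \<oplus>\<^bsub>obj (kcone x K) (n + 1)\<^esub> dif (kcone x K) n p'"
      using p p' c c' K S x susp_nth(2)[OF j0, where as = as and bs = as' and K = K and n = n]
      by (simp add: kcone_simps(3,5) mhom_add[OF cpx_dif[OF K refl]] mhom_add[OF cpx_dif[OF S refl]] mod_smult_add mod_ac)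
  }
  fix r assume r: "r \<in> carrier R"
  show "dif (kcone x K) n (r \<odot>\<^bsub>obj (kcone x K) n\<^esub> p) = r \<odot>\<^bsub>obj (kcone x K) (n + 1)\<^esub> dif (kcone x K) n p"
    using p c K S x r susp_nth(3)[OF j0, where as = as and r = r and K = K and n = n] mod_smult_comm[of "obj K (n + 1)" r x "as ! 0"]
    by (simp add: kcone_simps(4,5) mhom_smult[OF cpx_dif[OF K refl]] mhom_smult[OF cpx_dif[OF S refl]] mod_smult_add)
qed

text \<open>Along the powers of the differential, \<open>x\<close> times the leading entries of the suspension accumulate in the
  first component as in Horner's scheme.\<close>

lemma kcone_dpow:
  assumes y: "y \<in> elts K n" and as: "as \<in> elts (susp K) n"
  shows "m = n + int (Suc k) \<Longrightarrow> dpow (kcone x K) n (Suc k) (Node (y, as)) =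
     Node (dpow K n (Suc k) y \<oplus>\<^bsub>obj K m\<^esub> (x \<odot>\<^bsub>obj K m\<^esub> horner K (n + 1) (lead K n as) k), dpow (susp K) n (Suc k) as)"
proof (induction k arbitrary: m)
  case 0
  then show ?case by (simp add: kcone_simps(5) lead_def[OF K as] horner.simps(1)[OF K])
next
  case (Suc k)
  let ?n = "n + int (Suc k)"
  let ?a = "lead K n as"
  let ?d = "dpow K n (Suc k) y" and ?h = "horner K (n + 1) ?a k" and ?l = "?a (Suc k)"
  have m: "?n + 1 = m" using Suc by simp
  have e: "n + 1 + int k = ?n" by simp
  have a: "?a j \<in> elts K (n + 1 + int j)" for j by (rule lead_closed[OF K as])
  have d: "?d \<in> elts K ?n" by (rule dpow_closed[OF K y refl])
  have h: "?h \<in> elts K ?n" by (rule horner_closed[OF K a]) simp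
  have l: "?l \<in> elts K m" using a[of "Suc k"] m by (simp add: algebra_simps)
  have D: "dif K ?n ?d \<in> elts K m" "dif K ?n ?h \<in> elts K m"
    by (rule dif_closed[OF K d m[symmetric]], rule dif_closed[OF K h m[symmetric]])
  have l': "dpow (susp K) n (Suc k) as ! 0 = ?l" by (simp only: lead_def[OF K as])
  have xh: "x \<odot>\<^bsub>obj K ?n\<^esub> ?h \<in> elts K ?n" using K x h by simp
  have "dif K ?n (?d \<oplus>\<^bsub>obj K ?n\<^esub> (x \<odot>\<^bsub>obj K ?n\<^esub> ?h)) \<oplus>\<^bsub>obj K m\<^esub> (x \<odot>\<^bsub>obj K m\<^esub> ?l) =
     dif K ?n ?d \<oplus>\<^bsub>obj K m\<^esub> (x \<odot>\<^bsub>obj K m\<^esub> (dif K ?n ?h \<oplus>\<^bsub>obj K m\<^esub> ?l))"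
    unfolding mhom_add[OF cpx_dif[OF K m[symmetric]] d xh] mhom_smult[OF cpx_dif[OF K m[symmetric]] x h]
    using K x D l by (simp add: mod_smult_add mod_assoc)
  also have "dif K ?n ?h \<oplus>\<^bsub>obj K m\<^esub> ?l = horner K (n + 1) ?a (Suc k)"
    using horner.simps(2)[OF K, of "n + 1" ?a k] unfolding e m by (rule sym)
  finally show ?case
    using Suc.IH[OF refl] by (simp only: dpow.simps(2)[of _ _ "Suc k"] kcone_simps(5) l' m)
qed

text \<open>In the first component of the \<open>N\<close>-th power, what accumulates besides \<open>d\<^sup>N\<close> is an instance of the recursion
  \<open>lead_horner\<close>.\<close>

theorem kcone_n_complex: "n_complex R N (kcone x K)"
  unfolding n_complex_def
proof (intro allI conjI ballI)
  fix n p
  note S = susp_n_complex[OF K]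
  show "module R (obj (kcone x K) n)" by (rule kcone_module)
  show "dif (kcone x K) n \<in> mhom R (obj (kcone x K) n) (obj (kcone x K) (n + 1))" by (rule kcone_dif_mhom)
  assume "p \<in> elts (kcone x K) n"
  then obtain y as where p: "p = Node (y, as)" "y \<in> elts K n" "as \<in> elts (susp K) n"
    by (rule kcone_cases)
  have sN: "Suc (N - 1) = N" using N_ge_2 by simp
  have e: "n + 1 + int (N - 1) = n + int N" using N_ge_2 by (simp add: of_nat_diff)
  have h: "horner K (n + 1) (lead K n as) (N - 1) = \<zero>\<^bsub>obj K (n + int N)\<^esub>"
    using lead_horner[OF K p(3), of "n + 1" 0] unfolding e by simp
  have "dpow (kcone x K) n N p = Node (dpow K n N y \<oplus>\<^bsub>obj K (n + int N)\<^esub>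
      (x \<odot>\<^bsub>obj K (n + int N)\<^esub> \<zero>\<^bsub>obj K (n + int N)\<^esub>), dpow (susp K) n N as)"
    using kcone_dpow[OF p(2,3), of "n + int N" "N - 1"] unfolding sN h p(1) by simp
  then show "dpow (kcone x K) n N p = \<zero>\<^bsub>obj (kcone x K) (n + int N)\<^esub>"
    using K S x p by (simp add: kcone_simps(2) dpow_ge_N[OF K] dpow_ge_N[OF S])
qed

end

end

context q_complexes
begin

text \<open>The restriction of the differential of \<open>Hom(P, Y)\<close>, for \<open>P\<close> the cone of the identity of \<open>K\<close>, to a map from
  \<open>Hom(K, Y)\<close> to \<open>Hom(\<Sigma>K, Y)\<close>. The sign and the power of \<open>q\<close> come from the differential of the q-Hom complex,
  and the first entry from the cone.\<close>

definition cone_conn :: "('r, 'x) ncomplex \<Rightarrow> ('r, 'y) ncomplex \<Rightarrow> int \<Rightarrow> (int \<Rightarrow> 'x \<Rightarrow> 'y) \<Rightarrow> int \<Rightarrow> 'x list \<Rightarrow> 'y" where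
  "cone_conn K Y n g = (\<lambda>i. \<lambda>as\<in>elts (susp K) i.
     \<ominus>\<^bsub>obj Y (i + (n + 1))\<^esub> (q [^] n \<odot>\<^bsub>obj Y (i + (n + 1))\<^esub> g (i + 1) (as ! 0)))"

definition cone_split :: "('r, 'r koszul_elem) ncomplex \<Rightarrow> int \<Rightarrow> (int \<Rightarrow> 'r koszul_elem \<Rightarrow> 'y) \<Rightarrow>
    (int \<Rightarrow> 'r koszul_elem \<Rightarrow> 'y) \<times> (int \<Rightarrow> 'r koszul_elem list \<Rightarrow> 'y)" where
  "cone_split K n f = (\<lambda>i. \<lambda>y\<in>elts K i. f i (Node (y, \<zero>\<^bsub>obj (susp K) i\<^esub>)),
     \<lambda>i. \<lambda>as\<in>elts (susp K) i. f i (Node (\<zero>\<^bsub>obj K i\<^esub>, as)))"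

abbreviation cone_ext :: "'r \<Rightarrow> ('r, 'r koszul_elem) ncomplex \<Rightarrow> ('r, 'y) ncomplex \<Rightarrow>
    ('r, (int \<Rightarrow> 'r koszul_elem \<Rightarrow> 'y) \<times> (int \<Rightarrow> 'r koszul_elem list \<Rightarrow> 'y)) ncomplex" where
  "cone_ext x K Y \<equiv> ext_cpx (qHom K Y) (qHom (susp K) Y) (cone_conn K Y) x"

context
  fixes K :: "('r, 'r koszul_elem) ncomplex" and Y :: "('r, 'y) ncomplex"
  assumes K: "n_complex R N K" and Y: "n_complex R N Y"
begin

lemma hd_mhom: "m = n + 1 \<Longrightarrow> (\<lambda>as. as ! 0) \<in> mhom R (obj (susp K) n) (obj K m)"
  using N_ge_2 susp_hd[OF K zero_closed] by (intro mhomI) auto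

lemma cone_conn_mhom:
  "m = n + 1 \<Longrightarrow> cone_conn K Y n \<in> mhom R (obj (qHom K Y) n) (obj (qHom (susp K) Y) m)"
proof (rule mhomI)
  assume m: "m = n + 1"
  note S = susp_n_complex[OF K]
  have cl: "cone_conn K Y n f \<in> elts (qHom (susp K) Y) m" if f: "f \<in> elts (qHom K Y) n" for f
    unfolding cone_conn_def m
  proof (rule qHom_restrict)
    fix i
    show "(\<lambda>as. \<ominus>\<^bsub>obj Y (i + (n + 1))\<^esub> (q [^] n \<odot>\<^bsub>obj Y (i + (n + 1))\<^esub> f (i + 1) (as ! 0)))
       \<in> mhom R (obj (susp K) i) (obj Y (i + (n + 1)))"
      by (intro mhom_uminus mhom_scale mhom_comp[OF hd_mhom[OF refl] qHom_mhom[OF f]]) (use Y in auto)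
  qed (use S in simp)
  have ap: "cone_conn K Y n f i as = \<ominus>\<^bsub>obj Y (i + (n + 1))\<^esub> (q [^] n \<odot>\<^bsub>obj Y (i + (n + 1))\<^esub> f (i + 1) (as ! 0))"
    if "as \<in> elts (susp K) i" for f i as using that by (simp add: cone_conn_def)
  fix f assume f: "f \<in> elts (qHom K Y) n"
  show "cone_conn K Y n f \<in> elts (qHom (susp K) Y) m" by (rule cl[OF f])
  note Q = qHom_closures[OF K Y] and Q' = qHom_closures[OF S Y]
  have v: "f (i + 1) (as ! 0) \<in> elts Y (i + (n + 1))"
    if "as \<in> elts (susp K) i" "f \<in> elts (qHom K Y) n" for f i as
    by (rule qHom_closed[OF that(2) susp_hd[OF K zero_closed that(1) refl]]) simp
  {
    fix g assume g: "g \<in> elts (qHom K Y) n"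
    show "cone_conn K Y n (f \<oplus>\<^bsub>obj (qHom K Y) n\<^esub> g) = cone_conn K Y n f \<oplus>\<^bsub>obj (qHom (susp K) Y) m\<^esub> cone_conn K Y n g"
    proof (rule qHom_eqI[OF cl[OF Q(2)[OF f g]] Q'(2)[OF cl[OF f] cl[OF g]]])
      fix i as assume as: "as \<in> elts (susp K) i"
      have 1: "(f \<oplus>\<^bsub>obj (qHom K Y) n\<^esub> g) (i + 1) (as ! 0) = f (i + 1) (as ! 0) \<oplus>\<^bsub>obj Y (i + (n + 1))\<^esub> g (i + 1) (as ! 0)"
        by (rule qHom_apply(2)[OF susp_hd[OF K zero_closed as refl]]) simp
      show "cone_conn K Y n (f \<oplus>\<^bsub>obj (qHom K Y) n\<^esub> g) i as =
          (cone_conn K Y n f \<oplus>\<^bsub>obj (qHom (susp K) Y) m\<^esub> cone_conn K Y n g) i as"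
        unfolding qHom_apply(2)[OF as refl] ap[OF as] 1 m
        using v[OF as f] v[OF as g] Y by (simp add: mod_smult_add mod_neg_add)
    qed
  }
  fix r assume r: "r \<in> carrier R"
  show "cone_conn K Y n (r \<odot>\<^bsub>obj (qHom K Y) n\<^esub> f) = r \<odot>\<^bsub>obj (qHom (susp K) Y) m\<^esub> cone_conn K Y n f"
  proof (rule qHom_eqI[OF cl[OF Q(3)[OF r f]] Q'(3)[OF r cl[OF f]]])
    fix i as assume as: "as \<in> elts (susp K) i"
    have 1: "(r \<odot>\<^bsub>obj (qHom K Y) n\<^esub> f) (i + 1) (as ! 0) = r \<odot>\<^bsub>obj Y (i + (n + 1))\<^esub> f (i + 1) (as ! 0)"
      by (rule qHom_apply(3)[OF susp_hd[OF K zero_closed as refl]]) simp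
    show "cone_conn K Y n (r \<odot>\<^bsub>obj (qHom K Y) n\<^esub> f) i as = (r \<odot>\<^bsub>obj (qHom (susp K) Y) m\<^esub> cone_conn K Y n f) i as"
      unfolding qHom_apply(3)[OF as refl] ap[OF as] 1 m
      using v[OF as f] Y r mod_smult_comm[of "obj Y (i + (n + 1))" r "q [^] n" "f (i + 1) (as ! 0)"]
      by (simp add: mod_smult_neg)
  qed
qed

lemma cone_in_fst:
  "x \<in> carrier R \<Longrightarrow> (\<lambda>y. Node (y, \<zero>\<^bsub>obj (susp K) i\<^esub>)) \<in> mhom R (obj K i) (obj (kcone x K) i)"
  using susp_module[OF K] by (intro mhomI) (auto simp: kcone_simps(3,4))

lemma cone_in_snd:
  "x \<in> carrier R \<Longrightarrow> (\<lambda>as. Node (\<zero>\<^bsub>obj K i\<^esub>, as)) \<in> mhom R (obj (susp K) i) (obj (kcone x K) i)"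
  using K by (intro mhomI) (auto simp: kcone_simps(3,4))

context
  fixes x :: 'r
  assumes x: "x \<in> carrier R"
begin

lemma cone_split_closed:
  assumes f: "f \<in> elts (qHom (kcone x K) Y) n"
  shows "cone_split K n f \<in> elts (cone_ext x K Y) n"
  unfolding cone_split_def ext_cpx_simps
proof (rule SigmaI)
  note S = susp_n_complex[OF K]
  show "(\<lambda>i. \<lambda>y\<in>elts K i. f i (Node (y, \<zero>\<^bsub>obj (susp K) i\<^esub>))) \<in> elts (qHom K Y) n"
    by (rule qHom_restrict) (use K in simp, rule mhom_comp[OF cone_in_fst[OF x] qHom_mhom[OF f refl]])
  show "(\<lambda>i. \<lambda>as\<in>elts (susp K) i. f i (Node (\<zero>\<^bsub>obj K i\<^esub>, as))) \<in> elts (qHom (susp K) Y) n"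
    by (rule qHom_restrict) (use S in simp, rule mhom_comp[OF cone_in_snd[OF x] qHom_mhom[OF f refl]])
qed

lemma cone_split_fst: "y \<in> elts K i \<Longrightarrow> fst (cone_split K n f) i y = f i (Node (y, \<zero>\<^bsub>obj (susp K) i\<^esub>))"
  by (simp add: cone_split_def)

lemma cone_split_snd: "as \<in> elts (susp K) i \<Longrightarrow> snd (cone_split K n f) i as = f i (Node (\<zero>\<^bsub>obj K i\<^esub>, as))"
  by (simp add: cone_split_def)

lemma cone_ext_eqI:
  assumes p: "p \<in> elts (cone_ext x K Y) n" and p': "p' \<in> elts (cone_ext x K Y) n"
    and "\<And>i y. y \<in> elts K i \<Longrightarrow> fst p i y = fst p' i y"
    and "\<And>i as. as \<in> elts (susp K) i \<Longrightarrow> snd p i as = snd p' i as"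
  shows "p = p'"
proof (rule prod_eqI)
  show "fst p = fst p'" by (rule qHom_eqI[of _ K Y n]) (use assms in auto)
  show "snd p = snd p'" by (rule qHom_eqI[of _ "susp K" Y n]) (use assms in auto)
qed

lemma cone_split_chain_map: "chain_map R (qHom (kcone x K) Y) (cone_ext x K Y) (cone_split K)"
  unfolding chain_map_def
proof (intro allI conjI ballI)
  note S = susp_n_complex[OF K] and P = kcone_n_complex[OF K x]
  note Q = qHom_n_complex[OF P Y] and H = qHom_n_complex[OF K Y] and A = qHom_n_complex[OF S Y]
  have E: "module R (obj (cone_ext x K Y) n)" for n using H A by (intro ext_cpx_obj_module) auto
  have z: "Node (y, \<zero>\<^bsub>obj (susp K) i\<^esub>) \<in> elts (kcone x K) i" if "y \<in> elts K i" for y i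
    using that S by simp
  have z': "Node (\<zero>\<^bsub>obj K i\<^esub>, as) \<in> elts (kcone x K) i" if "as \<in> elts (susp K) i" for as i
    using that K by simp
  fix n
  show "cone_split K n \<in> mhom R (obj (qHom (kcone x K) Y) n) (obj (cone_ext x K Y) n)"
  proof (rule mhomI)
    fix f assume f: "f \<in> elts (qHom (kcone x K) Y) n"
    show "cone_split K n f \<in> elts (cone_ext x K Y) n" by (rule cone_split_closed[OF f])
    {
      fix g assume g: "g \<in> elts (qHom (kcone x K) Y) n"
      show "cone_split K n (f \<oplus>\<^bsub>obj (qHom (kcone x K) Y) n\<^esub> g) = cone_split K n f \<oplus>\<^bsub>obj (cone_ext x K Y) n\<^esub> cone_split K n g"
      proof (rule cone_ext_eqI)
        show "cone_split K n (f \<oplus>\<^bsub>obj (qHom (kcone x K) Y) n\<^esub> g) \<in> elts (cone_ext x K Y) n"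
          using f g Q by (intro cone_split_closed) simp
        show "cone_split K n f \<oplus>\<^bsub>obj (cone_ext x K Y) n\<^esub> cone_split K n g \<in> elts (cone_ext x K Y) n"
          by (rule mod_add[OF E cone_split_closed[OF f] cone_split_closed[OF g]])
        have sp: "cone_split K n f \<oplus>\<^bsub>obj (cone_ext x K Y) n\<^esub> cone_split K n g =
           (fst (cone_split K n f) \<oplus>\<^bsub>obj (qHom K Y) n\<^esub> fst (cone_split K n g),
            snd (cone_split K n f) \<oplus>\<^bsub>obj (qHom (susp K) Y) n\<^esub> snd (cone_split K n g))"
          by (simp add: ext_cpx_def)
        fix i
        show "fst (cone_split K n (f \<oplus>\<^bsub>obj (qHom (kcone x K) Y) n\<^esub> g)) i y =
           fst (cone_split K n f \<oplus>\<^bsub>obj (cone_ext x K Y) n\<^esub> cone_split K n g) i y" if y: "y \<in> elts K i" for y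
          unfolding sp fst_conv cone_split_fst[OF y] qHom_apply(2)[OF y refl] qHom_apply(2)[OF z[OF y] refl] ..
        show "snd (cone_split K n (f \<oplus>\<^bsub>obj (qHom (kcone x K) Y) n\<^esub> g)) i as =
           snd (cone_split K n f \<oplus>\<^bsub>obj (cone_ext x K Y) n\<^esub> cone_split K n g) i as" if as: "as \<in> elts (susp K) i" for as
          unfolding sp snd_conv cone_split_snd[OF as] qHom_apply(2)[OF as refl] qHom_apply(2)[OF z'[OF as] refl] ..
      qed
    }
    fix r assume r: "r \<in> carrier R"
    show "cone_split K n (r \<odot>\<^bsub>obj (qHom (kcone x K) Y) n\<^esub> f) = r \<odot>\<^bsub>obj (cone_ext x K Y) n\<^esub> cone_split K n f"
    proof (rule cone_ext_eqI)
      show "cone_split K n (r \<odot>\<^bsub>obj (qHom (kcone x K) Y) n\<^esub> f) \<in> elts (cone_ext x K Y) n"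
        using f r Q by (intro cone_split_closed) simp
      show "r \<odot>\<^bsub>obj (cone_ext x K Y) n\<^esub> cone_split K n f \<in> elts (cone_ext x K Y) n"
        by (rule mod_smult[OF E r cone_split_closed[OF f]])
      have sp: "r \<odot>\<^bsub>obj (cone_ext x K Y) n\<^esub> cone_split K n f =
         (r \<odot>\<^bsub>obj (qHom K Y) n\<^esub> fst (cone_split K n f), r \<odot>\<^bsub>obj (qHom (susp K) Y) n\<^esub> snd (cone_split K n f))"
        by (simp add: ext_cpx_def)
      fix i
      show "fst (cone_split K n (r \<odot>\<^bsub>obj (qHom (kcone x K) Y) n\<^esub> f)) i y =
         fst (r \<odot>\<^bsub>obj (cone_ext x K Y) n\<^esub> cone_split K n f) i y" if y: "y \<in> elts K i" for y
        unfolding sp fst_conv cone_split_fst[OF y] qHom_apply(3)[OF y refl] qHom_apply(3)[OF z[OF y] refl] ..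
      show "snd (cone_split K n (r \<odot>\<^bsub>obj (qHom (kcone x K) Y) n\<^esub> f)) i as =
         snd (r \<odot>\<^bsub>obj (cone_ext x K Y) n\<^esub> cone_split K n f) i as" if as: "as \<in> elts (susp K) i" for as
        unfolding sp snd_conv cone_split_snd[OF as] qHom_apply(3)[OF as refl] qHom_apply(3)[OF z'[OF as] refl] ..
    qed
  qed
  fix f assume f: "f \<in> elts (qHom (kcone x K) Y) n"
  let ?g = "fst (cone_split K n f)" and ?h = "snd (cone_split K n f)"
  have gh: "?g \<in> elts (qHom K Y) n" "?h \<in> elts (qHom (susp K) Y) n"
    using cone_split_closed[OF f] by auto
  have D: "dif (cone_ext x K Y) n (cone_split K n f) = (dif (qHom K Y) n ?g,
      x \<odot>\<^bsub>obj (qHom (susp K) Y) (n + 1)\<^esub> cone_conn K Y n ?g \<oplus>\<^bsub>obj (qHom (susp K) Y) (n + 1)\<^esub> dif (qHom (susp K) Y) n ?h)"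
    by (simp add: ext_cpx_def)
  have cc: "cone_conn K Y n ?g \<in> elts (qHom (susp K) Y) (n + 1)"
    by (rule mhom_closed[OF cone_conn_mhom[OF refl] gh(1)])
  show "cone_split K (n + 1) (dif (qHom (kcone x K) Y) n f) = dif (cone_ext x K Y) n (cone_split K n f)"
  proof (rule cone_ext_eqI)
    show "cone_split K (n + 1) (dif (qHom (kcone x K) Y) n f) \<in> elts (cone_ext x K Y) (n + 1)"
      by (intro cone_split_closed dif_closed[OF Q f refl])
    show "dif (cone_ext x K Y) n (cone_split K n f) \<in> elts (cone_ext x K Y) (n + 1)"
      unfolding D using cc x A dif_closed[OF H gh(1) refl] dif_closed[OF A gh(2) refl] by simp
    fix i
    let ?M = "obj Y (i + n + 1)"
    show "fst (cone_split K (n + 1) (dif (qHom (kcone x K) Y) n f)) i y = fst (dif (cone_ext x K Y) n (cone_split K n f)) i y"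
      if y: "y \<in> elts K i" for y
    proof -
      have dy: "dif K i y \<in> elts K (i + 1)" by (rule dif_closed[OF K y refl])
      have "dif (kcone x K) i (Node (y, \<zero>\<^bsub>obj (susp K) i\<^esub>)) = Node (dif K i y, \<zero>\<^bsub>obj (susp K) (i + 1)\<^esub>)"
        using dy K S x N_ge_2 by (simp add: kcone_simps(5) mhom_zero[OF cpx_dif[OF S refl]])
      then show ?thesis
        unfolding D fst_conv cone_split_fst[OF y] qHom_dif_apply[OF y refl] qHom_dif_apply[OF z[OF y] refl] cone_split_fst[OF dy]
        by simp
    qed
    fix as assume as: "as \<in> elts (susp K) i"
    have das: "dif (susp K) i as \<in> elts (susp K) (i + 1)" by (rule dif_closed[OF S as refl])
    have a0: "as ! 0 \<in> elts K (i + 1)" by (rule susp_hd[OF K x as refl])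
    let ?a = "Node (as ! 0, \<zero>\<^bsub>obj (susp K) (i + 1)\<^esub>)" and ?b = "Node (\<zero>\<^bsub>obj K (i + 1)\<^esub>, dif (susp K) i as)"
    have "dif (kcone x K) i (Node (\<zero>\<^bsub>obj K i\<^esub>, as)) = (x \<odot>\<^bsub>obj (kcone x K) (i + 1)\<^esub> ?a) \<oplus>\<^bsub>obj (kcone x K) (i + 1)\<^esub> ?b"
      using K S x a0 das by (simp add: kcone_simps mhom_zero[OF cpx_dif[OF K refl]])
    moreover have "f (i + 1) ((x \<odot>\<^bsub>obj (kcone x K) (i + 1)\<^esub> ?a) \<oplus>\<^bsub>obj (kcone x K) (i + 1)\<^esub> ?b) =
        (x \<odot>\<^bsub>?M\<^esub> f (i + 1) ?a) \<oplus>\<^bsub>?M\<^esub> f (i + 1) ?b"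
    proof -
      have fm: "f (i + 1) \<in> mhom R (obj (kcone x K) (i + 1)) ?M" by (rule qHom_mhom[OF f]) simp
      show ?thesis
        using mhom_add[OF fm mod_smult[OF cpx_module[OF P] x z[OF a0]] z'[OF das]] mhom_smult[OF fm x z[OF a0]] by simp
    qed
    ultimately have fd: "f (i + 1) (dif (kcone x K) i (Node (\<zero>\<^bsub>obj K i\<^esub>, as))) =
        (x \<odot>\<^bsub>?M\<^esub> f (i + 1) ?a) \<oplus>\<^bsub>?M\<^esub> f (i + 1) ?b" by simp
    have e: "i + (n + 1) = i + n + 1" by simp
    have c: "f (i + 1) ?a \<in> carrier ?M" "f (i + 1) ?b \<in> carrier ?M"
      by (rule qHom_closed[OF f z[OF a0]], simp, rule qHom_closed[OF f z'[OF das]], simp)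
    have d: "dif Y (i + n) (f i (Node (\<zero>\<^bsub>obj K i\<^esub>, as))) \<in> carrier ?M"
      by (rule dif_closed[OF Y qHom_closed[OF f z'[OF as] refl] refl])
    have A1: "(x \<odot>\<^bsub>obj (qHom (susp K) Y) (n + 1)\<^esub> cone_conn K Y n ?g \<oplus>\<^bsub>obj (qHom (susp K) Y) (n + 1)\<^esub> dif (qHom (susp K) Y) n ?h) i as =
       (x \<odot>\<^bsub>?M\<^esub> (\<ominus>\<^bsub>?M\<^esub> (q [^] n \<odot>\<^bsub>?M\<^esub> f (i + 1) ?a))) \<oplus>\<^bsub>?M\<^esub>
       (dif Y (i + n) (f i (Node (\<zero>\<^bsub>obj K i\<^esub>, as))) \<ominus>\<^bsub>?M\<^esub> (q [^] n \<odot>\<^bsub>?M\<^esub> f (i + 1) ?b))"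
      unfolding qHom_apply(2)[OF as refl] qHom_apply(3)[OF as refl] qHom_dif_apply[OF as refl] e
        cone_split_snd[OF as] cone_split_snd[OF das]
      using as a0 by (simp add: cone_conn_def e cone_split_fst)
    show "snd (cone_split K (n + 1) (dif (qHom (kcone x K) Y) n f)) i as = snd (dif (cone_ext x K Y) n (cone_split K n f)) i as"
      unfolding D snd_conv cone_split_snd[OF as] qHom_dif_apply[OF z'[OF as] refl] fd A1
      using Y x c d mod_smult_comm[of ?M x "q [^] n" "f (i + 1) ?a"]
      by (simp add: mod_smult_add mod_smult_neg mod_diff_eq mod_neg_add mod_ac)
  qed
qed

text \<open>As graded modules the cone is the direct sum of \<open>K\<close> and its suspension, so a homomorphism from the cone
  is determined by its two restrictions, which can be prescribed freely.\<close>

lemma cone_split_iso: "chain_iso (qHom (kcone x K) Y) (cone_ext x K Y) (cone_split K)"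
  unfolding chain_iso_def
proof (intro conjI allI)
  note S = susp_n_complex[OF K] and P = kcone_n_complex[OF K x]
  show "chain_map R (qHom (kcone x K) Y) (cone_ext x K Y) (cone_split K)" by (rule cone_split_chain_map)
  fix n
  have dec: "Node (y, as) = Node (y, \<zero>\<^bsub>obj (susp K) i\<^esub>) \<oplus>\<^bsub>obj (kcone x K) i\<^esub> Node (\<zero>\<^bsub>obj K i\<^esub>, as)"
    if "y \<in> elts K i" "as \<in> elts (susp K) i" for y as i
    using that K S by (simp add: kcone_simps(3))
  have z: "Node (y, \<zero>\<^bsub>obj (susp K) i\<^esub>) \<in> elts (kcone x K) i" if "y \<in> elts K i" for y i
    using that S by simp
  have z': "Node (\<zero>\<^bsub>obj K i\<^esub>, as) \<in> elts (kcone x K) i" if "as \<in> elts (susp K) i" for as i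
    using that K by simp
  show "bij_betw (cone_split K n) (elts (qHom (kcone x K) Y) n) (elts (cone_ext x K Y) n)"
    unfolding bij_betw_def
  proof (intro conjI equalityI subsetI)
    show "inj_on (cone_split K n) (elts (qHom (kcone x K) Y) n)"
    proof (rule inj_onI)
      fix f g assume f: "f \<in> elts (qHom (kcone x K) Y) n" and g: "g \<in> elts (qHom (kcone x K) Y) n"
        and eq: "cone_split K n f = cone_split K n g"
      show "f = g"
      proof (rule qHom_eqI[OF f g])
        fix i p assume "p \<in> elts (kcone x K) i"
        then obtain y as where p: "p = Node (y, as)" "y \<in> elts K i" "as \<in> elts (susp K) i"
          by (rule kcone_cases)
        have "f i (Node (y, \<zero>\<^bsub>obj (susp K) i\<^esub>)) = g i (Node (y, \<zero>\<^bsub>obj (susp K) i\<^esub>))"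
          using eq p by (metis cone_split_fst)
        moreover have "f i (Node (\<zero>\<^bsub>obj K i\<^esub>, as)) = g i (Node (\<zero>\<^bsub>obj K i\<^esub>, as))"
          using eq p by (metis cone_split_snd)
        ultimately show "f i p = g i p"
          unfolding p(1) dec[OF p(2,3)]
          by (simp only: mhom_add[OF qHom_mhom[OF f refl] z[OF p(2)] z'[OF p(3)]]
              mhom_add[OF qHom_mhom[OF g refl] z[OF p(2)] z'[OF p(3)]])
      qed
    qed
    show "p \<in> elts (cone_ext x K Y) n" if "p \<in> cone_split K n ` elts (qHom (kcone x K) Y) n" for p
      using that cone_split_closed by auto
    fix p assume "p \<in> elts (cone_ext x K Y) n"
    then obtain g h where p: "p = (g, h)" "g \<in> elts (qHom K Y) n" "h \<in> elts (qHom (susp K) Y) n" by auto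
    define f where "f = (\<lambda>i. \<lambda>p\<in>elts (kcone x K) i.
       g i (fst (the_node p)) \<oplus>\<^bsub>obj Y (i + n)\<^esub> h i (snd (the_node p)))"
    have f: "f \<in> elts (qHom (kcone x K) Y) n"
      unfolding f_def
    proof (rule qHom_restrict)
      fix i
      show "module R (obj (kcone x K) i)" using P by simp
      have "(\<lambda>p. fst (the_node p)) \<in> mhom R (obj (kcone x K) i) (obj K i)"
        by (rule mhomI) (auto elim!: kcone_cases simp: kcone_simps(3,4))
      moreover have "(\<lambda>p. snd (the_node p)) \<in> mhom R (obj (kcone x K) i) (obj (susp K) i)"
        by (rule mhomI) (auto elim!: kcone_cases simp: kcone_simps(3,4))
      ultimately show "(\<lambda>p. g i (fst (the_node p)) \<oplus>\<^bsub>obj Y (i + n)\<^esub> h i (snd (the_node p)))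
         \<in> mhom R (obj (kcone x K) i) (obj Y (i + n))"
        using Y by (intro mhom_plus mhom_comp[OF _ qHom_mhom[OF p(2) refl]] mhom_comp[OF _ qHom_mhom[OF p(3) refl]]) auto
    qed
    have "cone_split K n f = p"
    proof (rule cone_ext_eqI[OF cone_split_closed[OF f]])
      show "p \<in> elts (cone_ext x K Y) n" using p by simp
      fix i
      show "fst (cone_split K n f) i y = fst p i y" if y: "y \<in> elts K i" for y
        using z[OF y] Y S qHom_closed[OF p(2) y refl]
        by (simp add: cone_split_fst[OF y] f_def p(1) mhom_zero[OF qHom_mhom[OF p(3) refl]])
      show "snd (cone_split K n f) i as = snd p i as" if as: "as \<in> elts (susp K) i" for as
        using z'[OF as] Y K qHom_closed[OF p(3) as refl]
        by (simp add: cone_split_snd[OF as] f_def p(1) mhom_zero[OF qHom_mhom[OF p(2) refl]])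
    qed
    then show "p \<in> cone_split K n ` elts (qHom (kcone x K) Y) n" using f by blast
  qed
qed

end

text \<open>The condition on \<open>conn\<close> in \<open>ext_data\<close> is read off from \<open>Hom(P, Y)\<close> being an \<open>N\<close>-complex, where \<open>P\<close> is the
  cone of the identity.\<close>

lemma cone_ext_data: "ext_data (qHom K Y) (qHom (susp K) Y) (cone_conn K Y)"
  unfolding ext_data_def
proof (intro conjI allI ballI)
  note S = susp_n_complex[OF K] and P = kcone_n_complex[OF K one_closed]
  note Q = qHom_n_complex[OF P Y]
  show H: "n_complex R N (qHom K Y)" and A: "n_complex R N (qHom (susp K) Y)"
    by (rule qHom_n_complex[OF K Y], rule qHom_n_complex[OF S Y])
  fix n
  show "cone_conn K Y n \<in> mhom R (obj (qHom K Y) n) (obj (qHom (susp K) Y) (n + 1))" by (rule cone_conn_mhom[OF refl])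
  fix g assume g: "g \<in> elts (qHom K Y) n"
  note iso = cone_split_iso[OF one_closed]
  have cm: "chain_map R (qHom (kcone \<one> K) Y) (cone_ext \<one> K Y) (cone_split K)" using iso by (simp add: chain_iso_def)
  let ?z = "\<zero>\<^bsub>obj (qHom (susp K) Y) n\<^esub>"
  have z: "?z \<in> elts (qHom (susp K) Y) n" using A by simp
  have "(g, ?z) \<in> elts (cone_ext \<one> K Y) n" using g z by simp
  then have "(g, ?z) \<in> cone_split K n ` elts (qHom (kcone \<one> K) Y) n"
    using iso by (simp add: chain_iso_def bij_betw_def)
  then obtain f where f: "f \<in> elts (qHom (kcone \<one> K) Y) n" "(g, ?z) = cone_split K n f" by blast
  let ?m = "n + int N"
  have "dpow (cone_ext \<one> K Y) n N (g, ?z) = cone_split K ?m (dpow (qHom (kcone \<one> K) Y) n N f)"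
    unfolding f(2) by (rule chain_map_dpow[OF cm Q f(1) refl, symmetric])
  also have "dpow (qHom (kcone \<one> K) Y) n N f = \<zero>\<^bsub>obj (qHom (kcone \<one> K) Y) ?m\<^esub>"
    by (rule dpow_ge_N[OF Q order_refl f(1) refl])
  also have "cone_split K ?m \<dots> = \<zero>\<^bsub>obj (cone_ext \<one> K Y) ?m\<^esub>"
    by (rule mhom_zero[OF chain_map_mhom[OF cm] cpx_module[OF Q] ext_cpx_obj_module]) (use H A in auto)
  finally have "\<one> \<odot>\<^bsub>obj (qHom (susp K) Y) ?m\<^esub> conn (qHom K Y) (qHom (susp K) Y) (cone_conn K Y) N n g
      \<oplus>\<^bsub>obj (qHom (susp K) Y) ?m\<^esub> dpow (qHom (susp K) Y) n N ?z = \<zero>\<^bsub>obj (qHom (susp K) Y) ?m\<^esub>"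
    using ext_cpx_dpow[OF H A cone_conn_mhom g z one_closed refl, of N] by simp
  then show "conn (qHom K Y) (qHom (susp K) Y) (cone_conn K Y) N n g = \<zero>\<^bsub>obj (qHom (susp K) Y) ?m\<^esub>"
    using A conn_closed[OF H A cone_conn_mhom g refl, of N] by (simp add: dpow_zero[OF A refl])
qed

end

end

section \<open>Acyclicity for the cone of the identity\<close>

context n_complexes
begin

text \<open>An element of the cone in degree \<open>i\<close> has \<open>N\<close> coordinates, the \<open>j\<close>-th of which lies in \<open>K\<close> in degree
  \<open>i + j\<close>. Treating the component in \<open>K\<close> as the coordinate with index \<open>0\<close> makes the cone of the identity
  uniform: up to the ends, its differential shifts the coordinates.\<close>

definition coord :: "'r koszul_elem \<Rightarrow> nat \<Rightarrow> 'r koszul_elem" where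
  "coord p j = (if j = 0 then fst (the_node p) else snd (the_node p) ! (j - 1))"

definition slot :: "('r, 'r koszul_elem) ncomplex \<Rightarrow> nat \<Rightarrow> 'r koszul_elem \<Rightarrow> int \<Rightarrow> 'r koszul_elem" where
  "slot K j a i = Node (if j = 0 then a else \<zero>\<^bsub>obj K i\<^esub>,
     map (\<lambda>k. if Suc k = j then a else \<zero>\<^bsub>obj K (i + 1 + int k)\<^esub>) [0..<N - 1])"

definition lead_zeros :: "('r, 'r koszul_elem) ncomplex \<Rightarrow> nat \<Rightarrow> int \<Rightarrow> 'r koszul_elem \<Rightarrow> bool" where
  "lead_zeros K p i w \<longleftrightarrow> (\<forall>j<p. coord w j = \<zero>\<^bsub>obj K (i + int j)\<^esub>)"

lemma coord_vec: "k < N \<Longrightarrow> coord (slot K j a i) k = (if k = j then a else \<zero>\<^bsub>obj K (i + int k)\<^esub>)"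
  by (cases k) (auto simp: coord_def slot_def algebra_simps)

context
  fixes K :: "('r, 'r koszul_elem) ncomplex" and x :: 'r
  assumes K: "n_complex R N K" and x: "x \<in> carrier R"
begin

lemma kcone_coordI:
  assumes "length as = N - 1" and "\<And>j. j < N \<Longrightarrow> coord (Node (y, as)) j \<in> elts K (i + int j)"
  shows "Node (y, as) \<in> elts (kcone x K) i"
proof -
  have "y \<in> elts K i" using assms(2)[of 0] N_ge_2 by (simp add: coord_def)
  moreover have "as ! j \<in> elts K (i + 1 + int j)" if "j < N - 1" for j
    using assms(2)[of "Suc j"] that by (simp add: coord_def algebra_simps)
  ultimately show ?thesis using assms(1) by (simp add: susp_carrier)
qed

lemma coord_closed: "w \<in> elts (kcone x K) i \<Longrightarrow> j < N \<Longrightarrow> m = i + int j \<Longrightarrow> coord w j \<in> elts K m"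
proof (erule kcone_cases)
  fix y as assume w: "w = Node (y, as)" "y \<in> elts K i" "as \<in> elts (susp K) i"
    and j: "j < N" and m: "m = i + int j"
  show "coord w j \<in> elts K m"
  proof (cases j)
    case (Suc k)
    then have "k < N - 1" using j by simp
    then have "as ! k \<in> elts K (i + 1 + int k)" using w unfolding susp_carrier by blast
    moreover have "i + 1 + int k = m" using m Suc by simp
    ultimately show ?thesis using Suc w by (simp add: coord_def)
  qed (use w m in \<open>simp add: coord_def\<close>)
qed

lemma coord_eqI:
  assumes w: "w \<in> elts (kcone x K) i" and w': "w' \<in> elts (kcone x K) i"
    and eq: "\<And>j. j < N \<Longrightarrow> coord w j = coord w' j"
  shows "w = w'"
proof -
  obtain y as where 1: "w = Node (y, as)" "as \<in> elts (susp K) i" using w by (rule kcone_cases)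
  obtain y' as' where 2: "w' = Node (y', as')" "as' \<in> elts (susp K) i" using w' by (rule kcone_cases)
  have "as = as'"
  proof (rule susp_eqI[OF 1(2) 2(2)])
    fix j assume "j < N - 1"
    then show "as ! j = as' ! j" using eq[of "Suc j"] 1 2 by (simp add: coord_def)
  qed
  then show ?thesis using eq[of 0] 1 2 N_ge_2 by (simp add: coord_def)
qed

lemma slot_closed:
  assumes "a \<in> elts K (i + int j)" "j < N"
  shows "slot K j a i \<in> elts (kcone x K) i"
  unfolding slot_def
proof (rule kcone_coordI)
  fix k assume "k < N"
  then show "coord (Node (if j = 0 then a else \<zero>\<^bsub>obj K i\<^esub>,
     map (\<lambda>k. if Suc k = j then a else \<zero>\<^bsub>obj K (i + 1 + int k)\<^esub>) [0..<N - 1])) k \<in> elts K (i + int k)"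
    using coord_vec[of k K j a i] assms K by (simp add: slot_def)
qed simp

lemma coord_add:
  assumes "w \<in> elts (kcone x K) i" "w' \<in> elts (kcone x K) i" "j < N" "m = i + int j"
  shows "coord (w \<oplus>\<^bsub>obj (kcone x K) i\<^esub> w') j = coord w j \<oplus>\<^bsub>obj K m\<^esub> coord w' j"
  using assms by (cases j) (auto elim!: kcone_cases simp: kcone_simps(3) coord_def algebra_simps)

lemma coord_smult:
  assumes "w \<in> elts (kcone x K) i" "j < N" "m = i + int j"
  shows "coord (r \<odot>\<^bsub>obj (kcone x K) i\<^esub> w) j = r \<odot>\<^bsub>obj K m\<^esub> coord w j"
  using assms by (cases j) (auto elim!: kcone_cases simp: kcone_simps(4) coord_def algebra_simps)

lemma coord_diff:
  assumes w: "w \<in> elts (kcone x K) i" and w': "w' \<in> elts (kcone x K) i" and j: "j < N" "m = i + int j"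
  shows "coord (w \<ominus>\<^bsub>obj (kcone x K) i\<^esub> w') j = coord w j \<ominus>\<^bsub>obj K m\<^esub> coord w' j"
proof -
  note P = kcone_module[OF K x]
  have d: "w \<ominus>\<^bsub>obj (kcone x K) i\<^esub> w' \<in> elts (kcone x K) i" using P w w' by simp
  have "coord ((w \<ominus>\<^bsub>obj (kcone x K) i\<^esub> w') \<oplus>\<^bsub>obj (kcone x K) i\<^esub> w') j = coord w j" using P w w' by simp
  then show ?thesis
    using K coord_closed[OF w j] coord_closed[OF w' j] coord_closed[OF d j] by (simp add: coord_add[OF d w' j] mod_eq_diff)
qed

lemma coord_mhom: "j < N \<Longrightarrow> m = i + int j \<Longrightarrow> (\<lambda>w. coord w j) \<in> mhom R (obj (kcone x K) i) (obj K m)"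
  by (rule mhomI) (auto intro: coord_closed coord_add coord_smult)

lemma slot_mhom: "j < N \<Longrightarrow> m = i + int j \<Longrightarrow> (\<lambda>a. slot K j a i) \<in> mhom R (obj K m) (obj (kcone x K) i)"
proof (rule mhomI)
  assume j: "j < N" and m: "m = i + int j"
  note P = kcone_module[OF K x]
  fix a assume a: "a \<in> elts K m"
  show va: "slot K j a i \<in> elts (kcone x K) i" using a j m by (intro slot_closed) auto
  {
    fix b assume b: "b \<in> elts K m"
    have vb: "slot K j b i \<in> elts (kcone x K) i" using b j m by (intro slot_closed) auto
    show "slot K j (a \<oplus>\<^bsub>obj K m\<^esub> b) i = slot K j a i \<oplus>\<^bsub>obj (kcone x K) i\<^esub> slot K j b i"
    proof (rule coord_eqI)
      show "slot K j (a \<oplus>\<^bsub>obj K m\<^esub> b) i \<in> elts (kcone x K) i" using a b j m K by (intro slot_closed) auto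
      show "slot K j a i \<oplus>\<^bsub>obj (kcone x K) i\<^esub> slot K j b i \<in> elts (kcone x K) i" using P va vb by simp
      fix k assume k: "k < N"
      show "coord (slot K j (a \<oplus>\<^bsub>obj K m\<^esub> b) i) k = coord (slot K j a i \<oplus>\<^bsub>obj (kcone x K) i\<^esub> slot K j b i) k"
        unfolding coord_add[OF va vb k refl] using k K m by (simp add: coord_vec)
    qed
  }
  fix r assume r: "r \<in> carrier R"
  show "slot K j (r \<odot>\<^bsub>obj K m\<^esub> a) i = r \<odot>\<^bsub>obj (kcone x K) i\<^esub> slot K j a i"
  proof (rule coord_eqI)
    show "slot K j (r \<odot>\<^bsub>obj K m\<^esub> a) i \<in> elts (kcone x K) i" using a r j m K by (intro slot_closed) auto
    show "r \<odot>\<^bsub>obj (kcone x K) i\<^esub> slot K j a i \<in> elts (kcone x K) i" using P va r by simp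
    fix k assume k: "k < N"
    show "coord (slot K j (r \<odot>\<^bsub>obj K m\<^esub> a) i) k = coord (r \<odot>\<^bsub>obj (kcone x K) i\<^esub> slot K j a i) k"
      unfolding coord_smult[OF va k refl] using k K m r by (simp add: coord_vec)
  qed
qed

lemma lead_zeros_all:
  assumes w: "w \<in> elts (kcone x K) i" and z: "lead_zeros K N i w"
  shows "w = \<zero>\<^bsub>obj (kcone x K) i\<^esub>"
proof (rule coord_eqI[OF w])
  have P: "module R (obj (kcone x K) i)" by (rule kcone_module[OF K x])
  then show "\<zero>\<^bsub>obj (kcone x K) i\<^esub> \<in> elts (kcone x K) i" by simp
  fix j assume j: "j < N"
  show "coord w j = coord \<zero>\<^bsub>obj (kcone x K) i\<^esub> j"
    using z j mhom_zero[OF coord_mhom[OF j refl] P] K by (simp add: lead_zeros_def)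
qed

lemma lead_zeros_peel:
  assumes w: "w \<in> elts (kcone x K) i" and z: "lead_zeros K p i w" and p: "p < N"
    and v: "v \<in> elts (kcone x K) i" "lead_zeros K p i v" "coord v p = coord w p"
  shows "lead_zeros K (Suc p) i (w \<ominus>\<^bsub>obj (kcone x K) i\<^esub> v)"
  unfolding lead_zeros_def
proof (intro allI impI)
  fix j assume j: "j < Suc p"
  then have jN: "j < N" using p by simp
  show "coord (w \<ominus>\<^bsub>obj (kcone x K) i\<^esub> v) j = \<zero>\<^bsub>obj K (i + int j)\<^esub>"
    unfolding coord_diff[OF w v(1) jN refl]
    using K z v(2,3) j coord_closed[OF w p refl] by (cases "j = p") (auto simp: lead_zeros_def)
qed

text \<open>The elements with a single nonzero coordinate generate the cone.\<close>

lemma kcone_hom_eqI: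
  assumes L: "module R L" and f: "f \<in> mhom R (obj (kcone x K) i) L" and g: "g \<in> mhom R (obj (kcone x K) i) L"
    and eq: "\<And>j a. j < N \<Longrightarrow> a \<in> elts K (i + int j) \<Longrightarrow> f (slot K j a i) = g (slot K j a i)"
    and w: "w \<in> elts (kcone x K) i"
  shows "f w = g w"
proof -
  let ?P = "obj (kcone x K) i"
  have P: "module R ?P" by (rule kcone_module[OF K x])
  have "f w = g w" if "w \<in> carrier ?P" "lead_zeros K (N - p) i w" "p \<le> N" for p w
    using that
  proof (induction p arbitrary: w)
    case 0
    then have "w = \<zero>\<^bsub>?P\<^esub>" by (intro lead_zeros_all) auto
    then show ?case by (simp add: mhom_zero[OF f P L] mhom_zero[OF g P L])
  next
    case (Suc p)
    let ?k = "N - Suc p"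
    have k: "?k < N" "Suc ?k = N - p" using Suc.prems by auto
    let ?v = "slot K ?k (coord w ?k) i"
    have c: "coord w ?k \<in> elts K (i + int ?k)" by (rule coord_closed[OF Suc.prems(1) k(1) refl])
    have v: "?v \<in> carrier ?P" by (rule slot_closed[OF c k(1)])
    have "lead_zeros K (Suc ?k) i (w \<ominus>\<^bsub>?P\<^esub> ?v)"
      using Suc.prems k v by (intro lead_zeros_peel) (auto simp: lead_zeros_def coord_vec)
    then have "f (w \<ominus>\<^bsub>?P\<^esub> ?v) = g (w \<ominus>\<^bsub>?P\<^esub> ?v)" using Suc P v k(2) by (intro Suc.IH) auto
    moreover have "f ?v = g ?v" by (rule eq[OF k(1) c])
    moreover have "f w = f (w \<ominus>\<^bsub>?P\<^esub> ?v) \<oplus>\<^bsub>L\<^esub> f ?v" "g w = g (w \<ominus>\<^bsub>?P\<^esub> ?v) \<oplus>\<^bsub>L\<^esub> g ?v"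
      using mhom_add[OF f mod_diff[OF P Suc.prems(1) v] v] mhom_add[OF g mod_diff[OF P Suc.prems(1) v] v]
        Suc.prems(1) v P by simp_all
    ultimately show ?case by simp
  qed
  from this[of w N] show ?thesis using w by (simp add: lead_zeros_def)
qed

end

lemma coord_dif_one:
  assumes K: "n_complex R N K" and w: "w \<in> elts (kcone \<one> K) i"
  shows "coord (dif (kcone \<one> K) i w) 0 = dif K i (coord w 0) \<oplus>\<^bsub>obj K (i + 1)\<^esub> coord w 1"
    and "0 < j \<Longrightarrow> j < N - 1 \<Longrightarrow> coord (dif (kcone \<one> K) i w) j = coord w (Suc j)"
proof -
  obtain y as where p: "w = Node (y, as)" "y \<in> elts K i" "as \<in> elts (susp K) i"
    using w by (rule kcone_cases)
  have l: "length as = N - 1" using p by (simp add: susp_carrier)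
  show "coord (dif (kcone \<one> K) i w) 0 = dif K i (coord w 0) \<oplus>\<^bsub>obj K (i + 1)\<^esub> coord w 1"
    using p K susp_hd[OF K one_closed p(3) refl] by (simp add: kcone_simps(5) coord_def)
  assume j: "0 < j" "j < N - 1"
  then obtain j' where j': "j = Suc j'" by (cases j) auto
  have "j' < N - 1" "j' < N - 2" using j j' by auto
  then show "coord (dif (kcone \<one> K) i w) j = coord w (Suc j)"
    using p j' by (simp add: kcone_simps(5) coord_def susp_dif_nth[OF l])
qed

lemma dif_lead_zeros:
  assumes K: "n_complex R N K" and w: "w \<in> elts (kcone \<one> K) i"
    and z: "lead_zeros K (Suc p) i w" and p: "Suc p < N" and i': "i' = i + 1"
  shows "lead_zeros K p i' (dif (kcone \<one> K) i w)" "coord (dif (kcone \<one> K) i w) p = coord w (Suc p)"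
proof -
  have z0: "coord w 0 = \<zero>\<^bsub>obj K i\<^esub>" using z by (simp add: lead_zeros_def)
  have d0: "dif K i \<zero>\<^bsub>obj K i\<^esub> = \<zero>\<^bsub>obj K (i + 1)\<^esub>" using K by (simp add: mhom_zero[OF cpx_dif[OF K refl]])
  have c1: "coord w 1 \<in> elts K (i + 1)" by (rule coord_closed[OF K one_closed w]) (use N_ge_2 in auto)
  have c: "coord (dif (kcone \<one> K) i w) j = coord w (Suc j)" if "j \<le> p" for j
    using coord_dif_one[OF K w] that p z0 d0 c1 K by (cases "j = 0") auto
  show "coord (dif (kcone \<one> K) i w) p = coord w (Suc p)" by (rule c) simp
  show "lead_zeros K p i' (dif (kcone \<one> K) i w)"
    unfolding lead_zeros_def using z i' by (auto simp: c lead_zeros_def algebra_simps)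
qed

end

context q_complexes
begin

text \<open>A product of signs and powers of \<open>q\<close> is a unit.\<close>

lemma leibniz_unit: "\<exists>c\<in>carrier R. c \<otimes> leibniz j n = \<one>"
proof (induction j arbitrary: n)
  case 0
  then show ?case by auto
next
  case (Suc j)
  then obtain c where c: "c \<in> carrier R" "c \<otimes> leibniz j (n + 1) = \<one>" by blast
  have "(c \<otimes> (\<ominus> (q [^] (- n)))) \<otimes> leibniz (Suc j) n = (c \<otimes> leibniz j (n + 1)) \<otimes> (q [^] (- n) \<otimes> q [^] n)"
    using c(1) by (simp add: l_minus r_minus m_ac)
  also have "\<dots> = \<one>" by (simp add: c q_int_unit)
  finally show ?case using c by (intro bexI[of _ "c \<otimes> (\<ominus> (q [^] (- n)))"]) auto
qed

text \<open>The differential moves the leading coordinate to the left, so modulo elements with more leading zeros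
  every element of the cone of the identity is a differential, unless only its last coordinate is nonzero.
  A cocycle \<open>G\<close> therefore vanishes everywhere once it vanishes on the last coordinate. The induction runs
  over the number of leading zeros.\<close>

lemma kcone_one_cycle_zero:
  assumes K: "n_complex R N K" and Y: "n_complex R N Y"
    and G: "G \<in> elts (qHom (kcone \<one> K) Y) n"
    and dG: "dif (qHom (kcone \<one> K) Y) n G = \<zero>\<^bsub>obj (qHom (kcone \<one> K) Y) (n + 1)\<^esub>"
    and last: "\<And>i a. a \<in> elts K (i + int (N - 1)) \<Longrightarrow> G i (slot K (N - 1) a i) = \<zero>\<^bsub>obj Y (i + n)\<^esub>"
    and w: "w \<in> elts (kcone \<one> K) i"
  shows "G i w = \<zero>\<^bsub>obj Y (i + n)\<^esub>"
proof -
  let ?P = "kcone \<one> K"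
  note P = kcone_n_complex[OF K one_closed]
  have "G i w = \<zero>\<^bsub>obj Y (i + n)\<^esub>" if "w \<in> elts ?P i" "lead_zeros K (N - 1 - p) i w" "p \<le> N - 1" for p i w
    using that
  proof (induction p arbitrary: i w)
    case 0
    have N1: "N - 1 < N" using N_ge_2 by simp
    have c: "coord w (N - 1) \<in> elts K (i + int (N - 1))" by (rule coord_closed[OF K one_closed 0(1) N1 refl])
    have "w = slot K (N - 1) (coord w (N - 1)) i"
    proof (rule coord_eqI[OF K one_closed 0(1) slot_closed[OF K one_closed c N1]])
      fix j assume "j < N"
      then show "coord w j = coord (slot K (N - 1) (coord w (N - 1)) i) j"
        using 0(2) by (auto simp: coord_vec lead_zeros_def)
    qed
    then show ?case using last[OF c] by metis
  next
    case (Suc p)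
    let ?k = "N - 1 - Suc p"
    have k: "?k < N" "Suc ?k = N - 1 - p" "Suc ?k < N" using Suc.prems N_ge_2 by auto
    have e: "i - 1 + int (Suc ?k) = i + int ?k" by simp
    let ?v = "slot K (Suc ?k) (coord w ?k) (i - 1)"
    have c: "coord w ?k \<in> elts K (i + int ?k)" by (rule coord_closed[OF K one_closed Suc.prems(1) k(1) refl])
    have v: "?v \<in> elts ?P (i - 1)" using c by (intro slot_closed[OF K one_closed _ k(3)]) (simp add: e)
    have dv: "dif ?P (i - 1) ?v \<in> elts ?P i" by (rule dif_closed[OF P v]) simp
    have zv: "lead_zeros K (Suc ?k) (i - 1) ?v" using k by (auto simp: lead_zeros_def coord_vec)
    have i: "i = i - 1 + 1" by simp
    have "lead_zeros K ?k i (dif ?P (i - 1) ?v)" by (rule dif_lead_zeros(1)[OF K v zv k(3) i])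
    moreover have "coord (dif ?P (i - 1) ?v) ?k = coord w ?k"
      using dif_lead_zeros(2)[OF K v zv k(3) i] coord_vec[OF k(3), of K "Suc ?k" "coord w ?k" "i - 1"] by simp
    ultimately have "lead_zeros K (Suc ?k) i (w \<ominus>\<^bsub>obj ?P i\<^esub> dif ?P (i - 1) ?v)"
      using Suc.prems k dv by (intro lead_zeros_peel[OF K one_closed]) auto
    then have 1: "G i (w \<ominus>\<^bsub>obj ?P i\<^esub> dif ?P (i - 1) ?v) = \<zero>\<^bsub>obj Y (i + n)\<^esub>"
      using Suc P dv k(2) by (intro Suc.IH) auto
    have Gv: "G (i - 1) ?v = \<zero>\<^bsub>obj Y (i - 1 + n)\<^esub>"
      using Suc.prems v zv k(2) by (intro Suc.IH) auto
    have Gdv: "G i (dif ?P (i - 1) ?v) \<in> elts Y (i + n)" by (rule qHom_closed[OF G dv refl])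
    have a: "dif (qHom ?P Y) n G (i - 1) ?v = \<zero>\<^bsub>obj Y (i + n)\<^esub>"
      unfolding dG by (rule qHom_apply(1)[OF v]) simp
    have b: "dif (qHom ?P Y) n G (i - 1) ?v = dif Y (i - 1 + n) (G (i - 1) ?v) \<ominus>\<^bsub>obj Y (i + n)\<^esub>
        (q [^] n \<odot>\<^bsub>obj Y (i + n)\<^esub> G i (dif ?P (i - 1) ?v))"
      using qHom_dif_apply[OF v, of "i + n" n Y G] by simp
    have c0: "dif Y (i - 1 + n) (G (i - 1) ?v) = \<zero>\<^bsub>obj Y (i + n)\<^esub>"
      unfolding Gv using Y by (intro mhom_zero[OF cpx_dif[OF Y]]) auto
    have "\<zero>\<^bsub>obj Y (i + n)\<^esub> \<ominus>\<^bsub>obj Y (i + n)\<^esub> (q [^] n \<odot>\<^bsub>obj Y (i + n)\<^esub> G i (dif ?P (i - 1) ?v)) = \<zero>\<^bsub>obj Y (i + n)\<^esub>"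
      using b unfolding a c0 by (rule sym)
    then have "\<ominus>\<^bsub>obj Y (i + n)\<^esub> (q [^] n \<odot>\<^bsub>obj Y (i + n)\<^esub> G i (dif ?P (i - 1) ?v)) = \<zero>\<^bsub>obj Y (i + n)\<^esub>"
      using Y Gdv by (simp add: mod_diff_eq)
    then have "q [^] n \<odot>\<^bsub>obj Y (i + n)\<^esub> G i (dif ?P (i - 1) ?v) = \<zero>\<^bsub>obj Y (i + n)\<^esub>"
      using Y Gdv by (metis mod_neg_neg mod_neg_zero mod_smult cpx_module q_int_closed)
    then have "(q [^] (- n) \<otimes> q [^] n) \<odot>\<^bsub>obj Y (i + n)\<^esub> G i (dif ?P (i - 1) ?v) = \<zero>\<^bsub>obj Y (i + n)\<^esub>"
      using Y Gdv by (simp add: mod_mult_smult)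
    then have 2: "G i (dif ?P (i - 1) ?v) = \<zero>\<^bsub>obj Y (i + n)\<^esub>"
      using Y Gdv by (simp add: q_int_unit)
    have "G i w = G i (w \<ominus>\<^bsub>obj ?P i\<^esub> dif ?P (i - 1) ?v) \<oplus>\<^bsub>obj Y (i + n)\<^esub> G i (dif ?P (i - 1) ?v)"
      using Suc.prems(1) dv P by (subst mhom_add[OF qHom_mhom[OF G refl], symmetric]) auto
    then show ?case using 1 2 Y by simp
  qed
  from this[of w i "N - 1"] show ?thesis using w by (simp add: lead_zeros_def)
qed

text \<open>By the preceding lemma a cocycle \<open>f\<close> is known from its values on the last coordinate. Reading these
  values off the coordinate with index \<open>0\<close> instead gives a homomorphism \<open>f0\<close> of degree lower by \<open>N - 1\<close>.
  Since \<open>d\<^bsup>N-1\<^esup>\<close> moves the last coordinate to the first place, \<open>d\<^bsup>N-1\<^esup> f0\<close> agrees with \<open>f\<close> on the last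
  coordinate up to a unit, and so everywhere after rescaling.\<close>

lemma kcone_one_exact:
  assumes K: "n_complex R N K" and Y: "n_complex R N Y"
  shows "exact_at (qHom (kcone \<one> K) Y) 1 n"
  unfolding exact_at_def
proof (intro ballI impI)
  let ?P = "kcone \<one> K" and ?Q = "qHom (kcone \<one> K) Y" and ?m = "n - int (N - 1)"
  note P = kcone_n_complex[OF K one_closed]
  note Q = qHom_n_complex[OF P Y]
  have N1: "N - 1 < N" using N_ge_2 by simp
  fix f assume f: "f \<in> elts ?Q n" and "dpow ?Q n 1 f = \<zero>\<^bsub>obj ?Q (n + int 1)\<^esub>"
  then have df: "dif ?Q n f = \<zero>\<^bsub>obj ?Q (n + 1)\<^esub>" by simp
  obtain c where c: "c \<in> carrier R" "c \<otimes> leibniz (N - 1) ?m = \<one>" using leibniz_unit by blast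
  \<comment> \<open>Degree \<open>N - 1\<close> below that of \<open>f\<close>: the coordinate of \<open>p\<close> with index \<open>0\<close> lies in the degree of \<open>p\<close>, and as
    the last coordinate it belongs to an element of degree lower by \<open>N - 1\<close>.\<close>
  define f0 where "f0 = (\<lambda>i. \<lambda>p\<in>elts ?P i. f (i - int (N - 1)) (slot K (N - 1) (coord p 0) (i - int (N - 1))))"
  have f0: "f0 \<in> elts ?Q ?m"
    unfolding f0_def
  proof (rule qHom_restrict)
    fix i
    show "(\<lambda>p. f (i - int (N - 1)) (slot K (N - 1) (coord p 0) (i - int (N - 1)))) \<in> mhom R (obj ?P i) (obj Y (i + ?m))"
      by (rule mhom_comp[OF mhom_comp[OF coord_mhom[OF K one_closed] slot_mhom[OF K one_closed N1]] qHom_mhom[OF f]])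
        (use N_ge_2 in auto)
  qed (use P in simp)
  let ?f = "c \<odot>\<^bsub>obj ?Q ?m\<^esub> f0" and ?n = "?m + int (N - 1)"
  have f': "?f \<in> elts ?Q ?m" using Q f0 c by simp
  let ?F = "dpow ?Q ?m (N - 1) ?f"
  have F: "?F \<in> elts ?Q n" by (rule dpow_closed[OF Q f']) simp
  have dF: "dif ?Q n ?F = \<zero>\<^bsub>obj ?Q (n + 1)\<^esub>"
  proof -
    have "dpow ?Q n 1 ?F = dpow ?Q ?m N ?f" using N_ge_2 by (intro dpow_comp) auto
    also have "\<dots> = \<zero>\<^bsub>obj ?Q (n + 1)\<^esub>" using N_ge_2 by (intro dpow_ge_N[OF Q order_refl f']) (simp add: of_nat_diff)
    finally show ?thesis by simp
  qed
  have Fv: "?F i (slot K (N - 1) a i) = f i (slot K (N - 1) a i)" if a: "a \<in> elts K (i + int (N - 1))" for i a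
  proof -
    let ?v = "slot K (N - 1) a i"
    have v: "?v \<in> elts ?P i" by (rule slot_closed[OF K one_closed a N1])
    have dk: "lead_zeros K (N - 1 - k) (i + int k) (dpow ?P i k ?v) \<and> coord (dpow ?P i k ?v) (N - 1 - k) = a" if "k \<le> N - 1" for k
      using that
    proof (induction k)
      case 0
      then show ?case using N1 by (auto simp: lead_zeros_def coord_vec)
    next
      case (Suc k)
      let ?p = "N - 1 - Suc k"
      have p: "Suc ?p = N - 1 - k" "Suc ?p < N" using Suc.prems N_ge_2 by auto
      have dv: "dpow ?P i k ?v \<in> elts ?P (i + int k)" by (rule dpow_closed[OF P v refl])
      have z: "lead_zeros K (Suc ?p) (i + int k) (dpow ?P i k ?v)" unfolding p(1) using Suc by simp
      have "i + int (Suc k) = i + int k + 1" by simp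
      from dif_lead_zeros[OF K dv z p(2) this] show ?case unfolding p(1) using Suc by simp
    qed
    have dv: "dpow ?P i k ?v \<in> elts ?P (i + int k)" for k by (rule dpow_closed[OF P v refl])
    have f0k: "f0 (i + int k) (dpow ?P i k ?v) = f (i + int k - int (N - 1)) (slot K (N - 1) (coord (dpow ?P i k ?v) 0) (i + int k - int (N - 1)))" for k
      using dv[of k] by (simp add: f0_def)
    have "dpow ?Q ?m (N - 1) f0 i ?v = leibniz (N - 1) ?m \<odot>\<^bsub>obj Y (i + n)\<^esub> f0 (i + int (N - 1)) (dpow ?P i (N - 1) ?v)"
    proof (rule qHom_dpow_leading[OF P Y f0 v])
      fix k assume k: "k < N - 1"
      let ?i = "i + int k - int (N - 1)"
      have "lead_zeros K (N - 1 - k) (i + int k) (dpow ?P i k ?v)" using dk[of k] k by simp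
      then have "coord (dpow ?P i k ?v) 0 = \<zero>\<^bsub>obj K (i + int k)\<^esub>" using k by (auto simp: lead_zeros_def)
      moreover have "slot K (N - 1) \<zero>\<^bsub>obj K (i + int k)\<^esub> ?i = \<zero>\<^bsub>obj ?P ?i\<^esub>"
        using K P by (intro mhom_zero[OF slot_mhom[OF K one_closed N1]]) auto
      moreover have "f ?i \<zero>\<^bsub>obj ?P ?i\<^esub> = \<zero>\<^bsub>obj Y (i + int k + ?m)\<^esub>"
        using P Y by (intro mhom_zero[OF qHom_mhom[OF f]]) auto
      ultimately show "f0 (i + int k) (dpow ?P i k ?v) = \<zero>\<^bsub>obj Y (i + int k + ?m)\<^esub>" by (simp only: f0k)
    qed simp
    also have "f0 (i + int (N - 1)) (dpow ?P i (N - 1) ?v) = f i ?v"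
      unfolding f0k using dk[of "N - 1"] by simp
    finally have D: "dpow ?Q ?m (N - 1) f0 i ?v = leibniz (N - 1) ?m \<odot>\<^bsub>obj Y (i + n)\<^esub> f i ?v" .
    have "?F = c \<odot>\<^bsub>obj ?Q n\<^esub> dpow ?Q ?m (N - 1) f0" using c f0 by (intro dpow_smult[OF Q]) auto
    then have "?F i ?v = c \<odot>\<^bsub>obj Y (i + n)\<^esub> (leibniz (N - 1) ?m \<odot>\<^bsub>obj Y (i + n)\<^esub> f i ?v)"
      by (simp only: qHom_apply(3)[OF v refl] D)
    also have "\<dots> = (c \<otimes> leibniz (N - 1) ?m) \<odot>\<^bsub>obj Y (i + n)\<^esub> f i ?v"
      using Y c(1) qHom_closed[OF f v refl] by (simp add: mod_mult_smult)
    also have "\<dots> = f i ?v" using c Y qHom_closed[OF f v refl] by simp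
    finally show ?thesis .
  qed
  let ?G = "?F \<ominus>\<^bsub>obj ?Q n\<^esub> f"
  have G: "?G \<in> elts ?Q n" using Q F f by simp
  have dG: "dif ?Q n ?G = \<zero>\<^bsub>obj ?Q (n + 1)\<^esub>"
    unfolding mhom_diff[OF cpx_dif[OF Q refl] cpx_module[OF Q] cpx_module[OF Q] F f] dF df
    by (rule mod_diff_self[OF cpx_module[OF Q] mod_zero[OF cpx_module[OF Q]]])
  have "?F = f"
  proof (rule qHom_eqI[OF F f])
    fix i w assume w: "w \<in> elts ?P i"
    have "?G i w = \<zero>\<^bsub>obj Y (i + n)\<^esub>"
    proof (rule kcone_one_cycle_zero[OF K Y G dG _ w])
      fix i a assume a: "a \<in> elts K (i + int (N - 1))"
      have v: "slot K (N - 1) a i \<in> elts ?P i" by (rule slot_closed[OF K one_closed a N1])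
      show "?G i (slot K (N - 1) a i) = \<zero>\<^bsub>obj Y (i + n)\<^esub>"
        unfolding qHom_diff_apply[OF P Y F f v refl] Fv[OF a] using Y qHom_closed[OF f v refl] by simp
    qed
    then show "?F i w = f i w"
      unfolding qHom_diff_apply[OF P Y F f w refl]
      using Y qHom_closed[OF f w refl] qHom_closed[OF F w refl] by (simp add: mod_diff_eq_zero)
  qed
  then show "\<exists>y\<in>elts ?Q ?m. dpow ?Q ?m (N - 1) y = f" using f' by blast
qed

text \<open>Exactness in amplitude \<open>1\<close> implies exactness in all amplitudes.\<close>

theorem cone_ext_acyclic:
  fixes K :: "('r, 'r koszul_elem) ncomplex"
  assumes K: "n_complex R N K" and Y: "n_complex R N Y"
  shows "ext_acyclic (qHom K Y) (qHom (susp K) Y) (cone_conn K Y)"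
  unfolding ext_acyclic_def
proof (intro conjI ballI allI)
  show e: "ext_data (qHom K Y) (qHom (susp K) Y) (cone_conn K Y)" by (rule cone_ext_data[OF K Y])
  fix t n assume t: "t \<in> {1..N - 1}"
  note Q = qHom_n_complex[OF kcone_n_complex[OF K one_closed] Y]
  have "exact_at (qHom (kcone \<one> K) Y) t n"
    using t N_ge_2 by (intro exact_change[OF Q _ _ kcone_one_exact[OF K Y]]) auto
  then show "exact_at (cone_ext \<one> K Y) t n"
    using hiso_exact_at[OF chain_iso_hiso[OF cone_split_iso[OF K Y one_closed] Q ext_cpx_n_complex[OF e one_closed]]
        Q ext_cpx_n_complex[OF e one_closed]] t N_ge_2 by auto
qed

end

section \<open>Subcomplexes and free complexes of finite rank\<close>

context n_complexes
begin

definition sub_cpx :: "('r, 'y) ncomplex \<Rightarrow> (int \<Rightarrow> 'y set) \<Rightarrow> ('r, 'y) ncomplex" where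
  "sub_cpx Y S = Y\<lparr>obj := \<lambda>n. obj Y n\<lparr>carrier := S n\<rparr>\<rparr>"

definition subcomplex :: "('r, 'y) ncomplex \<Rightarrow> (int \<Rightarrow> 'y set) \<Rightarrow> bool" where
  "subcomplex Y S \<longleftrightarrow> (\<forall>n. S n \<subseteq> elts Y n \<and> \<zero>\<^bsub>obj Y n\<^esub> \<in> S n \<and>
     (\<forall>x\<in>S n. \<forall>y\<in>S n. x \<oplus>\<^bsub>obj Y n\<^esub> y \<in> S n) \<and> (\<forall>r\<in>carrier R. \<forall>x\<in>S n. r \<odot>\<^bsub>obj Y n\<^esub> x \<in> S n) \<and>
     (\<forall>x\<in>S n. dif Y n x \<in> S (n + 1)))"

lemma sub_cpx_simps [simp]:
  "elts (sub_cpx Y S) n = S n" "\<zero>\<^bsub>obj (sub_cpx Y S) n\<^esub> = \<zero>\<^bsub>obj Y n\<^esub>"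
  "x \<oplus>\<^bsub>obj (sub_cpx Y S) n\<^esub> y = x \<oplus>\<^bsub>obj Y n\<^esub> y" "r \<odot>\<^bsub>obj (sub_cpx Y S) n\<^esub> x = r \<odot>\<^bsub>obj Y n\<^esub> x"
  "dif (sub_cpx Y S) n = dif Y n"
  by (simp_all add: sub_cpx_def)

lemma sub_cpx_sub_cpx [simp]: "sub_cpx (sub_cpx Y T) S = sub_cpx Y S"
  by (simp add: sub_cpx_def)

lemma sub_cpx_dpow [simp]: "dpow (sub_cpx Y S) n k = dpow Y n k"
  by (induction k) auto

lemma sub_cpx_module: "n_complex R N Y \<Longrightarrow> subcomplex Y S \<Longrightarrow> module R (obj (sub_cpx Y S) n)"
  unfolding sub_cpx_def using module_restrict[of "obj Y n" "S n"] by (simp add: subcomplex_def)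

lemma subcomplex_closed: "subcomplex Y S \<Longrightarrow> x \<in> S n \<Longrightarrow> x \<in> elts Y n"
  by (auto simp: subcomplex_def)

lemma sub_cpx_n_complex:
  assumes Y: "n_complex R N Y" and S: "subcomplex Y S"
  shows "n_complex R N (sub_cpx Y S)"
  unfolding n_complex_def
proof (intro allI conjI ballI)
  fix n
  show "module R (obj (sub_cpx Y S) n)" by (rule sub_cpx_module[OF Y S])
  show "dif (sub_cpx Y S) n \<in> mhom R (obj (sub_cpx Y S) n) (obj (sub_cpx Y S) (n + 1))"
    using S Y by (intro mhomI) (auto simp: subcomplex_def subset_iff mhom_add[OF cpx_dif] mhom_smult[OF cpx_dif])
  fix x assume "x \<in> elts (sub_cpx Y S) n"
  then show "dpow (sub_cpx Y S) n N x = \<zero>\<^bsub>obj (sub_cpx Y S) (n + int N)\<^esub>"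
    using subcomplex_closed[OF S] Y by (simp add: dpow_ge_N)
qed

lemma sub_cpx_incl: "subcomplex Y S \<Longrightarrow> chain_map R (sub_cpx Y S) Y (\<lambda>n x. x)"
  unfolding chain_map_def by (auto intro!: mhomI subcomplex_closed)

text \<open>\<open>B\<close> behaves as a basis of \<open>M\<close> with respect to the one target module \<open>L\<close>. A formula cannot quantify over
  the carrier type of \<open>L\<close>, so freeness is relative to a target, and in \<open>finite_basis\<close> to a target type.\<close>

definition free_on :: "('r, 'm) module \<Rightarrow> 'm set \<Rightarrow> ('r, 'l) module \<Rightarrow> bool" where
  "free_on M B L \<longleftrightarrow> B \<subseteq> carrier M \<and>
     (\<forall>v. (\<forall>b\<in>B. v b \<in> carrier L) \<longrightarrow> (\<exists>f\<in>mhom R M L. \<forall>b\<in>B. f b = v b)) \<and>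
     (\<forall>f\<in>mhom R M L. \<forall>g\<in>mhom R M L. (\<forall>b\<in>B. f b = g b) \<longrightarrow> (\<forall>w\<in>carrier M. f w = g w))"

definition finite_basis :: "'l itself \<Rightarrow> ('r, 'x) ncomplex \<Rightarrow> (int \<Rightarrow> 'x set) \<Rightarrow> bool" where
  "finite_basis TL K B \<longleftrightarrow> finite (Sigma UNIV B) \<and>
     (\<forall>i. \<forall>L :: ('r, 'l) module. module R L \<longrightarrow> free_on (obj K i) (B i) L)"

lemma free_onE:
  assumes "free_on M B L" "\<And>b. b \<in> B \<Longrightarrow> v b \<in> carrier L"
  obtains f where "f \<in> mhom R M L" "\<And>b. b \<in> B \<Longrightarrow> f b = v b"
  using assms unfolding free_on_def by blast

lemma free_on_mem: "free_on M B L \<Longrightarrow> b \<in> B \<Longrightarrow> b \<in> carrier M"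
  unfolding free_on_def by blast

lemma free_on_eqI:
  assumes "free_on M B L" "f \<in> mhom R M L" "g \<in> mhom R M L" "\<And>b. b \<in> B \<Longrightarrow> f b = g b" "w \<in> carrier M"
  shows "f w = g w"
  using assms unfolding free_on_def by blast

text \<open>Each basis element of \<open>K\<close> contributes one basis element to the cone for each of the \<open>N\<close> coordinates.\<close>

lemma kcone_finite_basis:
  assumes B: "finite_basis TYPE('l) K B" and K: "n_complex R N K" and x: "x \<in> carrier R"
  shows "finite_basis TYPE('l) (kcone x K) (\<lambda>i. \<Union>j<N. (\<lambda>b. slot K j b i) ` B (i + int j))"
  unfolding finite_basis_def
proof (intro conjI allI impI)
  let ?B = "\<lambda>i. \<Union>j<N. (\<lambda>b. slot K j b i) ` B (i + int j)"
  have fin: "finite (Sigma UNIV B)" using B by (simp add: finite_basis_def)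
  have "Sigma UNIV ?B \<subseteq> (\<Union>j<N. (\<lambda>(i, b). (i - int j, slot K j b (i - int j))) ` Sigma UNIV B)"
  proof
    fix p assume "p \<in> Sigma UNIV ?B"
    then obtain i b' where p0: "p = (i, b')" "b' \<in> ?B i" by (rule SigmaE)
    then obtain j b where p: "p = (i, slot K j b i)" "j < N" "b \<in> B (i + int j)" by blast
    then have "p = (\<lambda>(i, b). (i - int j, slot K j b (i - int j))) (i + int j, b)" by simp
    moreover have "(i + int j, b) \<in> Sigma UNIV B" using p by simp
    ultimately show "p \<in> (\<Union>j<N. (\<lambda>(i, b). (i - int j, slot K j b (i - int j))) ` Sigma UNIV B)"
      using p(2) by blast
  qed
  then show "finite (Sigma UNIV ?B)" by (rule finite_subset) (use fin in auto)
  fix i and L :: "('r, 'l) module" assume L: "module R L"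
  have fr: "free_on (obj K m) (B m) L" for m using B L by (simp add: finite_basis_def)
  have Bc: "b \<in> elts K m" if "b \<in> B m" for b m by (rule free_on_mem[OF fr that])
  show "free_on (obj (kcone x K) i) (?B i) L"
    unfolding free_on_def
  proof (intro conjI allI impI ballI)
    show "?B i \<subseteq> elts (kcone x K) i"
      using slot_closed[OF K x] Bc by auto
  next
    fix v assume v: "\<forall>b\<in>?B i. v b \<in> carrier L"
    have "\<exists>g\<in>mhom R (obj K (i + int j)) L. \<forall>b\<in>B (i + int j). g b = v (slot K j b i)" if "j < N" for j
    proof -
      have "v (slot K j b i) \<in> carrier L" if "b \<in> B (i + int j)" for b using v that \<open>j < N\<close> by blast
      then obtain g where "g \<in> mhom R (obj K (i + int j)) L" "\<And>b. b \<in> B (i + int j) \<Longrightarrow> g b = v (slot K j b i)"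
        using free_onE[OF fr, of "i + int j" "\<lambda>b. v (slot K j b i)"] by metis
      then show ?thesis by blast
    qed
    then obtain g where g: "\<And>j. j < N \<Longrightarrow> g j \<in> mhom R (obj K (i + int j)) L"
      "\<And>j b. j < N \<Longrightarrow> b \<in> B (i + int j) \<Longrightarrow> g j b = v (slot K j b i)"
      by metis
    interpret L: abelian_group L using L by (rule mod_abelian)
    define f where "f w = (\<Oplus>\<^bsub>L\<^esub>j\<in>{..<N}. g j (coord w j))" for w
    have gm: "(\<lambda>w. g j (coord w j)) \<in> mhom R (obj (kcone x K) i) L" if "j < N" for j
      by (rule mhom_comp[OF coord_mhom[OF K x that refl] g(1)[OF that]])
    have "f \<in> mhom R (obj (kcone x K) i) L"
    proof (rule mhomI)
      fix w assume w: "w \<in> elts (kcone x K) i"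
      have c: "g j (coord w j) \<in> carrier L" if "j < N" for j by (rule mhom_closed[OF gm[OF that] w])
      show "f w \<in> carrier L" unfolding f_def using c by (intro L.finsum_closed) auto
      show "f (r \<odot>\<^bsub>obj (kcone x K) i\<^esub> w) = r \<odot>\<^bsub>L\<^esub> f w" if r: "r \<in> carrier R" for r
      proof -
        have "f (r \<odot>\<^bsub>obj (kcone x K) i\<^esub> w) = (\<Oplus>\<^bsub>L\<^esub>j\<in>{..<N}. r \<odot>\<^bsub>L\<^esub> g j (coord w j))"
          unfolding f_def using c L r by (intro L.finsum_cong') (auto simp: mhom_smult[OF gm r w])
        then show ?thesis
          unfolding f_def using c r by (simp add: module.finsum_smult_ldistr[OF L])
      qed
      fix w' assume w': "w' \<in> elts (kcone x K) i"
      have c': "g j (coord w' j) \<in> carrier L" if "j < N" for j by (rule mhom_closed[OF gm[OF that] w'])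
      have "f (w \<oplus>\<^bsub>obj (kcone x K) i\<^esub> w') = (\<Oplus>\<^bsub>L\<^esub>j\<in>{..<N}. g j (coord w j) \<oplus>\<^bsub>L\<^esub> g j (coord w' j))"
        unfolding f_def using c c' by (intro L.finsum_cong') (auto simp: mhom_add[OF gm w w'])
      also have "\<dots> = f w \<oplus>\<^bsub>L\<^esub> f w'" unfolding f_def using c c' by (intro L.finsum_addf) auto
      finally show "f (w \<oplus>\<^bsub>obj (kcone x K) i\<^esub> w') = f w \<oplus>\<^bsub>L\<^esub> f w'" .
    qed
    moreover have "f b' = v b'" if b': "b' \<in> ?B i" for b'
    proof -
      obtain j b where j: "j < N" "b \<in> B (i + int j)" "b' = slot K j b i" using b' by auto
      have gb: "g j b \<in> carrier L" by (rule mhom_closed[OF g(1)[OF j(1)] Bc[OF j(2)]])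
      have "f b' = (\<Oplus>\<^bsub>L\<^esub>k\<in>{..<N}. if j = k then g j b else \<zero>\<^bsub>L\<^esub>)"
        unfolding f_def j(3) using gb L K
        by (intro L.finsum_cong') (auto simp: coord_vec mhom_zero[OF g(1)])
      also have "\<dots> = g j b" using j(1) gb by (intro L.finsum_singleton[of j "{..<N}" "\<lambda>k. g j b"]) auto
      finally show ?thesis using g(2)[OF j(1,2)] j(3) by simp
    qed
    ultimately show "\<exists>f\<in>mhom R (obj (kcone x K) i) L. \<forall>b\<in>?B i. f b = v b" by blast
  next
    fix f g w assume f: "f \<in> mhom R (obj (kcone x K) i) L" and g: "g \<in> mhom R (obj (kcone x K) i) L"
      and eq: "\<forall>b\<in>?B i. f b = g b" and w: "w \<in> elts (kcone x K) i"
    show "f w = g w"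
    proof (rule kcone_hom_eqI[OF K x L f g _ w])
      fix j a assume j: "j < N" and a: "a \<in> elts K (i + int j)"
      show "f (slot K j a i) = g (slot K j a i)"
        by (rule free_on_eqI[OF fr mhom_comp[OF slot_mhom[OF K x j refl] f] mhom_comp[OF slot_mhom[OF K x j refl] g] _ a])
          (use eq j in auto)
    qed
  qed
qed

end

context q_complexes
begin

definition post :: "(int \<Rightarrow> 'y \<Rightarrow> 'z) \<Rightarrow> ('r, 'x) ncomplex \<Rightarrow> int \<Rightarrow> (int \<Rightarrow> 'x \<Rightarrow> 'y) \<Rightarrow> int \<Rightarrow> 'x \<Rightarrow> 'z" where
  "post \<eta> X n f = (\<lambda>i. \<lambda>x\<in>elts X i. \<eta> (i + n) (f i x))"

lemma post_apply: "x \<in> elts X i \<Longrightarrow> m = i + n \<Longrightarrow> post \<eta> X n f i x = \<eta> m (f i x)"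
  by (simp add: post_def)

lemma post_chain_map:
  assumes X: "n_complex R N X" and Y: "n_complex R N Y" and Z: "n_complex R N Z" and e: "chain_map R Y Z \<eta>"
  shows "chain_map R (qHom X Y) (qHom X Z) (post \<eta> X)"
  unfolding chain_map_def
proof (intro allI conjI ballI)
  note Q = qHom_n_complex[OF X Y] and Q' = qHom_n_complex[OF X Z]
  have cl: "post \<eta> X n f \<in> elts (qHom X Z) n" if "f \<in> elts (qHom X Y) n" for n f
    unfolding post_def using X
    by (intro qHom_restrict mhom_comp[OF qHom_mhom[OF that refl] chain_map_mhom[OF e]]) simp
  fix n
  show "post \<eta> X n \<in> mhom R (obj (qHom X Y) n) (obj (qHom X Z) n)"
  proof (rule mhomI)
    fix f assume f: "f \<in> elts (qHom X Y) n"
    show "post \<eta> X n f \<in> elts (qHom X Z) n" by (rule cl[OF f])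
    show "post \<eta> X n (f \<oplus>\<^bsub>obj (qHom X Y) n\<^esub> g) = post \<eta> X n f \<oplus>\<^bsub>obj (qHom X Z) n\<^esub> post \<eta> X n g"
      if g: "g \<in> elts (qHom X Y) n" for g
    proof (rule qHom_eqI[OF cl mod_add[OF cpx_module[OF Q'] cl[OF f] cl[OF g]]])
      show "f \<oplus>\<^bsub>obj (qHom X Y) n\<^esub> g \<in> elts (qHom X Y) n" using Q f g by simp
      fix i x assume x: "x \<in> elts X i"
      show "post \<eta> X n (f \<oplus>\<^bsub>obj (qHom X Y) n\<^esub> g) i x = (post \<eta> X n f \<oplus>\<^bsub>obj (qHom X Z) n\<^esub> post \<eta> X n g) i x"
        unfolding qHom_apply(2)[OF x refl] post_apply[OF x refl]
        by (rule mhom_add[OF chain_map_mhom[OF e] qHom_closed[OF f x refl] qHom_closed[OF g x refl]])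
    qed
    show "post \<eta> X n (r \<odot>\<^bsub>obj (qHom X Y) n\<^esub> f) = r \<odot>\<^bsub>obj (qHom X Z) n\<^esub> post \<eta> X n f" if r: "r \<in> carrier R" for r
    proof (rule qHom_eqI[OF cl mod_smult[OF cpx_module[OF Q'] r cl[OF f]]])
      show "r \<odot>\<^bsub>obj (qHom X Y) n\<^esub> f \<in> elts (qHom X Y) n" using Q f r by simp
      fix i x assume x: "x \<in> elts X i"
      show "post \<eta> X n (r \<odot>\<^bsub>obj (qHom X Y) n\<^esub> f) i x = (r \<odot>\<^bsub>obj (qHom X Z) n\<^esub> post \<eta> X n f) i x"
        unfolding qHom_apply(3)[OF x refl] post_apply[OF x refl]
        by (rule mhom_smult[OF chain_map_mhom[OF e] r qHom_closed[OF f x refl]])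
    qed
  qed
  fix f assume f: "f \<in> elts (qHom X Y) n"
  show "post \<eta> X (n + 1) (dif (qHom X Y) n f) = dif (qHom X Z) n (post \<eta> X n f)"
  proof (rule qHom_eqI[OF cl[OF dif_closed[OF Q f refl]] dif_closed[OF Q' cl[OF f] refl]])
    fix i x assume x: "x \<in> elts X i"
    have dx: "dif X i x \<in> elts X (i + 1)" by (rule dif_closed[OF X x refl])
    let ?m = "i + n + 1"
    have c: "f i x \<in> elts Y (i + n)" "f (i + 1) (dif X i x) \<in> elts Y ?m"
      by (rule qHom_closed[OF f x refl], rule qHom_closed[OF f dx], simp)
    have d: "dif Y (i + n) (f i x) \<in> elts Y ?m" by (rule dif_closed[OF Y c(1) refl])
    have p: "post \<eta> X (n + 1) (dif (qHom X Y) n f) i x = \<eta> ?m (dif (qHom X Y) n f i x)"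
      by (rule post_apply[OF x]) simp
    have p': "post \<eta> X n f (i + 1) (dif X i x) = \<eta> ?m (f (i + 1) (dif X i x))"
      by (rule post_apply[OF dx]) simp
    have p0: "post \<eta> X n f i x = \<eta> (i + n) (f i x)" by (rule post_apply[OF x refl])
    show "post \<eta> X (n + 1) (dif (qHom X Y) n f) i x = dif (qHom X Z) n (post \<eta> X n f) i x"
      unfolding p qHom_dif_apply[OF x refl] p' p0
      using Y Z c d by (simp add: mhom_diff[OF chain_map_mhom[OF e]] mhom_smult[OF chain_map_mhom[OF e]]
          chain_map_dif[OF e c(1) refl])
  qed
qed

lemma post_id: "f \<in> elts (qHom X Y) n \<Longrightarrow> post (\<lambda>n y. y) X n f = f"
  unfolding post_def by (rule ext) (auto simp: qHom_carrier intro: extensional_restrict)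

context
  fixes K :: "('r, 'r koszul_elem) ncomplex" and x :: 'r and Y :: "('r, 'y) ncomplex" and Z :: "('r, 'z) ncomplex"
    and \<eta> :: "int \<Rightarrow> 'y \<Rightarrow> 'z"
  assumes K: "n_complex R N K" and x: "x \<in> carrier R" and Y: "n_complex R N Y" and Z: "n_complex R N Z"
    and e: "chain_map R Y Z \<eta>"
begin

lemma post_cone_conn:
  assumes g: "g \<in> elts (qHom K Y) n"
  shows "post \<eta> (susp K) (n + 1) (cone_conn K Y n g) = cone_conn K Z n (post \<eta> K n g)"
proof (rule qHom_eqI)
  note S = susp_n_complex[OF K]
  note pc = post_chain_map[OF _ Y Z e]
  show "post \<eta> (susp K) (n + 1) (cone_conn K Y n g) \<in> elts (qHom (susp K) Z) (n + 1)"
    by (rule chain_map_closed[OF pc[OF S] mhom_closed[OF cone_conn_mhom[OF K Y refl] g]])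
  show "cone_conn K Z n (post \<eta> K n g) \<in> elts (qHom (susp K) Z) (n + 1)"
    by (rule mhom_closed[OF cone_conn_mhom[OF K Z refl] chain_map_closed[OF pc[OF K] g]])
  fix i as assume as: "as \<in> elts (susp K) i"
  have a0: "as ! 0 \<in> elts K (i + 1)" by (rule susp_hd[OF K x as refl])
  let ?m = "i + (n + 1)"
  have c: "g (i + 1) (as ! 0) \<in> elts Y ?m" by (rule qHom_closed[OF g a0]) simp
  have p: "post \<eta> K n g (i + 1) (as ! 0) = \<eta> ?m (g (i + 1) (as ! 0))" by (rule post_apply[OF a0]) simp
  show "post \<eta> (susp K) (n + 1) (cone_conn K Y n g) i as = cone_conn K Z n (post \<eta> K n g) i as"
    unfolding post_apply[OF as refl] cone_conn_def restrict_apply'[OF as] p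
    using Y Z c by (simp add: mhom_neg[OF chain_map_mhom[OF e]] mhom_smult[OF chain_map_mhom[OF e]])
qed

lemma post_cone_split:
  assumes f: "f \<in> elts (qHom (kcone x K) Y) n"
  shows "cone_split K n (post \<eta> (kcone x K) n f) =
    (post \<eta> K n (fst (cone_split K n f)), post \<eta> (susp K) n (snd (cone_split K n f)))"
proof -
  note S = susp_n_complex[OF K]
  have z: "Node (y, \<zero>\<^bsub>obj (susp K) i\<^esub>) \<in> elts (kcone x K) i" if "y \<in> elts K i" for y i
    using that S by simp
  have z': "Node (\<zero>\<^bsub>obj K i\<^esub>, as) \<in> elts (kcone x K) i" if "as \<in> elts (susp K) i" for as i
    using that K by simp
  show ?thesis
    unfolding cone_split_def post_def fst_conv snd_conv
    using mod_zero[OF cpx_module[OF S]] mod_zero[OF cpx_module[OF K]] by (auto simp: fun_eq_iff restrict_def)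
qed

text \<open>The splitting of \<open>Hom(P, Y)\<close> as a twisted extension is natural in \<open>Y\<close>, which reduces the claim to
  \<open>ext_cpx_hiso\<close>.\<close>

theorem hiso_kcone:
  assumes h: "hiso (qHom K Y) (qHom K Z) (post \<eta> K)"
  shows "hiso (qHom (kcone x K) Y) (qHom (kcone x K) Z) (post \<eta> (kcone x K))"
proof (rule hiso_conjugate)
  note S = susp_n_complex[OF K] and P = kcone_n_complex[OF K x]
  show "chain_iso (qHom (kcone x K) Y) (cone_ext x K Y) (cone_split K)" by (rule cone_split_iso[OF K Y x])
  show "chain_iso (qHom (kcone x K) Z) (cone_ext x K Z) (cone_split K)" by (rule cone_split_iso[OF K Z x])
  show "n_complex R N (qHom (kcone x K) Y)" "n_complex R N (qHom (kcone x K) Z)"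
    by (rule qHom_n_complex[OF P Y], rule qHom_n_complex[OF P Z])
  show "n_complex R N (cone_ext x K Y)" "n_complex R N (cone_ext x K Z)"
    by (rule ext_cpx_n_complex[OF cone_ext_data[OF K Y] x], rule ext_cpx_n_complex[OF cone_ext_data[OF K Z] x])
  show "hiso (cone_ext x K Y) (cone_ext x K Z) (\<lambda>n p. (post \<eta> K n (fst p), post \<eta> (susp K) n (snd p)))"
    by (rule ext_cpx_hiso[OF cone_ext_acyclic[OF K Y] cone_ext_acyclic[OF K Z] h _ _ x])
      (rule post_chain_map[OF S Y Z e], erule post_cone_conn)
  show "chain_map R (qHom (kcone x K) Y) (qHom (kcone x K) Z) (post \<eta> (kcone x K))"
    by (rule post_chain_map[OF P Y Z e])
  fix n f assume "f \<in> elts (qHom (kcone x K) Y) n"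
  then show "(post \<eta> K n (fst (cone_split K n f)), post \<eta> (susp K) n (snd (cone_split K n f))) =
      cone_split K n (post \<eta> (kcone x K) n f)"
    by (rule post_cone_split[symmetric])
qed

end

text \<open>Multiplication by \<open>x\<close> is bijective on the quotient of \<open>Y\<close> by \<open>S\<close>. For \<open>K\<close> free of finite rank it is then
  bijective on the corresponding quotient of q-Hom complexes, where surjectivity needs the basis, and
  \<open>ext_cpx_sub_hiso\<close> applies.\<close>

theorem hiso_kcone_sub:
  fixes K :: "('r, 'r koszul_elem) ncomplex"
  assumes K: "n_complex R N K" and x: "x \<in> carrier R" and Y: "n_complex R N Y" and S: "subcomplex Y S"
    and B: "finite_basis TYPE('y) K B"
    and cancel: "\<And>n y. y \<in> elts Y n \<Longrightarrow> x \<odot>\<^bsub>obj Y n\<^esub> y \<in> S n \<Longrightarrow> y \<in> S n"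
    and divis: "\<And>n y. y \<in> elts Y n \<Longrightarrow> \<exists>y'\<in>elts Y n. y \<ominus>\<^bsub>obj Y n\<^esub> (x \<odot>\<^bsub>obj Y n\<^esub> y') \<in> S n"
  shows "hiso (qHom (kcone x K) (sub_cpx Y S)) (qHom (kcone x K) (Y :: ('r, 'y) ncomplex)) (post (\<lambda>n y. y) (kcone x K))"
proof (rule hiso_conjugate)
  let ?F = "sub_cpx Y S"
  note F = sub_cpx_n_complex[OF Y S] and i = sub_cpx_incl[OF S]
  note Su = susp_n_complex[OF K] and P = kcone_n_complex[OF K x]
  show "chain_iso (qHom (kcone x K) ?F) (cone_ext x K ?F) (cone_split K)" by (rule cone_split_iso[OF K F x])
  show "chain_iso (qHom (kcone x K) Y) (cone_ext x K Y) (cone_split K)" by (rule cone_split_iso[OF K Y x])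
  show QF: "n_complex R N (qHom (kcone x K) ?F)" and "n_complex R N (qHom (kcone x K) Y)"
    by (rule qHom_n_complex[OF P F], rule qHom_n_complex[OF P Y])
  show "n_complex R N (cone_ext x K ?F)" "n_complex R N (cone_ext x K Y)"
    by (rule ext_cpx_n_complex[OF cone_ext_data[OF K F] x], rule ext_cpx_n_complex[OF cone_ext_data[OF K Y] x])
  note QK = qHom_n_complex[OF K Y]
  have inc: "chain_map R (qHom X ?F) (qHom X Y) (\<lambda>n f. f)" if X: "n_complex R N X" for X :: "('r, 'w) ncomplex"
    by (rule chain_map_cong[OF post_chain_map[OF X F Y i] qHom_n_complex[OF X F]]) (simp add: post_id)
  show "chain_map R (qHom (kcone x K) ?F) (qHom (kcone x K) Y) (post (\<lambda>n y. y) (kcone x K))"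
    by (rule post_chain_map[OF P F Y i])
  show "(\<lambda>n p. p) n (cone_split K n f) = cone_split K n (post (\<lambda>n y. y) (kcone x K) n f)"
    if "f \<in> elts (qHom (kcone x K) ?F) n" for n f using that by (simp add: post_id)
  show "hiso (cone_ext x K ?F) (cone_ext x K Y) (\<lambda>n p. p)"
  proof (rule ext_cpx_sub_hiso[OF cone_ext_acyclic[OF K Y] cone_ext_acyclic[OF K F] inc[OF K] inc[OF Su] _ x])
    fix n g assume "g \<in> elts (qHom K ?F) n"
    have "\<ominus>\<^bsub>obj ?F m\<^esub> y = \<ominus>\<^bsub>obj Y m\<^esub> y" if "y \<in> S m" for y m
      using mhom_neg[OF chain_map_mhom[OF i] cpx_module[OF F] cpx_module[OF Y]] that by simp
    moreover have "q [^] n \<odot>\<^bsub>obj Y (i + (n + 1))\<^esub> g (i + 1) (as ! 0) \<in> S (i + (n + 1))" if "as \<in> elts (susp K) i" for i as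
    proof -
      have "g (i + 1) (as ! 0) \<in> elts ?F (i + (n + 1))"
        by (rule qHom_closed[OF \<open>g \<in> elts (qHom K ?F) n\<close> susp_hd[OF K x that refl]]) simp
      then show ?thesis using mod_smult[OF cpx_module[OF F] q_int_closed] by simp
    qed
    ultimately show "cone_conn K ?F n g = cone_conn K Y n g"
      by (auto simp: cone_conn_def fun_eq_iff restrict_def)
  next
    fix n g assume g: "g \<in> elts (qHom K Y) n" and xg: "x \<odot>\<^bsub>obj (qHom K Y) n\<^esub> g \<in> elts (qHom K ?F) n"
    have gS: "g i k \<in> S (i + n)" if k: "k \<in> elts K i" for i k
    proof (rule cancel[OF qHom_closed[OF g k refl]])
      show "x \<odot>\<^bsub>obj Y (i + n)\<^esub> g i k \<in> S (i + n)"
        using qHom_closed[OF xg k refl] unfolding qHom_apply(3)[OF k refl] by simp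
    qed
    show "g \<in> elts (qHom K ?F) n"
      unfolding qHom_carrier
    proof (intro allI conjI)
      fix i
      have gm: "g i \<in> mhom R (obj K i) (obj Y (i + n))" by (rule qHom_mhom[OF g refl])
      show "g i \<in> mhom R (obj K i) (obj ?F (i + n))"
        by (rule mhomI) (use gS in \<open>auto simp: mhom_add[OF gm] mhom_smult[OF gm]\<close>)
      show "g i \<in> extensional (elts K i)" using g by (simp add: qHom_carrier)
    qed
  next
    fix n g assume g: "g \<in> elts (qHom K Y) n"
    have frY: "free_on (obj K i) (B i) (obj Y m)" and frF: "free_on (obj K i) (B i) (obj ?F m)" for i m
      using B Y F by (simp_all add: finite_basis_def)
    have Bc: "b \<in> elts K i" if "b \<in> B i" for b i by (rule free_on_mem[OF frY that])
    have "\<exists>u\<in>mhom R (obj K i) (obj Y (i + n)). \<forall>b\<in>B i. g i b \<ominus>\<^bsub>obj Y (i + n)\<^esub> (x \<odot>\<^bsub>obj Y (i + n)\<^esub> u b) \<in> S (i + n)" for i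
    proof -
      have "\<forall>b\<in>B i. \<exists>y'\<in>elts Y (i + n). g i b \<ominus>\<^bsub>obj Y (i + n)\<^esub> (x \<odot>\<^bsub>obj Y (i + n)\<^esub> y') \<in> S (i + n)"
        using divis qHom_closed[OF g Bc refl] by blast
      then obtain v where v: "\<And>b. b \<in> B i \<Longrightarrow> v b \<in> elts Y (i + n) \<and>
          g i b \<ominus>\<^bsub>obj Y (i + n)\<^esub> (x \<odot>\<^bsub>obj Y (i + n)\<^esub> v b) \<in> S (i + n)" by metis
      obtain u where u: "u \<in> mhom R (obj K i) (obj Y (i + n))" "\<And>b. b \<in> B i \<Longrightarrow> u b = v b"
        using free_onE[OF frY, of i v "i + n"] v by blast
      have "\<forall>b\<in>B i. g i b \<ominus>\<^bsub>obj Y (i + n)\<^esub> (x \<odot>\<^bsub>obj Y (i + n)\<^esub> u b) \<in> S (i + n)"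
        using u(2) v by simp
      then show ?thesis using u(1) by blast
    qed
    then obtain u where u: "\<And>i. u i \<in> mhom R (obj K i) (obj Y (i + n))"
      "\<And>i b. b \<in> B i \<Longrightarrow> g i b \<ominus>\<^bsub>obj Y (i + n)\<^esub> (x \<odot>\<^bsub>obj Y (i + n)\<^esub> u i b) \<in> S (i + n)" by metis
    define g' where "g' = (\<lambda>i. restrict (u i) (elts K i))"
    have g': "g' \<in> elts (qHom K Y) n" unfolding g'_def using K u(1) by (intro qHom_restrict) auto
    have xg': "x \<odot>\<^bsub>obj (qHom K Y) n\<^esub> g' \<in> elts (qHom K Y) n" using QK x g' by simp
    let ?d = "g \<ominus>\<^bsub>obj (qHom K Y) n\<^esub> (x \<odot>\<^bsub>obj (qHom K Y) n\<^esub> g')"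
    have d: "?d \<in> elts (qHom K Y) n" using QK g xg' by simp
    have dap: "?d i k = g i k \<ominus>\<^bsub>obj Y (i + n)\<^esub> (x \<odot>\<^bsub>obj Y (i + n)\<^esub> u i k)" if k: "k \<in> elts K i" for i k
      unfolding qHom_diff_apply[OF K Y g xg' k refl] qHom_apply(3)[OF k refl] using k by (simp add: g'_def)
    have "?d \<in> elts (qHom K ?F) n"
      unfolding qHom_carrier
    proof (intro allI conjI)
      fix i
      have dm: "?d i \<in> mhom R (obj K i) (obj Y (i + n))" by (rule qHom_mhom[OF d refl])
      obtain w where w: "w \<in> mhom R (obj K i) (obj ?F (i + n))" "\<And>b. b \<in> B i \<Longrightarrow> w b = ?d i b"
        using free_onE[OF frF, of i "?d i" "i + n"] u(2) dap[OF Bc] by (metis sub_cpx_simps(1))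
      have wY: "w \<in> mhom R (obj K i) (obj Y (i + n))"
        using mhom_comp[OF w(1) chain_map_mhom[OF i]] by simp
      have eq: "?d i k = w k" if "k \<in> elts K i" for k
        by (rule free_on_eqI[OF frY dm wY _ that]) (simp add: w(2))
      show "?d i \<in> mhom R (obj K i) (obj ?F (i + n))" by (rule mhom_cong[OF w(1) cpx_module[OF K] eq])
      show "?d i \<in> extensional (elts K i)" using d by (simp add: qHom_carrier)
    qed
    then show "\<exists>g'\<in>elts (qHom K Y) n. g \<ominus>\<^bsub>obj (qHom K Y) n\<^esub> (x \<odot>\<^bsub>obj (qHom K Y) n\<^esub> g') \<in> elts (qHom K ?F) n"
      using g' by blast
  qed
qed

text \<open>A homomorphism from a free module of finite rank takes finitely many values on the basis, and one power of
  \<open>x\<close> kills them all.\<close>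

lemma qHom_uniform_torsion:
  assumes B: "finite_basis TYPE('y) K B" and K: "n_complex R N K" and Y: "n_complex R N Y" and x: "x \<in> carrier R"
    and tors: "\<And>n y. y \<in> elts Y n \<Longrightarrow> \<exists>k::nat. (x [^] k) \<odot>\<^bsub>obj Y n\<^esub> y = \<zero>\<^bsub>obj Y n\<^esub>"
    and f: "f \<in> elts (qHom K (Y :: ('r, 'y) ncomplex)) n"
  shows "\<exists>k::nat. (x [^] k) \<odot>\<^bsub>obj (qHom K Y) n\<^esub> f = \<zero>\<^bsub>obj (qHom K Y) n\<^esub>"
proof -
  note Q = qHom_n_complex[OF K Y]
  have fr: "free_on (obj K i) (B i) (obj Y m)" for i m using B Y by (simp add: finite_basis_def)
  have Bc: "b \<in> elts K i" if "b \<in> B i" for b i by (rule free_on_mem[OF fr that])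
  have "\<forall>p\<in>Sigma UNIV B. \<exists>k::nat. (x [^] k) \<odot>\<^bsub>obj Y (fst p + n)\<^esub> f (fst p) (snd p) = \<zero>\<^bsub>obj Y (fst p + n)\<^esub>"
    using tors qHom_closed[OF f Bc refl] by auto
  then obtain kk :: "int \<times> 'a \<Rightarrow> nat" where kk: "\<And>p. p \<in> Sigma UNIV B \<Longrightarrow>
      (x [^] kk p) \<odot>\<^bsub>obj Y (fst p + n)\<^esub> f (fst p) (snd p) = \<zero>\<^bsub>obj Y (fst p + n)\<^esub>" by metis
  define k where "k = Max (insert 0 (kk ` Sigma UNIV B))"
  have fin: "finite (Sigma UNIV B)" using B by (simp add: finite_basis_def)
  let ?f = "(x [^] k) \<odot>\<^bsub>obj (qHom K Y) n\<^esub> f"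
  have xk: "x [^] k \<in> carrier R" using x by simp
  have f': "?f \<in> elts (qHom K Y) n" using Q f xk by simp
  have z: "\<zero>\<^bsub>obj (qHom K Y) n\<^esub> \<in> elts (qHom K Y) n" using Q by simp
  have "?f = \<zero>\<^bsub>obj (qHom K Y) n\<^esub>"
  proof (rule qHom_eqI[OF f' z])
    fix i w assume w: "w \<in> elts K i"
    show "?f i w = \<zero>\<^bsub>obj (qHom K Y) n\<^esub> i w"
    proof (rule free_on_eqI[OF fr qHom_mhom[OF f' refl] qHom_mhom[OF z refl] _ w])
      fix b assume b: "b \<in> B i"
      then have p: "(i, b) \<in> Sigma UNIV B" by simp
      then have le: "kk (i, b) \<le> k" unfolding k_def using fin by (intro Max_ge) auto
      then have "x [^] k = x [^] (k - kk (i, b)) \<otimes> x [^] kk (i, b)" using x by (simp add: nat_pow_mult)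
      then show "?f i b = \<zero>\<^bsub>obj (qHom K Y) n\<^esub> i b"
        unfolding qHom_apply(3)[OF Bc[OF b] refl] qHom_apply(1)[OF Bc[OF b] refl]
        using Y x kk[OF p] qHom_closed[OF f Bc[OF b] refl] by (simp add: mod_mult_smult)
    qed
  qed
  then show ?thesis by blast
qed

end

section \<open>Homomorphisms from the Koszul complex\<close>

context q_complexes
begin

abbreviation koszul_base :: "('r, 'r koszul_elem) ncomplex" where
  "koszul_base \<equiv> transport Base the_base (concentrated_in_0 (regular_module R))"

lemma koszul_base_simps:
  "elts koszul_base n = (if n = 0 then Base ` carrier R else {Base \<zero>})"
  "\<zero>\<^bsub>obj koszul_base n\<^esub> = Base \<zero>"
  "Base a \<oplus>\<^bsub>obj koszul_base n\<^esub> Base b = Base (a \<oplus> b)"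
  "r \<odot>\<^bsub>obj koszul_base n\<^esub> Base a = Base (r \<otimes> a)"
  "dif koszul_base n w = Base \<zero>"
  by (auto simp: transport_def concentrated_in_0_def regular_module_def mk_module_def)

lemma koszul_base_cases:
  assumes "w \<in> elts koszul_base n"
  obtains a where "w = Base a" "a \<in> carrier R" "n \<noteq> 0 \<Longrightarrow> a = \<zero>"
  using assms by (auto simp: koszul_base_simps(1) split: if_splits)

lemma koszul_base_module: "module R (obj koszul_base n)"
proof (rule module_by_zero_neg)
qed (auto elim!: koszul_base_cases simp: koszul_base_simps a_ac m_ac l_distr r_distr split: if_splits)

lemma koszul_base_n_complex: "n_complex R N koszul_base"
  unfolding n_complex_def
proof (intro allI conjI ballI)
  fix n
  show "module R (obj koszul_base n)" by (rule koszul_base_module)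
  show "dif koszul_base n \<in> mhom R (obj koszul_base n) (obj koszul_base (n + 1))"
    by (rule mhomI) (auto simp: koszul_base_simps)
  fix x
  obtain N' where "N = Suc N'" using N_ge_2 by (cases N) auto
  then show "dpow koszul_base n N x = \<zero>\<^bsub>obj koszul_base (n + int N)\<^esub>"
    by (simp add: koszul_base_simps)
qed

lemma koszul_base_basis: "finite_basis TYPE('l) koszul_base (\<lambda>i. if i = 0 then {Base \<one>} else {})"
  unfolding finite_basis_def
proof (intro conjI allI impI)
  have "Sigma UNIV (\<lambda>i::int. if i = 0 then {Base \<one>} else {}) = {(0, Base \<one>)}" by (auto split: if_splits)
  then show "finite (Sigma UNIV (\<lambda>i::int. if i = 0 then {Base \<one>} else {}))" by simp
  fix i :: int and L :: "('r, 'l) module" assume L: "module R L"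
  note K = koszul_base_module
  show "free_on (obj koszul_base i) (if i = 0 then {Base \<one>} else {}) L"
  proof (cases "i = 0")
    case False
    have "f w = g w" if "f \<in> mhom R (obj koszul_base i) L" "g \<in> mhom R (obj koszul_base i) L" "w \<in> elts koszul_base i" for f g w
    proof -
      have "w = \<zero>\<^bsub>obj koszul_base i\<^esub>" using that(3) False by (simp add: koszul_base_simps)
      then show ?thesis using mhom_zero[OF that(1) K L] mhom_zero[OF that(2) K L] by simp
    qed
    moreover have "(\<lambda>_. \<zero>\<^bsub>L\<^esub>) \<in> mhom R (obj koszul_base i) L" by (rule mhom_const_zero[OF L])
    ultimately show ?thesis using False unfolding free_on_def by auto
  next
    case True
    show ?thesis
      unfolding free_on_def
    proof (intro conjI allI impI ballI)
      show "(if i = 0 then {Base \<one>} else {}) \<subseteq> elts koszul_base i" using True by (simp add: koszul_base_simps)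
      fix v :: "'r koszul_elem \<Rightarrow> 'l" assume v: "\<forall>b\<in>if i = 0 then {Base \<one>} else {}. v b \<in> carrier L"
      then have v1: "v (Base \<one>) \<in> carrier L" using True by simp
      have "(\<lambda>w. the_base w \<odot>\<^bsub>L\<^esub> v (Base \<one>)) \<in> mhom R (obj koszul_base i) L"
        by (rule mhomI) (use True v1 L in \<open>auto elim!: koszul_base_cases simp: koszul_base_simps(3,4) mod_add_smult mod_mult_smult\<close>)
      then show "\<exists>f\<in>mhom R (obj koszul_base i) L. \<forall>b\<in>if i = 0 then {Base \<one>} else {}. f b = v b"
        using True v1 L by (intro bexI) auto
    next
      fix f g w assume f: "f \<in> mhom R (obj koszul_base i) L" and g: "g \<in> mhom R (obj koszul_base i) L"
        and eq: "\<forall>b\<in>if i = 0 then {Base \<one>} else {}. f b = g b" and w: "w \<in> elts koszul_base i"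
      obtain a where a: "w = Base a" "a \<in> carrier R" using w by (rule koszul_base_cases)
      have b: "Base \<one> \<in> elts koszul_base i" using True by (simp add: koszul_base_simps)
      have w': "w = a \<odot>\<^bsub>obj koszul_base i\<^esub> Base \<one>" using a by (simp add: koszul_base_simps)
      show "f w = g w" unfolding w' mhom_smult[OF f a(2) b] mhom_smult[OF g a(2) b] using eq True by simp
    qed
  qed
qed

text \<open>The Koszul complex of the empty sequence is \<open>R\<close> in degree \<open>0\<close>, and a homomorphism from \<open>R\<close> is determined
  by its value at \<open>1\<close>.\<close>

definition ev :: "int \<Rightarrow> (int \<Rightarrow> 'r koszul_elem \<Rightarrow> 'y) \<Rightarrow> 'y" where
  "ev n f = f 0 (Base \<one>)"

lemma ev_iso:
  fixes Y :: "('r, 'y) ncomplex"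
  assumes Y: "n_complex R N Y"
  shows "chain_iso (qHom koszul_base Y) Y ev"
  unfolding chain_iso_def
proof (intro conjI allI)
  note K = koszul_base_n_complex
  note Q = qHom_n_complex[OF K Y]
  have b: "Base \<one> \<in> elts koszul_base 0" by (simp add: koszul_base_simps)
  show "chain_map R (qHom koszul_base Y) Y ev"
    unfolding chain_map_def ev_def
  proof (intro allI conjI ballI)
    fix n
    show "(\<lambda>f. f 0 (Base \<one>)) \<in> mhom R (obj (qHom koszul_base Y) n) (obj Y n)"
    proof (rule mhomI)
      show "f 0 (Base \<one>) \<in> elts Y n" if "f \<in> elts (qHom koszul_base Y) n" for f
        by (rule qHom_closed[OF that b]) simp
    qed (simp_all add: qHom_apply(2,3)[OF b, of n n])
    fix f assume f: "f \<in> elts (qHom koszul_base Y) n"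
    have f1: "f 1 \<in> mhom R (obj koszul_base 1) (obj Y (n + 1))" by (rule qHom_mhom[OF f]) simp
    have "f 1 (Base \<zero>) = \<zero>\<^bsub>obj Y (n + 1)\<^esub>"
      using mhom_zero[OF f1] K Y by (simp add: koszul_base_simps)
    moreover have "f 0 (Base \<one>) \<in> elts Y n" by (rule qHom_closed[OF f b]) simp
    ultimately show "dif (qHom koszul_base Y) n f 0 (Base \<one>) = dif Y n (f 0 (Base \<one>))"
      using qHom_dif_apply[OF b, of "n + 1" n Y f] Y dif_closed[OF Y, of "f 0 (Base \<one>)" n]
      by (simp add: koszul_base_simps(5))
  qed
  fix n
  have fr: "free_on (obj koszul_base i) (if i = 0 then {Base \<one>} else {}) (obj Y m)" for i m
    using koszul_base_basis[where 'l = 'y] cpx_module[OF Y] unfolding finite_basis_def by blast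
  show "bij_betw (ev n) (elts (qHom koszul_base Y) n) (elts Y n)"
    unfolding bij_betw_def ev_def
  proof (intro conjI equalityI subsetI)
    show "inj_on (\<lambda>f. f 0 (Base \<one>)) (elts (qHom koszul_base Y) n)"
    proof (rule inj_onI)
      fix f g assume f: "f \<in> elts (qHom koszul_base Y) n" and g: "g \<in> elts (qHom koszul_base Y) n"
        and eq: "f 0 (Base \<one>) = g 0 (Base \<one>)"
      show "f = g"
      proof (rule qHom_eqI[OF f g])
        fix i x assume x: "x \<in> elts koszul_base i"
        show "f i x = g i x"
          by (rule free_on_eqI[OF fr qHom_mhom[OF f refl] qHom_mhom[OF g refl] _ x]) (use eq in \<open>auto split: if_splits\<close>)
      qed
    qed
    show "y \<in> elts Y n" if "y \<in> (\<lambda>f. f 0 (Base \<one>)) ` elts (qHom koszul_base Y) n" for y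
      using that qHom_closed[OF _ b, of _ Y n n] by auto
    fix y assume y: "y \<in> elts Y n"
    obtain u where u: "u \<in> mhom R (obj koszul_base 0) (obj Y n)" "u (Base \<one>) = y"
      using free_onE[OF fr[of 0 n], of "\<lambda>_. y"] y by auto
    define f where "f = (\<lambda>i::int. restrict (if i = 0 then u else (\<lambda>_. \<zero>\<^bsub>obj Y (i + n)\<^esub>)) (elts koszul_base i))"
    have "f \<in> elts (qHom koszul_base Y) n"
      unfolding f_def
    proof (rule qHom_restrict)
      fix i
      show "(if i = 0 then u else (\<lambda>_. \<zero>\<^bsub>obj Y (i + n)\<^esub>)) \<in> mhom R (obj koszul_base i) (obj Y (i + n))"
        using u(1) mhom_const_zero[OF cpx_module[OF Y]] by (cases "i = 0") simp_all
    qed (use K in simp)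
    moreover have "f 0 (Base \<one>) = y" using u b by (simp add: f_def)
    ultimately show "y \<in> (\<lambda>f. f 0 (Base \<one>)) ` elts (qHom koszul_base Y) n" by (intro image_eqI) auto
  qed
qed

lemma koszul_Nil: "koszul R N [] = koszul_base"
  by (simp add: koszul_def)

lemma koszul_snoc: "koszul R N (xs @ [x]) = kcone x (koszul R N xs)"
  by (simp add: koszul_def)

lemma koszul_n_complex: "set xs \<subseteq> carrier R \<Longrightarrow> n_complex R N (koszul R N xs)"
proof (induction xs rule: rev_induct)
  case Nil
  show ?case unfolding koszul_Nil by (rule koszul_base_n_complex)
next
  case (snoc x xs)
  then show ?case unfolding koszul_snoc by (intro kcone_n_complex) auto
qed

lemma koszul_finite_basis: "set xs \<subseteq> carrier R \<Longrightarrow> \<exists>B. finite_basis TYPE('l) (koszul R N xs) B"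
proof (induction xs rule: rev_induct)
  case Nil
  show ?case unfolding koszul_Nil using koszul_base_basis by blast
next
  case (snoc x xs)
  then obtain B where "finite_basis TYPE('l) (koszul R N xs) B" by auto
  from kcone_finite_basis[OF this koszul_n_complex, where x = x] show ?case
    unfolding koszul_snoc using snoc.prems by auto
qed

text \<open>By induction on the sequence, which for the empty sequence gives back the map \<open>\<eta>\<close> itself.\<close>

theorem koszul_hiso:
  assumes e: "hiso Y Z \<eta>" and Y: "n_complex R N Y" and Z: "n_complex R N Z"
  shows "set xs \<subseteq> carrier R \<Longrightarrow> hiso (qHom (koszul R N xs) Y) (qHom (koszul R N xs) Z) (post \<eta> (koszul R N xs))"
proof (induction xs rule: rev_induct)
  case Nil
  have ec: "chain_map R Y Z \<eta>" using e by (simp add: hiso_def)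
  note K = koszul_base_n_complex
  have b: "Base \<one> \<in> elts koszul_base 0" by (simp add: koszul_base_simps)
  show ?case
    unfolding koszul_Nil
  proof (rule hiso_conjugate[OF ev_iso[OF Y] ev_iso[OF Z] qHom_n_complex[OF K Y] qHom_n_complex[OF K Z] Y Z _ e post_chain_map[OF K Y Z ec]])
    show "\<eta> n (ev n f) = ev n (post \<eta> koszul_base n f)" for n f
      unfolding ev_def using post_apply[OF b, of n n \<eta> f] by simp
  qed
next
  case (snoc x xs)
  have ec: "chain_map R Y Z \<eta>" using e by (simp add: hiso_def)
  show ?case unfolding koszul_snoc
    using snoc by (intro hiso_kcone[OF koszul_n_complex _ Y Z ec]) auto
qed

text \<open>By induction on the sequence: homomorphisms from the finite free Koszul complex into a torsion complex are
  torsion, so attaching one more cone changes neither direction of exactness.\<close>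

theorem koszul_exact_torsion:
  assumes G: "n_complex R N (G :: ('r, 'y) ncomplex)" and t: "1 \<le> t" "t < N"
  shows "set xs \<subseteq> carrier R \<Longrightarrow>
    (\<And>x n g. x \<in> set xs \<Longrightarrow> g \<in> elts G n \<Longrightarrow> \<exists>k::nat. (x [^] k) \<odot>\<^bsub>obj G n\<^esub> g = \<zero>\<^bsub>obj G n\<^esub>) \<Longrightarrow>
    exact_below (qHom (koszul R N xs) G) t s \<longleftrightarrow> exact_below G t s"
proof (induction xs rule: rev_induct)
  case Nil
  note Q = qHom_n_complex[OF koszul_base_n_complex G]
  show ?case
    unfolding koszul_Nil exact_below_def using hiso_exact_at[OF chain_iso_hiso[OF ev_iso[OF G] Q G] Q G t] by simp
next
  case (snoc x xs)
  let ?K = "koszul R N xs"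
  have x: "x \<in> carrier R" and xs: "set xs \<subseteq> carrier R" using snoc.prems by auto
  note K = koszul_n_complex[OF xs]
  note Q = qHom_n_complex[OF kcone_n_complex[OF K x] G]
  note E = ext_cpx_n_complex[OF cone_ext_data[OF K G] x]
  obtain B where B: "finite_basis TYPE('y) ?K B" using koszul_finite_basis[OF xs] by blast
  have "exact_below (qHom (koszul R N (xs @ [x])) G) t s \<longleftrightarrow> exact_below (cone_ext x ?K G) t s"
    unfolding koszul_snoc exact_below_def
    using hiso_exact_at[OF chain_iso_hiso[OF cone_split_iso[OF K G x] Q E] Q E t] by simp
  also have "\<dots> \<longleftrightarrow> exact_below (qHom ?K G) t s"
  proof
    assume "exact_below (cone_ext x ?K G) t s"
    then show "exact_below (qHom ?K G) t s"
    proof (rule exact_below_of_ext_cpx[OF cone_ext_data[OF K G] x t])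
      show "\<exists>k::nat. (x [^] k) \<odot>\<^bsub>obj (qHom ?K G) n\<^esub> g = \<zero>\<^bsub>obj (qHom ?K G) n\<^esub>"
        if "g \<in> elts (qHom ?K G) n" for n g
        by (rule qHom_uniform_torsion[OF B K G x snoc.prems(2) that]) simp
    qed
  next
    assume "exact_below (qHom ?K G) t s"
    then show "exact_below (cone_ext x ?K G) t s" by (rule ext_cpx_exact_below[OF cone_ext_acyclic[OF K G] x t])
  qed
  also have "\<dots> \<longleftrightarrow> exact_below G t s" using snoc by (intro snoc.IH) auto
  finally show ?case .
qed

definition tors :: "('r, 'y) ncomplex \<Rightarrow> 'r set \<Rightarrow> int \<Rightarrow> 'y set" where
  "tors Y A n = {y \<in> elts Y n. \<forall>x\<in>A. \<exists>k::nat. (x [^] k) \<odot>\<^bsub>obj Y n\<^esub> y = \<zero>\<^bsub>obj Y n\<^esub>}"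

lemma power_kill_mono:
  assumes "module R M" "x \<in> carrier R" "y \<in> carrier M" "(x [^] (k::nat)) \<odot>\<^bsub>M\<^esub> y = \<zero>\<^bsub>M\<^esub>" "k \<le> l"
  shows "(x [^] l) \<odot>\<^bsub>M\<^esub> y = \<zero>\<^bsub>M\<^esub>"
proof -
  have "x [^] l = x [^] (l - k) \<otimes> x [^] k" using assms by (simp add: nat_pow_mult)
  then show ?thesis using assms by (simp add: mod_mult_smult)
qed

lemma tors_subcomplex:
  assumes Y: "n_complex R N Y" and A: "A \<subseteq> carrier R"
  shows "subcomplex Y (tors Y A)"
  unfolding subcomplex_def
proof (intro allI conjI ballI)
  fix n
  have M: "module R (obj Y n)" using Y by simp
  show "tors Y A n \<subseteq> elts Y n" by (auto simp: tors_def)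
  show "\<zero>\<^bsub>obj Y n\<^esub> \<in> tors Y A n" using M A by (auto simp: tors_def subset_iff)
  fix y assume y: "y \<in> tors Y A n"
  then have yc: "y \<in> elts Y n" by (simp add: tors_def)
  show "dif Y n y \<in> tors Y A (n + 1)"
  proof -
    have "(x [^] k) \<odot>\<^bsub>obj Y (n + 1)\<^esub> dif Y n y = \<zero>\<^bsub>obj Y (n + 1)\<^esub>"
      if "(x [^] k) \<odot>\<^bsub>obj Y n\<^esub> y = \<zero>\<^bsub>obj Y n\<^esub>" "x \<in> A" for x and k :: nat
    proof -
      have "x [^] k \<in> carrier R" using that A by auto
      then show ?thesis
        using mhom_smult[OF cpx_dif[OF Y refl] _ yc] mhom_zero[OF cpx_dif[OF Y refl]] that Y by (metis cpx_module)
    qed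
    then show ?thesis using y dif_closed[OF Y yc refl] by (fastforce simp: tors_def)
  qed
  show "r \<odot>\<^bsub>obj Y n\<^esub> y \<in> tors Y A n" if r: "r \<in> carrier R" for r
  proof -
    have "(x [^] k) \<odot>\<^bsub>obj Y n\<^esub> (r \<odot>\<^bsub>obj Y n\<^esub> y) = \<zero>\<^bsub>obj Y n\<^esub>"
      if "(x [^] k) \<odot>\<^bsub>obj Y n\<^esub> y = \<zero>\<^bsub>obj Y n\<^esub>" "x \<in> A" for x and k :: nat
    proof -
      have "x [^] k \<in> carrier R" using that A by auto
      then show ?thesis using mod_smult_comm[OF M _ r yc] that M r by simp
    qed
    then show ?thesis using y M r yc by (fastforce simp: tors_def)
  qed
  fix z assume z: "z \<in> tors Y A n"
  then have zc: "z \<in> elts Y n" by (simp add: tors_def)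
  have "\<exists>k::nat. (x [^] k) \<odot>\<^bsub>obj Y n\<^esub> (y \<oplus>\<^bsub>obj Y n\<^esub> z) = \<zero>\<^bsub>obj Y n\<^esub>" if x: "x \<in> A" for x
  proof -
    obtain k l :: nat where k: "(x [^] k) \<odot>\<^bsub>obj Y n\<^esub> y = \<zero>\<^bsub>obj Y n\<^esub>" and l: "(x [^] l) \<odot>\<^bsub>obj Y n\<^esub> z = \<zero>\<^bsub>obj Y n\<^esub>"
      using y z x unfolding tors_def by blast
    have xR: "x \<in> carrier R" using x A by auto
    have "(x [^] (k + l)) \<odot>\<^bsub>obj Y n\<^esub> y = \<zero>\<^bsub>obj Y n\<^esub>" by (rule power_kill_mono[OF M xR yc k]) simp
    moreover have "(x [^] (k + l)) \<odot>\<^bsub>obj Y n\<^esub> z = \<zero>\<^bsub>obj Y n\<^esub>" by (rule power_kill_mono[OF M xR zc l]) simp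
    ultimately have "(x [^] (k + l)) \<odot>\<^bsub>obj Y n\<^esub> (y \<oplus>\<^bsub>obj Y n\<^esub> z) = \<zero>\<^bsub>obj Y n\<^esub>"
      using M xR yc zc by (simp add: mod_smult_add)
    then show ?thesis by blast
  qed
  then show "y \<oplus>\<^bsub>obj Y n\<^esub> z \<in> tors Y A n" using M yc zc by (simp add: tors_def)
qed

text \<open>By induction on the sequence: the elements killed by powers of \<open>set xs\<close> are passed to first, and within
  them those killed by powers of the next element \<open>x\<close>. In the second step \<open>x\<close> acts injectively on the
  quotient, and surjectively by \<open>div\<close>. The clause on annihilators in \<open>div\<close> keeps the quotient \<open>y'\<close> inside the
  torsion part already reached.\<close>

theorem koszul_tors_hiso:
  assumes Y: "n_complex R N (Y :: ('r, 'y) ncomplex)"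
    and div: "\<And>n y x. y \<in> elts Y n \<Longrightarrow> x \<in> carrier R \<Longrightarrow> \<exists>k::nat. \<exists>y'\<in>elts Y n.
      (x [^] Suc k) \<odot>\<^bsub>obj Y n\<^esub> y' = (x [^] k) \<odot>\<^bsub>obj Y n\<^esub> y \<and>
      (\<forall>r\<in>carrier R. r \<odot>\<^bsub>obj Y n\<^esub> y = \<zero>\<^bsub>obj Y n\<^esub> \<longrightarrow> r \<odot>\<^bsub>obj Y n\<^esub> y' = \<zero>\<^bsub>obj Y n\<^esub>)"
  shows "set xs \<subseteq> carrier R \<Longrightarrow>
    hiso (qHom (koszul R N xs) (sub_cpx Y (tors Y (set xs)))) (qHom (koszul R N xs) Y) (post (\<lambda>n y. y) (koszul R N xs))"
proof (induction xs rule: rev_induct)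
  case Nil
  have "tors Y (set []) = (\<lambda>n. elts Y n)" by (simp add: tors_def fun_eq_iff)
  then have e: "sub_cpx Y (tors Y (set [])) = Y" by (simp add: sub_cpx_def)
  have "chain_iso Y Y (\<lambda>n y. y)" by (auto simp: chain_iso_def chain_map_def mhom_id bij_betw_def inj_on_def)
  from koszul_hiso[OF chain_iso_hiso[OF this Y Y] Y Y] show ?case unfolding e by simp
next
  case (snoc x xs)
  let ?K = "koszul R N xs" and ?U = "tors Y (set xs)" and ?T = "tors Y (set (xs @ [x]))"
  have x: "x \<in> carrier R" and xs: "set xs \<subseteq> carrier R" using snoc.prems by auto
  let ?Y0 = "sub_cpx Y ?U"
  note K = koszul_n_complex[OF xs]
  note P = kcone_n_complex[OF K x]
  have S0: "subcomplex Y ?U" by (rule tors_subcomplex[OF Y xs])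
  note Y0 = sub_cpx_n_complex[OF Y S0]
  have ST: "subcomplex Y ?T" by (rule tors_subcomplex[OF Y snoc.prems])
  have TT: "?T n \<subseteq> ?U n" for n by (auto simp: tors_def)
  have S: "subcomplex ?Y0 ?T" using ST TT by (auto simp: subcomplex_def)
  note F = sub_cpx_n_complex[OF Y0 S]
  obtain B where B: "finite_basis TYPE('y) ?K B" using koszul_finite_basis[OF xs] by blast
  have neg0: "y \<ominus>\<^bsub>obj ?Y0 n\<^esub> z = y \<ominus>\<^bsub>obj Y n\<^esub> z" if "y \<in> ?U n" "z \<in> ?U n" for y z n
    using mhom_diff[OF chain_map_mhom[OF sub_cpx_incl[OF S0]] cpx_module[OF Y0] cpx_module[OF Y]] that by simp
  have 1: "hiso (qHom (kcone x ?K) ?Y0) (qHom (kcone x ?K) Y) (post (\<lambda>n y. y) (kcone x ?K))"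
    using snoc xs by (intro hiso_kcone[OF K x Y0 Y sub_cpx_incl[OF S0]]) auto
  have 2: "hiso (qHom (kcone x ?K) (sub_cpx ?Y0 ?T)) (qHom (kcone x ?K) ?Y0) (post (\<lambda>n y. y) (kcone x ?K))"
  proof (rule hiso_kcone_sub[OF K x Y0 S B])
    fix n y assume "y \<in> elts ?Y0 n" and xy: "x \<odot>\<^bsub>obj ?Y0 n\<^esub> y \<in> ?T n"
    then have y: "y \<in> ?U n" "y \<in> elts Y n" by (auto simp: tors_def)
    obtain k :: nat where "(x [^] k) \<odot>\<^bsub>obj Y n\<^esub> (x \<odot>\<^bsub>obj Y n\<^esub> y) = \<zero>\<^bsub>obj Y n\<^esub>" using xy by (auto simp: tors_def)
    then have "(x [^] Suc k) \<odot>\<^bsub>obj Y n\<^esub> y = \<zero>\<^bsub>obj Y n\<^esub>" using Y y x by (simp add: mod_mult_smult)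
    then have "\<exists>k::nat. (x [^] k) \<odot>\<^bsub>obj Y n\<^esub> y = \<zero>\<^bsub>obj Y n\<^esub>" by blast
    then show "y \<in> ?T n" using y by (auto simp: tors_def)
  next
    fix n y assume "y \<in> elts ?Y0 n"
    then have y: "y \<in> ?U n" "y \<in> elts Y n" by (auto simp: tors_def)
    obtain k :: nat and y' where y': "y' \<in> elts Y n" "(x [^] Suc k) \<odot>\<^bsub>obj Y n\<^esub> y' = (x [^] k) \<odot>\<^bsub>obj Y n\<^esub> y"
      "\<And>r. r \<in> carrier R \<Longrightarrow> r \<odot>\<^bsub>obj Y n\<^esub> y = \<zero>\<^bsub>obj Y n\<^esub> \<Longrightarrow> r \<odot>\<^bsub>obj Y n\<^esub> y' = \<zero>\<^bsub>obj Y n\<^esub>"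
      using div[OF y(2) x] by blast
    have y0: "y' \<in> ?U n"
      unfolding tors_def
    proof (intro CollectI conjI ballI)
      fix z assume z: "z \<in> set xs"
      then obtain j :: nat where j: "(z [^] j) \<odot>\<^bsub>obj Y n\<^esub> y = \<zero>\<^bsub>obj Y n\<^esub>" using y by (auto simp: tors_def)
      have "z [^] j \<in> carrier R" using z xs by auto
      then show "\<exists>k::nat. (z [^] k) \<odot>\<^bsub>obj Y n\<^esub> y' = \<zero>\<^bsub>obj Y n\<^esub>" using y'(3) j by blast
    qed (rule y'(1))
    have xy': "x \<odot>\<^bsub>obj Y n\<^esub> y' \<in> ?U n" using mod_smult[OF cpx_module[OF Y0] x, of y' n] y0 by simp
    let ?d = "y \<ominus>\<^bsub>obj Y n\<^esub> (x \<odot>\<^bsub>obj Y n\<^esub> y')"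
    have d0: "?d \<in> ?U n" using mod_diff[OF cpx_module[OF Y0], of y n "x \<odot>\<^bsub>obj Y n\<^esub> y'"] y(1) xy' by (simp add: neg0)
    have "(x [^] k) \<odot>\<^bsub>obj Y n\<^esub> (x \<odot>\<^bsub>obj Y n\<^esub> y') = (x [^] Suc k) \<odot>\<^bsub>obj Y n\<^esub> y'"
      using Y x y'(1) by (simp add: mod_mult_smult)
    then have "(x [^] k) \<odot>\<^bsub>obj Y n\<^esub> ?d = \<zero>\<^bsub>obj Y n\<^esub>"
      unfolding y'(2) using Y x y(2) y'(1) by (simp add: mod_smult_diff)
    then have "?d \<in> ?T n" using d0 by (auto simp: tors_def)
    then show "\<exists>y'\<in>elts ?Y0 n. y \<ominus>\<^bsub>obj ?Y0 n\<^esub> (x \<odot>\<^bsub>obj ?Y0 n\<^esub> y') \<in> ?T n"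
      using y0 y(1) xy' by (intro bexI[of _ y']) (simp_all add: neg0)
  qed
  note Q = qHom_n_complex[OF P F] qHom_n_complex[OF P Y0] qHom_n_complex[OF P Y]
  have "hiso (qHom (kcone x ?K) (sub_cpx ?Y0 ?T)) (qHom (kcone x ?K) Y)
     (\<lambda>n f. post (\<lambda>n y. y) (kcone x ?K) n (post (\<lambda>n y. y) (kcone x ?K) n f))"
    by (rule hiso_comp[OF 2 1 Q])
  then show ?case
    unfolding koszul_snoc sub_cpx_sub_cpx
    by (rule hiso_cong) (use Q(1) in \<open>simp_all add: post_id\<close>)
qed

end

section \<open>Injective modules and torsion over noetherian rings\<close>

context cring
begin

definition annih :: "('a, 'm) module \<Rightarrow> 'm \<Rightarrow> 'a set" where
  "annih M m = {r \<in> carrier R. r \<odot>\<^bsub>M\<^esub> m = \<zero>\<^bsub>M\<^esub>}"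

lemma annih_ideal:
  assumes M: "module R M" and m: "m \<in> carrier M"
  shows "ideal (annih M m) R"
proof (rule idealI)
  show "ring R" by (rule ring_axioms)
  show "subgroup (annih M m) (add_monoid R)"
    by (rule subgroup.intro)
      (use M m in \<open>auto simp: annih_def mod_add_smult mod_neg_smult a_inv_def[symmetric]\<close>)
  fix a x assume "a \<in> annih M m" and x: "x \<in> carrier R"
  then have a: "a \<in> carrier R" "a \<odot>\<^bsub>M\<^esub> m = \<zero>\<^bsub>M\<^esub>" by (auto simp: annih_def)
  have "(x \<otimes> a) \<odot>\<^bsub>M\<^esub> m = \<zero>\<^bsub>M\<^esub>" using M m a x by (simp add: mod_mult_smult)
  then show "x \<otimes> a \<in> annih M m" "a \<otimes> x \<in> annih M m" using a x by (simp_all add: annih_def m_comm)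
qed

text \<open>Baer's criterion for the ideal \<open>I\<close> generated by \<open>J\<close> and \<open>r\<close>: the assignment \<open>j + c r \<mapsto> c y'\<close> is well
  defined by \<open>wd\<close>, and the value at \<open>1\<close> of an extension to \<open>R\<close> is the element sought. Modules over the test type
  \<open>nat \<Rightarrow> 'a\<close> are obtained from ideals by the embedding that sends a ring element to a constant sequence.\<close>

lemma injective_extend:
  fixes E :: "('a, 'i) module"
  assumes E: "injective_module TYPE(nat \<Rightarrow> 'a) R E" and J: "ideal J R" and r: "r \<in> carrier R"
    and y': "y' \<in> carrier E" and wd: "\<And>c. c \<in> carrier R \<Longrightarrow> c \<otimes> r \<in> J \<Longrightarrow> c \<odot>\<^bsub>E\<^esub> y' = \<zero>\<^bsub>E\<^esub>"
  shows "\<exists>y\<in>carrier E. (\<forall>j\<in>J. j \<odot>\<^bsub>E\<^esub> y = \<zero>\<^bsub>E\<^esub>) \<and> r \<odot>\<^bsub>E\<^esub> y = y'"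
proof -
  have M: "module R E" using E by (simp add: injective_module_def)
  interpret J: ideal J R by (rule J)
  let ?k = "\<lambda>a. (\<lambda>_::nat. a)"
  define B :: "('a, nat \<Rightarrow> 'a) module" where
    "B = mk_module (?k ` carrier R) (?k \<zero>) (\<lambda>u v. ?k (u 0 \<oplus> v 0)) (\<lambda>s u. ?k (s \<otimes> u 0))"
  define I where "I = {j \<oplus> c \<otimes> r | j c. j \<in> J \<and> c \<in> carrier R}"
  have B: "module R B"
    by (rule module_by_zero_neg) (auto simp: B_def a_ac m_ac l_distr r_distr)
  have Jc: "j \<in> J \<Longrightarrow> j \<in> carrier R" for j by (rule J.Icarr)
  have Iadd: "a \<oplus> b \<in> I" if ab: "a \<in> I" "b \<in> I" for a b
  proof -
    obtain j c j' c' where a: "a = j \<oplus> c \<otimes> r" "j \<in> J" "c \<in> carrier R" and b: "b = j' \<oplus> c' \<otimes> r" "j' \<in> J" "c' \<in> carrier R"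
      using ab unfolding I_def by blast
    have "a \<oplus> b = (j \<oplus> j') \<oplus> (c \<oplus> c') \<otimes> r" using a b r Jc by (simp add: l_distr a_ac)
    then show ?thesis unfolding I_def using a b by blast
  qed
  have Imul: "s \<otimes> a \<in> I" if a: "a \<in> I" and s: "s \<in> carrier R" for a s
  proof -
    obtain j c where j: "a = j \<oplus> c \<otimes> r" "j \<in> J" "c \<in> carrier R" using a unfolding I_def by blast
    have "s \<otimes> a = s \<otimes> j \<oplus> (s \<otimes> c) \<otimes> r" using j r Jc s by (simp add: r_distr m_assoc)
    moreover have "s \<otimes> j \<in> J" using j s by (simp add: J.I_l_closed)
    ultimately show ?thesis unfolding I_def using j s by blast
  qed
  have Ic: "I \<subseteq> carrier R" using Jc r by (auto simp: I_def)
  have JI: "j \<in> I" if "j \<in> J" for j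
  proof -
    have "j = j \<oplus> \<zero> \<otimes> r" using Jc[OF that] r by simp
    then show ?thesis unfolding I_def using that by blast
  qed
  have rI: "r \<in> I"
  proof -
    have "r = \<zero> \<oplus> \<one> \<otimes> r" using r by simp
    then show ?thesis unfolding I_def using J.zero_closed by blast
  qed
  let ?A = "B\<lparr>carrier := ?k ` I\<rparr>"
  have A: "module R ?A"
    by (rule module_restrict[OF B]) (use Ic JI J.zero_closed Iadd Imul in \<open>auto simp: B_def\<close>)
  define \<phi> where "\<phi> a = (SOME z. \<exists>j\<in>J. \<exists>c\<in>carrier R. a = j \<oplus> c \<otimes> r \<and> z = c \<odot>\<^bsub>E\<^esub> y')" for a
  have phi: "\<phi> (j \<oplus> c \<otimes> r) = c \<odot>\<^bsub>E\<^esub> y'" if j: "j \<in> J" and c: "c \<in> carrier R" for j c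
  proof -
    have "z = c \<odot>\<^bsub>E\<^esub> y'" if z: "\<exists>j'\<in>J. \<exists>c'\<in>carrier R. j \<oplus> c \<otimes> r = j' \<oplus> c' \<otimes> r \<and> z = c' \<odot>\<^bsub>E\<^esub> y'" for z
    proof -
      obtain j' c' where c': "j' \<in> J" "c' \<in> carrier R" "j \<oplus> c \<otimes> r = j' \<oplus> c' \<otimes> r" "z = c' \<odot>\<^bsub>E\<^esub> y'"
        using z by blast
      have "(c' \<ominus> c) \<otimes> r = j \<ominus> j'"
      proof -
        have cr: "c \<otimes> r \<in> carrier R" "c' \<otimes> r \<in> carrier R" using c c' r by auto
        have "c' \<otimes> r = \<ominus> j' \<oplus> (j \<oplus> c \<otimes> r)"
          unfolding c'(3) using Jc[OF c'(1)] cr by (simp add: r_neg1)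
        then have "c' \<otimes> r \<ominus> c \<otimes> r = j \<ominus> j'"
          using Jc[OF j] Jc[OF c'(1)] cr by (simp add: a_minus_def a_ac r_neg)
        then show ?thesis using c c' r by (simp add: a_minus_def l_distr l_minus)
      qed
      moreover have "j \<ominus> j' \<in> J" using j c'(1) by (simp add: a_minus_def J.a_closed J.a_inv_closed)
      ultimately have "(c' \<ominus> c) \<odot>\<^bsub>E\<^esub> y' = \<zero>\<^bsub>E\<^esub>" using c c' by (intro wd) auto
      then have "c' \<odot>\<^bsub>E\<^esub> y' \<ominus>\<^bsub>E\<^esub> c \<odot>\<^bsub>E\<^esub> y' = \<zero>\<^bsub>E\<^esub>"
        using M c c' y' by (simp add: a_minus_def mod_add_smult mod_neg_smult)
      then show ?thesis using M c c' y' by (simp add: mod_diff_eq_zero)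
    qed
    then show ?thesis unfolding \<phi>_def using j c by (intro some_equality) blast+
  qed
  have f: "(\<lambda>u. \<phi> (u 0)) \<in> mhom R ?A E"
  proof (rule mhomI)
    fix u assume "u \<in> carrier ?A"
    then obtain j c where u: "u = ?k (j \<oplus> c \<otimes> r)" "j \<in> J" "c \<in> carrier R" by (auto simp: I_def)
    show "\<phi> (u 0) \<in> carrier E" using u M y' by (simp add: phi)
    show "\<phi> ((s \<odot>\<^bsub>?A\<^esub> u) 0) = s \<odot>\<^bsub>E\<^esub> \<phi> (u 0)" if s: "s \<in> carrier R" for s
    proof -
      have "s \<otimes> (j \<oplus> c \<otimes> r) = s \<otimes> j \<oplus> (s \<otimes> c) \<otimes> r" using u r Jc s by (simp add: r_distr m_assoc)
      moreover have "s \<otimes> j \<in> J" using u s by (simp add: J.I_l_closed)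
      ultimately have "\<phi> (s \<otimes> (j \<oplus> c \<otimes> r)) = (s \<otimes> c) \<odot>\<^bsub>E\<^esub> y'" using u s by (simp add: phi)
      then show ?thesis using u s M y' by (simp add: B_def phi mod_mult_smult)
    qed
    fix v assume "v \<in> carrier ?A"
    then obtain j' c' where v: "v = ?k (j' \<oplus> c' \<otimes> r)" "j' \<in> J" "c' \<in> carrier R" by (auto simp: I_def)
    have "(j \<oplus> c \<otimes> r) \<oplus> (j' \<oplus> c' \<otimes> r) = (j \<oplus> j') \<oplus> (c \<oplus> c') \<otimes> r" using u v r Jc by (simp add: l_distr a_ac)
    then have "\<phi> ((j \<oplus> c \<otimes> r) \<oplus> (j' \<oplus> c' \<otimes> r)) = (c \<oplus> c') \<odot>\<^bsub>E\<^esub> y'" using u v by (simp add: phi J.a_closed)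
    then show "\<phi> ((u \<oplus>\<^bsub>?A\<^esub> v) 0) = \<phi> (u 0) \<oplus>\<^bsub>E\<^esub> \<phi> (v 0)"
      using u v M y' by (simp add: B_def phi mod_add_smult)
  qed
  have i: "(\<lambda>u. u) \<in> mhom R ?A B" "inj_on (\<lambda>u. u) (carrier ?A)"
  proof -
    have "carrier ?A \<subseteq> carrier B" unfolding B_def using image_mono[OF Ic, of ?k] by simp
    then show "(\<lambda>u. u) \<in> mhom R ?A B" by (intro mhomI) auto
  qed simp
  have "\<exists>g\<in>mhom R B E. \<forall>u\<in>carrier ?A. g ((\<lambda>u. u) u) = \<phi> (u 0)"
    using E A B f i unfolding injective_module_def by blast
  then obtain g where g: "g \<in> mhom R B E" "\<And>u. u \<in> carrier ?A \<Longrightarrow> g u = \<phi> (u 0)" by auto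
  let ?y = "g (?k \<one>)"
  have k1: "?k \<one> \<in> carrier B" by (auto simp: B_def)
  have ga: "g (?k a) = a \<odot>\<^bsub>E\<^esub> ?y" if "a \<in> carrier R" for a
    using mhom_smult[OF g(1) that k1] that by (simp add: B_def)
  show ?thesis
  proof (intro bexI conjI ballI)
    show "?y \<in> carrier E" by (rule mhom_closed[OF g(1) k1])
    fix j assume j: "j \<in> J"
    have "j \<odot>\<^bsub>E\<^esub> ?y = \<phi> (j \<oplus> \<zero> \<otimes> r)"
      using ga[OF Jc[OF j]] g(2)[of "?k j"] JI[OF j] Jc[OF j] r by simp
    then show "j \<odot>\<^bsub>E\<^esub> ?y = \<zero>\<^bsub>E\<^esub>" using phi[OF j zero_closed] M y' by simp
  next
    have "r \<odot>\<^bsub>E\<^esub> ?y = \<phi> (\<zero> \<oplus> \<one> \<otimes> r)" using ga[OF r] g(2)[of "?k r"] rI r by simp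
    then show "r \<odot>\<^bsub>E\<^esub> ?y = y'" using phi[OF J.zero_closed one_closed] M y' by simp
  qed
qed

text \<open>The ascending chain condition, in the form needed for noetherian induction.\<close>

lemma noetherian_wf:
  assumes "noetherian_ring R"
  shows "wf {(I, J). ideal I R \<and> ideal J R \<and> J \<subset> I}"
  unfolding wf_iff_no_infinite_down_chain
proof
  assume "\<exists>f. \<forall>i. (f (Suc i), f i) \<in> {(I, J). ideal I R \<and> ideal J R \<and> J \<subset> I}"
  then obtain f :: "nat \<Rightarrow> 'a set"
    where "\<forall>i. (f (Suc i), f i) \<in> {(I, J). ideal I R \<and> ideal J R \<and> J \<subset> I}" by (rule exE)
  then have f: "\<And>i. ideal (f i) R" "\<And>i. f i \<subset> f (Suc i)" by auto
  have mono: "f i \<subseteq> f j" if "i \<le> j" for i j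
    by (rule lift_Suc_mono_le[of f]) (use f(2) that in \<open>simp_all add: less_imp_le\<close>)
  interpret noetherian_ring R by (rule assms)
  have "subset.chain {I. ideal I R} (range f)"
    unfolding subset_chain_def
  proof (intro conjI ballI)
    show "range f \<subseteq> {I. ideal I R}" using f(1) by blast
    fix I J assume "I \<in> range f" and "J \<in> range f"
    then obtain i j where "I = f i" "J = f j" by blast
    then show "I \<subseteq> J \<or> J \<subseteq> I" using mono[of i j] mono[of j i] by (cases "i \<le> j") auto
  qed
  from ideal_chain_is_trivial[OF _ this] obtain k where "\<Union> (range f) = f k" by auto
  then show False using f(2)[of k] by blast
qed

text \<open>The annihilators of \<open>x\<^sup>k y\<close> increase with \<open>k\<close> and become stationary. For such a \<open>k\<close>, every \<open>c\<close> that kills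
  \<open>x\<^bsup>k+1\<^esup> y\<close> also kills \<open>x\<^sup>k y\<close>, so that the division of \<open>x\<^sup>k y\<close> by \<open>x\<^bsup>k+1\<^esup>\<close> is possible in an injective module,
  even with a quotient killed by everything that kills \<open>y\<close>.\<close>

lemma injective_divisible:
  assumes noeth: "noetherian_ring R" and E: "injective_module TYPE(nat \<Rightarrow> 'a) R E"
    and y: "y \<in> carrier E" and x: "x \<in> carrier R"
  shows "\<exists>k::nat. \<exists>y'\<in>carrier E. (x [^] Suc k) \<odot>\<^bsub>E\<^esub> y' = (x [^] k) \<odot>\<^bsub>E\<^esub> y \<and>
    (\<forall>r\<in>carrier R. r \<odot>\<^bsub>E\<^esub> y = \<zero>\<^bsub>E\<^esub> \<longrightarrow> r \<odot>\<^bsub>E\<^esub> y' = \<zero>\<^bsub>E\<^esub>)"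
proof -
  have M: "module R E" using E by (simp add: injective_module_def)
  let ?J = "\<lambda>k::nat. annih E ((x [^] k) \<odot>\<^bsub>E\<^esub> y)"
  have J: "ideal (?J k) R" for k using M x y by (intro annih_ideal) auto
  have sub: "?J k \<subseteq> ?J (Suc k)" for k
  proof
    fix r assume "r \<in> ?J k"
    then have r: "r \<in> carrier R" "r \<odot>\<^bsub>E\<^esub> ((x [^] k) \<odot>\<^bsub>E\<^esub> y) = \<zero>\<^bsub>E\<^esub>" by (auto simp: annih_def)
    have "(x [^] Suc k) \<odot>\<^bsub>E\<^esub> y = (x [^] k) \<odot>\<^bsub>E\<^esub> (x \<odot>\<^bsub>E\<^esub> y)" using M x y by (simp add: mod_mult_smult)
    also have "\<dots> = x \<odot>\<^bsub>E\<^esub> ((x [^] k) \<odot>\<^bsub>E\<^esub> y)" using M x y by (intro mod_smult_comm) auto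
    finally have "(x [^] Suc k) \<odot>\<^bsub>E\<^esub> y = x \<odot>\<^bsub>E\<^esub> ((x [^] k) \<odot>\<^bsub>E\<^esub> y)" .
    moreover have "r \<odot>\<^bsub>E\<^esub> (x \<odot>\<^bsub>E\<^esub> ((x [^] k) \<odot>\<^bsub>E\<^esub> y)) = \<zero>\<^bsub>E\<^esub>"
      using mod_smult_comm[OF M r(1) x, of "(x [^] k) \<odot>\<^bsub>E\<^esub> y"] M x y by (simp add: r(2))
    ultimately show "r \<in> ?J (Suc k)" unfolding annih_def using r(1) by (simp only: mem_Collect_eq)
  qed
  obtain k where "\<not> ?J k \<subset> ?J (Suc k)"
  proof (rule ccontr)
    assume "\<not> thesis"
    then have "\<forall>k. ?J k \<subset> ?J (Suc k)" using that by (rule_tac ccontr) (simp only: not_all, elim exE, simp)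
    then have "\<forall>k. (?J (Suc k), ?J k) \<in> {(I, J). ideal I R \<and> ideal J R \<and> J \<subset> I}"
      using J by (simp only: mem_Collect_eq case_prod_conv) simp
    then show False
      using noetherian_wf[OF noeth] unfolding wf_iff_no_infinite_down_chain by (elim notE, intro exI)
  qed
  then have k: "?J (Suc k) = ?J k" using sub[of k] unfolding psubset_eq by metis
  have J0: "ideal (annih E y) R" by (rule annih_ideal[OF M y])
  have xk: "(x [^] k) \<odot>\<^bsub>E\<^esub> y \<in> carrier E" using M x y by simp
  have "\<exists>y'\<in>carrier E. (\<forall>j\<in>annih E y. j \<odot>\<^bsub>E\<^esub> y' = \<zero>\<^bsub>E\<^esub>) \<and> (x [^] Suc k) \<odot>\<^bsub>E\<^esub> y' = (x [^] k) \<odot>\<^bsub>E\<^esub> y"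
  proof (rule injective_extend[OF E J0 _ xk])
    show "x [^] Suc k \<in> carrier R" using x by simp
    fix c assume c: "c \<in> carrier R" and "c \<otimes> x [^] Suc k \<in> annih E y"
    then have "c \<in> ?J (Suc k)" using M x y by (simp add: annih_def mod_mult_smult)
    then show "c \<odot>\<^bsub>E\<^esub> ((x [^] k) \<odot>\<^bsub>E\<^esub> y) = \<zero>\<^bsub>E\<^esub>" unfolding k by (simp add: annih_def)
  qed
  then obtain y' where y': "y' \<in> carrier E" "\<forall>j\<in>annih E y. j \<odot>\<^bsub>E\<^esub> y' = \<zero>\<^bsub>E\<^esub>"
    "(x [^] Suc k) \<odot>\<^bsub>E\<^esub> y' = (x [^] k) \<odot>\<^bsub>E\<^esub> y" by blast
  then have "\<forall>r\<in>carrier R. r \<odot>\<^bsub>E\<^esub> y = \<zero>\<^bsub>E\<^esub> \<longrightarrow> r \<odot>\<^bsub>E\<^esub> y' = \<zero>\<^bsub>E\<^esub>" by (simp add: annih_def)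
  then show ?thesis using y'(1,3) by blast
qed

definition killed :: "'a set \<Rightarrow> ('a, 'm) module \<Rightarrow> 'm \<Rightarrow> bool" where
  "killed I M m \<longleftrightarrow> (\<forall>r\<in>I. r \<odot>\<^bsub>M\<^esub> m = \<zero>\<^bsub>M\<^esub>)"

abbreviation ipow :: "'a set \<Rightarrow> nat \<Rightarrow> 'a set" where
  "ipow I n \<equiv> I [^]\<^bsub>ideals_set R\<^esub> n"

lemma ipow_0: "ipow I 0 = carrier R"
  by (simp add: ideals_set_def)

lemma ipow_Suc: "ipow I (Suc n) = ipow I n \<cdot>\<^bsub>R\<^esub> I"
  by (simp add: ideals_set_def)

lemma ipow_ideal: "ideal I R \<Longrightarrow> ideal (ipow I n) R"
proof (induction n)
  case 0
  show ?case unfolding ipow_0 by (rule oneideal)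
next
  case (Suc n)
  then show ?case unfolding ipow_Suc by (intro ideal_prod_is_ideal)
qed

lemma killed_prod:
  assumes M: "module R M" and m: "m \<in> carrier M" and I: "ideal I R" and J: "ideal J R"
    and k: "\<And>i j. i \<in> I \<Longrightarrow> j \<in> J \<Longrightarrow> (i \<otimes> j) \<odot>\<^bsub>M\<^esub> m = \<zero>\<^bsub>M\<^esub>"
  shows "killed (I \<cdot>\<^bsub>R\<^esub> J) M m"
  unfolding killed_def
proof
  fix r assume "r \<in> I \<cdot>\<^bsub>R\<^esub> J"
  then show "r \<odot>\<^bsub>M\<^esub> m = \<zero>\<^bsub>M\<^esub>"
  proof (induction r rule: ideal_prod.induct)
    case (prod i j)
    then show ?case by (rule k)
  next
    case (sum s1 s2)
    then have "s1 \<in> carrier R" "s2 \<in> carrier R"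
      using ideal_prod_in_carrier[OF I J] by blast+
    then show ?case using sum M m by (simp add: mod_add_smult)
  qed
qed

lemma killed_ipow_Suc:
  assumes M: "module R M" and m: "m \<in> carrier M" and I: "ideal I R" and k: "killed (ipow I n) M m"
  shows "killed (ipow I (Suc n)) M m"
  unfolding ipow_Suc
proof (rule killed_prod[OF M m ipow_ideal[OF I] I])
  fix i j assume i: "i \<in> ipow I n" and j: "j \<in> I"
  have "i \<in> carrier R" "j \<in> carrier R" using i j ideal.Icarr[OF ipow_ideal[OF I]] ideal.Icarr[OF I] by auto
  then show "(i \<otimes> j) \<odot>\<^bsub>M\<^esub> m = \<zero>\<^bsub>M\<^esub>"
    using i M m k by (simp add: mod_mult_smult mod_smult_comm[of M i j] killed_def)
qed

lemma killed_ipow_mono: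
  "module R M \<Longrightarrow> m \<in> carrier M \<Longrightarrow> ideal I R \<Longrightarrow> killed (ipow I n) M m \<Longrightarrow> n \<le> n' \<Longrightarrow> killed (ipow I n') M m"
proof (rotate_tac 4, induction n' rule: dec_induct)
  case (step k)
  show ?case by (rule killed_ipow_Suc[OF step(4-6) step(3)[OF step(4-7)]])
qed simp

lemma power_in_ipow: "x \<in> I \<Longrightarrow> x \<in> carrier R \<Longrightarrow> x [^] n \<in> ipow I n"
proof (induction n)
  case 0
  show ?case unfolding ipow_0 by simp
next
  case (Suc n)
  then show ?case unfolding ipow_Suc by (auto intro: ideal_prod.prod)
qed

text \<open>By induction on the sum of the exponents: each generator lowers one of them, so some power of the ideal
  kills all the products of \<open>m\<close> with a generator, and the next power kills \<open>m\<close>.\<close>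

lemma killed_of_generators:
  assumes M: "module R M" and A: "finite A" "A \<subseteq> carrier R"
  shows "m \<in> carrier M \<Longrightarrow> (\<forall>x\<in>A. (x [^] (e x :: nat)) \<odot>\<^bsub>M\<^esub> m = \<zero>\<^bsub>M\<^esub>) \<Longrightarrow> \<exists>n. killed (ipow (Idl A) n) M m"
proof (induction "\<Sum>x\<in>A. e x" arbitrary: m e rule: less_induct)
  case less
  note m = less.prems(1)
  have I: "ideal (Idl A) R" by (rule genideal_ideal[OF A(2)])
  show ?case
  proof (cases "\<exists>x\<in>A. e x = 0")
    case True
    then have "m = \<zero>\<^bsub>M\<^esub>" using less.prems M by auto
    then have "killed (ipow (Idl A) 0) M m" using M unfolding ipow_0 by (auto simp: killed_def)
    then show ?thesis by blast
  next
    case False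
    have "\<exists>n. killed (ipow (Idl A) n) M (x \<odot>\<^bsub>M\<^esub> m)" if x: "x \<in> A" for x
    proof (rule less.hyps)
      have xR: "x \<in> carrier R" using x A by auto
      let ?e = "e(x := e x - 1)"
      show "sum ?e A < sum e A"
        using x False A by (intro sum_strict_mono_ex1) (auto intro!: bexI[of _ x])
      show "x \<odot>\<^bsub>M\<^esub> m \<in> carrier M" using M xR m by simp
      show "\<forall>y\<in>A. (y [^] ?e y) \<odot>\<^bsub>M\<^esub> (x \<odot>\<^bsub>M\<^esub> m) = \<zero>\<^bsub>M\<^esub>"
      proof
        fix y assume y: "y \<in> A"
        have yR: "y \<in> carrier R" using y A by auto
        show "(y [^] ?e y) \<odot>\<^bsub>M\<^esub> (x \<odot>\<^bsub>M\<^esub> m) = \<zero>\<^bsub>M\<^esub>"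
        proof (cases "y = x")
          case True
          have "e x = Suc (e x - 1)" using False x by auto
          then have "x [^] e x = x [^] (e x - 1) \<otimes> x" by (metis nat_pow_Suc)
          then have "(x [^] (e x - 1)) \<odot>\<^bsub>M\<^esub> (x \<odot>\<^bsub>M\<^esub> m) = (x [^] e x) \<odot>\<^bsub>M\<^esub> m"
            using M xR m by (simp add: mod_mult_smult)
          then show ?thesis using True less.prems x by simp
        next
          case False
          have "(y [^] e y) \<odot>\<^bsub>M\<^esub> (x \<odot>\<^bsub>M\<^esub> m) = x \<odot>\<^bsub>M\<^esub> ((y [^] e y) \<odot>\<^bsub>M\<^esub> m)"
            using M xR yR m by (intro mod_smult_comm) auto
          then show ?thesis using False less.prems y M xR by simp
        qed
      qed
    qed
    then obtain n where n: "\<And>x. x \<in> A \<Longrightarrow> killed (ipow (Idl A) (n x)) M (x \<odot>\<^bsub>M\<^esub> m)" by metis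
    define n0 where "n0 = Max (insert 0 (n ` A))"
    have n0: "killed (ipow (Idl A) n0) M (x \<odot>\<^bsub>M\<^esub> m)" if x: "x \<in> A" for x
    proof (rule killed_ipow_mono[OF M _ I n[OF x]])
      show "x \<odot>\<^bsub>M\<^esub> m \<in> carrier M" using M m x A by auto
      show "n x \<le> n0" unfolding n0_def using x A by (intro Max_ge) auto
    qed
    have "killed (ipow (Idl A) (Suc n0)) M m"
      unfolding ipow_Suc
    proof (rule killed_prod[OF M m ipow_ideal[OF I] I])
      fix i j assume i: "i \<in> ipow (Idl A) n0" and j: "j \<in> Idl A"
      have iR: "i \<in> carrier R" using i ideal.Icarr[OF ipow_ideal[OF I]] by auto
      have im: "i \<odot>\<^bsub>M\<^esub> m \<in> carrier M" using M iR m by simp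
      have "A \<subseteq> annih M (i \<odot>\<^bsub>M\<^esub> m)"
      proof
        fix x assume x: "x \<in> A"
        then have "i \<odot>\<^bsub>M\<^esub> (x \<odot>\<^bsub>M\<^esub> m) = \<zero>\<^bsub>M\<^esub>" using n0 i by (auto simp: killed_def)
        then show "x \<in> annih M (i \<odot>\<^bsub>M\<^esub> m)" using x A M m iR mod_smult_comm[OF M iR _ m, of x] by (auto simp: annih_def)
      qed
      then have "Idl A \<subseteq> annih M (i \<odot>\<^bsub>M\<^esub> m)" by (rule genideal_minimal[OF annih_ideal[OF M im]])
      then have "j \<odot>\<^bsub>M\<^esub> (i \<odot>\<^bsub>M\<^esub> m) = \<zero>\<^bsub>M\<^esub>" "j \<in> carrier R" using j by (auto simp: annih_def)
      then show "(i \<otimes> j) \<odot>\<^bsub>M\<^esub> m = \<zero>\<^bsub>M\<^esub>" using M m iR by (simp add: mod_mult_smult mod_smult_comm[of M i j])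
    qed
    then show ?thesis by blast
  qed
qed

lemma torsion_submodule_generators:
  assumes M: "module R M" and A: "finite A" "A \<subseteq> carrier R"
  shows "torsion_submodule R (Idl A) M = {m \<in> carrier M. \<forall>x\<in>A. \<exists>k::nat. (x [^] k) \<odot>\<^bsub>M\<^esub> m = \<zero>\<^bsub>M\<^esub>}"
proof (intro equalityI subsetI)
  fix m assume "m \<in> torsion_submodule R (Idl A) M"
  then obtain n :: nat where m: "m \<in> carrier M" and n: "\<forall>r\<in>ipow (Idl A) n. r \<odot>\<^bsub>M\<^esub> m = \<zero>\<^bsub>M\<^esub>"
    by (auto simp: torsion_submodule_def)
  have "x [^] n \<in> ipow (Idl A) n" if "x \<in> A" for x
    using that A genideal_self[OF A(2)] by (intro power_in_ipow) auto
  then show "m \<in> {m \<in> carrier M. \<forall>x\<in>A. \<exists>k::nat. (x [^] k) \<odot>\<^bsub>M\<^esub> m = \<zero>\<^bsub>M\<^esub>}" using m n by blast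
next
  fix m assume "m \<in> {m \<in> carrier M. \<forall>x\<in>A. \<exists>k::nat. (x [^] k) \<odot>\<^bsub>M\<^esub> m = \<zero>\<^bsub>M\<^esub>}"
  then obtain e :: "'a \<Rightarrow> nat" where "m \<in> carrier M" "\<forall>x\<in>A. (x [^] e x) \<odot>\<^bsub>M\<^esub> m = \<zero>\<^bsub>M\<^esub>" by (auto dest: bchoice)
  then show "m \<in> torsion_submodule R (Idl A) M"
    using killed_of_generators[OF M A, of m e] by (auto simp: torsion_submodule_def killed_def)
qed

text \<open>Let \<open>n\<close> be the least exponent with \<open>I\<^sup>n m = 0\<close>. Then some \<open>r\<close> in \<open>I\<^bsup>n-1\<^esup>\<close> does not kill \<open>m\<close>, and \<open>I\<close> kills
  \<open>r m\<close>.\<close>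

lemma torsion_socle_multiple:
  assumes M: "module R M" and m: "m \<in> carrier M" and I: "ideal I R" and k: "killed (ipow I n) M m" and nz: "m \<noteq> \<zero>\<^bsub>M\<^esub>"
  obtains r where "r \<in> carrier R" "r \<odot>\<^bsub>M\<^esub> m \<noteq> \<zero>\<^bsub>M\<^esub>" "killed I M (r \<odot>\<^bsub>M\<^esub> m)"
proof -
  define n0 where "n0 = (LEAST n. killed (ipow I n) M m)"
  have k0: "killed (ipow I n0) M m" unfolding n0_def using k by (rule LeastI)
  have "n0 \<noteq> 0"
  proof
    assume "n0 = 0"
    then have "\<one> \<odot>\<^bsub>M\<^esub> m = \<zero>\<^bsub>M\<^esub>" using k0 ipow_0[of I] by (simp add: killed_def)
    then show False using M m nz by simp
  qed
  then obtain n' where n': "n0 = Suc n'" by (cases n0) auto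
  then have "\<not> killed (ipow I n') M m" unfolding n0_def using not_less_Least[of n' "\<lambda>n. killed (ipow I n) M m"] by simp
  then obtain r where r: "r \<in> ipow I n'" "r \<odot>\<^bsub>M\<^esub> m \<noteq> \<zero>\<^bsub>M\<^esub>" by (auto simp: killed_def)
  have rR: "r \<in> carrier R" using r ideal.Icarr[OF ipow_ideal[OF I]] by auto
  have "killed I M (r \<odot>\<^bsub>M\<^esub> m)"
    unfolding killed_def
  proof
    fix s assume s: "s \<in> I"
    have sR: "s \<in> carrier R" using ideal.Icarr[OF I s] .
    have "r \<otimes> s \<in> ipow I n0" unfolding n' ipow_Suc using r s by (intro ideal_prod.prod)
    then have "(r \<otimes> s) \<odot>\<^bsub>M\<^esub> m = \<zero>\<^bsub>M\<^esub>" using k0 by (auto simp: killed_def)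
    then show "s \<odot>\<^bsub>M\<^esub> (r \<odot>\<^bsub>M\<^esub> m) = \<zero>\<^bsub>M\<^esub>" using M m rR sR by (simp add: mod_mult_smult mod_smult_comm[of M s r])
  qed
  then show ?thesis using that rR r by blast
qed

end

section \<open>Lifting cycles through a semi-injective complex\<close>

text \<open>Names for the elements of the exact subcomplex generated by one element of a complex. \<open>Lift\<close> stands for a
  chosen primitive of a cycle. \<open>Down\<close> stands for zero one degree below; it is there so that all degrees are
  reached. The terms bound the size of the generated subcomplex: they can be encoded as sequences of ring
  elements.\<close>

datatype 'r sterm = Gen | Plus "'r sterm" "'r sterm" | Scal 'r "'r sterm" | Dif "'r sterm" | Lift "'r sterm" | Down "'r sterm"

text \<open>\<open>l\<close> is the degree of the generator and \<open>k\<close> the amount by which \<open>Lift\<close> lowers the degree.\<close>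

primrec sdeg :: "int \<Rightarrow> int \<Rightarrow> 'r sterm \<Rightarrow> int" where
  "sdeg l k Gen = l"
| "sdeg l k (Plus a b) = sdeg l k a"
| "sdeg l k (Scal r a) = sdeg l k a"
| "sdeg l k (Dif a) = sdeg l k a + 1"
| "sdeg l k (Lift a) = sdeg l k a - k"
| "sdeg l k (Down a) = sdeg l k a - 1"

text \<open>Terms that make no sense, like sums of terms of different degrees or lifts of elements that are not
  cycles, get harmless values, so that every term has a value.\<close>

primrec sval :: "('r, 's) ring_scheme \<Rightarrow> ('r, 'i) ncomplex \<Rightarrow> nat \<Rightarrow> (int \<Rightarrow> 'i \<Rightarrow> 'i) \<Rightarrow> int \<Rightarrow> int \<Rightarrow> 'i \<Rightarrow> 'r sterm \<Rightarrow> 'i" where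
  "sval R E t h l k z Gen = z"
| "sval R E t h l k z (Plus a b) =
     (if sdeg l k a = sdeg l k b then sval R E t h l k z a \<oplus>\<^bsub>obj E (sdeg l k a)\<^esub> sval R E t h l k z b else sval R E t h l k z a)"
| "sval R E t h l k z (Scal r a) =
     (if r \<in> carrier R then r \<odot>\<^bsub>obj E (sdeg l k a)\<^esub> sval R E t h l k z a else sval R E t h l k z a)"
| "sval R E t h l k z (Dif a) = dif E (sdeg l k a) (sval R E t h l k z a)"
| "sval R E t h l k z (Lift a) =
     (if dpow E (sdeg l k a) t (sval R E t h l k z a) = \<zero>\<^bsub>obj E (sdeg l k a + int t)\<^esub>
      then h (sdeg l k a) (sval R E t h l k z a) else \<zero>\<^bsub>obj E (sdeg l k a - k)\<^esub>)"
| "sval R E t h l k z (Down a) = \<zero>\<^bsub>obj E (sdeg l k a - 1)\<^esub>"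

text \<open>The sequence \<open>f\<close>, preceded by \<open>k\<close> copies of \<open>b\<close> and one \<open>a\<close>: the number \<open>k\<close> tags the constructor.\<close>

definition unary :: "'r \<Rightarrow> 'r \<Rightarrow> nat \<Rightarrow> (nat \<Rightarrow> 'r) \<Rightarrow> nat \<Rightarrow> 'r" where
  "unary a b k f n = (if n < k then b else if n = k then a else f (n - k - 1))"

definition interleave :: "(nat \<Rightarrow> 'r) \<Rightarrow> (nat \<Rightarrow> 'r) \<Rightarrow> nat \<Rightarrow> 'r" where
  "interleave f g n = (if even n then f (n div 2) else g (n div 2))"

lemma unary_inject:
  assumes "a \<noteq> b" "unary a b k f = unary a b k' f'"
  shows "k = k' \<and> f = f'"
proof
  have eq: "unary a b k f n = unary a b k' f' n" for n using assms(2) by simp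
  show k: "k = k'"
    using eq[of k] eq[of k'] assms(1) by (cases k k' rule: linorder_cases) (auto simp: unary_def)
  show "f = f'"
  proof
    fix n show "f n = f' n" using eq[of "n + k + 1"] k by (simp add: unary_def)
  qed
qed

lemma interleave_inject: "interleave f g = interleave f' g' \<Longrightarrow> f = f' \<and> g = g'"
proof (intro conjI ext)
  fix n assume eq: "interleave f g = interleave f' g'"
  show "f n = f' n" using fun_cong[OF eq, of "2 * n"] by (simp add: interleave_def)
  show "g n = g' n" using fun_cong[OF eq, of "2 * n + 1"] by (simp add: interleave_def)
qed

primrec sencode :: "'r \<Rightarrow> 'r \<Rightarrow> 'r sterm \<Rightarrow> nat \<Rightarrow> 'r" where
  "sencode a b Gen = unary a b 0 (\<lambda>_. a)"
| "sencode a b (Plus u v) = unary a b 1 (interleave (sencode a b u) (sencode a b v))"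
| "sencode a b (Scal r u) = unary a b 2 (case_nat r (sencode a b u))"
| "sencode a b (Dif u) = unary a b 3 (sencode a b u)"
| "sencode a b (Lift u) = unary a b 4 (sencode a b u)"
| "sencode a b (Down u) = unary a b 5 (sencode a b u)"

lemma unary_eq_iff: "a \<noteq> b \<Longrightarrow> unary a b k f = unary a b k' f' \<longleftrightarrow> k = k' \<and> f = f'"
  using unary_inject[of a b k f k' f'] by blast

lemma interleave_eq_iff: "interleave f g = interleave f' g' \<longleftrightarrow> f = f' \<and> g = g'"
  using interleave_inject[of f g f' g'] by blast

lemma case_nat_eq_iff: "case_nat r f = case_nat r' f' \<longleftrightarrow> r = r' \<and> f = f'"
proof
  assume eq: "case_nat r f = case_nat r' f'"
  show "r = r' \<and> f = f'"
    using fun_cong[OF eq, of 0] fun_cong[OF eq, of "Suc n" for n] by auto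
qed simp

lemma sencode_inject: "a \<noteq> b \<Longrightarrow> sencode a b u = sencode a b v \<Longrightarrow> u = v"
proof (induction u arbitrary: v)
  case Gen
  then show ?case by (cases v) (simp_all add: unary_eq_iff interleave_eq_iff case_nat_eq_iff)
next
  case (Plus u1 u2)
  then show ?case by (cases v) (simp_all add: unary_eq_iff interleave_eq_iff case_nat_eq_iff)
next
  case (Scal r u)
  then show ?case by (cases v) (simp_all add: unary_eq_iff interleave_eq_iff case_nat_eq_iff)
next
  case (Dif u)
  then show ?case by (cases v) (simp_all add: unary_eq_iff interleave_eq_iff case_nat_eq_iff)
next
  case (Lift u)
  then show ?case by (cases v) (simp_all add: unary_eq_iff interleave_eq_iff case_nat_eq_iff)
next
  case (Down u)
  then show ?case by (cases v) (simp_all add: unary_eq_iff interleave_eq_iff case_nat_eq_iff)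
qed

context n_complexes
begin

text \<open>Transport of structure along injections that may differ from degree to degree.\<close>

definition transport_along :: "(int \<Rightarrow> 'm \<Rightarrow> 'k) \<Rightarrow> ('r, 'm) ncomplex \<Rightarrow> ('r, 'k) ncomplex" where
  "transport_along e X =
     (let u = \<lambda>n. inv_into (elts X n) (e n) in
     \<lparr>obj = (\<lambda>n. mk_module (e n ` elts X n) (e n \<zero>\<^bsub>obj X n\<^esub>)
        (\<lambda>a b. e n (u n a \<oplus>\<^bsub>obj X n\<^esub> u n b)) (\<lambda>r a. e n (r \<odot>\<^bsub>obj X n\<^esub> u n a))),
      dif = (\<lambda>n x. e (n + 1) (dif X n (u n x)))\<rparr>)"

lemma transport_along_iso:
  assumes X: "n_complex R N X" and inj: "\<And>n. inj_on (e n) (elts X n)"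
  shows "n_complex R N (transport_along e X)" "chain_iso X (transport_along e X) e"
    "chain_map R (transport_along e X) X (\<lambda>n. inv_into (elts X n) (e n))"
proof -
  let ?A = "transport_along e X"
  define u where "u n = inv_into (elts X n) (e n)" for n
  have ue: "u n (e n x) = x" if "x \<in> elts X n" for n x
    unfolding u_def using inv_into_f_f[OF inj that] .
  have A: "elts ?A n = e n ` elts X n" "\<zero>\<^bsub>obj ?A n\<^esub> = e n \<zero>\<^bsub>obj X n\<^esub>"
    "a \<oplus>\<^bsub>obj ?A n\<^esub> b = e n (u n a \<oplus>\<^bsub>obj X n\<^esub> u n b)" "r \<odot>\<^bsub>obj ?A n\<^esub> a = e n (r \<odot>\<^bsub>obj X n\<^esub> u n a)"
    "dif ?A n a = e (n + 1) (dif X n (u n a))" for n a b r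
    by (simp_all add: transport_along_def u_def Let_def)
  have dp: "dpow ?A n k (e n x) = e (n + int k) (dpow X n k x)" if x: "x \<in> elts X n" for n k x
  proof (induction k)
    case (Suc k)
    then show ?case using dpow_closed[OF X x refl, of k] by (simp add: A ue algebra_simps)
  qed simp
  have Am: "module R (obj ?A n)" for n
    by (rule module_by_zero_neg) (use X in \<open>auto simp: A ue mod_ac mod_smult_add mod_add_smult mod_mult_smult\<close>)
  show An: "n_complex R N ?A"
    unfolding n_complex_def
  proof (intro allI conjI ballI)
    fix n
    show "module R (obj ?A n)" by (rule Am)
    show "dif ?A n \<in> mhom R (obj ?A n) (obj ?A (n + 1))"
      using X by (intro mhomI) (auto simp: A ue dif_closed mhom_add[OF cpx_dif] mhom_smult[OF cpx_dif])
    fix a assume "a \<in> elts ?A n"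
    then obtain x where x: "x \<in> elts X n" "a = e n x" by (auto simp: A)
    then show "dpow ?A n N a = \<zero>\<^bsub>obj ?A (n + int N)\<^esub>" using dpow_ge_N[OF X le_refl x(1) refl] by (simp add: dp A)
  qed
  show "chain_iso X ?A e"
    unfolding chain_iso_def chain_map_def bij_betw_def
    using inj X by (auto intro!: mhomI simp: A ue)
  show "chain_map R ?A X (\<lambda>n. inv_into (elts X n) (e n))"
    unfolding chain_map_def u_def[symmetric]
    using X by (auto intro!: mhomI simp: A ue dif_closed)
qed

text \<open>Semi-injectivity refers to complexes with carrier type \<open>nat \<Rightarrow> 'r\<close>. It carries over to every exact complex
  that embeds degreewise into this type.\<close>

lemma small_null_homotopic:
  fixes E :: "('r, 'i) ncomplex"
  assumes E: "semi_injective TYPE(nat \<Rightarrow> 'r) R N E" and X: "n_complex R N X" and t: "1 \<le> t" "t < N"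
    and ex: "\<And>l. exact_at X t l" and f: "chain_map R X E f"
    and inj: "\<And>n. inj_on (e n :: 'm \<Rightarrow> nat \<Rightarrow> 'r) (elts X n)"
  obtains s where "\<And>n. s n \<in> mhom R (obj X n) (obj E (n - int N + 1))"
    and "\<And>n x. x \<in> elts X n \<Longrightarrow> f n x = (\<Oplus>\<^bsub>obj E n\<^esub> i\<in>{0..N - 1}.
            dpow E (n + int i - int N + 1) (N - 1 - i) (s (n + int i) (dpow X n i x)))"
proof -
  let ?A = "transport_along e X" and ?u = "\<lambda>n. inv_into (elts X n) (e n)"
  note A = transport_along_iso[OF X inj]
  have En: "n_complex R N E" using E by (simp add: semi_injective_def)
  have em: "chain_map R X ?A e" using A(2) by (simp add: chain_iso_def)
  have "exact_at ?A t l" for l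
    using ex hiso_exact_at[OF chain_iso_hiso[OF A(2) X A(1)] X A(1) t] by blast
  then have "n_acyclic N ?A" by (rule n_acyclicI[OF A(1) t])
  moreover have fu: "chain_map R ?A E (\<lambda>n a. f n (?u n a))"
    unfolding chain_map_def
  proof (intro allI conjI ballI)
    fix n
    show "(\<lambda>a. f n (?u n a)) \<in> mhom R (obj ?A n) (obj E n)"
      by (rule mhom_comp[OF chain_map_mhom[OF A(3)] chain_map_mhom[OF f]])
    fix a assume a: "a \<in> elts ?A n"
    show "f (n + 1) (?u (n + 1) (dif ?A n a)) = dif E n (f n (?u n a))"
      unfolding chain_map_dif[OF A(3) a refl] by (rule chain_map_dif[OF f chain_map_closed[OF A(3) a] refl])
  qed
  ultimately have "null_homotopic R N ?A E (\<lambda>n a. f n (?u n a))"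
    using E A(1) by (simp add: semi_injective_def)
  then obtain s where s: "\<And>n. s n \<in> mhom R (obj ?A n) (obj E (n - int N + 1))"
    and h: "\<And>n a. a \<in> elts ?A n \<Longrightarrow> f n (?u n a) \<ominus>\<^bsub>obj E n\<^esub> \<zero>\<^bsub>obj E n\<^esub> = (\<Oplus>\<^bsub>obj E n\<^esub> i\<in>{0..N - 1}.
            dpow E (n + int i - int N + 1) (N - 1 - i) (s (n + int i) (dpow ?A n i a)))"
    unfolding null_homotopic_def homotopic_def by blast
  show ?thesis
  proof (rule that[of "\<lambda>n x. s n (e n x)"])
    show "(\<lambda>x. s n (e n x)) \<in> mhom R (obj X n) (obj E (n - int N + 1))" for n
      by (rule mhom_comp[OF chain_map_mhom[OF em] s])
    fix n x assume x: "x \<in> elts X n"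
    have ex: "e n x \<in> elts ?A n" by (rule chain_map_closed[OF em x])
    have "f n x \<ominus>\<^bsub>obj E n\<^esub> \<zero>\<^bsub>obj E n\<^esub> = f n x" using En chain_map_closed[OF f x] by simp
    then show "f n x = (\<Oplus>\<^bsub>obj E n\<^esub> i\<in>{0..N - 1}.
        dpow E (n + int i - int N + 1) (N - 1 - i) (s (n + int i) (e (n + int i) (dpow X n i x))))"
      using h[OF ex] by (simp only: inv_into_f_f[OF inj x] chain_map_dpow[OF em X x refl])
  qed
qed

text \<open>In the formula for a null-homotopy of the inclusion, evaluated at \<open>z\<close>, the terms with \<open>i \<ge> t\<close> vanish
  because \<open>d\<^sup>t z = 0\<close>. In each of the others at least \<open>N - t\<close> differentials are applied last. Removing them
  leaves \<open>y\<close>, which is a linear function of \<open>z\<close> and is thus killed by the annihilator of \<open>z\<close>.\<close>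

lemma null_homotopic_lift:
  fixes E :: "('r, 'i) ncomplex"
  assumes E: "semi_injective TYPE(nat \<Rightarrow> 'r) R N E" and t: "1 \<le> t" "t < N"
    and G: "subcomplex E G" and ex: "\<And>l. exact_at (sub_cpx E G) t l"
    and inj: "\<And>n. inj_on (e n :: 'i \<Rightarrow> nat \<Rightarrow> 'r) (G n)"
    and z: "z \<in> G l" and dz: "dpow E l t z = \<zero>\<^bsub>obj E (l + int t)\<^esub>"
  shows "\<exists>y\<in>elts E (l - int (N - t)). dpow E (l - int (N - t)) (N - t) y = z \<and>
    (\<forall>r\<in>carrier R. r \<odot>\<^bsub>obj E l\<^esub> z = \<zero>\<^bsub>obj E l\<^esub> \<longrightarrow> r \<odot>\<^bsub>obj E (l - int (N - t))\<^esub> y = \<zero>\<^bsub>obj E (l - int (N - t))\<^esub>)"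
proof -
  have En: "n_complex R N E" using E by (simp add: semi_injective_def)
  let ?X = "sub_cpx E G" and ?m = "l - int (N - t)"
  have X: "n_complex R N ?X" by (rule sub_cpx_n_complex[OF En G])
  have inj': "inj_on (e n) (elts ?X n)" for n using inj by simp
  obtain s where s: "\<And>n. s n \<in> mhom R (obj ?X n) (obj E (n - int N + 1))"
    and h: "\<And>n x. x \<in> elts ?X n \<Longrightarrow> x = (\<Oplus>\<^bsub>obj E n\<^esub> i\<in>{0..N - 1}.
            dpow E (n + int i - int N + 1) (N - 1 - i) (s (n + int i) (dpow ?X n i x)))"
    by (rule small_null_homotopic[OF E X t ex sub_cpx_incl[OF G] inj'], rule that) assumption+
  have zX: "z \<in> elts ?X l" using z by simp
  \<comment> \<open>The \<open>i\<close>-th term of the homotopy formula with the last \<open>N - t\<close> differentials removed.\<close>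
  define \<phi> where "\<phi> i x = dpow E (l + int i - int N + 1) (t - 1 - i) (s (l + int i) (dpow E l i x))" for i x
  have phi: "\<phi> i \<in> mhom R (obj ?X l) (obj E ?m)" if i: "i < t" for i
  proof -
    have "dpow ?X l i \<in> mhom R (obj ?X l) (obj ?X (l + int i))" by (rule dpow_mhom[OF X refl])
    then have 1: "dpow E l i \<in> mhom R (obj ?X l) (obj ?X (l + int i))" by simp
    have 2: "dpow E (l + int i - int N + 1) (t - 1 - i) \<in> mhom R (obj E (l + int i - int N + 1)) (obj E ?m)"
      using i t by (intro dpow_mhom[OF En]) auto
    show ?thesis unfolding \<phi>_def by (rule mhom_comp[OF mhom_comp[OF 1 s] 2])
  qed
  interpret M: abelian_group "obj E ?m" using En by (intro mod_abelian) simp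
  interpret L: abelian_group "obj E l" using En by (intro mod_abelian) simp
  have pc: "(\<lambda>i. \<phi> i z) \<in> {..<t} \<rightarrow> elts E ?m" by (intro funcsetI mhom_closed[OF phi zX]) simp
  define y where "y = (\<Oplus>\<^bsub>obj E ?m\<^esub>i\<in>{..<t}. \<phi> i z)"
  have y: "y \<in> elts E ?m" unfolding y_def by (rule M.finsum_closed[OF pc])
  have "dpow E ?m (N - t) y = (\<Oplus>\<^bsub>obj E l\<^esub>i\<in>{..<t}. dpow E ?m (N - t) (\<phi> i z))"
    unfolding y_def by (rule mhom_finsum[OF dpow_mhom[OF En] _ _ _ pc]) (use En t in auto)
  also have "\<dots> = (\<Oplus>\<^bsub>obj E l\<^esub>i\<in>{0..N - 1}. dpow E (l + int i - int N + 1) (N - 1 - i) (s (l + int i) (dpow E l i z)))"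
  proof (rule L.add.finprod_mono_neutral_cong_left)
    show "{..<t} \<subseteq> {0..N - 1}" using t by auto
    fix i assume "i \<in> {0..N - 1} - {..<t}"
    then have i: "t \<le> i" "i \<le> N - 1" by auto
    have "dpow E l i z = dpow E (l + int t) (i - t) (dpow E l t z)" using i by (simp add: dpow_dpow)
    also have "\<dots> = \<zero>\<^bsub>obj E (l + int i)\<^esub>" unfolding dz using i by (intro dpow_zero[OF En]) auto
    finally have "s (l + int i) (dpow E l i z) = s (l + int i) \<zero>\<^bsub>obj ?X (l + int i)\<^esub>" by simp
    also have "\<dots> = \<zero>\<^bsub>obj E (l + int i - int N + 1)\<^esub>" using X En by (intro mhom_zero[OF s]) auto
    finally show "dpow E (l + int i - int N + 1) (N - 1 - i) (s (l + int i) (dpow E l i z)) = \<zero>\<^bsub>obj E l\<^esub>"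
      using i t by (simp only:) (intro dpow_zero[OF En], auto)
  next
    fix i assume "i \<in> {..<t}"
    then have i: "i < t" by auto
    show "dpow E ?m (N - t) (\<phi> i z) = dpow E (l + int i - int N + 1) (N - 1 - i) (s (l + int i) (dpow E l i z))"
      unfolding \<phi>_def using i t by (intro dpow_comp) auto
  next
    show "(\<lambda>i. dpow E (l + int i - int N + 1) (N - 1 - i) (s (l + int i) (dpow E l i z))) \<in> {0..N - 1} \<rightarrow> elts E l"
    proof
      fix i assume "i \<in> {0..N - 1}"
      then have i: "i \<le> N - 1" by simp
      have "dpow ?X l i z \<in> elts ?X (l + int i)" by (rule dpow_closed[OF X zX refl])
      then have "s (l + int i) (dpow E l i z) \<in> elts E (l + int i - int N + 1)"
        by (intro mhom_closed[OF s]) simp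
      then show "dpow E (l + int i - int N + 1) (N - 1 - i) (s (l + int i) (dpow E l i z)) \<in> elts E l"
        using i t by (intro dpow_closed[OF En]) auto
    qed
  qed simp
  also have "\<dots> = z" using h[OF zX] by simp
  finally have dy: "dpow E ?m (N - t) y = z" .
  have "r \<odot>\<^bsub>obj E ?m\<^esub> y = \<zero>\<^bsub>obj E ?m\<^esub>" if r: "r \<in> carrier R" and rz: "r \<odot>\<^bsub>obj E l\<^esub> z = \<zero>\<^bsub>obj E l\<^esub>" for r
  proof -
    have Em: "module R (obj E ?m)" using En by simp
    have "r \<odot>\<^bsub>obj E ?m\<^esub> y = (\<Oplus>\<^bsub>obj E ?m\<^esub>i\<in>{..<t}. r \<odot>\<^bsub>obj E ?m\<^esub> \<phi> i z)"
      unfolding y_def by (rule mhom_finsum[OF mhom_scale[OF mhom_id r Em] Em Em _ pc]) simp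
    also have "\<dots> = (\<Oplus>\<^bsub>obj E ?m\<^esub>i\<in>{..<t}. \<zero>\<^bsub>obj E ?m\<^esub>)"
    proof (rule M.finsum_cong')
      fix i assume "i \<in> {..<t}"
      then have i: "\<phi> i \<in> mhom R (obj ?X l) (obj E ?m)" using phi by simp
      have "r \<odot>\<^bsub>obj E ?m\<^esub> \<phi> i z = \<phi> i \<zero>\<^bsub>obj ?X l\<^esub>" using mhom_smult[OF i r zX] rz by simp
      also have "\<dots> = \<zero>\<^bsub>obj E ?m\<^esub>" using X Em by (intro mhom_zero[OF i]) auto
      finally show "r \<odot>\<^bsub>obj E ?m\<^esub> \<phi> i z = \<zero>\<^bsub>obj E ?m\<^esub>" .
    qed auto
    finally show ?thesis by simp
  qed
  then show ?thesis using y dy by blast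
qed

text \<open>Exactness in degrees up to \<open>l\<close> suffices for an exact subcomplex that contains the cycles of degree \<open>l\<close>:
  below \<open>l\<close> one takes the elements that the differentials carry to zero in degree \<open>l + t\<close>, and above
  \<open>l\<close> the images of the cycles of degree \<open>l\<close>. Primitives of the latter arise from primitives of those
  cycles by applying differentials.\<close>

lemma truncation:
  assumes E: "n_complex R N E" and W: "subcomplex E W" and t: "1 \<le> t" "t < N"
    and ex: "\<And>j. j \<le> l \<Longrightarrow> exact_at (sub_cpx E W) t j"
  obtains T where "subcomplex E T" "\<And>j. exact_at (sub_cpx E T) t j"
    "\<And>z. z \<in> W l \<Longrightarrow> dpow E l t z = \<zero>\<^bsub>obj E (l + int t)\<^esub> \<Longrightarrow> z \<in> T l"
proof -
  \<comment> \<open>In degree \<open>l\<close> both descriptions give the cycles of \<open>W\<close>, which is what \<open>low\<close> and \<open>high\<close> express for \<open>k = 0\<close>.\<close>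
  define T where "T j = (if j \<le> l then {x \<in> W j. dpow E j (t + nat (l - j)) x = \<zero>\<^bsub>obj E (l + int t)\<^esub>}
     else dpow E l (nat (j - l)) ` {u \<in> W l. dpow E l t u = \<zero>\<^bsub>obj E (l + int t)\<^esub>})" for j
  have Wc: "x \<in> elts E n" if "x \<in> W n" for x n by (rule subcomplex_closed[OF W that])
  have Wx: "n_complex R N (sub_cpx E W)" by (rule sub_cpx_n_complex[OF E W])
  have Wd: "dpow E n k x \<in> W m" if "x \<in> W n" "m = n + int k" for x n k m
    using dpow_closed[OF Wx, of x n m k] that by simp
  have low: "x \<in> T n \<longleftrightarrow> x \<in> W n \<and> dpow E n (t + k) x = \<zero>\<^bsub>obj E (l + int t)\<^esub>" if "n = l - int k" for n k x
    using that by (simp add: T_def)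
  have high: "x \<in> T n \<longleftrightarrow> (\<exists>u \<in> W l. dpow E l t u = \<zero>\<^bsub>obj E (l + int t)\<^esub> \<and> x = dpow E l k u)" if "n = l + int k" for n k x
    using that by (cases "k = 0") (auto simp: T_def)
  have split: "(\<exists>k. j = l - int k) \<or> (\<exists>k. j = l + int k)" for j
    by (cases "j \<le> l") (auto intro: exI[of _ "nat (l - j)"] exI[of _ "nat (j - l)"])
  have WW: "\<zero>\<^bsub>obj E n\<^esub> \<in> W n" "x \<in> W n \<Longrightarrow> y \<in> W n \<Longrightarrow> x \<oplus>\<^bsub>obj E n\<^esub> y \<in> W n"
    "r \<in> carrier R \<Longrightarrow> x \<in> W n \<Longrightarrow> r \<odot>\<^bsub>obj E n\<^esub> x \<in> W n" for n x y r
    using W by (auto simp: subcomplex_def)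
  have T: "subcomplex E T"
    unfolding subcomplex_def
  proof (intro allI)
    fix n
    show "T n \<subseteq> elts E n \<and> \<zero>\<^bsub>obj E n\<^esub> \<in> T n \<and> (\<forall>x\<in>T n. \<forall>y\<in>T n. x \<oplus>\<^bsub>obj E n\<^esub> y \<in> T n) \<and>
      (\<forall>r\<in>carrier R. \<forall>x\<in>T n. r \<odot>\<^bsub>obj E n\<^esub> x \<in> T n) \<and> (\<forall>x\<in>T n. dif E n x \<in> T (n + 1))"
      using split[of n]
    proof (elim disjE exE)
      fix k assume n: "n = l - int k"
      have tk: "l + int t = n + int (t + k)" using n by simp
      show ?thesis
      proof (intro conjI ballI subsetI)
        show "x \<in> elts E n" if "x \<in> T n" for x using that Wc by (simp add: low[OF n])
        show "\<zero>\<^bsub>obj E n\<^esub> \<in> T n" unfolding low[OF n] using WW dpow_zero[OF E tk] by simp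
        show "x \<oplus>\<^bsub>obj E n\<^esub> y \<in> T n" if "x \<in> T n" "y \<in> T n" for x y
          using that WW Wc E unfolding low[OF n] by (simp add: dpow_add[OF E tk])
        show "r \<odot>\<^bsub>obj E n\<^esub> x \<in> T n" if "r \<in> carrier R" "x \<in> T n" for r x
          using that WW Wc E unfolding low[OF n] by (simp add: dpow_smult[OF E tk])
        fix x assume x: "x \<in> T n"
        show "dif E n x \<in> T (n + 1)"
        proof (cases k)
          case 0
          have "dpow E l 1 x = dif E n x" using n 0 by simp
          then show ?thesis using x n 0 high[of "n + 1" 1] unfolding low[OF n] by auto
        next
          case (Suc k')
          have "dpow E (n + 1) (t + k') (dif E n x) = dpow E n (t + k) x"
            using dpow_Suc_shift[of E n "t + k'" x] Suc by simp
          then show ?thesis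
            using x n Suc Wd[of x n "n + 1" 1] low[of "n + 1" k'] unfolding low[OF n] by simp
        qed
      qed
    next
      fix k assume n: "n = l + int k"
      let ?U = "\<lambda>u. u \<in> W l \<and> dpow E l t u = \<zero>\<^bsub>obj E (l + int t)\<^esub>"
      have mem: "dpow E l k u \<in> T n" if "?U u" for u using that by (auto simp: high[OF n])
      have obt: "\<exists>u. ?U u \<and> x = dpow E l k u" if "x \<in> T n" for x using that by (auto simp: high[OF n])
      show ?thesis
      proof (intro conjI ballI subsetI)
        show "x \<in> elts E n" if "x \<in> T n" for x
          using obt[OF that] Wc dpow_closed[OF E _ n] by auto
        have "?U \<zero>\<^bsub>obj E l\<^esub>" using WW dpow_zero[OF E refl] by simp
        from mem[OF this] show "\<zero>\<^bsub>obj E n\<^esub> \<in> T n" using dpow_zero[OF E n] by simp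
        show "x \<oplus>\<^bsub>obj E n\<^esub> y \<in> T n" if xy: "x \<in> T n" "y \<in> T n" for x y
        proof -
          obtain u v where u: "?U u" "x = dpow E l k u" and v: "?U v" "y = dpow E l k v" using obt xy by blast
          have "?U (u \<oplus>\<^bsub>obj E l\<^esub> v)" using u v WW Wc E by (simp add: dpow_add[OF E refl])
          from mem[OF this] show ?thesis using u v Wc by (simp add: dpow_add[OF E n])
        qed
        show "r \<odot>\<^bsub>obj E n\<^esub> x \<in> T n" if r: "r \<in> carrier R" and x: "x \<in> T n" for r x
        proof -
          obtain u where u: "?U u" "x = dpow E l k u" using obt x by blast
          have "?U (r \<odot>\<^bsub>obj E l\<^esub> u)" using u r WW Wc E by (simp add: dpow_smult[OF E refl])
          from mem[OF this] show ?thesis using u r Wc by (simp add: dpow_smult[OF E n])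
        qed
        fix x assume "x \<in> T n"
        then obtain u where u: "?U u" "x = dpow E l k u" using obt by blast
        then show "dif E n x \<in> T (n + 1)" using n high[of "n + 1" "Suc k"] by auto
      qed
    qed
  qed
  moreover have "exact_at (sub_cpx E T) t j" for j
    unfolding exact_at_def sub_cpx_simps sub_cpx_dpow
  proof (intro ballI impI)
    fix x assume x: "x \<in> T j" and dx: "dpow E j t x = \<zero>\<^bsub>obj E (j + int t)\<^esub>"
    let ?m = "j - int (N - t)"
    from split[of j] show "\<exists>y\<in>T ?m. dpow E ?m (N - t) y = x"
    proof (elim disjE exE)
      fix k assume j: "j = l - int k"
      have xW: "x \<in> W j" "dpow E j (t + k) x = \<zero>\<^bsub>obj E (l + int t)\<^esub>" using x by (simp_all add: low[OF j])
      have "exact_at (sub_cpx E W) t j" using j by (intro ex) simp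
      then obtain y where y: "y \<in> W ?m" "dpow E ?m (N - t) y = x"
        using xW dx by (elim exact_atE[OF _ _ _ refl refl refl]) auto
      have "dpow E ?m (t + (k + (N - t))) y = dpow E j (t + k) (dpow E ?m (N - t) y)"
        using t by (subst dpow_dpow) (auto simp: algebra_simps)
      then have "y \<in> T ?m" using y xW j low[of ?m "k + (N - t)" y] by simp
      then show ?thesis using y by blast
    next
      fix k assume j: "j = l + int k"
      obtain u where u: "u \<in> W l" "dpow E l t u = \<zero>\<^bsub>obj E (l + int t)\<^esub>" "x = dpow E l k u"
        using x by (auto simp: high[OF j])
      show ?thesis
      proof (cases "N - t \<le> k")
        case True
        then have "?m = l + int (k - (N - t))" using j by simp
        then have "dpow E l (k - (N - t)) u \<in> T ?m" using u high by blast
        moreover have "dpow E ?m (N - t) (dpow E l (k - (N - t)) u) = x"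
          unfolding u(3) using True j by (intro dpow_comp) auto
        ultimately show ?thesis by blast
      next
        case False
        have "exact_at (sub_cpx E W) t l" by (intro ex) simp
        then obtain y where y: "y \<in> W (l - int (N - t))" "dpow E (l - int (N - t)) (N - t) y = u"
          using u by (elim exact_atE[OF _ _ _ refl refl refl]) auto
        have m: "?m = l - int (N - t) + int k" "?m = l - int (N - t - k)" using j False by auto
        have "dpow E ?m (t + (N - t - k)) (dpow E (l - int (N - t)) k y) = dpow E l t (dpow E (l - int (N - t)) (N - t) y)"
          using m False by (subst (1 2) dpow_dpow) auto
        then have "dpow E (l - int (N - t)) k y \<in> T ?m"
          unfolding low[OF m(2)] using y u Wd[OF y(1) m(1)] by simp
        moreover have "dpow E ?m (N - t) (dpow E (l - int (N - t)) k y) = dpow E l k u"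
          unfolding y(2)[symmetric] using m by (subst (1 2) dpow_dpow) (auto simp: add.commute)
        ultimately show ?thesis using u by blast
      qed
    qed
  qed
  moreover have "z \<in> T l" if "z \<in> W l" "dpow E l t z = \<zero>\<^bsub>obj E (l + int t)\<^esub>" for z
    using that low[of l 0] by simp
  ultimately show ?thesis by (rule that)
qed

text \<open>Closing up \<open>z\<close> under addition, scalar multiplication, differentials and chosen primitives gives an exact
  subcomplex whose elements are values of terms. Choosing a term for each element and encoding it embeds
  the subcomplex into \<open>nat \<Rightarrow> 'r\<close>.\<close>

lemma generated_exact_subcomplex:
  fixes E :: "('r, 'i) ncomplex"
  assumes E: "n_complex R N E" and T: "subcomplex E T" and ex: "\<And>j. exact_at (sub_cpx E T) t j"
    and z: "z \<in> T l" and nt: "\<one> \<noteq> \<zero>"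
  obtains G and e :: "int \<Rightarrow> 'i \<Rightarrow> nat \<Rightarrow> 'r"
  where "subcomplex E G" "\<And>j. exact_at (sub_cpx E G) t j" "z \<in> G l" "\<And>n. inj_on (e n) (G n)"
proof -
  define h where "h n x = (SOME y. y \<in> T (n - int (N - t)) \<and> dpow E (n - int (N - t)) (N - t) y = x)" for n x
  let ?d = "sdeg l (int (N - t))" and ?v = "sval R E t h l (int (N - t)) z"
  have TT: "\<zero>\<^bsub>obj E n\<^esub> \<in> T n" "x \<in> T n \<Longrightarrow> y \<in> T n \<Longrightarrow> x \<oplus>\<^bsub>obj E n\<^esub> y \<in> T n"
    "r \<in> carrier R \<Longrightarrow> x \<in> T n \<Longrightarrow> r \<odot>\<^bsub>obj E n\<^esub> x \<in> T n" "x \<in> T n \<Longrightarrow> dif E n x \<in> T (n + 1)" for n x y r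
    using T by (auto simp: subcomplex_def)
  have h: "h n x \<in> T (n - int (N - t)) \<and> dpow E (n - int (N - t)) (N - t) (h n x) = x"
    if "x \<in> T n" "dpow E n t x = \<zero>\<^bsub>obj E (n + int t)\<^esub>" for n x
    unfolding h_def by (rule someI_ex) (use ex[of n] that in \<open>auto simp: exact_at_def\<close>)
  have vT: "?v \<tau> \<in> T (?d \<tau>)" for \<tau>
    by (induction \<tau>) (use z TT h in auto)
  define G where "G n = {?v \<tau> | \<tau>. ?d \<tau> = n}" for n
  have GI: "x \<in> G n" if "?v \<tau> = x" "?d \<tau> = n" for x n \<tau> using that unfolding G_def by blast
  have GE: "\<exists>\<tau>. ?v \<tau> = x \<and> ?d \<tau> = n" if "x \<in> G n" for x n using that unfolding G_def by blast
  have all: "\<exists>\<tau> :: 'r sterm. ?d \<tau> = n" for n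
  proof (induction n rule: int_induct[where k = l])
    case base
    show ?case by (rule exI[of _ Gen]) simp
  next
    case (step1 i)
    then obtain \<tau> :: "'r sterm" where "?d \<tau> = i" by blast
    then show ?case by (intro exI[of _ "Dif \<tau>"]) simp
  next
    case (step2 i)
    then obtain \<tau> :: "'r sterm" where "?d \<tau> = i" by blast
    then show ?case by (intro exI[of _ "Down \<tau>"]) simp
  qed
  have "subcomplex E G"
    unfolding subcomplex_def
  proof (intro allI conjI ballI subsetI)
    fix n
    show "x \<in> elts E n" if "x \<in> G n" for x
      using GE[OF that] vT subcomplex_closed[OF T] by auto
    obtain \<tau> :: "'r sterm" where "?d \<tau> = n + 1" using all by blast
    then show "\<zero>\<^bsub>obj E n\<^esub> \<in> G n" by (intro GI[of "Down \<tau>"]) auto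
    show "x \<oplus>\<^bsub>obj E n\<^esub> y \<in> G n" if xy: "x \<in> G n" "y \<in> G n" for x y
    proof -
      obtain \<tau> \<sigma> where "?v \<tau> = x" "?d \<tau> = n" "?v \<sigma> = y" "?d \<sigma> = n" using GE xy by metis
      then show ?thesis by (intro GI[of "Plus \<tau> \<sigma>"]) auto
    qed
    show "r \<odot>\<^bsub>obj E n\<^esub> x \<in> G n" if r: "r \<in> carrier R" and x: "x \<in> G n" for r x
    proof -
      obtain \<tau> where "?v \<tau> = x" "?d \<tau> = n" using GE x by metis
      then show ?thesis using r by (intro GI[of "Scal r \<tau>"]) auto
    qed
    fix x assume "x \<in> G n"
    then obtain \<tau> where "?v \<tau> = x" "?d \<tau> = n" using GE by metis
    then show "dif E n x \<in> G (n + 1)" by (intro GI[of "Dif \<tau>"]) auto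
  qed
  moreover have "exact_at (sub_cpx E G) t j" for j
    unfolding exact_at_def sub_cpx_simps sub_cpx_dpow
  proof (intro ballI impI)
    fix x assume x: "x \<in> G j" and dx: "dpow E j t x = \<zero>\<^bsub>obj E (j + int t)\<^esub>"
    obtain \<tau> where \<tau>: "?v \<tau> = x" "?d \<tau> = j" using GE[OF x] by metis
    have "h j x \<in> G (j - int (N - t))" using \<tau> dx by (intro GI[of "Lift \<tau>"]) auto
    moreover have "x \<in> T j" using vT[of \<tau>] \<tau> by simp
    ultimately show "\<exists>y\<in>G (j - int (N - t)). dpow E (j - int (N - t)) (N - t) y = x" using h[OF _ dx] by blast
  qed
  moreover have "z \<in> G l" by (rule GI[of Gen]) auto
  moreover define e :: "int \<Rightarrow> 'i \<Rightarrow> nat \<Rightarrow> 'r" where "e n x = sencode \<zero> \<one> (SOME \<tau>. ?v \<tau> = x \<and> ?d \<tau> = n)" for n x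
  have "inj_on (e n) (G n)" for n
  proof (rule inj_onI)
    fix x y assume x: "x \<in> G n" and y: "y \<in> G n" and eq: "e n x = e n y"
    have "(SOME \<tau>. ?v \<tau> = x \<and> ?d \<tau> = n) = (SOME \<tau>. ?v \<tau> = y \<and> ?d \<tau> = n)"
      by (rule sencode_inject[OF nt[symmetric] eq[unfolded e_def]])
    then show "x = y" using someI_ex[OF GE[OF x]] someI_ex[OF GE[OF y]] by metis
  qed
  ultimately show ?thesis by (rule that)
qed

text \<open>Inside the truncation of \<open>W\<close> at \<open>l\<close>, the element \<open>z\<close> generates a small exact subcomplex of \<open>E\<close>, and the
  null-homotopy of its inclusion provides \<open>y\<close>. If \<open>1 = 0\<close> in \<open>R\<close>, all modules are zero; this case is separate,
  because sequences over a ring with one element encode nothing.\<close>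

lemma exact_below_lift:
  fixes E :: "('r, 'i) ncomplex"
  assumes E: "semi_injective TYPE(nat \<Rightarrow> 'r) R N E" and W: "subcomplex E W" and t: "1 \<le> t" "t < N"
    and ex: "exact_below (sub_cpx E W) t s" and l: "l < s" and z: "z \<in> W l"
    and dz: "dpow E l t z = \<zero>\<^bsub>obj E (l + int t)\<^esub>"
  obtains y where "y \<in> elts E (l - int (N - t))" "dpow E (l - int (N - t)) (N - t) y = z"
    "\<And>r. r \<in> carrier R \<Longrightarrow> r \<odot>\<^bsub>obj E l\<^esub> z = \<zero>\<^bsub>obj E l\<^esub> \<Longrightarrow>
       r \<odot>\<^bsub>obj E (l - int (N - t))\<^esub> y = \<zero>\<^bsub>obj E (l - int (N - t))\<^esub>"
proof (cases "\<one> = \<zero>")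
  case True
  have En: "n_complex R N E" using E by (simp add: semi_injective_def)
  have triv: "x = \<zero>\<^bsub>obj E n\<^esub>" if "x \<in> elts E n" for x n
    using mod_one_smult[OF cpx_module[OF En] that] mod_zero_smult[OF cpx_module[OF En] that] True by simp
  let ?m = "l - int (N - t)"
  have 0: "\<zero>\<^bsub>obj E ?m\<^esub> \<in> elts E ?m" using En by simp
  have "dpow E ?m (N - t) \<zero>\<^bsub>obj E ?m\<^esub> = z"
    using triv[OF subcomplex_closed[OF W z]] dpow_zero[OF En, of l ?m "N - t"] by simp
  then show ?thesis using En by (intro that[OF 0]) auto
next
  case False
  have En: "n_complex R N E" using E by (simp add: semi_injective_def)
  have ex': "exact_at (sub_cpx E W) t j" if "j \<le> l" for j using ex l that by (simp add: exact_below_def)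
  obtain T where T: "subcomplex E T" "\<And>j. exact_at (sub_cpx E T) t j"
    "\<And>z. z \<in> W l \<Longrightarrow> dpow E l t z = \<zero>\<^bsub>obj E (l + int t)\<^esub> \<Longrightarrow> z \<in> T l"
    by (rule truncation[OF En W t ex'], assumption) (rule that, assumption+)
  obtain G and e :: "int \<Rightarrow> 'i \<Rightarrow> nat \<Rightarrow> 'r"
    where G: "subcomplex E G" "\<And>j. exact_at (sub_cpx E G) t j" "z \<in> G l" "\<And>n. inj_on (e n) (G n)"
    by (rule generated_exact_subcomplex[OF En T(1,2) T(3)[OF z dz] False], rule that) assumption+
  from null_homotopic_lift[OF E t G(1,2,4,3) dz] show ?thesis
  proof (elim bexE conjE)
    fix y assume y: "y \<in> elts E (l - int (N - t))" "dpow E (l - int (N - t)) (N - t) y = z"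
      "\<forall>r\<in>carrier R. r \<odot>\<^bsub>obj E l\<^esub> z = \<zero>\<^bsub>obj E l\<^esub> \<longrightarrow>
         r \<odot>\<^bsub>obj E (l - int (N - t))\<^esub> y = \<zero>\<^bsub>obj E (l - int (N - t))\<^esub>"
    show thesis by (rule that[OF y(1,2) bspec[OF y(3), THEN mp]])
  qed
qed

end

section \<open>The three infima\<close>

context n_complexes
begin

text \<open>\<open>Hom(R/I, Y)\<close>, realised inside \<open>Y\<close>.\<close>

definition annihilated :: "('r, 'y) ncomplex \<Rightarrow> 'r set \<Rightarrow> int \<Rightarrow> 'y set" where
  "annihilated Y I n = {y \<in> elts Y n. \<forall>r\<in>I. r \<odot>\<^bsub>obj Y n\<^esub> y = \<zero>\<^bsub>obj Y n\<^esub>}"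

lemma annihilated_subcomplex:
  assumes Y: "n_complex R N Y" and I: "I \<subseteq> carrier R"
  shows "subcomplex Y (annihilated Y I)"
proof -
  have dif0: "r \<odot>\<^bsub>obj Y (n + 1)\<^esub> dif Y n y = \<zero>\<^bsub>obj Y (n + 1)\<^esub>"
    if "y \<in> elts Y n" "r \<in> carrier R" "r \<odot>\<^bsub>obj Y n\<^esub> y = \<zero>\<^bsub>obj Y n\<^esub>" for n y r
    using mhom_smult[OF cpx_dif[OF Y refl] that(2,1)] that(3) Y by (simp add: mhom_zero[OF cpx_dif[OF Y refl]])
  have comm0: "s \<odot>\<^bsub>obj Y n\<^esub> (r \<odot>\<^bsub>obj Y n\<^esub> y) = \<zero>\<^bsub>obj Y n\<^esub>"
    if "y \<in> elts Y n" "r \<in> carrier R" "s \<in> I" "s \<odot>\<^bsub>obj Y n\<^esub> y = \<zero>\<^bsub>obj Y n\<^esub>" for n y r s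
    using mod_smult_comm[OF cpx_module[OF Y], of s r y n] that I Y by auto
  show ?thesis
    unfolding subcomplex_def annihilated_def
    using Y I dif0 comm0 dif_closed[OF Y _ refl] by (auto simp: mod_smult_add subset_iff)
qed

end

context q_complexes
begin

text \<open>From right to left: a cycle killed by the ideal is torsion, and \<open>exact_below_lift\<close> for the torsion part
  gives a primitive that is killed by the ideal as well. From left to right, by noetherian induction on the
  annihilator of the torsion cycle \<open>z\<close>: let \<open>r z \<noteq> 0\<close> be killed by the ideal and let \<open>y'\<close> be a primitive of
  \<open>r z\<close> as in \<open>exact_below_lift\<close>. By \<open>injective_extend\<close> there is \<open>y\<close> with \<open>r y = y'\<close> that is killed by the
  annihilator of \<open>z\<close>, so \<open>y\<close> is torsion. The cycle \<open>z - d\<^bsup>N-t\<^esup> y\<close> is killed by the annihilator of \<open>z\<close> and in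
  addition by \<open>r\<close>.\<close>

theorem exact_below_annihilated_iff_torsion:
  fixes E :: "('r, 'i) ncomplex"
  assumes noeth: "noetherian_ring R" and E: "semi_injective TYPE(nat \<Rightarrow> 'r) R N E"
    and A: "finite A" "A \<subseteq> carrier R" and t: "1 \<le> t" "t < N"
  shows "exact_below (sub_cpx E (annihilated E (Idl A))) t s \<longleftrightarrow> exact_below (sub_cpx E (tors E A)) t s"
proof
  let ?S = "annihilated E (Idl A)" and ?T = "tors E A"
  have En: "n_complex R N E" and Ei: "injective_module TYPE(nat \<Rightarrow> 'r) R (obj E n)" for n
    using E by (simp_all add: semi_injective_def)
  have I: "ideal (Idl A) R" by (rule genideal_ideal[OF A(2)])
  have IR: "r \<in> carrier R" if "r \<in> Idl A" for r by (rule ideal.Icarr[OF I that])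
  have S: "subcomplex E ?S" using IR by (intro annihilated_subcomplex[OF En]) blast
  have T: "subcomplex E ?T" by (rule tors_subcomplex[OF En A(2)])
  have AI: "x \<in> Idl A" if "x \<in> A" for x using genideal_self[OF A(2)] that by blast
  {
    assume ex: "exact_below (sub_cpx E ?T) t s"
    show "exact_below (sub_cpx E ?S) t s"
      unfolding exact_below_def exact_at_def sub_cpx_simps sub_cpx_dpow
    proof (intro allI impI ballI)
      fix l z assume l: "l < s" and z: "z \<in> ?S l" and dz: "dpow E l t z = \<zero>\<^bsub>obj E (l + int t)\<^esub>"
      have zc: "z \<in> elts E l" and z0: "\<And>r. r \<in> Idl A \<Longrightarrow> r \<odot>\<^bsub>obj E l\<^esub> z = \<zero>\<^bsub>obj E l\<^esub>"
        using z by (auto simp: annihilated_def)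
      have "\<exists>k::nat. (x [^] k) \<odot>\<^bsub>obj E l\<^esub> z = \<zero>\<^bsub>obj E l\<^esub>" if "x \<in> A" for x
        using z0[OF AI[OF that]] that A(2) by (intro exI[of _ 1]) auto
      then have zT: "z \<in> ?T l" using zc by (simp add: tors_def)
      obtain y where y: "y \<in> elts E (l - int (N - t))" "dpow E (l - int (N - t)) (N - t) y = z"
        "\<And>r. r \<in> carrier R \<Longrightarrow> r \<odot>\<^bsub>obj E l\<^esub> z = \<zero>\<^bsub>obj E l\<^esub> \<Longrightarrow>
           r \<odot>\<^bsub>obj E (l - int (N - t))\<^esub> y = \<zero>\<^bsub>obj E (l - int (N - t))\<^esub>"
        by (rule exact_below_lift[OF E T t ex l zT dz], rule that) assumption+
      have "y \<in> ?S (l - int (N - t))" unfolding annihilated_def using y(1) y(3)[OF IR z0] by simp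
      then show "\<exists>y\<in>?S (l - int (N - t)). dpow E (l - int (N - t)) (N - t) y = z" using y(2) by blast
    qed
  next
    assume ex: "exact_below (sub_cpx E ?S) t s"
    show "exact_below (sub_cpx E ?T) t s"
      unfolding exact_below_def exact_at_def sub_cpx_simps sub_cpx_dpow
    proof (intro allI impI ballI)
      fix l z assume l: "l < s"
      let ?m = "l - int (N - t)" and ?an = "annih (obj E l)"
      have lm: "l = ?m + int (N - t)" using t by simp
      have lt: "l + int t = ?m + int N" using t by simp
      have Ml: "module R (obj E l)" and Mm: "module R (obj E ?m)" using En by simp_all
      have Tx: "n_complex R N (sub_cpx E ?T)" by (rule sub_cpx_n_complex[OF En T])
      have anI: "ideal (?an w) R" if "w \<in> ?T l" for w by (rule annih_ideal[OF Ml subcomplex_closed[OF T that]])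
      assume "z \<in> ?T l" and "dpow E l t z = \<zero>\<^bsub>obj E (l + int t)\<^esub>"
      then show "\<exists>y\<in>?T ?m. dpow E ?m (N - t) y = z"
      proof (induction "?an z" arbitrary: z rule: wf_induct_rule[OF noetherian_wf[OF noeth]])
        case (1 z)
        note z = "1.prems"(1) and dz = "1.prems"(2)
        have zc: "z \<in> elts E l" by (rule subcomplex_closed[OF T z])
        show ?case
        proof (cases "z = \<zero>\<^bsub>obj E l\<^esub>")
          case True
          have "\<zero>\<^bsub>obj E ?m\<^esub> \<in> ?T ?m" using T by (simp add: subcomplex_def)
          then show ?thesis using dpow_zero[OF En lm] True by blast
        next
          case False
          have "z \<in> torsion_submodule R (Idl A) (obj E l)"
            using z unfolding torsion_submodule_generators[OF Ml A] tors_def .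
          then obtain n where "killed (ipow (Idl A) n) (obj E l) z" by (auto simp: torsion_submodule_def killed_def)
          note kill = this
          obtain r where r: "r \<in> carrier R" "r \<odot>\<^bsub>obj E l\<^esub> z \<noteq> \<zero>\<^bsub>obj E l\<^esub>" "killed (Idl A) (obj E l) (r \<odot>\<^bsub>obj E l\<^esub> z)"
            by (rule torsion_socle_multiple[OF Ml zc I kill False], rule that) assumption+
          let ?z = "r \<odot>\<^bsub>obj E l\<^esub> z"
          have rzc: "?z \<in> elts E l" by (rule mod_smult[OF Ml r(1) zc])
          have rzS: "?z \<in> ?S l" using r(3) rzc by (simp add: annihilated_def killed_def)
          have drz: "dpow E l t ?z = \<zero>\<^bsub>obj E (l + int t)\<^esub>"
            using dz r(1) En by (simp add: dpow_smult[OF En refl r(1) zc])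
          obtain y' where y': "y' \<in> elts E ?m" "dpow E ?m (N - t) y' = ?z"
            "\<And>c. c \<in> carrier R \<Longrightarrow> c \<odot>\<^bsub>obj E l\<^esub> ?z = \<zero>\<^bsub>obj E l\<^esub> \<Longrightarrow> c \<odot>\<^bsub>obj E ?m\<^esub> y' = \<zero>\<^bsub>obj E ?m\<^esub>"
            by (rule exact_below_lift[OF E S t ex l rzS drz], rule that) assumption+
          have "\<exists>y\<in>elts E ?m. (\<forall>j\<in>?an z. j \<odot>\<^bsub>obj E ?m\<^esub> y = \<zero>\<^bsub>obj E ?m\<^esub>) \<and> r \<odot>\<^bsub>obj E ?m\<^esub> y = y'"
          proof (rule injective_extend[OF Ei anI[OF z] r(1) y'(1)])
            fix c assume c: "c \<in> carrier R" "c \<otimes> r \<in> ?an z"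
            then show "c \<odot>\<^bsub>obj E ?m\<^esub> y' = \<zero>\<^bsub>obj E ?m\<^esub>"
              using mod_mult_smult[OF Ml c(1) r(1) zc] by (intro y'(3)) (simp_all add: annih_def)
          qed
          then obtain y where y: "y \<in> elts E ?m" "r \<odot>\<^bsub>obj E ?m\<^esub> y = y'"
            and yJ: "\<And>j. j \<in> ?an z \<Longrightarrow> j \<odot>\<^bsub>obj E ?m\<^esub> y = \<zero>\<^bsub>obj E ?m\<^esub>" by blast
          have yT: "y \<in> ?T ?m"
            unfolding tors_def
          proof (intro CollectI conjI ballI)
            fix x assume x: "x \<in> A"
            then obtain k :: nat where "(x [^] k) \<odot>\<^bsub>obj E l\<^esub> z = \<zero>\<^bsub>obj E l\<^esub>" using z by (auto simp: tors_def)
            then have "x [^] k \<in> ?an z" using x A(2) by (auto simp: annih_def)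
            then show "\<exists>k::nat. (x [^] k) \<odot>\<^bsub>obj E ?m\<^esub> y = \<zero>\<^bsub>obj E ?m\<^esub>" using yJ by blast
          qed (rule y(1))
          let ?dy = "dpow E ?m (N - t) y"
          have dyT: "?dy \<in> ?T l" using dpow_closed[OF Tx, of y ?m l "N - t"] yT lm by simp
          have dyc: "?dy \<in> elts E l" by (rule subcomplex_closed[OF T dyT])
          \<comment> \<open>Subtraction is written with the scalar \<open>-1\<close>, since subcomplexes are closed under scalars.\<close>
          define w where "w = z \<oplus>\<^bsub>obj E l\<^esub> (\<ominus> \<one>) \<odot>\<^bsub>obj E l\<^esub> ?dy"
          have w': "w = z \<ominus>\<^bsub>obj E l\<^esub> ?dy"
            unfolding w_def mod_diff_eq using Ml dyc by (simp add: mod_neg_smult)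
          have wT: "w \<in> ?T l" unfolding w_def using T z dyT by (simp add: subcomplex_def)
          have wc: "w \<in> elts E l" by (rule subcomplex_closed[OF T wT])
          have "dpow E l t ?dy = \<zero>\<^bsub>obj E (l + int t)\<^esub>"
            using dpow_comp[OF lm, of N t E y] dpow_ge_N[OF En le_refl y(1) lt] t by simp
          then have dw: "dpow E l t w = \<zero>\<^bsub>obj E (l + int t)\<^esub>"
            unfolding w' dpow_diff[OF En refl zc dyc] dz using En by simp
          have jw: "j \<odot>\<^bsub>obj E l\<^esub> w = j \<odot>\<^bsub>obj E l\<^esub> z \<ominus>\<^bsub>obj E l\<^esub> dpow E ?m (N - t) (j \<odot>\<^bsub>obj E ?m\<^esub> y)" if j: "j \<in> carrier R" for j
            unfolding w' mod_smult_diff[OF Ml j zc dyc] dpow_smult[OF En lm j y(1)] ..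
          have "?an z \<subseteq> ?an w"
          proof
            fix j assume j: "j \<in> ?an z"
            then have jR: "j \<in> carrier R" "j \<odot>\<^bsub>obj E l\<^esub> z = \<zero>\<^bsub>obj E l\<^esub>" by (simp_all add: annih_def)
            have "j \<odot>\<^bsub>obj E l\<^esub> w = \<zero>\<^bsub>obj E l\<^esub>"
              unfolding jw[OF jR(1)] jR(2) yJ[OF j] dpow_zero[OF En lm] using Ml by simp
            then show "j \<in> ?an w" using jR by (simp add: annih_def)
          qed
          moreover have "r \<in> ?an w" "r \<notin> ?an z"
            unfolding annih_def using r(1,2) jw[OF r(1)] y(2) y'(2) Ml rzc by simp_all
          ultimately have "?an z \<subset> ?an w" by blast
          then have "(?an w, ?an z) \<in> {(I, J). ideal I R \<and> ideal J R \<and> J \<subset> I}"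
            using anI[OF wT] anI[OF z] by simp
          from "1.hyps"[OF this wT dw] obtain v where v: "v \<in> ?T ?m" "dpow E ?m (N - t) v = w" by blast
          have vc: "v \<in> elts E ?m" by (rule subcomplex_closed[OF T v(1)])
          have "dpow E ?m (N - t) (v \<oplus>\<^bsub>obj E ?m\<^esub> y) = z"
            unfolding dpow_add[OF En lm vc y(1)] v(2) w' using Ml zc dyc by simp
          moreover have "v \<oplus>\<^bsub>obj E ?m\<^esub> y \<in> ?T ?m" using T v(1) yT by (simp add: subcomplex_def)
          ultimately show ?thesis by blast
        qed
      qed
    qed
  }
qed

lemma concentrated_n_complex:
  assumes M: "module R M"
  shows "n_complex R N (concentrated_in_0 M)"
  unfolding n_complex_def
proof (intro allI conjI ballI)
  have M0: "module R (M\<lparr>carrier := {\<zero>\<^bsub>M\<^esub>}\<rparr>)" by (rule module_restrict[OF M]) (use M in auto)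
  then show m: "module R (obj (concentrated_in_0 M) n)" for n using M by (simp add: concentrated_in_0_def)
  fix n
  show "dif (concentrated_in_0 M) n \<in> mhom R (obj (concentrated_in_0 M) n) (obj (concentrated_in_0 M) (n + 1))"
    by (rule mhomI) (use M in \<open>auto simp: concentrated_in_0_def\<close>)
  fix x
  obtain N' where "N = Suc N'" using N_ge_2 by (cases N) auto
  then show "dpow (concentrated_in_0 M) n N x = \<zero>\<^bsub>obj (concentrated_in_0 M) (n + int N)\<^esub>"
    by (simp add: concentrated_in_0_def)
qed

text \<open>A homomorphism from a cyclic module is determined by its value at the generator \<open>m\<close>, which can be any
  element killed by the annihilator of \<open>m\<close>.\<close>

lemma qHom_cyclic:
  fixes Y :: "('r, 'y) ncomplex"
  assumes Y: "n_complex R N Y" and M: "module R M" and m: "m \<in> carrier M"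
    and gen: "\<And>x. x \<in> carrier M \<Longrightarrow> \<exists>r\<in>carrier R. x = r \<odot>\<^bsub>M\<^esub> m"
  shows "chain_iso (qHom (concentrated_in_0 M) Y) (sub_cpx Y (annihilated Y (annih M m))) (\<lambda>n f. f 0 m)"
  unfolding chain_iso_def
proof (intro conjI allI)
  let ?C = "concentrated_in_0 M" and ?S = "sub_cpx Y (annihilated Y (annih M m))"
  note K = concentrated_n_complex[OF M]
  have C: "elts ?C n = (if n = 0 then carrier M else {\<zero>\<^bsub>M\<^esub>})" "\<zero>\<^bsub>obj ?C n\<^esub> = \<zero>\<^bsub>M\<^esub>"
    "x \<oplus>\<^bsub>obj ?C n\<^esub> y = x \<oplus>\<^bsub>M\<^esub> y" "r \<odot>\<^bsub>obj ?C n\<^esub> x = r \<odot>\<^bsub>M\<^esub> x" "dif ?C n x = \<zero>\<^bsub>M\<^esub>" for n x y r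
    by (simp_all add: concentrated_in_0_def)
  have b: "m \<in> elts ?C 0" using m by (simp add: C)
  have zero: "f i \<zero>\<^bsub>M\<^esub> = \<zero>\<^bsub>obj Y j\<^esub>" if f: "f \<in> elts (qHom ?C Y) n" and j: "j = i + n" for f n i j
    using mhom_zero[OF qHom_mhom[OF f j]] K Y by (simp add: C)
  have sm: "f 0 (r \<odot>\<^bsub>M\<^esub> m) = r \<odot>\<^bsub>obj Y n\<^esub> f 0 m" if f: "f \<in> elts (qHom ?C Y) n" and r: "r \<in> carrier R" for f n r
    using mhom_smult[OF qHom_mhom[OF f, of n 0] r b] by (simp add: C)
  have cl: "f 0 m \<in> elts Y n" if f: "f \<in> elts (qHom ?C Y) n" for f n
    by (rule qHom_closed[OF f b]) simp
  have annihilated: "f 0 m \<in> annihilated Y (annih M m) n" if f: "f \<in> elts (qHom ?C Y) n" for f n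
    unfolding annihilated_def annih_def using cl[OF f] sm[OF f, symmetric] zero[OF f, of n 0] by simp
  show "chain_map R (qHom ?C Y) ?S (\<lambda>n f. f 0 m)"
    unfolding chain_map_def
  proof (intro allI conjI ballI)
    fix n
    show "(\<lambda>f. f 0 m) \<in> mhom R (obj (qHom ?C Y) n) (obj ?S n)"
    proof (rule mhomI)
      show "f 0 m \<in> elts ?S n" if "f \<in> elts (qHom ?C Y) n" for f
        unfolding sub_cpx_simps by (rule annihilated[OF that])
    qed (simp_all add: qHom_apply(2,3)[OF b, of n n])
    fix f assume f: "f \<in> elts (qHom ?C Y) n"
    have "dif (qHom ?C Y) n f 0 m = dif Y n (f 0 m) \<ominus>\<^bsub>obj Y (n + 1)\<^esub> (q [^] n \<odot>\<^bsub>obj Y (n + 1)\<^esub> f 1 \<zero>\<^bsub>M\<^esub>)"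
      using qHom_dif_apply[OF b, of "n + 1" n Y f] by (simp add: C(5))
    also have "\<dots> = dif Y n (f 0 m)"
      using Y dif_closed[OF Y cl[OF f] refl] by (simp add: zero[OF f, of "n + 1" 1])
    finally show "dif (qHom ?C Y) n f 0 m = dif ?S n (f 0 m)" by simp
  qed
  fix n
  show "bij_betw (\<lambda>f. f 0 m) (elts (qHom ?C Y) n) (elts ?S n)"
    unfolding bij_betw_def sub_cpx_simps
  proof (intro conjI equalityI subsetI)
    show "inj_on (\<lambda>f. f 0 m) (elts (qHom ?C Y) n)"
    proof (rule inj_onI)
      fix f g assume f: "f \<in> elts (qHom ?C Y) n" and g: "g \<in> elts (qHom ?C Y) n"
        and eq: "f 0 m = g 0 m"
      show "f = g"
      proof (rule qHom_eqI[OF f g])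
        fix i x assume x: "x \<in> elts ?C i"
        show "f i x = g i x"
        proof (cases "i = 0")
          case True
          then obtain r where "r \<in> carrier R" "x = r \<odot>\<^bsub>M\<^esub> m" using gen x by (auto simp: C)
          then show ?thesis using True sm[OF f] sm[OF g] eq by simp
        next
          case False
          then show ?thesis using x zero[OF f refl] zero[OF g refl] by (simp add: C)
        qed
      qed
    qed
    show "y \<in> annihilated Y (annih M m) n" if "y \<in> (\<lambda>f. f 0 m) ` elts (qHom ?C Y) n" for y
      using that annihilated by auto
    fix y assume y: "y \<in> annihilated Y (annih M m) n"
    have yc: "y \<in> elts Y n" and y0: "\<And>r. r \<in> carrier R \<Longrightarrow> r \<odot>\<^bsub>M\<^esub> m = \<zero>\<^bsub>M\<^esub> \<Longrightarrow> r \<odot>\<^bsub>obj Y n\<^esub> y = \<zero>\<^bsub>obj Y n\<^esub>"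
      using y by (auto simp: annihilated_def annih_def)
    have Yn: "module R (obj Y n)" using Y by simp
    define u where "u x = (SOME v. \<exists>r\<in>carrier R. x = r \<odot>\<^bsub>M\<^esub> m \<and> v = r \<odot>\<^bsub>obj Y n\<^esub> y)" for x
    have u: "u (r \<odot>\<^bsub>M\<^esub> m) = r \<odot>\<^bsub>obj Y n\<^esub> y" if r: "r \<in> carrier R" for r
      unfolding u_def
    proof (rule some_equality)
      show "\<exists>r'\<in>carrier R. r \<odot>\<^bsub>M\<^esub> m = r' \<odot>\<^bsub>M\<^esub> m \<and> r \<odot>\<^bsub>obj Y n\<^esub> y = r' \<odot>\<^bsub>obj Y n\<^esub> y" using r by blast
      fix v assume "\<exists>r'\<in>carrier R. r \<odot>\<^bsub>M\<^esub> m = r' \<odot>\<^bsub>M\<^esub> m \<and> v = r' \<odot>\<^bsub>obj Y n\<^esub> y"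
      then obtain r' where r': "r' \<in> carrier R" "r \<odot>\<^bsub>M\<^esub> m = r' \<odot>\<^bsub>M\<^esub> m" "v = r' \<odot>\<^bsub>obj Y n\<^esub> y" by blast
      have "(r' \<oplus> \<ominus> r) \<odot>\<^bsub>M\<^esub> m = \<zero>\<^bsub>M\<^esub>" using M m r r' by (simp add: mod_add_smult mod_neg_smult)
      then have "(r' \<oplus> \<ominus> r) \<odot>\<^bsub>obj Y n\<^esub> y = \<zero>\<^bsub>obj Y n\<^esub>" using r r' by (intro y0) auto
      then have "r' \<odot>\<^bsub>obj Y n\<^esub> y \<ominus>\<^bsub>obj Y n\<^esub> r \<odot>\<^bsub>obj Y n\<^esub> y = \<zero>\<^bsub>obj Y n\<^esub>"
        unfolding mod_diff_eq using Yn yc r r' by (simp add: mod_add_smult mod_neg_smult)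
      then show "v = r \<odot>\<^bsub>obj Y n\<^esub> y" using Yn yc r r' by (simp add: mod_diff_eq_zero)
    qed
    have um: "u \<in> mhom R M (obj Y n)"
    proof (rule mhomI)
      fix x assume "x \<in> carrier M"
      then obtain r where r: "r \<in> carrier R" "x = r \<odot>\<^bsub>M\<^esub> m" using gen by blast
      show "u x \<in> elts Y n" using r yc Yn by (simp add: u)
      show "u (c \<odot>\<^bsub>M\<^esub> x) = c \<odot>\<^bsub>obj Y n\<^esub> u x" if c: "c \<in> carrier R" for c
        using u[of "c \<otimes> r"] r c yc Yn M m by (simp add: u mod_mult_smult)
      fix x' assume "x' \<in> carrier M"
      then obtain r' where r': "r' \<in> carrier R" "x' = r' \<odot>\<^bsub>M\<^esub> m" using gen by blast
      show "u (x \<oplus>\<^bsub>M\<^esub> x') = u x \<oplus>\<^bsub>obj Y n\<^esub> u x'"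
        using u[of "r \<oplus> r'"] r r' yc Yn M m by (simp add: u mod_add_smult)
    qed
    define f where "f = (\<lambda>i::int. restrict (if i = 0 then u else (\<lambda>_. \<zero>\<^bsub>obj Y (i + n)\<^esub>)) (elts ?C i))"
    have "f \<in> elts (qHom ?C Y) n"
      unfolding f_def
    proof (rule qHom_restrict)
      fix i
      have "obj ?C 0 = M" by (simp add: concentrated_in_0_def)
      then show "(if i = 0 then u else (\<lambda>_. \<zero>\<^bsub>obj Y (i + n)\<^esub>)) \<in> mhom R (obj ?C i) (obj Y (i + n))"
        using um mhom_const_zero[OF cpx_module[OF Y]] by (cases "i = 0") simp_all
    qed (use K in simp)
    moreover have "f 0 m = y" using u[of \<one>] b M m Yn yc by (simp add: f_def)
    ultimately show "y \<in> (\<lambda>f. f 0 m) ` elts (qHom ?C Y) n" by (intro image_eqI) auto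
  qed
qed

end

context cring
begin

lemma quotient_ring_cyclic:
  assumes I: "ideal I R"
  defines "Q \<equiv> quotient_module (regular_module R) I"
  shows "module R Q" "I +> \<one> \<in> carrier Q" "\<And>x. x \<in> carrier Q \<Longrightarrow> \<exists>r\<in>carrier R. x = r \<odot>\<^bsub>Q\<^esub> (I +> \<one>)"
    "annih Q (I +> \<one>) = I"
proof -
  interpret I: ideal I R by (rule I)
  have coset: "A +>\<^bsub>regular_module R\<^esub> x = A +> x" for A x
    by (simp add: a_r_coset_def' regular_module_def)
  have add: "set_add (regular_module R) A B = A <+> B" for A B
    by (simp add: set_add_def' regular_module_def)
  have cosets: "a_rcosets\<^bsub>regular_module R\<^esub> I = {I +> x | x. x \<in> carrier R}"
    by (auto simp: A_RCOSETS_def' a_r_coset_def' regular_module_def)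
  have smult: "(\<Union>y\<in>I +> x. I +> (r \<otimes> y)) = I +> (r \<otimes> x)" if x: "x \<in> carrier R" and r: "r \<in> carrier R" for x r
  proof -
    have "I +> (r \<otimes> y) = I +> (r \<otimes> x)" if y: "y \<in> I +> x" for y
    proof -
      obtain a where a: "a \<in> I" "y = a \<oplus> x" using y by (auto simp: a_r_coset_def')
      have "r \<otimes> y = r \<otimes> a \<oplus> r \<otimes> x" using a x r I.Icarr by (simp add: r_distr)
      moreover have "r \<otimes> a \<in> I" using a r by (simp add: I.I_l_closed)
      ultimately have "r \<otimes> y \<in> I +> (r \<otimes> x)" by (auto simp: a_r_coset_def')
      then show ?thesis using I.a_repr_independence'[of "r \<otimes> y" "r \<otimes> x"] x r by simp
    qed
    then show ?thesis using I.a_rcos_self[OF x] by blast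
  qed
  have Q: "carrier Q = {I +> x | x. x \<in> carrier R}" "\<zero>\<^bsub>Q\<^esub> = I" "A \<oplus>\<^bsub>Q\<^esub> B = A <+> B" for A B
    unfolding Q_def quotient_module_def by (simp_all add: cosets add)
  have Qs: "r \<odot>\<^bsub>Q\<^esub> (I +> x) = I +> (r \<otimes> x)" if "x \<in> carrier R" "r \<in> carrier R" for x r
    using smult[OF that] unfolding Q_def quotient_module_def by (simp add: coset) (simp add: regular_module_def)
  have Qa: "(I +> x) <+> (I +> y) = I +> (x \<oplus> y)" if "x \<in> carrier R" "y \<in> carrier R" for x y
    using that by (rule I.a_rcos_sum)
  have z: "I +> \<zero> = I" by (rule I.a_rcos_const[OF I.zero_closed])
  have zl: "I <+> (I +> x) = I +> x" if "x \<in> carrier R" for x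
    using Qa[OF zero_closed that] that by (simp add: z)
  have mem: "I +> x \<in> carrier Q" if "x \<in> carrier R" for x using that by (auto simp: Q)
  have memE: "\<exists>x\<in>carrier R. A = I +> x" if "A \<in> carrier Q" for A using that by (auto simp: Q)
  show "module R Q"
  proof (rule module_by_zero_neg)
    show "\<zero>\<^bsub>Q\<^esub> \<in> carrier Q" using mem[OF zero_closed] by (simp add: z Q(2))
  qed (use mem in \<open>auto dest!: memE simp: Q(2,3) Qs Qa zl a_ac m_ac l_distr r_distr z\<close>)
  show "I +> \<one> \<in> carrier Q" by (rule mem) simp
  show "\<exists>r\<in>carrier R. x = r \<odot>\<^bsub>Q\<^esub> (I +> \<one>)" if "x \<in> carrier Q" for x
    using memE[OF that] by (auto simp: Qs)
  have iff: "I +> r = I \<longleftrightarrow> r \<in> I" if "r \<in> carrier R" for r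
    using I.a_rcos_self[OF that] I.a_rcos_const[of r] by metis
  have "annih Q (I +> \<one>) = {r \<in> carrier R. I +> r = I}"
    unfolding annih_def Q(2) using Qs[OF one_closed] by auto
  also have "\<dots> = {r \<in> carrier R. r \<in> I}" by (rule Collect_cong) (use iff in metis)
  also have "\<dots> = I" using I.a_subset by blast
  finally show "annih Q (I +> \<one>) = I" .
qed

end

theorem theorem7p4:
  fixes R :: "('r, 's) ring_scheme" and N t :: nat and q :: 'r
    and \<aa> :: "'r set" and xs :: "'r list"
    and C :: "('r, 'x) ncomplex" and E :: "('r, 'i) ncomplex" and \<eta> :: "int \<Rightarrow> 'x \<Rightarrow> 'i"
  assumes "N \<ge> 2"
    and "cring R" and "noetherian_ring R"
    and "primitive_root_of_unity R N q"
    and "ideal \<aa> R" and "set xs \<subseteq> carrier R" and "\<aa> = Idl\<^bsub>R\<^esub> (set xs)"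
    and "n_complex R N C"
    and "semi_injective_resolution R N C E \<eta>"
    and "t \<in> {1..N - 1}"
  shows "inf_ext {l. \<not> trivial_module (homology N
             (q_Hom R q (concentrated_in_0 (quotient_module (regular_module R) \<aa>)) E) t l)}
         = inf_ext {l. \<not> trivial_module (homology N (torsion_complex R \<aa> E) t l)} \<and>
         inf_ext {l. \<not> trivial_module (homology N (torsion_complex R \<aa> E) t l)}
         = inf_ext {l. \<not> trivial_module (homology N (q_Hom R q (koszul R N xs) C) t l)}"
proof -
  interpret cring R by (rule assms(2))
  interpret q_complexes R N q using assms(1,4) by unfold_locales
  note noeth = assms(3) and \<aa>I = assms(5) and xs = assms(6) and C = assms(8)
  have t: "1 \<le> t" "t < N" "t \<le> N" using assms(1,10) by auto
  have semi: "semi_injective TYPE(nat \<Rightarrow> 'r) R N E" and quasi: "quasi_iso R N C E \<eta>"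
    using assms(9) by (simp_all add: semi_injective_resolution_def)
  have E: "n_complex R N E" and inj: "injective_module TYPE(nat \<Rightarrow> 'r) R (obj E n)" for n
    using semi by (simp_all add: semi_injective_def)
  let ?Q = "quotient_module (regular_module R) \<aa>" and ?T = "sub_cpx E (tors E (set xs))" and ?K = "koszul R N xs"
  let ?H1 = "qHom (concentrated_in_0 ?Q) E" and ?H3 = "qHom ?K C"
  note Q = quotient_ring_cyclic[OF \<aa>I]
  have S: "subcomplex E (annihilated E \<aa>)" using ideal.Icarr[OF \<aa>I] by (intro annihilated_subcomplex[OF E]) blast
  have SE: "n_complex R N (sub_cpx E (annihilated E \<aa>))" by (rule sub_cpx_n_complex[OF E S])
  have H1: "n_complex R N ?H1" by (rule qHom_n_complex[OF concentrated_n_complex[OF Q(1)] E])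
  have T: "n_complex R N ?T" by (rule sub_cpx_n_complex[OF E tors_subcomplex[OF E xs]])
  note K = koszul_n_complex[OF xs]
  have H3: "n_complex R N ?H3" by (rule qHom_n_complex[OF K C])
  have KE: "n_complex R N (qHom ?K E)" and KT: "n_complex R N (qHom ?K ?T)"
    by (rule qHom_n_complex[OF K E], rule qHom_n_complex[OF K T])
  have torsion: "torsion_complex R \<aa> E = ?T"
    unfolding torsion_complex_def sub_cpx_def assms(7)
    by (simp add: torsion_submodule_generators[OF cpx_module[OF E] finite_set xs] tors_def)
  have "chain_iso ?H1 (sub_cpx E (annihilated E \<aa>)) (\<lambda>n f. f 0 (\<aa> +>\<^bsub>R\<^esub> \<one>\<^bsub>R\<^esub>))"
    using qHom_cyclic[OF E Q(1-3)] unfolding Q(4) .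
  then have "exact_at ?H1 t l \<longleftrightarrow> exact_at (sub_cpx E (annihilated E \<aa>)) t l" for l
    by (rule hiso_exact_at[OF chain_iso_hiso[OF _ H1 SE] H1 SE t(1,2)])
  moreover have "exact_below (sub_cpx E (annihilated E \<aa>)) t s \<longleftrightarrow> exact_below ?T t s" for s
    unfolding assms(7) by (rule exact_below_annihilated_iff_torsion[OF noeth semi finite_set xs t(1,2)])
  ultimately have 12: "exact_below ?H1 t s \<longleftrightarrow> exact_below ?T t s" for s
    by (simp add: exact_below_def)
  have "exact_below ?T t s \<longleftrightarrow> exact_below (qHom ?K ?T) t s" for s
    by (rule koszul_exact_torsion[OF T t(1,2) xs, symmetric]) (simp add: tors_def)
  moreover have "exact_at (qHom ?K ?T) t l \<longleftrightarrow> exact_at (qHom ?K E) t l" for l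
    by (rule hiso_exact_at[OF koszul_tors_hiso[OF E injective_divisible[OF noeth inj] xs] KT KE t(1,2)])
  moreover have "exact_at ?H3 t l \<longleftrightarrow> exact_at (qHom ?K E) t l" for l
    by (rule hiso_exact_at[OF koszul_hiso[OF quasi_iso_hiso[OF quasi C E] C E xs] H3 KE t(1,2)])
  ultimately have 23: "exact_below ?T t s \<longleftrightarrow> exact_below ?H3 t s" for s
    by (simp add: exact_below_def)
  have inf: "inf_ext {l. \<not> trivial_module (homology N X t l)} = inf_ext {l. \<not> trivial_module (homology N Y t l)}"
    if X: "n_complex R N X" and Y: "n_complex R N Y" and eq: "\<And>s. exact_below X t s \<longleftrightarrow> exact_below Y t s"
    for X :: "('r, 'a) ncomplex" and Y :: "('r, 'b) ncomplex"
    using eq by (intro inf_ext_cong)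
      (simp add: trivial_homology_iff[OF X t(3)] trivial_homology_iff[OF Y t(3)] exact_below_def)
  show ?thesis unfolding torsion using inf[OF H1 T 12] inf[OF T H3 23] by (rule conjI)
qed

end
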